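(* Let $(\Sigma,d_\Sigma)$ be a Polish space and let $((x_i^n)_{1\le i\le n})_{n\ge1}$ be a triangular array of elements of $\Sigma$ such that $\frac1n\sum_{i=1}^n\delta_{x_i^n}\to\mu\in M_1(\Sigma)$ weakly. Let $((W_i^n)_{1\le i\le n})_{n\ge1}$ be a triangular array of $\mathbb{R}_+$-valued random variables on a probability space $(\Omega,\mathcal{A},\mathbb{P})$ such that: for every $n\ge1$, $\sum_{i=1}^nW_i^n=n$; for every $n\ge1$ the vector $(W_1^n,\dots,W_n^n)$ is exchangeable; and $\left(\frac1n\sum_{i=1}^n\delta_{W_i^n}\right)_{n\ge1}$ satisfies an LDP on $M_1^1(\mathbb{R}_+)$ endowed with the distance $W_{1,|\cdot|}$ with good rate function $I^W$. Then the sequence $$\mathcal{L}^n=\frac1n\sum_{i=1}^nW_i^n\delta_{x_i^n},\qquad n\ge1,$$ satisfies an LDP on $M_1(\Sigma)$ endowed with the weak convergence topology with good rate function $$\mathcal{K}(\nu;\mu)=\inf_{\rho:\,F(\rho)=\nu}\mathcal{J}(\rho;\mu)=\inf_{\rho_x:\,F(\rho_x\otimes\mu)=\nu}\left\{\int_\Sigma H(\rho_x|\rho_1)\,\mu(dx)+I^W(\rho_1)\right\}.$$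
   Context: LDP: a sequence of Borel probability measures $(P^n)$ on a topological space $\mathcal{Y}$ satisfies an LDP with rate function $I$ if $I:\mathcal{Y}\to[0,\infty]$ is lower semicontinuous and, for every measurable $A\subset\mathcal{Y}$ with interior $A^o$ and closure $\bar A$, $-\inf_{A^o}I\le\liminf_n\frac1n\log P^n(A)\le\limsup_n\frac1n\log P^n(A)\le-\inf_{\bar A}I$. $I$ is good if its level sets $\{I\le\alpha\}$, $\alpha<\infty$, are compact. A sequence of random variables satisfies an LDP if their laws do. $M_1(E)$ denotes the set of Borel probability measures on $E$. $M_1^1(\mathbb{R}_+)=\{\rho\in M_1(\mathbb{R}_+):\int x\,\rho(dx)=1\}$. $W_{1,|\cdot|}(\rho,\gamma)=\inf_\pi\int|x-y|\,\pi(dx,dy)$ over couplings $\pi$ of $\rho,\gamma$. For $\rho\in M_1(\mathbb{R}_+\times\Sigma)$, $\rho_1,\rho_2$ are its marginals on $\mathbb{R}_+$ and $\Sigma$. $\mathcal{M}_1^1(\mathbb{R}_+\times\Sigma)=\{\rho\in M_1(\mathbb{R}_+\times\Sigma):\int x\,\rho_1(dx)=1\}$. The map $F:\mathcal{M}_1^1(\mathbb{R}_+\times\Sigma)\to M_1(\Sigma)$ is $F(\rho)(A)=\int_{\mathbb{R}_+\times A}w\,\rho(dw,dx)$. $H(\nu|\rho)=\int\log\frac{d\nu}{d\rho}d\nu$ if $\nu\ll\rho$, $+\infty$ otherwise. $\mathcal{J}(\rho;\mu)=H(\rho|\rho_1\otimes\mu)+I^W(\rho_1)$ if $\rho_2=\mu$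 and $+\infty$ otherwise, for $\rho\in\mathcal{M}_1^1(\mathbb{R}_+\times\Sigma)$. In the last infimum, $x\mapsto\rho_x(dw)\in M_1(\mathbb{R}_+)$ ranges over stochastic kernels, $\rho=\rho_x\otimes\mu$ denotes the measure $\rho_x(dw)\mu(dx)$ on $\mathbb{R}_+\times\Sigma$, and $\rho_1$ is its first marginal. Exchangeable means that the law is invariant under every permutation of coordinates. *)

theory Defs
  imports "HOL-Probability.Probability"
begin

section \<open>Spaces of probability measures\<close>

abbreviation M1 :: "'a measure \<Rightarrow> 'a measure set" where
  "M1 E \<equiv> space (prob_algebra E)"

abbreviation Rplus :: "real measure" where
  "Rplus \<equiv> restrict_space borel {0..}"

definition M11_Rplus :: "real measure set" where
  "M11_Rplus = {\<rho> \<in> M1 Rplus. (\<integral>\<^sup>+ w. ennreal w \<partial>\<rho>) = 1}"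

definition weak_topology :: "'a::topological_space measure topology" where
  "weak_topology = topology_generated_by
     {{\<nu> \<in> M1 borel. (\<integral>x. f x \<partial>\<nu>) \<in> U} | (f :: 'a \<Rightarrow> real) U.
        continuous_on UNIV f \<and> bounded (range f) \<and> open U}"

definition couplings :: "real measure \<Rightarrow> real measure \<Rightarrow> (real \<times> real) measure set" where
  "couplings \<rho> \<gamma> =
     {\<pi> \<in> M1 (Rplus \<Otimes>\<^sub>M Rplus). distr \<pi> Rplus fst = \<rho> \<and> distr \<pi> Rplus snd = \<gamma>}"

definition wasserstein1 :: "real measure \<Rightarrow> real measure \<Rightarrow> ennreal" where
  "wasserstein1 \<rho> \<gamma> = (INF \<pi>\<in>couplings \<rho> \<gamma>. \<integral>\<^sup>+ z. ennreal \<bar>fst z - snd z\<bar> \<partial>\<pi>)"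

text \<open>
  The metric topology of the distance \<^const>\<open>wasserstein1\<close> on \<^const>\<open>M11_Rplus\<close>, spelled out as in
  \<open>Metric_space.mopen\<close>, so that unfolding it does not require the metric axioms.
\<close>

definition wasserstein_topology :: "real measure topology" where
  "wasserstein_topology = topology (\<lambda>U. U \<subseteq> M11_Rplus \<and>
     (\<forall>\<rho>\<in>U. \<exists>r>0. {\<gamma> \<in> M11_Rplus. wasserstein1 \<rho> \<gamma> < r} \<subseteq> U))"

lemma openin_wasserstein_topology:
  "openin wasserstein_topology U \<longleftrightarrow> U \<subseteq> M11_Rplus \<and>
     (\<forall>\<rho>\<in>U. \<exists>r>0. {\<gamma> \<in> M11_Rplus. wasserstein1 \<rho> \<gamma> < r} \<subseteq> U)"
proof -
  have "istopology (\<lambda>U. U \<subseteq> M11_Rplus \<and>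
     (\<forall>\<rho>\<in>U. \<exists>r>0. {\<gamma> \<in> M11_Rplus. wasserstein1 \<rho> \<gamma> < r} \<subseteq> U))"
    unfolding istopology_def
  proof (intro conjI allI impI, goal_cases)
    case (2 S T)
    show ?case
    proof
      fix \<rho> assume "\<rho> \<in> S \<inter> T"
      then obtain r s where "r > 0" "{\<gamma> \<in> M11_Rplus. wasserstein1 \<rho> \<gamma> < r} \<subseteq> S"
        and "s > 0" "{\<gamma> \<in> M11_Rplus. wasserstein1 \<rho> \<gamma> < s} \<subseteq> T"
        using 2 by blast
      then show "\<exists>r>0. {\<gamma> \<in> M11_Rplus. wasserstein1 \<rho> \<gamma> < r} \<subseteq> S \<inter> T"
        by (intro exI[of _ "min r s"]) (auto simp: subset_iff)
    qed
  next
    case (4 \<K>)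
    then show ?case by (meson Union_upper UnionE order_trans)
  qed blast+
  then show ?thesis
    unfolding wasserstein_topology_def by (simp add: topology_inverse')
qed


section \<open>Large deviation principles\<close>

definition borel_of :: "'y topology \<Rightarrow> 'y measure" where
  "borel_of T = sigma (topspace T) {U. openin T U}"

definition lower_semicontinuous_on :: "'y topology \<Rightarrow> ('y \<Rightarrow> ennreal) \<Rightarrow> bool" where
  "lower_semicontinuous_on T I \<longleftrightarrow> (\<forall>\<alpha>. closedin T {y \<in> topspace T. I y \<le> \<alpha>})"

definition good :: "'y topology \<Rightarrow> ('y \<Rightarrow> ennreal) \<Rightarrow> bool" where
  "good T I \<longleftrightarrow> (\<forall>\<alpha><\<infinity>. compactin T {y \<in> topspace T. I y \<le> \<alpha>})"

definition ext_log :: "real \<Rightarrow> ereal" where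
  "ext_log p = (if p = 0 then -\<infinity> else ereal (ln p))"

text \<open>
  Sequences are indexed by \<open>n \<ge> 1\<close>; index \<open>0\<close> is irrelevant. Infima of rate functions are taken in
  \<open>[0,\<infinity>]\<close>, so that the infimum over the empty set is \<open>\<infinity>\<close>.
\<close>

definition LDP :: "'y topology \<Rightarrow> (nat \<Rightarrow> 'y measure) \<Rightarrow> ('y \<Rightarrow> ennreal) \<Rightarrow> bool" where
  "LDP T P I \<longleftrightarrow>
     (\<forall>n\<ge>1. P n \<in> M1 (borel_of T)) \<and>
     lower_semicontinuous_on T I \<and>
     (\<forall>A\<in>sets (borel_of T).
        - enn2ereal (INF y\<in>T interior_of A. I y)
          \<le> liminf (\<lambda>n. ereal (1 / real n) * ext_log (measure (P n) A)) \<and>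
        limsup (\<lambda>n. ereal (1 / real n) * ext_log (measure (P n) A))
          \<le> - enn2ereal (INF y\<in>T closure_of A. I y))"

definition LDP_rv ::
  "'w measure \<Rightarrow> 'y topology \<Rightarrow> (nat \<Rightarrow> 'w \<Rightarrow> 'y) \<Rightarrow> ('y \<Rightarrow> ennreal) \<Rightarrow> bool" where
  "LDP_rv \<Omega> T X I \<longleftrightarrow>
     (\<forall>n\<ge>1. X n \<in> \<Omega> \<rightarrow>\<^sub>M borel_of T) \<and> LDP T (\<lambda>n. distr \<Omega> (borel_of T) (X n)) I"


section \<open>Weighted empirical measures and exchangeability\<close>

definition weighted_empirical ::
  "'a measure \<Rightarrow> nat \<Rightarrow> (nat \<Rightarrow> real) \<Rightarrow> (nat \<Rightarrow> 'a) \<Rightarrow> 'a measure" where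
  "weighted_empirical E n w x =
     distr (point_measure {1..n} (\<lambda>i. ennreal (w i / real n))) E x"

definition empirical :: "'a measure \<Rightarrow> nat \<Rightarrow> (nat \<Rightarrow> 'a) \<Rightarrow> 'a measure" where
  "empirical E n x = weighted_empirical E n (\<lambda>_. 1) x"

lemma emeasure_weighted_empirical:
  assumes "\<And>i. i \<in> {1..n} \<Longrightarrow> x i \<in> space E" and "A \<in> sets E"
  shows "emeasure (weighted_empirical E n w x) A
    = (\<Sum>i=1..n. ennreal (w i / real n) * indicator A (x i))"
proof -
  have "emeasure (weighted_empirical E n w x) A
      = emeasure (point_measure {1..n} (\<lambda>i. ennreal (w i / real n))) (x -` A \<inter> {1..n})"
    unfolding weighted_empirical_def using assms
    by (subst emeasure_distr) (auto simp: measurable_def sets_point_measure space_point_measure)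
  also have "\<dots> = (\<Sum>i\<in>x -` A \<inter> {1..n}. ennreal (w i / real n))"
    by (intro emeasure_point_measure_finite) auto
  also have "\<dots> = (\<Sum>i=1..n. ennreal (w i / real n) * indicator A (x i))"
    by (intro sum.mono_neutral_cong_left) (auto simp: indicator_def)
  finally show ?thesis .
qed

definition exchangeable :: "'w measure \<Rightarrow> nat \<Rightarrow> (nat \<Rightarrow> 'w \<Rightarrow> real) \<Rightarrow> bool" where
  "exchangeable \<Omega> n W \<longleftrightarrow> (\<forall>\<sigma>. \<sigma> permutes {1..n} \<longrightarrow>
     distr \<Omega> (\<Pi>\<^sub>M i\<in>{1..n}. Rplus) (\<lambda>\<omega>. \<lambda>i\<in>{1..n}. W (\<sigma> i) \<omega>) =
     distr \<Omega> (\<Pi>\<^sub>M i\<in>{1..n}. Rplus) (\<lambda>\<omega>. \<lambda>i\<in>{1..n}. W i \<omega>))"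


section \<open>The rate function\<close>

text \<open>
  Relative entropy of \<open>\<nu>\<close> with respect to \<open>\<rho>\<close>; note that \<^const>\<open>KL_divergence\<close> takes its arguments
  in the opposite order. For probability measures the negative part of the logarithmic density is
  always \<open>\<nu>\<close>-integrable and the integral is nonnegative, so failure of integrability means that the
  integral is \<open>+\<infinity>\<close>, and the coercion to \<^typ>\<open>ennreal\<close> loses nothing.
\<close>

definition rel_entropy :: "'a measure \<Rightarrow> 'a measure \<Rightarrow> ennreal" where
  "rel_entropy \<nu> \<rho> =
     (if absolutely_continuous \<rho> \<nu> \<and> integrable \<nu> (entropy_density (exp 1) \<rho> \<nu>)
      then ennreal (KL_divergence (exp 1) \<rho> \<nu>) else \<infinity>)"

definition marg1 :: "(real \<times> 'a::topological_space) measure \<Rightarrow> real measure" where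
  "marg1 \<rho> = distr \<rho> Rplus fst"

definition marg2 :: "(real \<times> 'a::topological_space) measure \<Rightarrow> 'a measure" where
  "marg2 \<rho> = distr \<rho> borel snd"

definition M11 :: "(real \<times> 'a::topological_space) measure set" where
  "M11 = {\<rho> \<in> M1 (Rplus \<Otimes>\<^sub>M borel). (\<integral>\<^sup>+ w. ennreal w \<partial>marg1 \<rho>) = 1}"

definition F_map :: "(real \<times> 'a::topological_space) measure \<Rightarrow> 'a measure" where
  "F_map \<rho> = distr (density \<rho> (\<lambda>z. ennreal (fst z))) borel snd"

lemma emeasure_F_map:
  assumes "sets \<rho> = sets (Rplus \<Otimes>\<^sub>M (borel :: 'a::topological_space measure))" and "A \<in> sets borel"
  shows "emeasure (F_map \<rho>) A = (\<integral>\<^sup>+ z. ennreal (fst z) * indicator (UNIV \<times> A) z \<partial>\<rho>)"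
proof -
  have 1: "fst \<in> \<rho> \<rightarrow>\<^sub>M Rplus" "snd \<in> \<rho> \<rightarrow>\<^sub>M (borel :: 'a measure)"
    using measurable_cong_sets[OF assms(1) refl] measurable_fst measurable_snd by blast+
  have [measurable]: "fst \<in> \<rho> \<rightarrow>\<^sub>M borel"
    using measurable_restrict_space2_iff 1(1) by blast
  note [measurable] = 1(2) assms(2)
  have "emeasure (F_map \<rho>) A = (\<integral>\<^sup>+ z. ennreal (fst z) * indicator (snd -` A \<inter> space \<rho>) z \<partial>\<rho>)"
    unfolding F_map_def by (subst emeasure_distr, simp_all, subst emeasure_density) auto
  also have "\<dots> = (\<integral>\<^sup>+ z. ennreal (fst z) * indicator (UNIV \<times> A) z \<partial>\<rho>)"
    by (intro nn_integral_cong) (auto simp: indicator_def)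
  finally show ?thesis .
qed

definition J_rate ::
  "(real measure \<Rightarrow> ennreal) \<Rightarrow> 'a::topological_space measure \<Rightarrow> (real \<times> 'a) measure \<Rightarrow> ennreal" where
  "J_rate I\<^sub>W \<mu> \<rho> =
     (if marg2 \<rho> = \<mu> then rel_entropy \<rho> (marg1 \<rho> \<Otimes>\<^sub>M \<mu>) + I\<^sub>W (marg1 \<rho>) else \<infinity>)"

definition kernel_prod ::
  "('a::topological_space \<Rightarrow> real measure) \<Rightarrow> 'a measure \<Rightarrow> (real \<times> 'a) measure" where
  "kernel_prod \<kappa> \<mu> = \<mu> \<bind> (\<lambda>x. distr (\<kappa> x) (Rplus \<Otimes>\<^sub>M borel) (\<lambda>w. (w, x)))"

lemma emeasure_kernel_prod:
  fixes \<kappa> :: "'a::topological_space \<Rightarrow> real measure"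
  assumes "\<mu> \<in> M1 borel" and \<kappa>: "\<kappa> \<in> borel \<rightarrow>\<^sub>M prob_algebra Rplus"
    and "A \<in> sets Rplus" and "B \<in> sets borel"
  shows "emeasure (kernel_prod \<kappa> \<mu>) (A \<times> B) = (\<integral>\<^sup>+ x. emeasure (\<kappa> x) A * indicator B x \<partial>\<mu>)"
proof -
  have \<mu>: "sets \<mu> = sets borel" "space \<mu> \<noteq> {}"
    using assms(1) by (auto simp: space_prob_algebra prob_space.not_empty)
  have \<kappa>x: "sets (\<kappa> x) = sets Rplus" for x
    using measurable_space[OF \<kappa>, of x] by (simp add: space_prob_algebra)
  have "(\<lambda>x. distr (\<kappa> x) (Rplus \<Otimes>\<^sub>M (borel :: 'a measure)) (\<lambda>w. (w, x)))
      \<in> borel \<rightarrow>\<^sub>M prob_algebra (Rplus \<Otimes>\<^sub>M borel)"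
    by (rule measurable_distr_prob_space2[OF \<kappa>]) measurable
  then have m: "(\<lambda>x. distr (\<kappa> x) (Rplus \<Otimes>\<^sub>M borel) (\<lambda>w. (w, x)))
      \<in> \<mu> \<rightarrow>\<^sub>M subprob_algebra (Rplus \<Otimes>\<^sub>M borel)"
    using \<mu>(1) by (auto intro: measurable_prob_algebraD cong: measurable_cong_sets)
  have "emeasure (kernel_prod \<kappa> \<mu>) (A \<times> B)
      = (\<integral>\<^sup>+ x. emeasure (distr (\<kappa> x) (Rplus \<Otimes>\<^sub>M borel) (\<lambda>w. (w, x))) (A \<times> B) \<partial>\<mu>)"
    unfolding kernel_prod_def
    by (rule emeasure_bind[OF \<mu>(2) m]) (intro pair_measureI assms(3,4))
  also have "\<dots> = (\<integral>\<^sup>+ x. emeasure (\<kappa> x) A * indicator B x \<partial>\<mu>)"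
  proof (intro nn_integral_cong)
    fix x
    have meas: "(\<lambda>w. (w, x)) \<in> \<kappa> x \<rightarrow>\<^sub>M Rplus \<Otimes>\<^sub>M borel"
      unfolding measurable_cong_sets[OF \<kappa>x refl] by measurable
    have "A \<subseteq> space (\<kappa> x)"
      using sets.sets_into_space[OF assms(3)] sets_eq_imp_space_eq[OF \<kappa>x] by blast
    then have "(\<lambda>w. (w, x)) -` (A \<times> B) \<inter> space (\<kappa> x) = (if x \<in> B then A else {})"
      by auto
    then show "emeasure (distr (\<kappa> x) (Rplus \<Otimes>\<^sub>M borel) (\<lambda>w. (w, x))) (A \<times> B)
        = emeasure (\<kappa> x) A * indicator B x"
      using emeasure_distr[OF meas pair_measureI[OF assms(3,4)]] by simp
  qed
  finally show ?thesis .
qed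

definition K_rate ::
  "(real measure \<Rightarrow> ennreal) \<Rightarrow> 'a::topological_space measure \<Rightarrow> 'a measure \<Rightarrow> ennreal" where
  "K_rate I\<^sub>W \<mu> \<nu> = (INF \<rho>\<in>{\<rho> \<in> M11. F_map \<rho> = \<nu>}. J_rate I\<^sub>W \<mu> \<rho>)"

definition K_rate_kernel ::
  "(real measure \<Rightarrow> ennreal) \<Rightarrow> 'a::topological_space measure \<Rightarrow> 'a measure \<Rightarrow> ennreal" where
  "K_rate_kernel I\<^sub>W \<mu> \<nu> =
     (INF \<kappa>\<in>{\<kappa> \<in> borel \<rightarrow>\<^sub>M prob_algebra Rplus.
              kernel_prod \<kappa> \<mu> \<in> M11 \<and> F_map (kernel_prod \<kappa> \<mu>) = \<nu>}.
        (\<integral>\<^sup>+ x. rel_entropy (\<kappa> x) (marg1 (kernel_prod \<kappa> \<mu>)) \<partial>\<mu>) + I\<^sub>W (marg1 (kernel_prod \<kappa> \<mu>)))"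

end

theory Submission
  imports Defs
begin

text \<open>
  A law on \<open>\<real>\<^sub>+ \<times> \<Sigma>\<close> with marginals \<open>\<gamma>\<close> and \<open>\<mu>\<close> is the image of a coupling \<open>\<pi>\<close> of the uniform law \<open>\<lambda>\<close> on
  \<open>(0, 1)\<close> and \<open>\<mu>\<close> under the quantile function of \<open>\<gamma>\<close>, so \<open>K(\<nu>; \<mu>)\<close> is the infimum of
  \<open>H(\<pi> | \<lambda> \<otimes> \<mu>) + I(\<gamma>)\<close> over all \<open>(\<gamma>, \<pi>)\<close> that mix to \<open>\<nu>\<close>. Entropy balls are compact for setwise
  convergence by the variational formula, which makes \<open>K\<close> good.

  By exchangeability the sorted weights may be matched with the points by a uniformly random
  permutation. Divide the points into the joint level cells of finitely many test functions and the
  sorted weights into blocks of equal size. The number of permutations with a prescribed contingency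
  table of cells and blocks is a quotient of products of factorials, and Stirling's bounds turn its
  proportion among all permutations into \<open>exp (- n H)\<close>, \<open>H\<close> being the entropy of the table relative to
  the product of its margins. Conditionally on an empirical weight law near \<open>\<gamma>\<close>, the measure \<open>L\<^sup>n\<close> is
  therefore near the mixture of \<open>\<gamma>\<close> and \<open>\<pi>\<close> with probability about \<open>exp (- n H(\<pi> | \<lambda> \<otimes> \<mu>))\<close>. Together with
  the large deviation bounds of the weights on a finite cover of a sublevel set of \<open>I\<close> by small balls
  this yields both bounds.
\<close>

section \<open>Relative entropy\<close>

text \<open>The weights \<open>quantile \<gamma> u\<close> are unbounded and only measurable in
  \<open>u\<close>, so weak convergence of couplings does not apply to them directly. Setwise
  convergence handles bounded measurable integrands, and the tail of the quantile is cut off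
  uniformly, because all couplings share the uniform first marginal and \<gamma> has mean one. The
  price is that a setwise limit of measures is a priori only finitely additive; the entropy bound
  restores countable additivity. The Wasserstein distance enters through the integrated difference
  of distribution functions, which bounds it from below and equals the \<open>L1\<close> distance of
  the quantile functions. Hence integrals of mixtures are Lipschitz in \<gamma>, uniformly over
  couplings. In the upper bound \<gamma> and \<pi> cannot be optimised together: counting produces
  \<pi> from a whole ball of weight laws, and a nearly cheapest \<gamma> of the ball is picked
  afterwards. The estimates for one \<pi> therefore have to hold for every \<gamma> of the
  ball.\<close>

lemma rel_entropy_density:
  fixes f :: "'a \<Rightarrow> real"
  assumes "prob_space m" and f[measurable]: "f \<in> borel_measurable m" and nn: "\<And>x. 0 \<le> f x"
  shows "rel_entropy (density m (\<lambda>x. ennreal (f x))) m =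
    (if integrable m (\<lambda>x. f x * ln (f x)) then ennreal (\<integral>x. f x * ln (f x) \<partial>m) else \<infinity>)"
proof -
  interpret prob_space m by fact
  let ?\<nu> = "density m (\<lambda>x. ennreal (f x))"
  have ac: "absolutely_continuous m ?\<nu>"
    by (intro absolutely_continuousI_density) auto
  have KL: "KL_divergence (exp 1) m ?\<nu> = (\<integral>x. f x * ln (f x) \<partial>m)"
    using KL_density[of "exp 1" f] nn by (simp add: log_def)
  have [measurable]: "entropy_density (exp 1) m ?\<nu> \<in> borel_measurable m"
    by (simp add: entropy_density_def comp_def)
  have "density m (RN_deriv m ?\<nu>) = ?\<nu>"
    using nn by (intro density_RN_deriv_density) auto
  then have eq: "AE x in m. RN_deriv m ?\<nu> x = f x"
    using nn by (intro density_unique) auto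
  have "integrable ?\<nu> (entropy_density (exp 1) m ?\<nu>)
    \<longleftrightarrow> integrable m (\<lambda>x. f x * entropy_density (exp 1) m ?\<nu> x)"
    using nn by (subst integrable_real_density) auto
  also have "\<dots> \<longleftrightarrow> integrable m (\<lambda>x. f x * ln (f x))"
    using eq nn by (intro integrable_cong_AE) (auto simp: entropy_density_def log_def)
  finally show ?thesis
    unfolding rel_entropy_def using ac KL by simp
qed

lemma prob_density_obtain:
  assumes "prob_space m" "prob_space \<nu>" "sets \<nu> = sets m" "absolutely_continuous m \<nu>"
  obtains f :: "'a \<Rightarrow> real" where "f \<in> borel_measurable m" "\<And>x. 0 \<le> f x" "\<nu> = density m (\<lambda>x. ennreal (f x))"
    "integrable m f" "(\<integral>x. f x \<partial>m) = 1"
proof -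
  interpret m: prob_space m by fact
  interpret \<nu>: prob_space \<nu> by fact
  obtain f where f[measurable]: "f \<in> borel_measurable m" and ae: "AE x in m. RN_deriv m \<nu> x = ennreal (f x)"
    and nn: "\<And>x. 0 \<le> f x"
    using m.real_RN_deriv[OF \<nu>.finite_measure_axioms assms(4,3)] by metis
  have "\<nu> = density m (RN_deriv m \<nu>)" using m.density_RN_deriv[OF assms(4,3)] by simp
  also have "\<dots> = density m (\<lambda>x. ennreal (f x))" using ae by (intro density_cong) auto
  finally have \<nu>: "\<nu> = density m (\<lambda>x. ennreal (f x))" .
  have "(\<integral>\<^sup>+x. ennreal (f x) \<partial>m) = 1"
    using \<nu>.emeasure_space_1 unfolding \<nu> by (subst (asm) emeasure_density) (auto cong: nn_integral_cong)
  then have "integrable m f" "(\<integral>x. f x \<partial>m) = 1"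
    using nn by (auto intro!: integrableI_nonneg simp: integral_eq_nn_integral)
  with that f nn \<nu> show thesis by blast
qed

lemma rel_entropy_finiteE:
  assumes "prob_space m" "prob_space \<nu>" "sets \<nu> = sets m" "rel_entropy \<nu> m < \<infinity>"
  obtains f :: "'a \<Rightarrow> real" where "f \<in> borel_measurable m" "\<And>x. 0 \<le> f x"
    "\<nu> = density m (\<lambda>x. ennreal (f x))" "integrable m f" "(\<integral>x. f x \<partial>m) = 1"
    "integrable m (\<lambda>x. f x * ln (f x))" "rel_entropy \<nu> m = ennreal (\<integral>x. f x * ln (f x) \<partial>m)"
proof -
  have "absolutely_continuous m \<nu>" using assms(4) by (auto simp: rel_entropy_def split: if_splits)
  then obtain f where f: "f \<in> borel_measurable m" "\<And>x. 0 \<le> f x" "\<nu> = density m (\<lambda>x. ennreal (f x))"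
    "integrable m f" "(\<integral>x. f x \<partial>m) = 1"
    using prob_density_obtain[OF assms(1-3)] by blast
  show thesis
    using that[OF f] rel_entropy_density[OF assms(1) f(1,2)] f(3) assms(4) by (auto split: if_splits)
qed

text \<open>The easy half of the Donsker-Varadhan formula. A real upper bound \<open>b\<close>
  stands in for the entropy itself, so that the inequality can be reused as a closed condition on
  measures.\<close>

lemma rel_entropy_variational:
  fixes \<phi> :: "'a \<Rightarrow> real"
  assumes "prob_space m" "prob_space \<nu>" "sets \<nu> = sets m" "rel_entropy \<nu> m \<le> ennreal b" "0 \<le> b"
    and \<phi>[measurable]: "\<phi> \<in> borel_measurable m" and bd: "\<And>x. \<bar>\<phi> x\<bar> \<le> C"
  shows "(\<integral>x. \<phi> x \<partial>\<nu>) \<le> b + ln (\<integral>x. exp (\<phi> x) \<partial>m)"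
proof -
  interpret m: prob_space m by fact
  interpret \<nu>: prob_space \<nu> by fact
  obtain f :: "'a \<Rightarrow> real" where f[measurable]: "f \<in> borel_measurable m" and nn: "\<And>x. 0 \<le> f x"
    and \<nu>: "\<nu> = density m (\<lambda>x. ennreal (f x))" and intf: "integrable m f" and f1: "(\<integral>x. f x \<partial>m) = 1"
    and int: "integrable m (\<lambda>x. f x * ln (f x))" and H: "rel_entropy \<nu> m = ennreal (\<integral>x. f x * ln (f x) \<partial>m)"
    using rel_entropy_finiteE[OF assms(1-3)]
    le_less_trans[OF assms(4) ennreal_less_top] unfolding infinity_ennreal_def by blast
  have hb: "(\<integral>x. f x * ln (f x) \<partial>m) \<le> b"
    using assms(4,5) H by (simp add: ennreal_le_iff)
  have intexp: "integrable m (\<lambda>x. exp (\<phi> x))"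
    using bd by (intro m.integrable_const_bound[where B="exp C"]) (auto simp: abs_le_iff)
  define Z where "Z = (\<integral>x. exp (\<phi> x) \<partial>m)"
  have "exp (- C) \<le> exp (\<phi> x)" for x using bd[of x] by auto
  then have "(\<integral>x. exp (- C) \<partial>m) \<le> Z"
    unfolding Z_def by (intro integral_mono intexp) auto
  then have Zpos: "0 < Z" by (simp add: m.prob_space) (meson exp_gt_zero less_le_trans)
  have int\<phi>: "integrable m (\<lambda>x. f x * \<phi> x)"
  proof (rule Bochner_Integration.integrable_bound)
    show "integrable m (\<lambda>x. C * f x)" using intf by auto
    show "AE x in m. norm (f x * \<phi> x) \<le> norm (C * f x)"
      using bd nn by (auto simp: abs_mult mult.commute[of C]
          intro!: mult_left_mono order_trans[OF bd])
  qed auto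
  \<comment> \<open>Gibbs' inequality via \<open>ln y \<le> y - 1\<close> with \<open>y = exp (\<phi> x) / (Z * f x)\<close>\<close>
  have "f x * \<phi> x - f x * ln (f x) - f x * ln Z \<le> exp (\<phi> x) / Z - f x" for x
  proof (cases "f x = 0")
    case False
    then have "f x > 0" using nn[of x] by simp
    have "ln (exp (\<phi> x) / (Z * f x)) \<le> exp (\<phi> x) / (Z * f x) - 1"
      using \<open>f x > 0\<close> Zpos by (intro ln_le_minus_one) auto
    moreover have "ln (exp (\<phi> x) / (Z * f x)) = \<phi> x - ln Z - ln (f x)"
      using \<open>f x > 0\<close> Zpos by (simp add: ln_div ln_mult)
    ultimately have "f x * (\<phi> x - ln Z - ln (f x)) \<le> f x * (exp (\<phi> x) / (Z * f x) - 1)"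
      using \<open>f x > 0\<close> by (intro mult_left_mono) auto
    then show ?thesis using \<open>f x > 0\<close> by (simp add: algebra_simps)
  qed (use Zpos in simp)
  then have "(\<integral>x. f x * \<phi> x - f x * ln (f x) - f x * ln Z \<partial>m) \<le> (\<integral>x. exp (\<phi> x) / Z - f x \<partial>m)"
    using int\<phi> int intf intexp by (intro integral_mono) auto
  then have "(\<integral>x. f x * \<phi> x \<partial>m) - (\<integral>x. f x * ln (f x) \<partial>m) - ln Z \<le> 0"
    using int\<phi> int intf intexp f1 Zpos by (simp add: Z_def)
  moreover have "(\<integral>x. \<phi> x \<partial>\<nu>) = (\<integral>x. f x * \<phi> x \<partial>m)"
    unfolding \<nu> using nn by (subst integral_real_density) auto
  ultimately show ?thesis using hb Z_def by simp
qed

text \<open>Rounding \<phi> down to multiples of \<open>1 / j\<close> with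
  \<open>1 / j \<le> e\<close>; boundedness leaves finitely many values.\<close>

lemma simple_function_uniform_approx:
  fixes \<phi> :: "'a \<Rightarrow> real"
  assumes \<phi>[measurable]: "\<phi> \<in> borel_measurable m" and bd: "\<And>x. \<bar>\<phi> x\<bar> \<le> C" and "0 < e"
  obtains \<psi> where "simple_function m \<psi>" "\<And>x. \<psi> x \<le> \<phi> x" "\<And>x. \<phi> x \<le> \<psi> x + e"
proof -
  obtain j :: nat where j: "1 / e < real j" using reals_Archimedean2 by blast
  then have jpos: "0 < real j" using \<open>0 < e\<close> by (meson divide_pos_pos less_trans zero_less_one)
  have je: "1 / real j \<le> e" using j \<open>0 < e\<close> jpos by (simp add: field_simps)
  define \<psi> where "\<psi> x = of_int \<lfloor>real j * \<phi> x\<rfloor> / real j" for x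
  have 1: "\<psi> x \<le> \<phi> x" "\<phi> x \<le> \<psi> x + 1 / real j" for x
  proof -
    have "of_int \<lfloor>real j * \<phi> x\<rfloor> \<le> real j * \<phi> x" "real j * \<phi> x \<le> of_int \<lfloor>real j * \<phi> x\<rfloor> + 1"
      by linarith+
    then show "\<psi> x \<le> \<phi> x" "\<phi> x \<le> \<psi> x + 1 / real j"
      using jpos by (simp_all add: \<psi>_def field_simps)
  qed
  have [measurable]: "\<psi> \<in> borel_measurable m" unfolding \<psi>_def by measurable
  have "\<psi> ` space m \<subseteq> (\<lambda>i. of_int i / real j) ` {\<lfloor>- (real j * C)\<rfloor> .. \<lfloor>real j * C\<rfloor>}"
  proof
    fix y assume "y \<in> \<psi> ` space m"
    then obtain x where x: "y = \<psi> x" by auto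
    have "\<phi> x \<le> C" "- C \<le> \<phi> x" using bd[of x] by auto
    then have "real j * \<phi> x \<le> real j * C" "- (real j * C) \<le> real j * \<phi> x"
      using jpos mult_left_mono[of "- C" "\<phi> x" "real j"] by auto
    then have "\<lfloor>real j * \<phi> x\<rfloor> \<in> {\<lfloor>- (real j * C)\<rfloor> .. \<lfloor>real j * C\<rfloor>}"
      by (simp add: floor_mono)
    then show "y \<in> (\<lambda>i. of_int i / real j) ` {\<lfloor>- (real j * C)\<rfloor> .. \<lfloor>real j * C\<rfloor>}"
      unfolding x \<psi>_def by blast
  qed
  then have sf: "simple_function m \<psi>"
    by (intro simple_function_borel_measurable) (auto dest: finite_subset)
  show thesis
  proof (rule that[OF sf 1(1)])
    show "\<phi> x \<le> \<psi> x + e" for x using 1(2)[of x] je by linarith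
  qed
qed

text \<open>For simple functions the inequality involves finitely many values
  \<open>measure \<nu> A\<close> at a time, hence is closed under setwise limits; here it is
  upgraded to the bounded test functions of the variational formula. Approximating from below moves
  the exponential integral in the right direction.\<close>

lemma variational_bounded_of_simple:
  fixes \<phi> :: "'a \<Rightarrow> real"
  assumes "prob_space m" "prob_space \<nu>" "sets \<nu> = sets m"
    and simple: "\<And>\<psi>::'a \<Rightarrow> real. simple_function m \<psi> \<Longrightarrow> (\<integral>x. \<psi> x \<partial>\<nu>) \<le> b + ln (\<integral>x. exp (\<psi> x) \<partial>m)"
    and \<phi>[measurable]: "\<phi> \<in> borel_measurable m" and bd: "\<And>x. \<bar>\<phi> x\<bar> \<le> C"
  shows "(\<integral>x. \<phi> x \<partial>\<nu>) \<le> b + ln (\<integral>x. exp (\<phi> x) \<partial>m)"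
proof (rule field_le_epsilon)
  interpret m: prob_space m by fact
  interpret \<nu>: prob_space \<nu> by fact
  have [measurable]: "\<phi> \<in> borel_measurable \<nu>" using \<phi> assms(3) by (simp cong: measurable_cong_sets)
  fix e :: real assume "0 < e"
  obtain \<psi> where sf: "simple_function m \<psi>" and 1: "\<And>x. \<psi> x \<le> \<phi> x" "\<And>x. \<phi> x \<le> \<psi> x + e"
    using simple_function_uniform_approx[OF \<phi> bd \<open>0 < e\<close>] by metis
  have [measurable]: "\<psi> \<in> borel_measurable m" by (rule borel_measurable_simple_function[OF sf])
  then have sf': "simple_function \<nu> \<psi>" using assms(3)
    sf by (simp add: simple_function_def sets_eq_imp_space_eq[OF assms(3)])
  have fin: "finite (\<psi> ` space m)" using sf by (simp add: simple_function_def)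
  have int\<psi>: "integrable \<nu> \<psi>"
    by (rule integrable_simple_function[OF sf']) (simp add: \<nu>.emeasure_eq_measure)
  have int\<phi>: "integrable \<nu> \<phi>" using bd by (intro \<nu>.integrable_const_bound[where B=C]) auto
  have ie: "integrable m (\<lambda>x. exp (\<phi> x))"
    using bd by (intro m.integrable_const_bound[where B="exp C"]) (auto simp: abs_le_iff)
  have "integrable m (\<lambda>x. exp (\<psi> x))"
    by (rule Bochner_Integration.integrable_bound[OF ie]) (use 1 in auto)
  then have "(\<integral>x. exp (\<psi> x) \<partial>m) \<le> (\<integral>x. exp (\<phi> x) \<partial>m)"
    using ie 1 by (intro integral_mono) auto
  moreover have "0 < (\<integral>x. exp (\<psi> x) \<partial>m)"
  proof -
    have "- C - e \<le> \<psi> x" for x using 1[of x] bd[of x] by (auto simp: abs_le_iff)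
    then have "(\<integral>x. exp (- C - e) \<partial>m) \<le> (\<integral>x. exp (\<psi> x) \<partial>m)"
      using \<open>integrable m (\<lambda>x. exp (\<psi> x))\<close> by (intro integral_mono) auto
    then show ?thesis by (simp add: m.prob_space) (meson exp_gt_zero less_le_trans)
  qed
  ultimately have "ln (\<integral>x. exp (\<psi> x) \<partial>m) \<le> ln (\<integral>x. exp (\<phi> x) \<partial>m)" by simp
  moreover have "(\<integral>x. \<phi> x \<partial>\<nu>) \<le> (\<integral>x. \<psi> x + e \<partial>\<nu>)"
    using int\<phi> int\<psi> 1 by (intro integral_mono) auto
  ultimately show "(\<integral>x. \<phi> x \<partial>\<nu>) \<le> b + ln (\<integral>x. exp (\<phi> x) \<partial>m) + e"
    using simple[OF sf] int\<psi> by (simp add: \<nu>.prob_space)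
qed

text \<open>The test function is \<open>t * indicator A\<close>: with
  \<open>measure m A \<le> exp (- t)\<close> its exponential integral is at most 2. The number
  \<open>p\<close> is kept abstract because it is later also the value at \<open>A\<close> of a set
  function that is not yet known to be a measure.\<close>

lemma two_set_variational:
  fixes p :: real
  assumes "prob_space m" and A: "A \<in> sets m"
    and le: "p * t \<le> b + ln (\<integral>x. exp (t * indicator A x) \<partial>m)" and "0 < t" and "measure m A \<le> exp (- t)"
  shows "p \<le> (b + ln 2) / t"
proof -
  interpret m: prob_space m by fact
  have "exp (t * indicator A x) \<le> 1 + exp t * indicator A x" for x
    by (auto simp: indicator_def)
  moreover have i: "integrable m (\<lambda>x. exp (t * indicator A x))"
    using \<open>0 < t\<close> A by (intro m.integrable_const_bound[where B="exp t"]) (auto simp: indicator_def)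
  ultimately have "(\<integral>x. exp (t * indicator A x) \<partial>m) \<le> (\<integral>x. 1 + exp t * indicator A x \<partial>m)"
    using A by (intro integral_mono) (auto simp: m.emeasure_eq_measure)
  also have "\<dots> = 1 + exp t * measure m A"
    using A by (simp add: m.emeasure_eq_measure m.prob_space)
  also have "\<dots> \<le> 1 + exp t * exp (- t)"
    using assms(5) by (intro add_left_mono mult_left_mono) auto
  finally have le2: "(\<integral>x. exp (t * indicator A x) \<partial>m) \<le> 2"
    by (simp add: exp_minus)
  have "(\<integral>x. (1::real) \<partial>m) \<le> (\<integral>x. exp (t * indicator A x) \<partial>m)"
    using i \<open>0 < t\<close> by (intro integral_mono) auto
  then have "ln (\<integral>x. exp (t * indicator A x) \<partial>m) \<le> ln 2"
    using le2 by (simp add: m.prob_space)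
  then show ?thesis using le \<open>0 < t\<close> by (simp add: field_simps)
qed

text \<open>For a null set the exponential integral stays bounded for every \<open>t\<close>, so
  \<open>measure \<nu> A\<close> is at most \<open>(b + ln 2) / t\<close> for all
  \<open>t > 0\<close>.\<close>

lemma absolutely_continuous_of_variational:
  assumes "prob_space m" "prob_space \<nu>" "sets \<nu> = sets m" "0 \<le> b"
    and var: "\<And>(\<phi>::'a \<Rightarrow> real) C. \<phi> \<in> borel_measurable m \<Longrightarrow> (\<And>x. \<bar>\<phi> x\<bar> \<le> C) \<Longrightarrow> (\<integral>x. \<phi> x \<partial>\<nu>) \<le> b + ln (\<integral>x. exp (\<phi> x) \<partial>m)"
  shows "absolutely_continuous m \<nu>"
  unfolding absolutely_continuous_def
proof
  interpret m: prob_space m by fact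
  interpret \<nu>: prob_space \<nu> by fact
  fix A assume A: "A \<in> null_sets m"
  then have Am: "A \<in> sets m" "measure m A = 0" by (auto simp: measure_def)
  have "measure \<nu> A \<le> 0"
  proof (rule field_le_epsilon)
    fix e :: real assume "0 < e"
    define t where "t = (b + ln 2) / e"
    have "t > 0" using \<open>0 < e\<close> \<open>0 \<le> b\<close> by (simp add: t_def add_nonneg_pos)
    have "measure \<nu> A * t \<le> b + ln (\<integral>x. exp (t * indicator A x) \<partial>m)"
    proof -
      have "(\<integral>x. t * indicator A x \<partial>\<nu>) \<le> b + ln (\<integral>x. exp (t * indicator A x) \<partial>m)"
        using Am(1) \<open>t > 0\<close> by (intro var[where C=t]) (auto simp: indicator_def)
      then show ?thesis using Am(1) assms(3) by (simp add: mult.commute)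
    qed
    from two_set_variational[OF assms(1) Am(1) this \<open>t > 0\<close>]
    have "measure \<nu> A \<le> (b + ln 2) / t" using Am by simp
    also have "\<dots> = e" using \<open>0 < e\<close> \<open>t > 0\<close> by (auto simp: t_def)
    finally show "measure \<nu> A \<le> 0 + e" by simp
  qed
  then have "measure \<nu> A = 0" using measure_nonneg[of \<nu> A] by linarith
  then show "A \<in> null_sets \<nu>" using Am assms(3) by (auto simp: \<nu>.emeasure_eq_measure)
qed

text \<open>Bounds \<open>y * ln y\<close> below by -1, so that adding 1 turns entropy integrands
  into nonnegative functions; integrated against a density it also gives the nonnegativity of the
  entropy.\<close>

lemma diff_one_le_mult_ln: "0 \<le> y \<Longrightarrow> y - 1 \<le> y * ln (y::real)"
proof (cases "y = 0")
  case False
  assume "0 \<le> y"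
  then have "0 < y" using False by simp
  have "y * ln (1 / y) \<le> y * (1 / y - 1)"
    using \<open>0 < y\<close> by (intro mult_left_mono ln_le_minus_one) auto
  then show ?thesis using \<open>0 < y\<close> by (simp add: ln_div algebra_simps)
qed simp

text \<open>The hard half of the Donsker-Varadhan formula: the inequality for bounded test functions
  alone forces a density and bounds its entropy. Integrability of \<open>f * ln f\<close> has to
  come out of the argument, since \<open>rel_entropy\<close> is infinite otherwise.\<close>

theorem rel_entropy_le_of_variational:
  assumes m: "prob_space m" and \<nu>: "prob_space \<nu>" and sets: "sets \<nu> = sets m" and "0 \<le> b"
    and var: "\<And>(\<phi>::'a \<Rightarrow> real) C. \<phi> \<in> borel_measurable m \<Longrightarrow> (\<And>x. \<bar>\<phi> x\<bar> \<le> C) \<Longrightarrow> (\<integral>x. \<phi> x \<partial>\<nu>) \<le> b + ln (\<integral>x. exp (\<phi> x) \<partial>m)"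
  shows "rel_entropy \<nu> m \<le> ennreal b"
proof -
  interpret m: prob_space m by fact
  interpret \<nu>: prob_space \<nu> by fact
  have ac: "absolutely_continuous m \<nu>" by (rule absolutely_continuous_of_variational[OF assms])
  obtain f where f[measurable]: "f \<in> borel_measurable m" and nn: "\<And>x. (0::real) \<le> f x"
    and \<nu>f: "\<nu> = density m (\<lambda>x. ennreal (f x))" and intf: "integrable m f" and f1: "(\<integral>x. f x \<partial>m) = 1"
    using prob_density_obtain[OF m \<nu> sets ac] by blast
  \<comment> \<open>truncate the optimal test function \<open>ln f\<close> and pass to the limit by Fatou's lemma\<close>
  define cl where "cl k x = min (max (f x) (1 / real k)) (real k)" for k x
  define \<phi> where "\<phi> k x = ln (cl k x)" for k x
  have cl_bds: "1 / real k \<le> cl k x" "cl k x \<le> real k" if "k \<ge> 1" for k x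
    using that by (auto simp: cl_def field_simps min_def max_def)
      (use that in \<open>metis mult_le_mono of_nat_1 of_nat_le_iff of_nat_mult nat_mult_1\<close>)+
  have \<phi>_bd: "\<bar>\<phi> k x\<bar> \<le> ln (real k)" if "k \<ge> 1" for k x
  proof -
    have "ln (1 / real k) \<le> \<phi> k x" "\<phi> k x \<le> ln (real k)"
      unfolding \<phi>_def using cl_bds[OF that, of x] that
      by (subst ln_le_cancel_iff; force intro: less_le_trans[of _ "1 / real k"])+
    then show ?thesis using that by (simp add: ln_div)
  qed
  have [measurable]: "\<phi> k \<in> borel_measurable m" for k unfolding \<phi>_def cl_def by measurable
  \<comment> \<open>The shift by 1 that makes Fatou's lemma applicable must work for all
    \<open>k\<close> at once. Above \<open>1 / k\<close> the truncated product is at least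
    \<open>min (f * ln f) 0\<close>; below it the product is \<open>- f * ln k\<close>, and
    \<open>ln k \<le> k\<close>.\<close>
  have low: "- 1 \<le> f x * \<phi> k x" if "k \<ge> 1" for k x
  proof (cases "f x \<ge> 1 / real k")
    case True
    have "f x * \<phi> k x \<ge> min (f x * ln (f x)) 0"
    proof (cases "f x \<le> real k")
      case True
      then show ?thesis using \<open>f x \<ge> 1 / real k\<close> by (simp add: \<phi>_def cl_def)
    next
      case False
      then have "\<phi> k x = ln (real k)" using that cl_bds[OF that, of x] by (simp add: \<phi>_def cl_def)
      then show ?thesis using nn[of x] that by (auto intro: min.coboundedI2)
    qed
    then show ?thesis using diff_one_le_mult_ln[OF nn, of x] nn[of x] by linarith
  next
    case False
    then have "cl k x = 1 / real k" using that cl_bds[OF that, of x] by (simp add: cl_def min_def max_def split: if_splits)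
    then have "\<phi> k x = - ln (real k)" using that by (simp add: \<phi>_def ln_div)
    moreover have "f x * ln (real k) \<le> 1 / real k * ln (real k)"
      using False that by (intro mult_right_mono) auto
    moreover have "1 / real k * ln (real k) \<le> 1 / real k * real k"
      using that ln_le_minus_one[of "real k"] by (intro mult_left_mono) auto
    moreover have "1 / real k * real k = 1" using that by simp
    ultimately have "f x * ln (real k) \<le> 1" by linarith
    then show ?thesis using \<open>\<phi> k x = - ln (real k)\<close> by simp
  qed
  have bound: "(\<integral>\<^sup>+x. ennreal (f x * \<phi> k x + 1) \<partial>m) \<le> ennreal (b + 1 / real k + 1)" if "k \<ge> 1" for k
  proof -
    have "(\<integral>x. \<phi> k x \<partial>\<nu>) \<le> b + ln (\<integral>x. exp (\<phi> k x) \<partial>m)"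
      by (rule var[OF _ \<phi>_bd[OF that]]) measurable
    moreover have "ln (\<integral>x. exp (\<phi> k x) \<partial>m) \<le> 1 / real k"
    proof -
      have e: "exp (\<phi> k x) = cl k x" for x
        using cl_bds[OF that, of x] that unfolding \<phi>_def
        by (intro exp_ln) (force intro: less_le_trans[of _ "1 / real k"])
      have "0 \<le> cl k x" for x
        by (rule order_trans[OF _ cl_bds(1)[OF that]]) simp
      then have "AE x in m. norm (cl k x) \<le> real k" using cl_bds(2)[OF that] by simp
      moreover have "cl k \<in> borel_measurable m" unfolding cl_def[abs_def] by measurable
      ultimately have i: "integrable m (cl k)"
        by (intro m.integrable_const_bound) auto
      have "(\<integral>x. 1 / real k \<partial>m) \<le> (\<integral>x. cl k x \<partial>m)"
        using i cl_bds[OF that] by (intro integral_mono) auto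
      then have pos: "0 < (\<integral>x. cl k x \<partial>m)" using that by (simp add: m.prob_space) (meson less_le_trans zero_less_divide_1_iff of_nat_0_less_iff less_eq_Suc_le One_nat_def)
      \<comment> \<open>Clamping from below adds at most \<open>1 / k\<close> to \<open>f\<close>,
        so the exponential integral of \<open>\<phi> k\<close> is at most \<open>1 + 1 / k\<close>
        and its logarithm at most \<open>1 / k\<close>.\<close>
      have "cl k x \<le> f x + 1 / real k" for x
      proof -
        have "0 \<le> 1 / real k" by simp
        moreover have "min (max a d) c \<le> a + d" if "0 \<le> a" "0 \<le> d" for a c d :: real
          using that by (auto simp: min_def max_def)
        ultimately show ?thesis using nn[of x] unfolding cl_def by blast
      qed
      then have "(\<integral>x. cl k x \<partial>m) \<le> (\<integral>x. f x + 1 / real k \<partial>m)"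
        using i intf by (intro integral_mono) auto
      then have "(\<integral>x. cl k x \<partial>m) \<le> 1 + 1 / real k" using intf f1 by (simp add: m.prob_space)
      then show ?thesis using e ln_le_minus_one[OF pos] by simp
    qed
    moreover have "(\<integral>x. \<phi> k x \<partial>\<nu>) = (\<integral>x. f x * \<phi> k x \<partial>m)"
      unfolding \<nu>f using nn by (subst integral_real_density) auto
    moreover have i: "integrable m (\<lambda>x. f x * \<phi> k x)"
      using \<phi>_bd[OF that] nn that
      by (intro Bochner_Integration.integrable_bound[OF integrable_mult_right[OF intf, of "ln (real k)"]])
         (auto simp: abs_mult mult.commute intro!: mult_left_mono AE_I2)
    ultimately have "(\<integral>x. f x * \<phi> k x + 1 \<partial>m) \<le> b + 1 / real k + 1" by (simp add: m.prob_space)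
    moreover have "0 \<le> f x * \<phi> k x + 1" for x using low[OF that, of x] by linarith
    then have "(\<integral>\<^sup>+x. ennreal (f x * \<phi> k x + 1) \<partial>m) = ennreal (\<integral>x. f x * \<phi> k x + 1 \<partial>m)"
      using i by (intro nn_integral_eq_integral) auto
    ultimately show ?thesis by (simp add: ennreal_leI)
  qed
  have lim: "(\<lambda>k. f x * \<phi> k x + 1) \<longlonglongrightarrow> f x * ln (f x) + 1" for x
  proof (cases "f x = 0")
    case False
    then have fx: "0 < f x" using nn[of x] by simp
    have "eventually (\<lambda>k. max (f x) (1 / f x) < real k) sequentially"
      using filterlim_at_top_dense[THEN iffD1, OF filterlim_real_sequentially] by blast
    then have "eventually (\<lambda>k. f x * \<phi> k x + 1 = f x * ln (f x) + 1) sequentially"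
    proof eventually_elim
      case (elim k)
      then have "1 / real k \<le> f x" "f x \<le> real k"
        using fx by (auto simp: field_simps intro: less_imp_le)
      then have "cl k x = f x" by (simp add: cl_def)
      then show ?case by (simp add: \<phi>_def)
    qed
    then show ?thesis by (rule tendsto_eventually)
  qed simp
  have "(\<integral>\<^sup>+x. ennreal (f x * ln (f x) + 1) \<partial>m) = (\<integral>\<^sup>+x. liminf (\<lambda>k. ennreal (f x * \<phi> k x + 1)) \<partial>m)"
    by (intro nn_integral_cong lim_imp_Liminf[symmetric] tendsto_ennrealI lim) simp
  also have "\<dots> \<le> liminf (\<lambda>k. \<integral>\<^sup>+x. ennreal (f x * \<phi> k x + 1) \<partial>m)"
    by (intro nn_integral_liminf) measurable
  also have "\<dots> \<le> liminf (\<lambda>k. ennreal (b + 1 / real k + 1))"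
    using bound by (intro Liminf_mono) (auto simp: eventually_sequentially)
  also have "\<dots> = ennreal (b + 0 + 1)"
    by (intro lim_imp_Liminf tendsto_ennrealI tendsto_intros lim_1_over_n) auto
  finally have le: "(\<integral>\<^sup>+x. ennreal (f x * ln (f x) + 1) \<partial>m) \<le> ennreal (b + 1)" by simp
  have nn1: "0 \<le> f x * ln (f x) + 1" for x using diff_one_le_mult_ln[OF nn, of x] nn[of x] by linarith
  have i1: "integrable m (\<lambda>x. f x * ln (f x) + 1)"
    using le nn1 by (intro integrableI_nonneg) (auto simp: order_le_less_trans)
  then have int: "integrable m (\<lambda>x. f x * ln (f x))"
    using Bochner_Integration.integrable_diff[OF i1, of "\<lambda>_. 1"] by simp
  have "ennreal (\<integral>x. f x * ln (f x) + 1 \<partial>m) \<le> ennreal (b + 1)"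
    using le nn_integral_eq_integral[OF i1] nn1 by auto
  then have "(\<integral>x. f x * ln (f x) + 1 \<partial>m) \<le> b + 1"
    by (rule iffD1[OF ennreal_le_iff, rotated]) (use \<open>0 \<le> b\<close> in simp)
  then have "(\<integral>x. f x * ln (f x) \<partial>m) \<le> b"
    using int by (simp add: m.prob_space)
  then show ?thesis
    using int rel_entropy_density[OF m f nn] by (simp add: \<nu>f ennreal_leI)
qed

text \<open>Data processing: a test function on the target, composed with \<open>T\<close>, is a
  test function on the source with the same integrals.\<close>

lemma rel_entropy_distr_le:
  assumes "prob_space m" "prob_space \<nu>" "sets \<nu> = sets m" and T: "T \<in> m \<rightarrow>\<^sub>M N"
  shows "rel_entropy (distr \<nu> N T) (distr m N T) \<le> rel_entropy \<nu> m"
proof (cases "rel_entropy \<nu> m" rule: ennreal_cases)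
  case (real b)
  have T': "T \<in> \<nu> \<rightarrow>\<^sub>M N" using T assms(3) by (simp cong: measurable_cong_sets)
  show ?thesis unfolding real(2)
  proof (rule rel_entropy_le_of_variational)
    show "prob_space (distr m N T)" "prob_space (distr \<nu> N T)"
      using assms T T' by (auto intro: prob_space.prob_space_distr)
    note [measurable] = T T'
    fix \<phi> :: "'b \<Rightarrow> real" and C assume [measurable]: "\<phi> \<in> borel_measurable (distr m N T)" and "\<And>y. \<bar>\<phi> y\<bar> \<le> C"
    with rel_entropy_variational[OF assms(1-3), of b "\<lambda>x. \<phi> (T x)" C] real
    show "(\<integral>x. \<phi> x \<partial>distr \<nu> N T) \<le> b + ln (\<integral>x. exp (\<phi> x) \<partial>distr m N T)"
      by (simp add: integral_distr)
  qed (use real in auto)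
qed simp

lemma density_distr_comp:
  assumes T: "T \<in> m \<rightarrow>\<^sub>M N" and f[measurable]: "f \<in> borel_measurable N"
  shows "distr (density m (\<lambda>x. f (T x))) N T = density (distr m N T) f"
proof (rule measure_eqI)
  note [measurable] = T
  fix A assume "A \<in> sets (distr (density m (\<lambda>x. f (T x))) N T)"
  then have [measurable]: "A \<in> sets N" by simp
  show "emeasure (distr (density m (\<lambda>x. f (T x))) N T) A = emeasure (density (distr m N T) f) A"
    by (subst emeasure_distr, simp, simp, subst emeasure_density, simp, measurable,
        subst emeasure_density, simp, simp, subst nn_integral_distr)
       (auto intro!: nn_integral_cong simp: indicator_def)
qed simp

text \<open>Equality in the data processing inequality when the density is a function of
  \<open>T\<close>, that is, when \<open>T\<close> is sufficient for the two measures.\<close>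

lemma rel_entropy_density_comp:
  fixes f :: "'b \<Rightarrow> real"
  assumes "prob_space m" and T: "T \<in> m \<rightarrow>\<^sub>M N"
    and f[measurable]: "f \<in> borel_measurable N" and nn: "\<And>x. 0 \<le> f x"
  shows "rel_entropy (density m (\<lambda>x. ennreal (f (T x)))) m
    = rel_entropy (density (distr m N T) (\<lambda>y. ennreal (f y))) (distr m N T)"
proof -
  note [measurable] = T
  have "prob_space (distr m N T)" using assms by (intro prob_space.prob_space_distr)
  then show ?thesis
    using rel_entropy_density[OF assms(1), of "\<lambda>x. f (T x)"]
      rel_entropy_density[of "distr m N T" f] nn
    by (simp add: integrable_distr_eq integral_distr)
qed

section \<open>Compactness of entropy balls\<close>

definition entropy_ball :: "'a measure \<Rightarrow> real \<Rightarrow> 'a measure set" where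
  "entropy_ball m b = {\<nu>. prob_space \<nu> \<and> sets \<nu> = sets m \<and> rel_entropy \<nu> m \<le> ennreal b}"

text \<open>Restricted to \<open>sets m\<close> because the points of the product topology are
  extensional functions.\<close>

definition set_function :: "'a measure \<Rightarrow> 'a measure \<Rightarrow> 'a set \<Rightarrow> real" where
  "set_function m \<nu> = restrict (measure \<nu>) (sets m)"

definition measure_of_fun :: "'a measure \<Rightarrow> ('a set \<Rightarrow> real) \<Rightarrow> 'a measure" where
  "measure_of_fun m p = measure_of (space m) (sets m) (\<lambda>A. ennreal (p A))"

abbreviation setwise_topology :: "'a measure \<Rightarrow> ('a set \<Rightarrow> real) topology" where
  "setwise_topology m \<equiv> product_topology (\<lambda>_. euclideanreal) (sets m)"

text \<open>A measure is determined by its values, so the embedding into the product space can be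
  undone; in this way integrals become functions of points of that space.\<close>

lemma measure_of_fun_set_function:
  assumes "finite_measure \<nu>" "sets \<nu> = sets m"
  shows "measure_of_fun m (set_function m \<nu>) = \<nu>"
proof -
  interpret finite_measure \<nu> by fact
  have "measure_of_fun m (set_function m \<nu>) = measure_of (space \<nu>) (sets \<nu>) (emeasure \<nu>)"
    unfolding measure_of_fun_def assms(2) sets_eq_imp_space_eq[OF assms(2)]
    by (intro measure_of_eq)
       (auto simp: sets.space_closed set_function_def emeasure_eq_measure sets.sigma_sets_eq)
  then show ?thesis by (simp add: measure_of_of_measure)
qed

text \<open>The integral of a simple function as a finite combination of evaluations. It makes sense
  for any set function and is continuous for setwise convergence.\<close>

definition simple_integral_of :: "'a measure \<Rightarrow> ('a \<Rightarrow> real) \<Rightarrow> ('a set \<Rightarrow> real) \<Rightarrow> real" where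
  "simple_integral_of m \<psi> p = (\<Sum>y\<in>\<psi> ` space m. p {x\<in>space m. \<psi> x = y} * y)"

lemma integral_simple_function:
  assumes "finite_measure \<nu>" "sets \<nu> = sets m" and \<psi>: "simple_function m \<psi>"
  shows "(\<integral>x. \<psi> x \<partial>\<nu>) = simple_integral_of m \<psi> (set_function m \<nu>)"
proof -
  interpret finite_measure \<nu> by fact
  have sp: "space \<nu> = space m" by (rule sets_eq_imp_space_eq) fact
  have meas: "{x\<in>space m. \<psi> x = y} \<in> sets m" for y
    using borel_measurable_simple_function[OF \<psi>] by measurable
  have "Bochner_Integration.simple_bochner_integrable \<nu> \<psi>"
  proof (rule simple_bochner_integrable.intros)
    show "simple_function \<nu> \<psi>" using \<psi> assms(2) sp by (simp add: simple_function_def)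
  qed (simp add: emeasure_eq_measure)
  then have "(\<integral>x. \<psi> x \<partial>\<nu>) = (\<Sum>y\<in>\<psi> ` space \<nu>. measure \<nu> {x\<in>space \<nu>. \<psi> x = y} *\<^sub>R y)"
    by (simp add: simple_bochner_integrable_eq_integral[symmetric] simple_bochner_integral_def)
  then show ?thesis using meas by (simp add: simple_integral_of_def set_function_def sp)
qed

lemma continuous_map_simple_integral_of:
  assumes \<psi>: "simple_function m \<psi>"
  shows "continuous_map (setwise_topology m) euclideanreal (simple_integral_of m \<psi>)"
proof -
  have meas: "{x\<in>space m. \<psi> x = y} \<in> sets m" for y
    using borel_measurable_simple_function[OF \<psi>] by measurable
  show ?thesis
    unfolding simple_integral_of_def using \<psi> meas
    by (intro continuous_map_sum continuous_map_real_mult_right continuous_map_product_projection)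
       (auto simp: simple_function_def)
qed

text \<open>Setwise limits inherit finite additivity only. The entropy inequality, tested with
  multiples of an indicator, makes \<open>p A\<close> small as soon as \<open>measure m A\<close> is
  exponentially small, which yields continuity at the empty set and thus countable
  additivity.\<close>

lemma entropic_set_function_measure:
  fixes p :: "'a set \<Rightarrow> real"
  assumes m: "prob_space m" and "0 \<le> b"
    and nn: "\<And>A. A \<in> sets m \<Longrightarrow> 0 \<le> p A" and one: "p (space m) = 1"
    and add: "\<And>A B. A \<in> sets m \<Longrightarrow> B \<in> sets m \<Longrightarrow> A \<inter> B = {} \<Longrightarrow> p (A \<union> B) = p A + p B"
    and ent: "\<And>\<psi>. simple_function m \<psi> \<Longrightarrow> simple_integral_of m \<psi> p \<le> b + ln (\<integral>x. exp (\<psi> x) \<partial>m)"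
  obtains \<nu> where "\<nu> \<in> entropy_ball m b" "\<And>A. A \<in> sets m \<Longrightarrow> measure \<nu> A = p A"
proof -
  interpret m: prob_space m by fact
  define \<nu> where "\<nu> = measure_of_fun m p"
  have empty: "p {} = 0" using add[of "{}" "{}"] by simp
  have pt: "p A * t \<le> b + ln (\<integral>x. exp (t * indicator A x) \<partial>m)" if A: "A \<in> sets m" and "t > 0" for A t
  proof -
    have sf: "simple_function m (\<lambda>x. t * indicator A x)" using A by auto
    \<comment> \<open>The level set of the value 0 has an unknown mass under \<open>p\<close>, but
      this mass is multiplied by 0. The empty set is a separate case below, since then
      \<open>t\<close> is not a value of the function.\<close>
    have i: "p {x\<in>space m. t * indicator A x = y} * y = (if y = t then p A * t else 0)" for y
    proof (cases "y = t")
      case True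
      then have "{x\<in>space m. t * indicator A x = y} = A"
        using sets.sets_into_space[OF A] \<open>t > 0\<close> by (auto simp: indicator_def)
      then show ?thesis using True by simp
    next
      case False
      then have "{x\<in>space m. t * indicator A x = y} = {}" if "y \<noteq> 0"
        using that by (auto simp: indicator_def)
      then show ?thesis using False empty by (cases "y = 0") (simp, metis mult_zero_left)
    qed
    have "simple_integral_of m (\<lambda>x. t * indicator A x) p = p A * t"
    proof (cases "A = {}")
      case True then show ?thesis using empty unfolding simple_integral_of_def i by (intro trans[OF sum.neutral]) auto
    next
      case False
      then have "t \<in> (\<lambda>x. t * indicator A x) ` space m"
        using sets.sets_into_space[OF A] by (force simp: indicator_def)
      moreover have "finite ((\<lambda>x. t * indicator A x) ` space m)" using sf by (simp add: simple_function_def)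
      ultimately show ?thesis unfolding simple_integral_of_def i by simp
    qed
    then show ?thesis using ent[OF sf] by simp
  qed
  have cont: "(\<lambda>i. ennreal (p (A i))) \<longlonglongrightarrow> 0"
    if A: "range A \<subseteq> sets m" "decseq A" "(\<Inter>i. A i) = {}" for A
  proof -
    have lim: "(\<lambda>i. measure m (A i)) \<longlonglongrightarrow> 0"
      using m.finite_Lim_measure_decseq[OF A(1,2)] A(3) by simp
    have "(\<lambda>i. p (A i)) \<longlonglongrightarrow> 0"
    proof (rule LIMSEQ_I)
      fix e :: real assume "0 < e"
      \<comment> \<open>Twice the threshold that would give \<open>e\<close>; the bound becomes
        \<open>e / 2\<close> and the inequality strict.\<close>
      define t where "t = 2 * (b + ln 2) / e"
      have "t > 0" using \<open>0 < e\<close> \<open>0 \<le> b\<close> by (simp add: t_def add_nonneg_pos)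
      obtain N where N: "\<And>i. i \<ge> N \<Longrightarrow> measure m (A i) < exp (- t)"
        using order_tendstoD(2)[OF lim, of "exp (- t)"] by (auto simp: eventually_sequentially)
      have "norm (p (A i) - 0) < e" if "i \<ge> N" for i
      proof -
        have Ai: "A i \<in> sets m" using A by auto
        have "p (A i) \<le> (b + ln 2) / t"
          using two_set_variational[OF m Ai pt[OF Ai \<open>t > 0\<close>] \<open>t > 0\<close>] N[OF that] by simp
        also have "(b + ln 2) / t = e / 2"
        proof -
          have "c / (2 * c / e) = e / 2" if "0 < c" for c using that by simp
          from this[of "b + ln 2"] show ?thesis using \<open>0 \<le> b\<close> by (simp only: t_def add_nonneg_pos ln_gt_zero_iff)
        qed
        finally show ?thesis using nn[OF Ai] \<open>0 < e\<close> by simp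
      qed
      then show "\<exists>no. \<forall>n\<ge>no. norm (p (A n) - 0) < e" by blast
    qed
    then show ?thesis using tendsto_ennrealI by fastforce
  qed
  have ca: "countably_additive (sets m) (\<lambda>A. ennreal (p A))"
  proof (rule sets.empty_continuous_imp_countably_additive)
    show "positive (sets m) (\<lambda>A. ennreal (p A))" using empty by (simp add: positive_def)
    show "additive (sets m) (\<lambda>A. ennreal (p A))"
      using add nn by (simp add: additive_def)
  qed (use cont in auto)
  have em: "emeasure \<nu> A = ennreal (p A)" if "A \<in> sets m" for A
    unfolding \<nu>_def measure_of_fun_def using that ca empty
    by (subst emeasure_measure_of_sigma) (auto simp: positive_def sets.sigma_algebra_axioms)
  have s: "sets \<nu> = sets m" by (simp add: \<nu>_def measure_of_fun_def)
  have sp: "space \<nu> = space m" by (simp add: \<nu>_def measure_of_fun_def)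
  have ps: "prob_space \<nu>" using em[of "space m"] one sp by (intro prob_spaceI) auto
  have meas: "measure \<nu> A = p A" if "A \<in> sets m" for A
    using em[OF that] nn[OF that] by (simp add: measure_def)
  have "rel_entropy \<nu> m \<le> ennreal b"
  proof (rule rel_entropy_le_of_variational[OF m ps s \<open>0 \<le> b\<close> variational_bounded_of_simple[OF m ps s]])
    fix \<psi> :: "'a \<Rightarrow> real" assume \<psi>: "simple_function m \<psi>"
    have "{x\<in>space m. \<psi> x = y} \<in> sets m" for y
      using borel_measurable_simple_function[OF \<psi>] by measurable
    then have "simple_integral_of m \<psi> (set_function m \<nu>) = simple_integral_of m \<psi> p"
      unfolding simple_integral_of_def by (intro sum.cong) (auto simp: set_function_def meas)
    then show "(\<integral>x. \<psi> x \<partial>\<nu>) \<le> b + ln (\<integral>x. exp (\<psi> x) \<partial>m)"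
      using integral_simple_function[OF prob_space.finite_measure[OF ps] s \<psi>] ent[OF \<psi>] by simp
  qed
  then show thesis using that[of \<nu>] ps s meas by (simp add: entropy_ball_def)
qed

text \<open>The ball is cut out of the compact cube of all functions from \<open>sets m\<close> to
  the unit interval by closed conditions: normalisation, finite additivity, and one entropy
  inequality for each simple function.\<close>

theorem compactin_entropy_ball:
  assumes m: "prob_space m" and "0 \<le> b"
  shows "compactin (setwise_topology m) (set_function m ` entropy_ball m b)"
proof -
  let ?X = "setwise_topology m"
  define K0 where "K0 = PiE (sets m) (\<lambda>_. {0..1::real})"
  define K1 where "K1 = {p \<in> topspace ?X. p (space m) \<in> {1}}"
  define K2 where "K2 = (\<lambda>(A, B). {p \<in> topspace ?X. p (A \<union> B) - (p A + p B) \<in> {0}})"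
  define K3 where "K3 \<psi> = {p \<in> topspace ?X. simple_integral_of m \<psi> p \<in> {.. b + ln (\<integral>x. exp (\<psi> x) \<partial>m)}}" for \<psi>
  define \<K> where "\<K> = insert K0 (insert K1 (K2 ` {(A, B). A \<in> sets m \<and> B \<in> sets m \<and> A \<inter> B = {}}
    \<union> K3 ` {\<psi>. simple_function m \<psi>}))"
  have K0: "compactin ?X K0" unfolding K0_def by (simp add: compactin_PiE)
  have "closedin ?X K0" unfolding K0_def by (simp add: closedin_product_topology)
  moreover have "closedin ?X K1"
    unfolding K1_def by (intro closedin_continuous_map_preimage[where Y=euclideanreal] continuous_map_product_projection) auto
  moreover have "closedin ?X (K2 (A, B))" if "A \<in> sets m" "B \<in> sets m" for A B
    unfolding K2_def prod.case using that
    by (intro closedin_continuous_map_preimage[where Y=euclideanreal] continuous_map_diff continuous_map_add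
        continuous_map_product_projection) auto
  moreover have "closedin ?X (K3 \<psi>)" if "simple_function m \<psi>" for \<psi>
    unfolding K3_def using that
    by (intro closedin_continuous_map_preimage[where Y=euclideanreal] continuous_map_simple_integral_of) auto
  ultimately have "compactin ?X (\<Inter>\<K>)"
    by (intro closed_compactin_Inter[OF K0]) (auto simp: \<K>_def)
  moreover have "\<Inter>\<K> = set_function m ` entropy_ball m b"
  proof (intro set_eqI iffI)
    fix p assume p: "p \<in> \<Inter>\<K>"
    then have "p \<in> K0" "p \<in> K1" by (auto simp: \<K>_def)
    have "p \<in> K2 (A, B)" if "A \<in> sets m" "B \<in> sets m" "A \<inter> B = {}" for A B
      using p that by (auto simp: \<K>_def)
    then have add: "p (A \<union> B) = p A + p B" if "A \<in> sets m" "B \<in> sets m" "A \<inter> B = {}" for A B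
      using that by (force simp: K2_def)
    have "p \<in> K3 \<psi>" if "simple_function m \<psi>" for \<psi>
      using p that by (auto simp: \<K>_def)
    then obtain \<nu> where \<nu>: "\<nu> \<in> entropy_ball m b" "\<And>A. A \<in> sets m \<Longrightarrow> measure \<nu> A = p A"
      using \<open>p \<in> K0\<close> \<open>p \<in> K1\<close> add
      by (elim entropic_set_function_measure[OF m \<open>0 \<le> b\<close>, rotated -1, of p])
         (auto simp: K0_def K1_def K3_def PiE_iff)
    have "p = set_function m \<nu>"
      using \<open>p \<in> K0\<close> \<nu>(2) by (auto simp: K0_def set_function_def PiE_iff extensional_def)
    then show "p \<in> set_function m ` entropy_ball m b" using \<nu>(1) by blast
  next
    fix p assume "p \<in> set_function m ` entropy_ball m b"
    then obtain \<nu> where \<nu>: "prob_space \<nu>" "sets \<nu> = sets m" "rel_entropy \<nu> m \<le> ennreal b"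
      and p: "p = set_function m \<nu>" by (auto simp: entropy_ball_def)
    interpret \<nu>: prob_space \<nu> by fact
    have "space \<nu> = space m" by (rule sets_eq_imp_space_eq) fact
    have "p \<in> K0" by (auto simp: K0_def p set_function_def)
    moreover have "p \<in> K1" using \<nu>.prob_space \<open>space \<nu> = space m\<close> by (simp add: K1_def p set_function_def)
    moreover have "p \<in> K2 (A, B)" if "A \<in> sets m" "B \<in> sets m" "A \<inter> B = {}" for A B
      using that \<nu>(2) \<nu>.finite_measure_Union[of A B] by (simp add: K2_def p set_function_def)
    moreover have "p \<in> K3 \<psi>" if \<psi>: "simple_function m \<psi>" for \<psi>
    proof -
      have fin: "finite (\<psi> ` space m)" using \<psi> by (simp add: simple_function_def)
      \<comment> \<open>\<open>rel_entropy_variational\<close> asks for a bound on the whole type,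
        while a simple function is controlled on \<open>space m\<close> only.\<close>
      define \<psi>' where "\<psi>' x = (if x \<in> space m then \<psi> x else 0)" for x
      have "finite (range \<psi>')"
        by (rule finite_subset[of _ "insert 0 (\<psi> ` space m)"]) (use fin in \<open>auto simp: \<psi>'_def\<close>)
      then have bd: "\<And>x. \<bar>\<psi>' x\<bar> \<le> Max ((\<lambda>y. \<bar>y\<bar>) ` range \<psi>')" by (auto intro!: Max_ge)
      have "\<psi>' \<in> borel_measurable m"
        using borel_measurable_simple_function[OF \<psi>]
        by (subst measurable_cong[of m \<psi>' \<psi>]) (auto simp: \<psi>'_def)
      from rel_entropy_variational[OF m \<nu> \<open>0 \<le> b\<close> this bd]
      have "(\<integral>x. \<psi> x \<partial>\<nu>) \<le> b + ln (\<integral>x. exp (\<psi> x) \<partial>m)"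
      proof -
        assume "(\<integral>x. \<psi>' x \<partial>\<nu>) \<le> b + ln (\<integral>x. exp (\<psi>' x) \<partial>m)"
        moreover have "(\<integral>x. \<psi>' x \<partial>\<nu>) = (\<integral>x. \<psi> x \<partial>\<nu>)" "(\<integral>x. exp (\<psi>' x) \<partial>m) = (\<integral>x. exp (\<psi> x) \<partial>m)"
          using \<open>space \<nu> = space m\<close> by (auto intro!: Bochner_Integration.integral_cong simp: \<psi>'_def)
        ultimately show ?thesis by simp
      qed
      then show ?thesis
        using integral_simple_function[OF \<nu>.finite_measure_axioms \<nu>(2) \<psi>]
        by (simp add: K3_def p set_function_def)
    qed
    ultimately show "p \<in> \<Inter>\<K>" by (auto simp: \<K>_def)
  qed
  ultimately show ?thesis by simp
qed

section \<open>Continuity of integrals for setwise convergence\<close>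

lemma continuous_map_local_approx:
  fixes f :: "'a \<Rightarrow> real"
  assumes "\<And>x e. x \<in> topspace X \<Longrightarrow> e > 0 \<Longrightarrow> \<exists>g U. continuous_map X euclideanreal g \<and> openin X U \<and>
    x \<in> U \<and> (\<forall>y\<in>U. \<bar>f y - g y\<bar> \<le> e)"
  shows "continuous_map X euclideanreal f"
  unfolding continuous_map_atin limitin_canonical_iff
proof (intro ballI tendstoI)
  fix x and e :: real assume x: "x \<in> topspace X" and "e > 0"
  obtain g U where g: "continuous_map X euclideanreal g" and U: "openin X U" "x \<in> U"
    and fg: "\<And>y. y \<in> U \<Longrightarrow> \<bar>f y - g y\<bar> \<le> e / 4"
    using assms[OF x, of "e / 4"] \<open>e > 0\<close> by auto
  have "(g \<longlongrightarrow> g x) (atin X x)" using g x by (simp add: continuous_map_atin limitin_canonical_iff)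
  then have "\<forall>\<^sub>F y in atin X x. dist (g y) (g x) < e / 4" using \<open>e > 0\<close> by (intro tendstoD) auto
  moreover have "\<forall>\<^sub>F y in atin X x. y \<in> U"
    using x U by (auto simp: eventually_atin)
  ultimately show "\<forall>\<^sub>F y in atin X x. dist (f y) (f x) < e"
  proof eventually_elim
    case (elim y)
    then show ?case using fg[of y] fg[OF U(2)] \<open>e > 0\<close> unfolding dist_real_def by arith
  qed
qed

lemma continuous_map_uniform_approx:
  fixes f :: "'a \<Rightarrow> real"
  assumes "\<And>e. e > 0 \<Longrightarrow> \<exists>g. continuous_map X euclideanreal g \<and> (\<forall>x\<in>topspace X. \<bar>f x - g x\<bar> \<le> e)"
  shows "continuous_map X euclideanreal f"
  using assms by (intro continuous_map_local_approx) (metis openin_topspace)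

text \<open>A bounded measurable integrand is a uniform limit of simple ones, so its integral is a
  uniform limit of continuous functions. On the subtopology \<open>measure_of_fun\<close> meets only
  genuine probability measures.\<close>

lemma continuous_map_integral_bounded:
  fixes \<phi> :: "'a \<Rightarrow> real"
  assumes \<phi>[measurable]: "\<phi> \<in> borel_measurable m" and bd: "\<And>x. \<bar>\<phi> x\<bar> \<le> C"
    and S: "\<And>\<nu>. \<nu> \<in> S \<Longrightarrow> prob_space \<nu> \<and> sets \<nu> = sets m"
  shows "continuous_map (subtopology (setwise_topology m) (set_function m ` S)) euclideanreal
    (\<lambda>p. \<integral>x. \<phi> x \<partial>measure_of_fun m p)"
proof (rule continuous_map_uniform_approx)
  fix e :: real assume "0 < e"
  obtain \<psi> where sf: "simple_function m \<psi>" and 1: "\<And>x. \<psi> x \<le> \<phi> x" "\<And>x. \<phi> x \<le> \<psi> x + e"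
    using simple_function_uniform_approx[OF \<phi> bd \<open>0 < e\<close>] by metis
  have [measurable]: "\<psi> \<in> borel_measurable m" by (rule borel_measurable_simple_function[OF sf])
  show "\<exists>g. continuous_map (subtopology (setwise_topology m) (set_function m ` S)) euclideanreal g \<and>
     (\<forall>p\<in>topspace (subtopology (setwise_topology m) (set_function m ` S)).
       \<bar>(\<integral>x. \<phi> x \<partial>measure_of_fun m p) - g p\<bar> \<le> e)"
  proof (intro exI conjI ballI)
    show "continuous_map (subtopology (setwise_topology m) (set_function m ` S)) euclideanreal (simple_integral_of m \<psi>)"
      by (intro continuous_map_from_subtopology continuous_map_simple_integral_of sf)
    fix p assume "p \<in> topspace (subtopology (setwise_topology m) (set_function m ` S))"
    then obtain \<nu> where p: "p = set_function m \<nu>" and \<nu>: "prob_space \<nu>" "sets \<nu> = sets m"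
      using S by auto
    interpret \<nu>: prob_space \<nu> by fact
    have eq: "measure_of_fun m p = \<nu>"
      unfolding p by (intro measure_of_fun_set_function \<nu>.finite_measure_axioms \<nu>)
    have [measurable]: "\<phi> \<in> borel_measurable \<nu>" "\<psi> \<in> borel_measurable \<nu>"
      using \<phi> \<open>\<psi> \<in> borel_measurable m\<close> \<nu>(2) by (simp_all cong: measurable_cong_sets)
    have i1: "integrable \<nu> \<phi>" using bd by (intro \<nu>.integrable_const_bound[where B=C]) auto
    have b\<psi>: "\<bar>\<psi> x\<bar> \<le> C + e" for x
    proof -
      have "\<bar>\<psi> x\<bar> \<le> \<bar>\<phi> x\<bar> + e" using 1[of x] by arith
      then show ?thesis using bd[of x] by linarith
    qed
    then have i2: "integrable \<nu> \<psi>" by (intro \<nu>.integrable_const_bound[where B="C + e"]) auto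
    have "\<bar>(\<integral>x. \<phi> x \<partial>\<nu>) - (\<integral>x. \<psi> x \<partial>\<nu>)\<bar> \<le> e"
    proof -
      have "(\<integral>x. \<psi> x \<partial>\<nu>) \<le> (\<integral>x. \<phi> x \<partial>\<nu>)" using i1 i2 1 by (intro integral_mono) auto
      moreover have "(\<integral>x. \<phi> x \<partial>\<nu>) \<le> (\<integral>x. \<psi> x + e \<partial>\<nu>)" using i1 i2 1 by (intro integral_mono) auto
      ultimately show ?thesis using i2 by (simp add: \<nu>.prob_space)
    qed
    then show "\<bar>(\<integral>x. \<phi> x \<partial>measure_of_fun m p) - simple_integral_of m \<psi> p\<bar> \<le> e"
      using eq integral_simple_function[OF \<nu>.finite_measure_axioms \<nu>(2) sf] p by simp
  qed
qed

section \<open>Quantile functions\<close>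

text \<open>The open interval: the quantile at each of its levels is finite.\<close>

abbreviation unit_interval :: "real measure" where
  "unit_interval \<equiv> restrict_space lborel {0<..<1}"

lemma prob_space_unit_interval: "prob_space unit_interval"
  by (auto simp: emeasure_restrict_space space_restrict_space intro!: prob_spaceI)

lemma space_unit_interval: "space unit_interval = {0<..<1}"
  by (simp add: space_restrict_space)

definition distribution_function :: "real measure \<Rightarrow> real \<Rightarrow> real" where
  "distribution_function \<gamma> t = measure \<gamma> {0..t}"

text \<open>The maximum with 0 only matters for \<open>u \<notin> {0<..<1}\<close>.\<close>

definition quantile :: "real measure \<Rightarrow> real \<Rightarrow> real" where
  "quantile \<gamma> u = max 0 (Inf {t. u \<le> distribution_function \<gamma> t})"

lemma quantile_nonneg: "0 \<le> quantile \<gamma> u"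
  by (simp add: quantile_def)

lemma Icc_in_sets_Rplus: "{0..t} \<in> sets Rplus"
  by (auto simp: sets_restrict_space_iff)

context
  fixes \<gamma> :: "real measure"
  assumes \<gamma>: "\<gamma> \<in> M1 Rplus"
begin

lemma sets_M1_Rplus: "sets \<gamma> = sets Rplus" and prob_space_M1_Rplus: "prob_space \<gamma>"
  and space_M1_Rplus: "space \<gamma> = {0..}"
  using \<gamma> sets_eq_imp_space_eq[of \<gamma> Rplus] by (auto simp: space_prob_algebra space_restrict_space)

lemma id_measurable_M1_Rplus: "(\<lambda>w. w) \<in> borel_measurable \<gamma>"
  by (subst measurable_cong_sets[OF sets_M1_Rplus refl]) (auto intro!: measurable_restrict_space1)

text \<open>Pushing \<gamma> forward to the whole line gives access to the quantile transform of
  \<open>cdf_distribution\<close>, from which the facts on \<open>quantile\<close> below are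
  derived.\<close>

lemma cdf_distribution_M1_Rplus: "cdf_distribution (distr \<gamma> borel (\<lambda>w. w))"
proof -
  interpret prob_space \<gamma> by (rule prob_space_M1_Rplus)
  show ?thesis
    unfolding cdf_distribution_def using id_measurable_M1_Rplus by (rule real_distribution_distr)
qed

lemma distribution_function_eq_cdf: "distribution_function \<gamma> = cdf (distr \<gamma> borel (\<lambda>w. w))"
proof
  fix t :: real
  have "{..t} \<inter> {0..} = {0..t}" by auto
  then show "distribution_function \<gamma> t = cdf (distr \<gamma> borel (\<lambda>w. w)) t"
    using id_measurable_M1_Rplus
    by (simp add: cdf_def measure_distr space_M1_Rplus distribution_function_def Int_def conj_commute)
qed

lemma distribution_function_neg: "t < 0 \<Longrightarrow> distribution_function \<gamma> t = 0"
  by (simp add: distribution_function_def)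

lemma quantile_eq_Inf: assumes "0 < u" "u < 1" shows "quantile \<gamma> u = Inf {t. u \<le> distribution_function \<gamma> t}"
proof -
  interpret cdf_distribution "distr \<gamma> borel (\<lambda>w. w)" by (rule cdf_distribution_M1_Rplus)
  have "u \<le> distribution_function \<gamma> (Inf {t. u \<le> distribution_function \<gamma> t})"
    using pseudoinverse[of u "I u"] assms unfolding distribution_function_eq_cdf by simp
  then have "0 \<le> Inf {t. u \<le> distribution_function \<gamma> t}"
    using assms(1) distribution_function_neg by (metis leD le_less_linear)
  then show ?thesis by (simp add: quantile_def)
qed

text \<open>The Galois connection between quantile and distribution function. Monotonicity, the
  comparison of two laws and the formula for sorted samples all go through it.\<close>

lemma quantile_le_iff:
  assumes "0 < u" "u < 1"
  shows "quantile \<gamma> u \<le> t \<longleftrightarrow> u \<le> distribution_function \<gamma> t"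
proof -
  interpret cdf_distribution "distr \<gamma> borel (\<lambda>w. w)" by (rule cdf_distribution_M1_Rplus)
  show ?thesis
    using pseudoinverse[of u t] assms by (simp add: quantile_eq_Inf distribution_function_eq_cdf)
qed

lemma distribution_function_bounds: "0 \<le> distribution_function \<gamma> t" "distribution_function \<gamma> t \<le> 1"
  using prob_space.prob_le_1[OF prob_space_M1_Rplus] by (auto simp: distribution_function_def)

lemma mono_distribution_function: "mono (distribution_function \<gamma>)"
proof -
  interpret cdf_distribution "distr \<gamma> borel (\<lambda>w. w)" by (rule cdf_distribution_M1_Rplus)
  show ?thesis using mono unfolding distribution_function_eq_cdf .
qed

lemma measurable_distribution_function[measurable]: "distribution_function \<gamma> \<in> borel_measurable borel"
  by (intro borel_measurable_mono mono_distribution_function)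

lemma mono_on_quantile: "mono_on {0<..<1} (quantile \<gamma>)"
proof (rule mono_onI)
  fix r s :: real assume rs: "r \<in> {0<..<1}" "s \<in> {0<..<1}" "r \<le> s"
  then have "s \<le> distribution_function \<gamma> (quantile \<gamma> s)" using quantile_le_iff[of s "quantile \<gamma> s"] by auto
  then show "quantile \<gamma> r \<le> quantile \<gamma> s" using rs quantile_le_iff[of r] by auto
qed

lemma measurable_quantile_borel: "quantile \<gamma> \<in> borel_measurable unit_interval"
proof -
  have "quantile \<gamma> \<in> borel_measurable (restrict_space borel {0<..<1})"
    by (rule borel_measurable_mono_on_fnc[OF mono_on_quantile])
  then show ?thesis by (simp add: measurable_def sets_restrict_space space_restrict_space)
qed

lemma measurable_quantile: "quantile \<gamma> \<in> unit_interval \<rightarrow>\<^sub>M Rplus"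
  using measurable_quantile_borel quantile_nonneg by (intro measurable_restrict_space2) auto

lemma distr_quantile: "distr unit_interval Rplus (quantile \<gamma>) = \<gamma>"
proof (rule measure_eqI)
  interpret cdf_distribution "distr \<gamma> borel (\<lambda>w. w)" by (rule cdf_distribution_M1_Rplus)
  have eq: "distr unit_interval borel (quantile \<gamma>) = distr \<gamma> borel (\<lambda>w. w)"
  proof -
    have "distr unit_interval borel (quantile \<gamma>) = distr unit_interval borel I"
      by (intro distr_cong) (auto simp: space_restrict_space quantile_eq_Inf distribution_function_eq_cdf)
    then show ?thesis by (simp add: distr_I_eq_M)
  qed
  fix A assume "A \<in> sets (distr unit_interval Rplus (quantile \<gamma>))"
  then have A: "A \<in> sets Rplus" by simp
  then have A': "A \<in> sets borel" "A \<subseteq> {0..}" by (auto simp: sets_restrict_space_iff)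
  have "emeasure (distr unit_interval Rplus (quantile \<gamma>)) A = emeasure (distr unit_interval borel (quantile \<gamma>)) A"
    using A A' measurable_quantile measurable_quantile_borel by (simp add: emeasure_distr)
  also have "\<dots> = emeasure \<gamma> A"
    unfolding eq using A' id_measurable_M1_Rplus
    by (simp add: emeasure_distr space_M1_Rplus Int_absorb2)
  finally show "emeasure (distr unit_interval Rplus (quantile \<gamma>)) A = emeasure \<gamma> A" .
qed (simp add: sets_M1_Rplus)

end

text \<open>For laws on the line this is the classical formula for the Wasserstein distance. Unlike
  \<open>wasserstein1\<close> it carries no infimum over couplings. Both distribution functions
  vanish at negative \<open>t\<close>, so integrating over the whole line is harmless.\<close>

definition cdf_dist :: "real measure \<Rightarrow> real measure \<Rightarrow> ennreal" where
  "cdf_dist \<gamma> \<gamma>' = (\<integral>\<^sup>+t. ennreal \<bar>distribution_function \<gamma> t - distribution_function \<gamma>' t\<bar> \<partial>lborel)"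

lemma nn_integral_indicator_between:
  "(\<integral>\<^sup>+t. indicator {min a b..<max a b} t \<partial>lborel) = ennreal \<bar>a - b\<bar>" for a b :: real
  by (auto simp: min_def max_def)

text \<open>Both sides are the area between two curves, computed in the two orders of integration: a
  distance is the length of an interval, and by \<open>quantile_le_iff\<close> the point
  \<open>t\<close> lies between the quantiles at \<open>u\<close> exactly if \<open>u\<close> lies
  between the distribution functions at \<open>t\<close>.\<close>

lemma nn_integral_abs_diff_eq_cdf_dist:
  assumes \<gamma>: "\<gamma> \<in> M1 Rplus" and \<gamma>': "\<gamma>' \<in> M1 Rplus"
  shows "(\<integral>\<^sup>+u. ennreal \<bar>quantile \<gamma> u - quantile \<gamma>' u\<bar> \<partial>unit_interval) = cdf_dist \<gamma> \<gamma>'"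
proof -
  note [measurable] = measurable_quantile_borel[OF \<gamma>] measurable_quantile_borel[OF \<gamma>']
    measurable_distribution_function[OF \<gamma>] measurable_distribution_function[OF \<gamma>']
  interpret U: prob_space unit_interval by (rule prob_space_unit_interval)
  interpret P: pair_sigma_finite unit_interval lborel ..
  have "(\<integral>\<^sup>+u. ennreal \<bar>quantile \<gamma> u - quantile \<gamma>' u\<bar> \<partial>unit_interval)
    = (\<integral>\<^sup>+u. (\<integral>\<^sup>+t. indicator {min (quantile \<gamma> u) (quantile \<gamma>' u)..<max (quantile \<gamma> u) (quantile \<gamma>' u)} t \<partial>lborel) \<partial>unit_interval)"
    by (simp only: nn_integral_indicator_between)
  also have "\<dots> = (\<integral>\<^sup>+t. (\<integral>\<^sup>+u. indicator {min (quantile \<gamma> u) (quantile \<gamma>' u)..<max (quantile \<gamma> u) (quantile \<gamma>' u)} t \<partial>unit_interval) \<partial>lborel)"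
    by (rule P.Fubini'[symmetric]) (simp add: indicator_def[abs_def] split_beta', measurable)
  also have "\<dots> = (\<integral>\<^sup>+t. ennreal \<bar>distribution_function \<gamma> t - distribution_function \<gamma>' t\<bar> \<partial>lborel)"
  proof (rule nn_integral_cong)
    fix t
    let ?a = "distribution_function \<gamma> t" and ?b = "distribution_function \<gamma>' t"
    have ab: "0 \<le> ?a" "?a \<le> 1" "0 \<le> ?b" "?b \<le> 1"
      using distribution_function_bounds \<gamma> \<gamma>' by auto
    have "(\<integral>\<^sup>+u. indicator {min (quantile \<gamma> u) (quantile \<gamma>' u)..<max (quantile \<gamma> u) (quantile \<gamma>' u)} t \<partial>unit_interval)
      = (\<integral>\<^sup>+u. indicator ({min ?a ?b<..max ?a ?b} \<inter> {0<..<1}) u \<partial>unit_interval)"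
    proof (rule nn_integral_cong)
      fix u assume "u \<in> space unit_interval"
      then have u: "0 < u" "u < 1" by (auto simp: space_restrict_space)
      show "indicator {min (quantile \<gamma> u) (quantile \<gamma>' u)..<max (quantile \<gamma> u) (quantile \<gamma>' u)} t
        = (indicator ({min ?a ?b<..max ?a ?b} \<inter> {0<..<1}) u :: ennreal)"
        using u quantile_le_iff[OF \<gamma> u, of t] quantile_le_iff[OF \<gamma>' u, of t]
        by (auto simp: indicator_def min_le_iff_disj less_max_iff_disj not_le[symmetric] le_max_iff_disj)
    qed
    also have "\<dots> = emeasure unit_interval ({min ?a ?b<..max ?a ?b} \<inter> {0<..<1})"
      by (intro nn_integral_indicator) (auto simp: sets_restrict_space_iff)
    also have "\<dots> = emeasure lborel ({min ?a ?b<..max ?a ?b} \<inter> {0<..<1})"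
      by (subst emeasure_restrict_space) auto
    \<comment> \<open>Cutting down to \<open>{0<..<1}\<close> loses at most the point 1, a null
      set.\<close>
    also have "\<dots> = emeasure lborel {min ?a ?b<..max ?a ?b}"
    proof (rule emeasure_eq_AE)
      have "AE u in lborel. u \<noteq> (1::real)" by (rule AE_lborel_singleton)
      then show "AE u in lborel. u \<in> {min ?a ?b<..max ?a ?b} \<inter> {0<..<1} \<longleftrightarrow> u \<in> {min ?a ?b<..max ?a ?b}"
        by eventually_elim (use ab in \<open>auto simp: min_less_iff_disj le_max_iff_disj\<close>)
    qed auto
    also have "\<dots> = ennreal \<bar>?a - ?b\<bar>" by (auto simp: min_def max_def)
    finally show "(\<integral>\<^sup>+u. indicator {min (quantile \<gamma> u) (quantile \<gamma>' u)..<max (quantile \<gamma> u) (quantile \<gamma>' u)} t \<partial>unit_interval)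
      = ennreal \<bar>?a - ?b\<bar>" .
  qed
  finally show ?thesis by (simp add: cdf_dist_def)
qed

text \<open>Under a coupling the two distribution functions at \<open>t\<close> differ by at most
  the probability that \<open>t\<close> separates the two coordinates; integrating over
  \<open>t\<close> turns this probability into the expected distance.\<close>

lemma cdf_dist_le_wasserstein1:
  assumes \<gamma>: "\<gamma> \<in> M1 Rplus" and \<gamma>': "\<gamma>' \<in> M1 Rplus"
  shows "cdf_dist \<gamma> \<gamma>' \<le> wasserstein1 \<gamma> \<gamma>'"
  unfolding wasserstein1_def
proof (rule INF_greatest)
  fix \<pi> assume "\<pi> \<in> couplings \<gamma> \<gamma>'"
  then have \<pi>: "prob_space \<pi>" "sets \<pi> = sets (Rplus \<Otimes>\<^sub>M Rplus)"
    and m1: "distr \<pi> Rplus fst = \<gamma>" and m2: "distr \<pi> Rplus snd = \<gamma>'"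
    by (auto simp: couplings_def space_prob_algebra)
  interpret prob_space \<pi> by fact
  interpret P: pair_sigma_finite \<pi> lborel ..
  have fs: "fst \<in> \<pi> \<rightarrow>\<^sub>M Rplus" "snd \<in> \<pi> \<rightarrow>\<^sub>M Rplus"
    using \<pi>(2) by (auto cong: measurable_cong_sets)
  have [measurable]: "fst \<in> borel_measurable \<pi>" "snd \<in> borel_measurable \<pi>"
    using fs measurable_restrict_space2_iff by blast+
  have F: "distribution_function \<gamma> t = measure \<pi> {z\<in>space \<pi>. fst z \<le> t}"
    "distribution_function \<gamma>' t = measure \<pi> {z\<in>space \<pi>. snd z \<le> t}" for t
  proof -
    have "space \<pi> = {0..} \<times> {0..}"
      unfolding sets_eq_imp_space_eq[OF \<pi>(2)] by (simp add: space_pair_measure space_restrict_space)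
    then have sp: "0 \<le> fst z \<and> 0 \<le> snd z" if "z \<in> space \<pi>" for z
      using that by (auto simp: mem_Times_iff)
    have "fst -` {0..t} \<inter> space \<pi> = {z\<in>space \<pi>. fst z \<le> t}"
      "snd -` {0..t} \<inter> space \<pi> = {z\<in>space \<pi>. snd z \<le> t}" using sp by auto
    then show "distribution_function \<gamma> t = measure \<pi> {z\<in>space \<pi>. fst z \<le> t}"
      "distribution_function \<gamma>' t = measure \<pi> {z\<in>space \<pi>. snd z \<le> t}"
      unfolding m1[symmetric] m2[symmetric] distribution_function_def
      using fs Icc_in_sets_Rplus by (simp_all add: measure_distr)
  qed
  have "cdf_dist \<gamma> \<gamma>' \<le> (\<integral>\<^sup>+t. (\<integral>\<^sup>+z. indicator {min (fst z) (snd z)..<max (fst z) (snd z)} t \<partial>\<pi>) \<partial>lborel)"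
    unfolding cdf_dist_def
  proof (rule nn_integral_mono)
    fix t :: real
    let ?A = "{z\<in>space \<pi>. fst z \<le> t}" and ?B = "{z\<in>space \<pi>. snd z \<le> t}"
    let ?C = "{z\<in>space \<pi>. min (fst z) (snd z) \<le> t \<and> t < max (fst z) (snd z)}"
    have [measurable]: "?A \<in> sets \<pi>" "?B \<in> sets \<pi>" "?C \<in> sets \<pi>" by measurable
    have "?A \<subseteq> ?B \<union> ?C" "?B \<subseteq> ?A \<union> ?C" by auto
    then have "measure \<pi> ?A \<le> measure \<pi> (?B \<union> ?C)" "measure \<pi> ?B \<le> measure \<pi> (?A \<union> ?C)"
      by (intro finite_measure_mono; simp)+
    moreover have "measure \<pi> (?B \<union> ?C) \<le> measure \<pi> ?B + measure \<pi> ?C"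
      "measure \<pi> (?A \<union> ?C) \<le> measure \<pi> ?A + measure \<pi> ?C"
      by (intro measure_Un_le; simp)+
    ultimately have "\<bar>measure \<pi> ?A - measure \<pi> ?B\<bar> \<le> measure \<pi> ?C" by linarith
    then have "ennreal \<bar>measure \<pi> ?A - measure \<pi> ?B\<bar> \<le> emeasure \<pi> ?C"
      by (simp add: emeasure_eq_measure ennreal_leI)
    also have "\<dots> = (\<integral>\<^sup>+z. indicator ?C z \<partial>\<pi>)" by simp
    also have "\<dots> = (\<integral>\<^sup>+z. indicator {min (fst z) (snd z)..<max (fst z) (snd z)} t \<partial>\<pi>)"
      by (intro nn_integral_cong) (auto simp: indicator_def)
    finally show "ennreal \<bar>distribution_function \<gamma> t - distribution_function \<gamma>' t\<bar>
      \<le> (\<integral>\<^sup>+z. indicator {min (fst z) (snd z)..<max (fst z) (snd z)} t \<partial>\<pi>)"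
      by (simp add: F)
  qed
  also have "\<dots> = (\<integral>\<^sup>+z. (\<integral>\<^sup>+t. indicator {min (fst z) (snd z)..<max (fst z) (snd z)} t \<partial>lborel) \<partial>\<pi>)"
    by (rule P.Fubini') (simp add: indicator_def[abs_def] split_beta', measurable)
  also have "\<dots> = (\<integral>\<^sup>+z. ennreal \<bar>fst z - snd z\<bar> \<partial>\<pi>)" by (simp only: nn_integral_indicator_between)
  finally show "cdf_dist \<gamma> \<gamma>' \<le> (\<integral>\<^sup>+z. ennreal \<bar>fst z - snd z\<bar> \<partial>\<pi>)" .
qed

lemma cdf_dist_commute: "cdf_dist \<gamma> \<gamma>' = cdf_dist \<gamma>' \<gamma>"
  by (simp add: cdf_dist_def abs_minus_commute)

lemma cdf_dist_triangle:
  assumes "\<gamma> \<in> M1 Rplus" "\<gamma>' \<in> M1 Rplus" "\<gamma>'' \<in> M1 Rplus"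
  shows "cdf_dist \<gamma> \<gamma>'' \<le> cdf_dist \<gamma> \<gamma>' + cdf_dist \<gamma>' \<gamma>''"
proof -
  note [measurable] = assms[THEN measurable_distribution_function]
  have "cdf_dist \<gamma> \<gamma>'' \<le> (\<integral>\<^sup>+t. ennreal \<bar>distribution_function \<gamma> t - distribution_function \<gamma>' t\<bar>
    + ennreal \<bar>distribution_function \<gamma>' t - distribution_function \<gamma>'' t\<bar> \<partial>lborel)"
    unfolding cdf_dist_def by (intro nn_integral_mono) (auto simp: ennreal_plus[symmetric] simp del: ennreal_plus intro!: ennreal_leI)
  then show ?thesis unfolding cdf_dist_def by (simp add: nn_integral_add)
qed

lemma cdf_dist_self: "cdf_dist \<gamma> \<gamma> = 0"
  by (simp add: cdf_dist_def)

lemma M11_Rplus_subset: "\<gamma> \<in> M11_Rplus \<Longrightarrow> \<gamma> \<in> M1 Rplus"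
  by (simp add: M11_Rplus_def)

lemma nn_integral_quantile:
  assumes "\<gamma> \<in> M11_Rplus" shows "(\<integral>\<^sup>+u. ennreal (quantile \<gamma> u) \<partial>unit_interval) = 1"
proof -
  have \<gamma>: "\<gamma> \<in> M1 Rplus" using assms by (rule M11_Rplus_subset)
  have "(\<integral>\<^sup>+w. ennreal w \<partial>distr unit_interval Rplus (quantile \<gamma>)) = (\<integral>\<^sup>+u. ennreal (quantile \<gamma> u) \<partial>unit_interval)"
    by (rule nn_integral_distr[OF measurable_quantile[OF \<gamma>]]) (auto intro!: measurable_restrict_space1)
  then show ?thesis using assms by (simp add: distr_quantile[OF \<gamma>] M11_Rplus_def)
qed

lemma topspace_wasserstein_topology: "topspace wasserstein_topology = M11_Rplus"
proof -
  have "openin wasserstein_topology M11_Rplus"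
    unfolding openin_wasserstein_topology by (auto intro: exI[of _ 1])
  moreover have "\<And>U. openin wasserstein_topology U \<Longrightarrow> U \<subseteq> M11_Rplus"
    by (simp add: openin_wasserstein_topology)
  ultimately show ?thesis unfolding topspace_def by blast
qed

text \<open>Since \<open>cdf_dist\<close> lies below \<open>wasserstein1\<close>, its balls contain
  small Wasserstein balls around each of their points. They serve as the neighbourhoods to which the
  large deviation bounds of the weights are applied.\<close>

lemma openin_cdf_dist_ball:
  assumes "\<gamma> \<in> M11_Rplus" shows "openin wasserstein_topology {\<gamma>' \<in> M11_Rplus. cdf_dist \<gamma> \<gamma>' < r}"
  unfolding openin_wasserstein_topology
proof (intro conjI ballI)
  fix \<rho> assume "\<rho> \<in> {\<gamma>' \<in> M11_Rplus. cdf_dist \<gamma> \<gamma>' < r}"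
  then have \<rho>: "\<rho> \<in> M11_Rplus" "cdf_dist \<gamma> \<rho> < r" by auto
  have "{\<gamma>' \<in> M11_Rplus. wasserstein1 \<rho> \<gamma>' < r - cdf_dist \<gamma> \<rho>} \<subseteq> {\<gamma>' \<in> M11_Rplus. cdf_dist \<gamma> \<gamma>' < r}"
  proof clarify
    fix \<gamma>' assume \<gamma>': "\<gamma>' \<in> M11_Rplus" "wasserstein1 \<rho> \<gamma>' < r - cdf_dist \<gamma> \<rho>"
    have "cdf_dist \<rho> \<gamma>' < r - cdf_dist \<gamma> \<rho>"
      using cdf_dist_le_wasserstein1[of \<rho> \<gamma>'] \<gamma>' \<rho> by (auto intro: M11_Rplus_subset le_less_trans)
    then have "cdf_dist \<gamma> \<rho> + cdf_dist \<rho> \<gamma>' < r"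
      using less_diff_eq_ennreal[of r "cdf_dist \<gamma> \<rho>" "cdf_dist \<rho> \<gamma>'"] order_less_le_trans[OF \<rho>(2) top_greatest]
      by (simp only: add.commute simp_thms)
    then show "cdf_dist \<gamma> \<gamma>' < r"
      using cdf_dist_triangle[of \<gamma> \<rho> \<gamma>'] assms \<rho> \<gamma>' by (auto intro: M11_Rplus_subset le_less_trans)
  qed
  moreover have "0 < r - cdf_dist \<gamma> \<rho>" using \<rho>(2) by (simp add: diff_gr0_ennreal)
  ultimately show "\<exists>s>0. {\<gamma>' \<in> M11_Rplus. wasserstein1 \<rho> \<gamma>' < s} \<subseteq> {\<gamma>' \<in> M11_Rplus. cdf_dist \<gamma> \<gamma>' < r}"
    by blast
qed auto

text \<open>Supplies closed sets around the open balls, as the upper bound for the weights refers to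
  closures.\<close>

lemma closedin_cdf_dist_cball:
  assumes "\<gamma> \<in> M11_Rplus" shows "closedin wasserstein_topology {\<gamma>' \<in> M11_Rplus. cdf_dist \<gamma> \<gamma>' \<le> r}"
  unfolding closedin_def topspace_wasserstein_topology openin_wasserstein_topology
proof (intro conjI ballI)
  fix \<rho> assume "\<rho> \<in> M11_Rplus - {\<gamma>' \<in> M11_Rplus. cdf_dist \<gamma> \<gamma>' \<le> r}"
  then have \<rho>: "\<rho> \<in> M11_Rplus" "r < cdf_dist \<gamma> \<rho>" by auto
  have rfin: "r < top" using \<rho>(2) by (auto intro: less_le_trans)
  have "{\<gamma>' \<in> M11_Rplus. wasserstein1 \<rho> \<gamma>' < cdf_dist \<gamma> \<rho> - r} \<subseteq> M11_Rplus - {\<gamma>' \<in> M11_Rplus. cdf_dist \<gamma> \<gamma>' \<le> r}"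
  proof (clarsimp simp: not_le)
    fix \<gamma>' assume \<gamma>': "\<gamma>' \<in> M11_Rplus" "wasserstein1 \<rho> \<gamma>' < cdf_dist \<gamma> \<rho> - r" and le: "cdf_dist \<gamma> \<gamma>' \<le> r"
    have "cdf_dist \<gamma>' \<rho> < cdf_dist \<gamma> \<rho> - r"
      using cdf_dist_le_wasserstein1[of \<rho> \<gamma>'] \<gamma>' \<rho> cdf_dist_commute[of \<gamma>' \<rho>] by (auto intro: M11_Rplus_subset le_less_trans)
    then have "cdf_dist \<gamma>' \<rho> + r < cdf_dist \<gamma> \<rho>" using rfin by (simp add: less_diff_eq_ennreal)
    moreover have "cdf_dist \<gamma> \<rho> \<le> r + cdf_dist \<gamma>' \<rho>"
      using cdf_dist_triangle[of \<gamma> \<gamma>' \<rho>] assms \<rho> \<gamma>' le by (meson M11_Rplus_subset add_right_mono order_trans)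
    ultimately show False by (simp add: add.commute)
  qed
  moreover have "0 < cdf_dist \<gamma> \<rho> - r" using \<rho>(2) by (simp add: diff_gr0_ennreal)
  ultimately show "\<exists>s>0. {\<gamma>' \<in> M11_Rplus. wasserstein1 \<rho> \<gamma>' < s} \<subseteq> M11_Rplus - {\<gamma>' \<in> M11_Rplus. cdf_dist \<gamma> \<gamma>' \<le> r}"
    by blast
qed auto

section \<open>The weak topology\<close>

definition bounded_continuous :: "('a::topological_space \<Rightarrow> real) set" where
  "bounded_continuous = {f. continuous_on UNIV f \<and> bounded (range f)}"

lemma bounded_continuous_measurable: "f \<in> bounded_continuous \<Longrightarrow> f \<in> borel_measurable borel"
  by (auto simp: bounded_continuous_def intro: borel_measurable_continuous_onI)

lemma bounded_continuous_bounded: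
  assumes "f \<in> bounded_continuous" obtains B where "0 < B" "\<And>x. \<bar>f x\<bar> \<le> B"
  using assms by (auto simp: bounded_continuous_def bounded_pos)

lemma sets_M1_borel: "\<nu> \<in> M1 borel \<Longrightarrow> sets \<nu> = sets borel"
  and prob_space_M1_borel: "\<nu> \<in> M1 borel \<Longrightarrow> prob_space \<nu>"
  and space_M1_borel: "\<nu> \<in> M1 borel \<Longrightarrow> space \<nu> = UNIV"
  using sets_eq_imp_space_eq[of \<nu> borel] by (auto simp: space_prob_algebra)

lemma weak_topology_eq: "weak_topology = topology_generated_by
  {{\<nu> \<in> M1 borel. (\<integral>x. f x \<partial>\<nu>) \<in> U} | f U. f \<in> bounded_continuous \<and> open U}"
  unfolding weak_topology_def bounded_continuous_def by (simp add: conj_assoc)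

lemma topspace_weak_topology: "topspace weak_topology = (M1 borel :: 'a::topological_space measure set)"
proof -
  have "(\<lambda>_::'a. 0) \<in> bounded_continuous" by (simp add: bounded_continuous_def)
  then show ?thesis unfolding weak_topology_eq topology_generated_by_topspace
    by (auto intro!: exI[of _ "M1 borel"] exI[of _ "\<lambda>_. 0"] exI[of _ UNIV])
qed

text \<open>Finitely many test functions decide membership near a point: finite intersections of
  generators keep this form, with the union of the families and the smaller radius.\<close>

lemma openin_weak_topology_nhd:
  assumes "openin weak_topology U" "\<nu> \<in> U"
  obtains G e where "finite G" "G \<subseteq> bounded_continuous" "(e::real) > 0"
    "\<And>\<nu>'. \<nu>' \<in> M1 borel \<Longrightarrow> (\<And>g. g \<in> G \<Longrightarrow> \<bar>(\<integral>x. g x \<partial>\<nu>') - (\<integral>x. g x \<partial>\<nu>)\<bar> < e) \<Longrightarrow> \<nu>' \<in> U"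
proof -
  have "\<exists>G e. finite G \<and> G \<subseteq> bounded_continuous \<and> (e::real) > 0 \<and>
    (\<forall>\<nu>'\<in>M1 borel. (\<forall>g\<in>G. \<bar>(\<integral>x. g x \<partial>\<nu>') - (\<integral>x. g x \<partial>\<nu>)\<bar> < e) \<longrightarrow> \<nu>' \<in> U)"
    using openin_topology_generated_by[OF assms(1)[unfolded weak_topology_eq]] assms(2)
  proof (induction arbitrary: \<nu>)
    case (Int S T)
    then have S: "\<nu> \<in> S" and T: "\<nu> \<in> T" by auto
    from Int.IH(1)[OF S] obtain G e where "finite G" "G \<subseteq> bounded_continuous" "(e::real) > 0"
      "\<forall>\<nu>'\<in>M1 borel. (\<forall>g\<in>G. \<bar>(\<integral>x. g x \<partial>\<nu>') - (\<integral>x. g x \<partial>\<nu>)\<bar> < e)  \<longrightarrow> \<nu>' \<in> S"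
      by blast
    moreover from Int.IH(2)[OF T] obtain G' e' where "finite G'" "G' \<subseteq> bounded_continuous" "(e'::real) > 0"
      "\<forall>\<nu>'\<in>M1 borel. (\<forall>g\<in>G'. \<bar>(\<integral>x. g x \<partial>\<nu>') - (\<integral>x. g x \<partial>\<nu>)\<bar> < e') \<longrightarrow> \<nu>' \<in> T"
      by blast
    ultimately show ?case by (intro exI[of _ "G \<union> G'"] exI[of _ "min e e'"]) auto
  next
    case (UN K)
    then obtain S where S: "S \<in> K" "\<nu> \<in> S" by auto
    from UN.IH[OF this] show ?case using S(1) by (meson UnionI)
  next
    case (Basis S)
    then obtain f U where S: "S = {\<nu> \<in> M1 borel. (\<integral>x. f x \<partial>\<nu>) \<in> U}" "f \<in> bounded_continuous" "open U"
      by auto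
    then obtain e where "e > 0" "\<forall>y. dist y (\<integral>x. f x \<partial>\<nu>) < e \<longrightarrow> y \<in> U"
      using Basis by (auto simp: open_dist)
    then show ?case using S by (intro exI[of _ "{f}"] exI[of _ e]) (auto simp: dist_real_def)
  qed auto
  then show thesis using that by metis
qed

lemma openin_weak_topology_basic:
  assumes "finite G" "G \<subseteq> bounded_continuous"
  shows "openin weak_topology {\<nu> \<in> M1 borel. \<forall>g\<in>G. \<bar>(\<integral>x. g x \<partial>\<nu>) - c g\<bar> < e}"
  using assms
proof induction
  case empty
  then show ?case using openin_topspace[of weak_topology] by (simp add: topspace_weak_topology)
next
  case (insert g G)
  have "{\<nu> \<in> M1 borel. \<bar>(\<integral>x. g x \<partial>\<nu>) - c g\<bar> < e} = {\<nu> \<in> M1 borel. (\<integral>x. g x \<partial>\<nu>) \<in> ball (c g) e}"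
    by (auto simp: dist_real_def abs_minus_commute)
  moreover have "openin weak_topology {\<nu> \<in> M1 borel. (\<integral>x. g x \<partial>\<nu>) \<in> ball (c g) e}"
    unfolding weak_topology_eq using insert.prems
    by (intro topology_generated_by_Basis) (auto intro!: exI[of _ g] exI[of _ "ball (c g) e"])
  moreover have "{\<nu> \<in> M1 borel. \<forall>g\<in>insert g G. \<bar>(\<integral>x. g x \<partial>\<nu>) - c g\<bar> < e}
    = {\<nu> \<in> M1 borel. \<bar>(\<integral>x. g x \<partial>\<nu>) - c g\<bar> < e} \<inter> {\<nu> \<in> M1 borel. \<forall>g\<in>G. \<bar>(\<integral>x. g x \<partial>\<nu>) - c g\<bar> < e}"
    by auto
  ultimately show ?case using insert by auto
qed

lemma continuous_map_weak_topology:
  fixes f :: "'b \<Rightarrow> 'a::topological_space measure"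
  assumes "\<And>p. p \<in> topspace X \<Longrightarrow> f p \<in> M1 borel"
    and "\<And>g. g \<in> bounded_continuous \<Longrightarrow> continuous_map X euclideanreal (\<lambda>p. \<integral>x. g x \<partial>f p)"
  shows "continuous_map X weak_topology f"
  unfolding weak_topology_eq
proof (rule continuous_on_generated_topo)
  fix U :: "'a measure set" assume "U \<in> {{\<nu> \<in> M1 borel. (\<integral>x. f x \<partial>\<nu>) \<in> U} | f U. f \<in> bounded_continuous \<and> open U}"
  then obtain g V where "U = {\<nu> \<in> M1 borel. (\<integral>x. g x \<partial>\<nu>) \<in> V}" "g \<in> bounded_continuous" "open V" by auto
  then have "f -` U \<inter> topspace X = {p\<in>topspace X. (\<integral>x. g x \<partial>f p) \<in> V}" using assms(1) by auto
  then show "openin X (f -` U \<inter> topspace X)"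
    using openin_continuous_map_preimage[OF assms(2)[OF \<open>g \<in> _\<close>], of V] \<open>open V\<close> by simp
next
  show "f ` topspace X \<subseteq> \<Union> {{\<nu> \<in> M1 borel. (\<integral>x. f x \<partial>\<nu>) \<in> U} | f U. f \<in> bounded_continuous \<and> open U}"
    using assms(1) topspace_weak_topology[where 'a='a]
    unfolding weak_topology_eq topology_generated_by_topspace by blast
qed

text \<open>Closed sets form a generating system stable under intersection, and the indicator of a
  nonempty closed set is the limit of the bounded continuous functions
  \<open>max 0 (1 - k * infdist x C)\<close>.\<close>

lemma M1_borel_eqI:
  fixes \<nu> \<nu>' :: "'a::metric_space measure"
  assumes \<nu>: "\<nu> \<in> M1 borel" "\<nu>' \<in> M1 borel"
    and eq: "\<And>g. g \<in> bounded_continuous \<Longrightarrow> (\<integral>x. g x \<partial>\<nu>) = (\<integral>x. g x \<partial>\<nu>')"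
  shows "\<nu> = \<nu>'"
proof (rule measure_eqI_generator_eq[where E="Collect closed" and \<Omega>=UNIV and A="\<lambda>_. UNIV"])
  interpret \<nu>: prob_space \<nu> using \<nu>(1) by (rule prob_space_M1_borel)
  interpret \<nu>': prob_space \<nu>' using \<nu>(2) by (rule prob_space_M1_borel)
  show "Int_stable (Collect (closed :: 'a set \<Rightarrow> bool))" by (auto simp: Int_stable_def)
  show "sets \<nu> = sigma_sets UNIV (Collect closed)" "sets \<nu>' = sigma_sets UNIV (Collect closed)"
    using \<nu>[THEN sets_M1_borel] by (simp_all add: borel_eq_closed)
  fix C :: "'a set" assume "C \<in> Collect closed"
  then have C: "closed C" by simp
  show "emeasure \<nu> C = emeasure \<nu>' C"
  \<comment> \<open>\<open>infdist x {}\<close> is 0, so the approximation would converge to 1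
    instead of 0 for the empty set.\<close>
  proof (cases "C = {}")
    case False
    define g where "g k x = max 0 (1 - real k * infdist x C)" for k x
    have g: "g k \<in> bounded_continuous" for k
      unfolding bounded_continuous_def g_def bounded_iff
      by (auto intro!: continuous_intros exI[of _ 1] simp: infdist_nonneg)
    have lim: "(\<lambda>k. g k x) \<longlonglongrightarrow> indicator C x" for x
    proof (cases "x \<in> C")
      case True
      then have "g k x = 1" for k by (simp add: g_def)
      then show ?thesis using True by simp
    next
      case False
      then have "infdist x C > 0" using C \<open>C \<noteq> {}\<close>
        by (metis in_closed_iff_infdist_zero infdist_nonneg order_le_imp_less_or_eq)
      then have "eventually (\<lambda>k. 1 / infdist x C < real k) sequentially"
        using filterlim_at_top_dense[THEN iffD1, OF filterlim_real_sequentially] by blast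
      then have "eventually (\<lambda>k. g k x = 0) sequentially"
        by eventually_elim (use \<open>infdist x C > 0\<close> in \<open>auto simp: g_def field_simps\<close>)
      then show ?thesis using False by (simp add: tendsto_eventually)
    qed
    have "(\<lambda>k. \<integral>x. g k x \<partial>M) \<longlonglongrightarrow> measure M C" if M: "prob_space M" "sets M = sets borel" for M
    proof -
      interpret M: prob_space M by fact
      have C': "C \<in> sets M" using C M by simp
      have "(\<lambda>k. \<integral>x. g k x \<partial>M) \<longlonglongrightarrow> (\<integral>x. indicator C x \<partial>M)"
      proof (rule integral_dominated_convergence[where w="\<lambda>_. 1"])
        show "g k \<in> borel_measurable M" for k
          using bounded_continuous_measurable[OF g] M(2) by (simp cong: measurable_cong_sets)
        show "AE x in M. norm (g k x) \<le> 1" for k by (simp add: g_def infdist_nonneg)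
      qed (use C' lim in auto)
      then show ?thesis using C' by simp
    qed
    from this[OF \<nu>.prob_space_axioms sets_M1_borel[OF \<nu>(1)]] this[OF \<nu>'.prob_space_axioms sets_M1_borel[OF \<nu>(2)]]
    have "measure \<nu> C = measure \<nu>' C" unfolding eq[OF g] by (rule LIMSEQ_unique)
    then show ?thesis by (simp add: \<nu>.emeasure_eq_measure \<nu>'.emeasure_eq_measure)
  qed simp
qed (use prob_space.emeasure_space_1[OF prob_space_M1_borel[OF \<nu>(1)]] in \<open>auto simp: space_M1_borel[OF \<nu>(1)]\<close>)

text \<open>Makes compact sets closed, which turns compactness of sublevel sets into lower
  semicontinuity and makes infinite intersections of compact sets compact.\<close>

lemma Hausdorff_weak_topology: "Hausdorff_space (weak_topology :: 'a::metric_space measure topology)"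
  unfolding Hausdorff_space_def topspace_weak_topology
proof (intro allI impI)
  fix \<nu> \<nu>' :: "'a measure" assume h: "\<nu> \<in> M1 borel \<and> \<nu>' \<in> M1 borel \<and> \<nu> \<noteq> \<nu>'"
  then obtain g where g: "g \<in> bounded_continuous" "(\<integral>x. g x \<partial>\<nu>) \<noteq> (\<integral>x. g x \<partial>\<nu>')"
    using M1_borel_eqI by blast
  define e where "e = \<bar>(\<integral>x. g x \<partial>\<nu>) - (\<integral>x. g x \<partial>\<nu>')\<bar> / 2"
  let ?U = "\<lambda>c. {\<nu> \<in> M1 borel. \<forall>g'\<in>{g}. \<bar>(\<integral>x. g' x \<partial>\<nu>) - c\<bar> < e}"
  have "openin weak_topology (?U (\<integral>x. g x \<partial>\<nu>))" "openin weak_topology (?U (\<integral>x. g x \<partial>\<nu>'))"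
    using openin_weak_topology_basic[of "{g}" "\<lambda>_. \<integral>x. g x \<partial>\<nu>"]
      openin_weak_topology_basic[of "{g}" "\<lambda>_. \<integral>x. g x \<partial>\<nu>'"] g by auto
  moreover have "\<nu> \<in> ?U (\<integral>x. g x \<partial>\<nu>)" "\<nu>' \<in> ?U (\<integral>x. g x \<partial>\<nu>')" using h g by (auto simp: e_def)
  moreover have "disjnt (?U (\<integral>x. g x \<partial>\<nu>)) (?U (\<integral>x. g x \<partial>\<nu>'))"
    by (auto simp: disjnt_def e_def abs_if field_simps split: if_splits)
  ultimately show "\<exists>U V. openin weak_topology U \<and> openin weak_topology V \<and> \<nu> \<in> U \<and> \<nu>' \<in> V \<and> disjnt U V"
    by blast
qed

section \<open>Weighted empirical measures\<close>

text \<open>A set of functions on all natural numbers, with coordinates outside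
  \<open>{1..n}\<close> unconstrained, so that permutations and measurability are treated in one
  type for all \<open>n\<close>.\<close>

definition weight_simplex :: "nat \<Rightarrow> (nat \<Rightarrow> real) set" where
  "weight_simplex n = {w. (\<forall>i\<in>{1..n}. 0 \<le> w i) \<and> (\<Sum>i=1..n. w i) = real n}"

lemma integral_weighted_empirical:
  fixes f :: "'a \<Rightarrow> real"
  assumes "\<And>i. i \<in> {1..n} \<Longrightarrow> 0 \<le> w i" and f: "f \<in> borel_measurable E"
    and x: "\<And>i. i \<in> {1..n} \<Longrightarrow> x i \<in> space E"
  shows "(\<integral>y. f y \<partial>weighted_empirical E n w x) = (\<Sum>i=1..n. w i / real n * f (x i))"
proof -
  have "(\<integral>y. f y \<partial>weighted_empirical E n w x) = (\<integral>i. f (x i) \<partial>point_measure {1..n} (\<lambda>i. ennreal (w i / real n)))"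
    unfolding weighted_empirical_def using x f
    by (intro integral_distr) (auto simp: measurable_def sets_point_measure space_point_measure)
  also have "\<dots> = (\<Sum>i=1..n. w i / real n * f (x i))"
    using assms(1) by (subst lebesgue_integral_point_measure_finite) auto
  finally show ?thesis .
qed

lemma weighted_empirical_in_M1:
  assumes "n \<ge> 1" "w \<in> weight_simplex n"
  shows "weighted_empirical borel n w x \<in> M1 borel"
proof -
  have w: "\<And>i. i \<in> {1..n} \<Longrightarrow> 0 \<le> w i" "(\<Sum>i=1..n. w i) = real n"
    using assms by (auto simp: weight_simplex_def)
  have "emeasure (weighted_empirical borel n w x) UNIV = (\<Sum>i=1..n. ennreal (w i / real n))"
    by (subst emeasure_weighted_empirical) auto
  also have "\<dots> = ennreal (\<Sum>i=1..n. w i / real n)" using w by (intro sum_ennreal) auto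
  also have "\<dots> = 1" using w assms(1) by (simp add: sum_divide_distrib[symmetric])
  finally show ?thesis
    by (auto simp: space_prob_algebra weighted_empirical_def intro!: prob_spaceI)
qed

text \<open>The Borel structure comes from all weakly open sets, so measurability of each single
  integral does not settle the claim directly. Continuity in the weights does: it pulls every open
  set back to a relatively open one.\<close>

lemma measurable_weighted_empirical:
  fixes x :: "nat \<Rightarrow> 'a::metric_space"
  assumes "n \<ge> 1"
  shows "(\<lambda>w. weighted_empirical borel n w x) \<in> restrict_space borel (weight_simplex n) \<rightarrow>\<^sub>M borel_of weak_topology"
proof -
  let ?L = "\<lambda>w. weighted_empirical borel n w x"
  have cont: "continuous_map (top_of_set (weight_simplex n)) weak_topology ?L"
  proof (rule continuous_map_weak_topology)
    fix g :: "'a \<Rightarrow> real" assume "g \<in> bounded_continuous"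
    then have "(\<integral>y. g y \<partial>?L w) = (\<Sum>i=1..n. w i / real n * g (x i))" if "w \<in> weight_simplex n" for w
      using that by (intro integral_weighted_empirical) (auto simp: weight_simplex_def bounded_continuous_measurable)
    moreover have "continuous_on (weight_simplex n) (\<lambda>w. \<Sum>i=1..n. w i / real n * g (x i))"
      by (intro continuous_intros continuous_on_subset[OF continuous_on_product_coordinates]) auto
    ultimately show "continuous_map (top_of_set (weight_simplex n)) euclideanreal (\<lambda>w. \<integral>y. g y \<partial>?L w)"
      by (simp cong: continuous_on_cong)
  qed (use assms weighted_empirical_in_M1 in auto)
  show ?thesis
    unfolding borel_of_def
  proof (rule measurable_measure_of)
    show "{U. openin weak_topology U} \<subseteq> Pow (topspace weak_topology)" by (auto dest: openin_subset)
    show "?L \<in> space (restrict_space borel (weight_simplex n)) \<rightarrow> topspace weak_topology"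
      using assms weighted_empirical_in_M1 by (auto simp: space_restrict_space topspace_weak_topology)
    fix U :: "'a measure set" assume "U \<in> {U. openin weak_topology U}"
    then have "openin (top_of_set (weight_simplex n)) {w \<in> weight_simplex n. ?L w \<in> U}"
      using openin_continuous_map_preimage[OF cont, of U] by simp
    then obtain V where V: "open V" "{w \<in> weight_simplex n. ?L w \<in> U} = weight_simplex n \<inter> V"
      by (auto simp: openin_open)
    have "?L -` U \<inter> space (restrict_space borel (weight_simplex n)) = weight_simplex n \<inter> V"
      using V(2) by (auto simp: space_restrict_space)
    then show "?L -` U \<inter> space (restrict_space borel (weight_simplex n)) \<in> sets (restrict_space borel (weight_simplex n))"
      using V(1) by (auto simp: sets_restrict_space)
  qed
qed

section \<open>The rate function in terms of quantile couplings\<close>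

text \<open>
  A pair law \<open>\<rho>\<close> with first marginal \<open>\<gamma>\<close> is written as the image of a coupling of the uniform law
  on the unit interval and \<open>\<mu>\<close> under \<open>(u, x) \<mapsto> (quantile \<gamma> u, x)\<close>. The reference measure of the
  relative entropy is then the same for all \<open>\<gamma>\<close>.
\<close>

abbreviation unit_prod :: "'a measure \<Rightarrow> (real \<times> 'a) measure" where
  "unit_prod \<mu> \<equiv> unit_interval \<Otimes>\<^sub>M \<mu>"

definition unit_couplings :: "'a measure \<Rightarrow> (real \<times> 'a) measure set" where
  "unit_couplings \<mu> = {\<pi>. prob_space \<pi> \<and> sets \<pi> = sets (unit_prod \<mu>) \<and>
     distr \<pi> unit_interval fst = unit_interval \<and> distr \<pi> \<mu> snd = \<mu>}"

text \<open>The value of \<open>F_map\<close> at the image of \<pi> under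
  \<open>quantile_pair \<gamma>\<close>, written over the coupling so that \<gamma> enters through
  the weight only.\<close>

definition mixture :: "real measure \<Rightarrow> (real \<times> 'a::topological_space) measure \<Rightarrow> 'a measure" where
  "mixture \<gamma> \<pi> = distr (density \<pi> (\<lambda>z. ennreal (quantile \<gamma> (fst z)))) borel snd"

definition quantile_pair :: "real measure \<Rightarrow> real \<times> 'a \<Rightarrow> real \<times> 'a" where
  "quantile_pair \<gamma> z = (quantile \<gamma> (fst z), snd z)"

lemma (in pair_sigma_finite) distr_fst_density:
  assumes f[measurable]: "f \<in> borel_measurable (M1 \<Otimes>\<^sub>M M2)"
  shows "distr (density (M1 \<Otimes>\<^sub>M M2) f) M1 fst = density M1 (\<lambda>x. \<integral>\<^sup>+y. f (x, y) \<partial>M2)"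
proof (rule measure_eqI)
  fix A assume "A \<in> sets (distr (density (M1 \<Otimes>\<^sub>M M2) f) M1 fst)"
  then have A[measurable]: "A \<in> sets M1" by simp
  have "emeasure (distr (density (M1 \<Otimes>\<^sub>M M2) f) M1 fst) A = emeasure (density (M1 \<Otimes>\<^sub>M M2) f) (A \<times> space M2)"
    using sets.sets_into_space[OF A] by (subst emeasure_distr) (auto intro!: arg_cong2[where f=emeasure] simp: space_pair_measure)
  also have "\<dots> = (\<integral>\<^sup>+z. f z * indicator (A \<times> space M2) z \<partial>(M1 \<Otimes>\<^sub>M M2))" by (intro emeasure_density) auto
  also have "\<dots> = (\<integral>\<^sup>+x. (\<integral>\<^sup>+y. f (x, y) * indicator (A \<times> space M2) (x, y) \<partial>M2) \<partial>M1)"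
    by (intro M2.nn_integral_fst[symmetric, where f="\<lambda>z. f z * indicator (A \<times> space M2) z"]) measurable
  also have "\<dots> = (\<integral>\<^sup>+x. (\<integral>\<^sup>+y. f (x, y) \<partial>M2) * indicator A x \<partial>M1)"
    by (intro nn_integral_cong) (auto simp: indicator_def cong: nn_integral_cong)
  also have "\<dots> = emeasure (density M1 (\<lambda>x. \<integral>\<^sup>+y. f (x, y) \<partial>M2)) A"
    using M2.borel_measurable_nn_integral_fst[OF f] by (intro emeasure_density[symmetric]) auto
  finally show "emeasure (distr (density (M1 \<Otimes>\<^sub>M M2) f) M1 fst) A = emeasure (density M1 (\<lambda>x. \<integral>\<^sup>+y. f (x, y) \<partial>M2)) A" .
qed simp

lemma (in pair_sigma_finite) distr_snd_density:
  assumes f[measurable]: "f \<in> borel_measurable (M1 \<Otimes>\<^sub>M M2)"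
  shows "distr (density (M1 \<Otimes>\<^sub>M M2) f) M2 snd = density M2 (\<lambda>y. \<integral>\<^sup>+x. f (x, y) \<partial>M1)"
proof (rule measure_eqI)
  fix A assume "A \<in> sets (distr (density (M1 \<Otimes>\<^sub>M M2) f) M2 snd)"
  then have A[measurable]: "A \<in> sets M2" by simp
  have "emeasure (distr (density (M1 \<Otimes>\<^sub>M M2) f) M2 snd) A = emeasure (density (M1 \<Otimes>\<^sub>M M2) f) (space M1 \<times> A)"
    using sets.sets_into_space[OF A] by (subst emeasure_distr) (auto intro!: arg_cong2[where f=emeasure] simp: space_pair_measure)
  also have "\<dots> = (\<integral>\<^sup>+z. f z * indicator (space M1 \<times> A) z \<partial>(M1 \<Otimes>\<^sub>M M2))" by (intro emeasure_density) auto
  also have "\<dots> = (\<integral>\<^sup>+y. (\<integral>\<^sup>+x. f (x, y) * indicator (space M1 \<times> A) (x, y) \<partial>M1) \<partial>M2)"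
    by (intro nn_integral_snd[symmetric, where f="\<lambda>z. f z * indicator (space M1 \<times> A) z"]) measurable
  also have "\<dots> = (\<integral>\<^sup>+y. (\<integral>\<^sup>+x. f (x, y) \<partial>M1) * indicator A y \<partial>M2)"
    by (intro nn_integral_cong) (auto simp: indicator_def cong: nn_integral_cong)
  also have "\<dots> = emeasure (density M2 (\<lambda>y. \<integral>\<^sup>+x. f (x, y) \<partial>M1)) A"
    using M1.borel_measurable_nn_integral[of "\<lambda>y x. f (x, y)" M2] measurable_pair_swap[OF f] by (intro emeasure_density[symmetric]) auto
  finally show "emeasure (distr (density (M1 \<Otimes>\<^sub>M M2) f) M2 snd) A = emeasure (density M2 (\<lambda>y. \<integral>\<^sup>+x. f (x, y) \<partial>M1)) A" .
qed simp

lemma prob_space_unit_prod: "prob_space \<mu> \<Longrightarrow> prob_space (unit_prod \<mu>)"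
  by (rule prob_space_pair[OF prob_space_unit_interval])

context
  fixes \<mu> :: "'a::topological_space measure"
  assumes \<mu>: "\<mu> \<in> M1 borel"
begin

lemma sets_unit_prod: "sets (unit_prod \<mu>) = sets (unit_interval \<Otimes>\<^sub>M borel)"
  using sets_M1_borel[OF \<mu>] by (intro sets_pair_measure_cong) auto

lemma space_unit_prod: "space (unit_prod \<mu>) = {0<..<1} \<times> UNIV"
  by (simp add: space_pair_measure space_unit_interval space_M1_borel[OF \<mu>])

lemma prob_space_unit_prod': "prob_space (unit_prod \<mu>)"
  by (rule prob_space_unit_prod[OF prob_space_M1_borel[OF \<mu>]])

context
  fixes \<pi> assumes \<pi>: "sets \<pi> = sets (unit_prod \<mu>)"
begin

lemma fst_measurable_unit_prod: "fst \<in> \<pi> \<rightarrow>\<^sub>M unit_interval"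
  and snd_measurable_unit_prod: "snd \<in> \<pi> \<rightarrow>\<^sub>M borel"
  using \<pi> sets_unit_prod by (auto cong: measurable_cong_sets)

lemma quantile_pair_measurable:
  assumes "\<gamma> \<in> M1 Rplus" shows "quantile_pair \<gamma> \<in> \<pi> \<rightarrow>\<^sub>M Rplus \<Otimes>\<^sub>M borel"
  unfolding quantile_pair_def[abs_def]
  using measurable_compose[OF fst_measurable_unit_prod measurable_quantile[OF assms]]
    snd_measurable_unit_prod by (rule measurable_Pair)

lemma quantile_fst_measurable:
  assumes "\<gamma> \<in> M1 Rplus" shows "(\<lambda>z. quantile \<gamma> (fst z)) \<in> borel_measurable \<pi>"
  using measurable_compose[OF fst_measurable_unit_prod measurable_quantile_borel[OF assms]] .

lemma F_map_quantile_pair: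
  assumes \<gamma>: "\<gamma> \<in> M1 Rplus"
  shows "F_map (distr \<pi> (Rplus \<Otimes>\<^sub>M borel) (quantile_pair \<gamma>)) = mixture \<gamma> \<pi>"
proof -
  note [measurable] = quantile_pair_measurable[OF \<gamma>] quantile_fst_measurable[OF \<gamma>]
  have "(\<lambda>z. fst z) \<in> Rplus \<Otimes>\<^sub>M (borel :: 'a measure) \<rightarrow>\<^sub>M Rplus" by simp
  then have [measurable]: "(\<lambda>z. fst z) \<in> borel_measurable (Rplus \<Otimes>\<^sub>M (borel :: 'a measure))"
    by (simp add: measurable_restrict_space2_iff)
  have "density (distr \<pi> (Rplus \<Otimes>\<^sub>M borel) (quantile_pair \<gamma>)) (\<lambda>z. ennreal (fst z))
    = distr (density \<pi> (\<lambda>z. ennreal (fst (quantile_pair \<gamma> z)))) (Rplus \<Otimes>\<^sub>M borel) (quantile_pair \<gamma>)"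
    by (subst density_distr_comp) auto
  then have "F_map (distr \<pi> (Rplus \<Otimes>\<^sub>M borel) (quantile_pair \<gamma>)) =
    distr (distr (density \<pi> (\<lambda>z. ennreal (fst (quantile_pair \<gamma> z)))) (Rplus \<Otimes>\<^sub>M borel) (quantile_pair \<gamma>)) borel snd"
    by (simp add: F_map_def)
  also have "\<dots> = distr (density \<pi> (\<lambda>z. ennreal (fst (quantile_pair \<gamma> z)))) borel (snd \<circ> quantile_pair \<gamma>)"
    by (intro distr_distr) (auto simp: quantile_pair_measurable[OF \<gamma>])
  also have "\<dots> = mixture \<gamma> \<pi>"
    unfolding mixture_def by (intro distr_cong) (auto simp: quantile_pair_def)
  finally show ?thesis .
qed

end

lemma distr_quantile_pair_unit_prod:
  assumes \<gamma>: "\<gamma> \<in> M1 Rplus"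
  shows "distr (unit_prod \<mu>) (Rplus \<Otimes>\<^sub>M borel) (quantile_pair \<gamma>) = \<gamma> \<Otimes>\<^sub>M \<mu>"
proof -
  have id: "distr \<mu> borel (\<lambda>x. x) = \<mu>" using sets_M1_borel[OF \<mu>] by (intro distr_id2) simp
  have "\<gamma> \<Otimes>\<^sub>M \<mu> = distr unit_interval Rplus (quantile \<gamma>) \<Otimes>\<^sub>M distr \<mu> borel (\<lambda>x. x)"
    by (simp add: id distr_quantile[OF \<gamma>])
  also have "\<dots> = distr (unit_prod \<mu>) (Rplus \<Otimes>\<^sub>M borel) (\<lambda>(u, x). (quantile \<gamma> u, x))"
  proof (rule pair_measure_distr[OF measurable_quantile[OF \<gamma>]])
    show "(\<lambda>x. x) \<in> \<mu> \<rightarrow>\<^sub>M borel" using sets_M1_borel[OF \<mu>] by (simp cong: measurable_cong_sets)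
    show "sigma_finite_measure (distr \<mu> borel (\<lambda>x. x))"
      unfolding id using prob_space_M1_borel[OF \<mu>]
      by (simp add: prob_space_imp_sigma_finite)
  qed
  also have "(\<lambda>(u, x). (quantile \<gamma> u, x)) = quantile_pair \<gamma>"
    by (auto simp: quantile_pair_def)
  finally show ?thesis by simp
qed

lemma sets_pair_M1: assumes "\<gamma> \<in> M1 Rplus" shows "sets (\<gamma> \<Otimes>\<^sub>M \<mu>) = sets (Rplus \<Otimes>\<^sub>M borel)"
  using sets_M1_borel[OF \<mu>] sets_M1_Rplus[OF assms] by (intro sets_pair_measure_cong) auto

section \<open>Integrals under couplings with uniform first marginal\<close>

context
  fixes \<pi> assumes \<pi>: "\<pi> \<in> unit_couplings \<mu>"
begin

lemma unit_couplingsD: "prob_space \<pi>" "sets \<pi> = sets (unit_prod \<mu>)"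
  "distr \<pi> unit_interval fst = unit_interval" "distr \<pi> \<mu> snd = \<mu>"
  using \<pi> by (auto simp: unit_couplings_def)

lemma nn_integral_fst_coupling:
  assumes "h \<in> borel_measurable unit_interval"
  shows "(\<integral>\<^sup>+z. h (fst z) \<partial>\<pi>) = (\<integral>\<^sup>+u. h u \<partial>unit_interval)"
proof -
  have "(\<integral>\<^sup>+u. h u \<partial>distr \<pi> unit_interval fst) = (\<integral>\<^sup>+z. h (fst z) \<partial>\<pi>)"
    using assms by (intro nn_integral_distr fst_measurable_unit_prod unit_couplingsD(2)) auto
  then show ?thesis by (simp add: unit_couplingsD(3))
qed

lemma marg_quantile_pair:
  assumes \<gamma>: "\<gamma> \<in> M1 Rplus"
  shows "marg1 (distr \<pi> (Rplus \<Otimes>\<^sub>M borel) (quantile_pair \<gamma>)) = \<gamma>"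
    "marg2 (distr \<pi> (Rplus \<Otimes>\<^sub>M borel) (quantile_pair \<gamma>)) = \<mu>"
proof -
  note m = quantile_pair_measurable[OF unit_couplingsD(2) \<gamma>]
  have "marg1 (distr \<pi> (Rplus \<Otimes>\<^sub>M borel) (quantile_pair \<gamma>)) = distr \<pi> Rplus (fst \<circ> quantile_pair \<gamma>)"
    unfolding marg1_def by (intro distr_distr m) auto
  also have "\<dots> = distr (distr \<pi> unit_interval fst) Rplus (quantile \<gamma>)"
    by (subst distr_distr[OF measurable_quantile[OF \<gamma>] fst_measurable_unit_prod[OF unit_couplingsD(2)]])
       (auto intro!: distr_cong simp: quantile_pair_def)
  finally show "marg1 (distr \<pi> (Rplus \<Otimes>\<^sub>M borel) (quantile_pair \<gamma>)) = \<gamma>"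
    by (simp add: unit_couplingsD(3) distr_quantile[OF \<gamma>])
  have "marg2 (distr \<pi> (Rplus \<Otimes>\<^sub>M borel) (quantile_pair \<gamma>)) = distr \<pi> borel (snd \<circ> quantile_pair \<gamma>)"
    unfolding marg2_def by (intro distr_distr m) auto
  also have "\<dots> = distr \<pi> \<mu> snd"
    using sets_M1_borel[OF \<mu>] by (intro distr_cong) (auto simp: quantile_pair_def)
  finally show "marg2 (distr \<pi> (Rplus \<Otimes>\<^sub>M borel) (quantile_pair \<gamma>)) = \<mu>"
    by (simp add: unit_couplingsD(4))
qed

lemma mixture_in_M1:
  assumes "\<gamma> \<in> M11_Rplus" shows "mixture \<gamma> \<pi> \<in> M1 borel"
proof -
  have \<gamma>: "\<gamma> \<in> M1 Rplus" using assms by (rule M11_Rplus_subset)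
  note [measurable] = quantile_fst_measurable[OF unit_couplingsD(2) \<gamma>] snd_measurable_unit_prod[OF unit_couplingsD(2)]
  have "emeasure (mixture \<gamma> \<pi>) UNIV = (\<integral>\<^sup>+z. ennreal (quantile \<gamma> (fst z)) \<partial>\<pi>)"
    unfolding mixture_def by (subst emeasure_distr) (auto simp: emeasure_density cong: nn_integral_cong)
  also have "\<dots> = 1"
    using measurable_quantile_borel[OF \<gamma>] assms
    by (subst nn_integral_fst_coupling[of "\<lambda>u. ennreal (quantile \<gamma> u)"]) (auto simp: nn_integral_quantile)
  finally show ?thesis by (auto simp: space_prob_algebra mixture_def intro!: prob_spaceI)
qed

lemma integrable_quantile_fst:
  assumes "\<gamma> \<in> M11_Rplus" shows "integrable \<pi> (\<lambda>z. quantile \<gamma> (fst z))"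
proof (rule integrableI_nonneg)
  have \<gamma>: "\<gamma> \<in> M1 Rplus" using assms by (rule M11_Rplus_subset)
  show "(\<lambda>z. quantile \<gamma> (fst z)) \<in> borel_measurable \<pi>" by (rule quantile_fst_measurable[OF unit_couplingsD(2) \<gamma>])
  show "(\<integral>\<^sup>+z. ennreal (quantile \<gamma> (fst z)) \<partial>\<pi>) < \<infinity>"
    using measurable_quantile_borel[OF \<gamma>] assms
    by (subst nn_integral_fst_coupling[of "\<lambda>u. ennreal (quantile \<gamma> u)"]) (auto simp: nn_integral_quantile)
qed (simp add: quantile_nonneg)

lemma integral_mixture:
  fixes g :: "'a \<Rightarrow> real"
  assumes "\<gamma> \<in> M11_Rplus" and g: "g \<in> borel_measurable borel"
  shows "(\<integral>x. g x \<partial>mixture \<gamma> \<pi>) = (\<integral>z. quantile \<gamma> (fst z) * g (snd z) \<partial>\<pi>)"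
proof -
  have \<gamma>: "\<gamma> \<in> M1 Rplus" using assms(1) by (rule M11_Rplus_subset)
  note [measurable] = quantile_fst_measurable[OF unit_couplingsD(2) \<gamma>] snd_measurable_unit_prod[OF unit_couplingsD(2)] g
  show ?thesis
    unfolding mixture_def
    by (subst integral_distr) (auto simp: integral_real_density quantile_nonneg)
qed

lemma integrable_mult_bounded_snd:
  fixes g :: "'a \<Rightarrow> real"
  assumes h: "integrable \<pi> (\<lambda>z. h (fst z))" and g: "g \<in> borel_measurable borel" "\<And>x. \<bar>g x\<bar> \<le> B"
  shows "integrable \<pi> (\<lambda>z. h (fst z) * g (snd z) :: real)"
proof (rule Bochner_Integration.integrable_bound[OF integrable_mult_right[OF h, of B]])
  note [measurable] = snd_measurable_unit_prod[OF unit_couplingsD(2)] g(1)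
  show "(\<lambda>z. h (fst z) * g (snd z)) \<in> borel_measurable \<pi>"
    using borel_measurable_integrable[OF h] by measurable
  have "0 \<le> B" using g(2) abs_ge_zero order_trans by blast
  then show "AE z in \<pi>. norm (h (fst z) * g (snd z)) \<le> norm (B * h (fst z))"
    using g(2) by (auto simp: abs_mult mult.commute[of B] intro!: mult_left_mono)
qed

text \<open>The first marginal is the uniform law for every coupling, so an \<open>L1\<close> error
  between the weight functions on \<open>{0<..<1}\<close> becomes an error of the integrals that
  does not depend on \<pi>.\<close>

lemma integral_coupling_diff_le:
  fixes g :: "'a \<Rightarrow> real"
  assumes h: "h \<in> borel_measurable unit_interval" "h' \<in> borel_measurable unit_interval"
    and ih: "integrable \<pi> (\<lambda>z. h (fst z))" "integrable \<pi> (\<lambda>z. h' (fst z))"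
    and g: "g \<in> borel_measurable borel" "\<And>x. \<bar>g x\<bar> \<le> B" and "0 \<le> d"
    and le: "(\<integral>\<^sup>+u. ennreal \<bar>h u - h' u\<bar> \<partial>unit_interval) \<le> ennreal d"
  shows "\<bar>(\<integral>z. h (fst z) * g (snd z) \<partial>\<pi>) - (\<integral>z. h' (fst z) * g (snd z) \<partial>\<pi>)\<bar> \<le> B * d"
proof -
  have B: "0 \<le> B" using g(2) abs_ge_zero order_trans by blast
  have i: "integrable \<pi> (\<lambda>z. \<bar>h (fst z) - h' (fst z)\<bar>)" using ih by auto
  have "(\<integral>\<^sup>+z. ennreal \<bar>h (fst z) - h' (fst z)\<bar> \<partial>\<pi>) \<le> ennreal d"
    using h le by (subst nn_integral_fst_coupling[of "\<lambda>u. ennreal \<bar>h u - h' u\<bar>"]) auto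
  then have d: "(\<integral>z. \<bar>h (fst z) - h' (fst z)\<bar> \<partial>\<pi>) \<le> d"
    using \<open>0 \<le> d\<close> nn_integral_eq_integral[OF i] by (simp add: ennreal_le_iff)
  have "(\<integral>z. h (fst z) * g (snd z) \<partial>\<pi>) - (\<integral>z. h' (fst z) * g (snd z) \<partial>\<pi>)
    = (\<integral>z. h (fst z) * g (snd z) - h' (fst z) * g (snd z) \<partial>\<pi>)"
    using integrable_mult_bounded_snd[OF ih(1) g] integrable_mult_bounded_snd[OF ih(2) g] by simp
  also have "\<bar>\<dots>\<bar> \<le> (\<integral>z. \<bar>h (fst z) * g (snd z) - h' (fst z) * g (snd z)\<bar> \<partial>\<pi>)"
    by (rule integral_abs_bound)
  also have "\<dots> \<le> (\<integral>z. B * \<bar>h (fst z) - h' (fst z)\<bar> \<partial>\<pi>)"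
  proof (intro integral_mono integrable_abs Bochner_Integration.integrable_diff)
    show "\<bar>h (fst z) * g (snd z) - h' (fst z) * g (snd z)\<bar> \<le> B * \<bar>h (fst z) - h' (fst z)\<bar>" for z
      using g(2) by (auto simp: left_diff_distrib[symmetric] abs_mult mult.commute[of B] intro!: mult_left_mono)
  qed (use i integrable_mult_bounded_snd[OF ih(1) g] integrable_mult_bounded_snd[OF ih(2) g] in auto)
  also have "\<dots> \<le> B * d" using d B by (simp add: mult_left_mono)
  finally show ?thesis .
qed

text \<open>\<open>cdf_dist\<close> is the \<open>L1\<close> distance of the quantile functions, so
  the mixture is Lipschitz in \<gamma>, uniformly over the couplings.\<close>

lemma integral_mixture_diff_le:
  fixes g :: "'a \<Rightarrow> real"
  assumes "\<gamma> \<in> M11_Rplus" "\<gamma>' \<in> M11_Rplus" and g: "g \<in> borel_measurable borel" "\<And>x. \<bar>g x\<bar> \<le> B"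
    and d: "cdf_dist \<gamma> \<gamma>' \<le> ennreal d" "0 \<le> d"
  shows "\<bar>(\<integral>x. g x \<partial>mixture \<gamma> \<pi>) - (\<integral>x. g x \<partial>mixture \<gamma>' \<pi>)\<bar> \<le> B * d"
  unfolding integral_mixture[OF assms(1) g(1)] integral_mixture[OF assms(2) g(1)]
  using assms M11_Rplus_subset[OF assms(1)] M11_Rplus_subset[OF assms(2)]
  by (intro integral_coupling_diff_le)
     (auto simp: measurable_quantile_borel integrable_quantile_fst nn_integral_abs_diff_eq_cdf_dist)

end

text \<open>Data processing along \<open>quantile_pair \<gamma>\<close>, which maps the fixed
  reference measure to \<open>\<gamma> \<Otimes>\<^sub>M \<mu>\<close>.\<close>

lemma rel_entropy_quantile_pair_le:
  assumes \<pi>: "\<pi> \<in> unit_couplings \<mu>" and \<gamma>: "\<gamma> \<in> M1 Rplus"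
  shows "rel_entropy (distr \<pi> (Rplus \<Otimes>\<^sub>M borel) (quantile_pair \<gamma>)) (\<gamma> \<Otimes>\<^sub>M \<mu>) \<le> rel_entropy \<pi> (unit_prod \<mu>)"
  unfolding distr_quantile_pair_unit_prod[OF \<gamma>, symmetric]
  by (intro rel_entropy_distr_le prob_space_unit_prod' unit_couplingsD[OF \<pi>] quantile_pair_measurable \<gamma>) auto

text \<open>The density of \<rho> with respect to the product of its marginals, read through
  \<open>quantile_pair\<close>, is the density of \<pi>. Where the first marginal has atoms the
  quantile map is not injective; the mass of a fibre is then spread evenly, and since the density
  factors through the map the entropy is unchanged.\<close>

lemma coupling_of_pair_law:
  assumes \<rho>: "\<rho> \<in> M11" "marg2 \<rho> = \<mu>" and fin: "rel_entropy \<rho> (marg1 \<rho> \<Otimes>\<^sub>M \<mu>) < \<infinity>"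
  obtains \<pi> where "\<pi> \<in> unit_couplings \<mu>" "rel_entropy \<pi> (unit_prod \<mu>) = rel_entropy \<rho> (marg1 \<rho> \<Otimes>\<^sub>M \<mu>)"
    "mixture (marg1 \<rho>) \<pi> = F_map \<rho>"
proof -
  define \<gamma> where "\<gamma> = marg1 \<rho>"
  have ps: "prob_space \<rho>" and sets: "sets \<rho> = sets (Rplus \<Otimes>\<^sub>M borel)"
    using \<rho> by (auto simp: M11_def space_prob_algebra)
  have fst_m: "fst \<in> \<rho> \<rightarrow>\<^sub>M Rplus" and snd_m: "snd \<in> \<rho> \<rightarrow>\<^sub>M borel"
    using sets by (auto cong: measurable_cong_sets)
  have \<gamma>: "\<gamma> \<in> M1 Rplus"
    using prob_space.prob_space_distr[OF ps fst_m] by (simp add: \<gamma>_def marg1_def space_prob_algebra)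
  interpret G: prob_space \<gamma> by (rule prob_space_M1_Rplus[OF \<gamma>])
  interpret Mu: prob_space \<mu> by (rule prob_space_M1_borel[OF \<mu>])
  interpret U: prob_space unit_interval by (rule prob_space_unit_interval)
  interpret UM: pair_prob_space unit_interval \<mu> ..
  interpret GM: pair_prob_space \<gamma> \<mu> ..
  let ?T = "quantile_pair \<gamma> :: real \<times> 'a \<Rightarrow> _"
  have T: "?T \<in> unit_prod \<mu> \<rightarrow>\<^sub>M Rplus \<Otimes>\<^sub>M borel" by (rule quantile_pair_measurable[OF refl \<gamma>])
  have dT: "distr (unit_prod \<mu>) (Rplus \<Otimes>\<^sub>M borel) ?T = \<gamma> \<Otimes>\<^sub>M \<mu>"
    by (rule distr_quantile_pair_unit_prod[OF \<gamma>])
  obtain f :: "real \<times> 'a \<Rightarrow> real" where f: "f \<in> borel_measurable (\<gamma> \<Otimes>\<^sub>M \<mu>)" and nn: "\<And>z. 0 \<le> f z"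
    and \<rho>f: "\<rho> = density (\<gamma> \<Otimes>\<^sub>M \<mu>) (\<lambda>z. ennreal (f z))"
    using rel_entropy_finiteE[of "\<gamma> \<Otimes>\<^sub>M \<mu>" \<rho>] fin ps sets sets_pair_M1[OF \<gamma>]
      prob_space_pair[OF G.prob_space_axioms Mu.prob_space_axioms] unfolding \<gamma>_def by metis
  have f'[measurable]: "f \<in> borel_measurable (Rplus \<Otimes>\<^sub>M borel)"
    using f sets_pair_M1[OF \<gamma>] by (simp cong: measurable_cong_sets)
  define \<pi> where "\<pi> = density (unit_prod \<mu>) (\<lambda>z. ennreal (f (?T z)))"
  note [measurable] = T
  have \<pi>sets: "sets \<pi> = sets (unit_prod \<mu>)" by (simp add: \<pi>_def)
  have T\<pi>: "?T \<in> \<pi> \<rightarrow>\<^sub>M Rplus \<Otimes>\<^sub>M borel" by (rule quantile_pair_measurable[OF \<pi>sets \<gamma>])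
  have \<rho>\<pi>: "distr \<pi> (Rplus \<Otimes>\<^sub>M borel) ?T = \<rho>"
    unfolding \<pi>_def \<rho>f dT[symmetric] by (rule density_distr_comp[OF T]) measurable
  have "prob_space \<pi>" using prob_space_distrD[OF T\<pi>] ps by (simp add: \<rho>\<pi>)
  moreover have "distr \<pi> \<mu> snd = \<mu>"
  proof -
    have "distr \<pi> \<mu> snd = distr \<pi> borel (snd \<circ> ?T)"
      using sets_M1_borel[OF \<mu>] by (intro distr_cong) (auto simp: quantile_pair_def)
    also have "\<dots> = distr (distr \<pi> (Rplus \<Otimes>\<^sub>M borel) ?T) borel snd"
      by (intro distr_distr[symmetric] T\<pi>) auto
    also have "\<dots> = \<mu>" using \<rho>(2) by (simp add: \<rho>\<pi> marg2_def)
    finally show ?thesis .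
  qed
  moreover have "distr \<pi> unit_interval fst = unit_interval"
  proof -
    \<comment> \<open>The first marginal of \<rho> has density 1 almost everywhere with respect to
      itself; composing with the quantile carries this over to the unit interval.\<close>
    define h where "h w = (\<integral>\<^sup>+x. ennreal (f (w, x)) \<partial>\<mu>)" for w
    have [measurable]: "(\<lambda>z. ennreal (f z)) \<in> borel_measurable (\<gamma> \<Otimes>\<^sub>M \<mu>)" using f by measurable
    have hm: "h \<in> borel_measurable \<gamma>" unfolding h_def by (rule Mu.borel_measurable_nn_integral_fst) measurable
    have "density \<gamma> h = distr \<rho> \<gamma> fst"
      unfolding \<rho>f h_def[abs_def] by (rule GM.distr_fst_density[symmetric]) measurable
    also have "\<dots> = density \<gamma> (\<lambda>_. 1)"
      using sets_M1_Rplus[OF \<gamma>] by (simp add: density_1) (simp add: \<gamma>_def marg1_def cong: distr_cong)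
    finally have "AE w in \<gamma>. h w = 1" using hm by (intro G.density_unique) auto
    then have "AE w in distr unit_interval Rplus (quantile \<gamma>). h w = 1" unfolding distr_quantile[OF \<gamma>] .
    then have AEu: "AE u in unit_interval. h (quantile \<gamma> u) = 1" by (rule AE_distrD[OF measurable_quantile[OF \<gamma>]])
    have fT: "(\<lambda>z. ennreal (f (?T z))) \<in> borel_measurable (unit_prod \<mu>)" by measurable
    have "distr \<pi> unit_interval fst = density unit_interval (\<lambda>u. h (quantile \<gamma> u))"
      unfolding \<pi>_def by (subst UM.distr_fst_density[OF fT]) (simp add: h_def quantile_pair_def)
    also have "\<dots> = density unit_interval (\<lambda>_. 1)"
      using AEu measurable_compose[OF measurable_quantile[OF \<gamma>], of h] hm sets_M1_Rplus[OF \<gamma>]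
      by (intro density_cong) (auto cong: measurable_cong_sets)
    finally show ?thesis by (simp add: density_1)
  qed
  ultimately have "\<pi> \<in> unit_couplings \<mu>" using \<pi>sets by (simp add: unit_couplings_def)
  moreover have "rel_entropy \<pi> (unit_prod \<mu>) = rel_entropy \<rho> (\<gamma> \<Otimes>\<^sub>M \<mu>)"
    unfolding \<pi>_def \<rho>f dT[symmetric]
    by (rule rel_entropy_density_comp[OF UM.prob_space_axioms T f' nn])
  moreover have "mixture \<gamma> \<pi> = F_map \<rho>"
    using F_map_quantile_pair[OF \<pi>sets \<gamma>] \<rho>\<pi> by simp
  ultimately show thesis using that by (simp add: \<gamma>_def)
qed

text \<open>Stated with strict inequalities because an infimum below \<open>c\<close> is witnessed,
  whether or not it is attained. One direction lifts a pair law to a coupling of the same cost; the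
  other maps a coupling down, where the entropy can only decrease.\<close>

theorem K_rate_less_iff:
  "K_rate I \<mu> \<nu> < c \<longleftrightarrow> (\<exists>\<gamma>\<in>M11_Rplus. \<exists>\<pi>\<in>unit_couplings \<mu>. mixture \<gamma> \<pi> = \<nu> \<and>
     rel_entropy \<pi> (unit_prod \<mu>) + I \<gamma> < c)"
proof
  assume "K_rate I \<mu> \<nu> < c"
  then obtain \<rho> where \<rho>: "\<rho> \<in> M11" "F_map \<rho> = \<nu>" "J_rate I \<mu> \<rho> < c"
    by (auto simp: K_rate_def INF_less_iff)
  then have m2: "marg2 \<rho> = \<mu>" and lt: "rel_entropy \<rho> (marg1 \<rho> \<Otimes>\<^sub>M \<mu>) + I (marg1 \<rho>) < c"
    by (auto simp: J_rate_def split: if_splits)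
  then have "rel_entropy \<rho> (marg1 \<rho> \<Otimes>\<^sub>M \<mu>) < \<infinity>"
    by (metis ennreal_add_eq_top infinity_ennreal_def not_less_iff_gr_or_eq not_top_less top.not_eq_extremum)
  from coupling_of_pair_law[OF \<rho>(1) m2 this] obtain \<pi> where "\<pi> \<in> unit_couplings \<mu>"
    "rel_entropy \<pi> (unit_prod \<mu>) = rel_entropy \<rho> (marg1 \<rho> \<Otimes>\<^sub>M \<mu>)" "mixture (marg1 \<rho>) \<pi> = F_map \<rho>" .
  moreover have "marg1 \<rho> \<in> M11_Rplus"
  proof -
    have ps: "prob_space \<rho>" and sets: "sets \<rho> = sets (Rplus \<Otimes>\<^sub>M borel)"
      using \<rho> by (auto simp: M11_def space_prob_algebra)
    have "fst \<in> \<rho> \<rightarrow>\<^sub>M Rplus" using sets by (auto cong: measurable_cong_sets)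
    then show ?thesis using prob_space.prob_space_distr[OF ps] \<rho>(1)
      by (auto simp: M11_Rplus_def M11_def marg1_def space_prob_algebra)
  qed
  ultimately show "\<exists>\<gamma>\<in>M11_Rplus. \<exists>\<pi>\<in>unit_couplings \<mu>. mixture \<gamma> \<pi> = \<nu> \<and> rel_entropy \<pi> (unit_prod \<mu>) + I \<gamma> < c"
    using lt \<rho>(2) by (intro bexI[of _ "marg1 \<rho>"] bexI[of _ \<pi>]) auto
next
  assume "\<exists>\<gamma>\<in>M11_Rplus. \<exists>\<pi>\<in>unit_couplings \<mu>. mixture \<gamma> \<pi> = \<nu> \<and> rel_entropy \<pi> (unit_prod \<mu>) + I \<gamma> < c"
  then obtain \<gamma> \<pi> where \<gamma>1: "\<gamma> \<in> M11_Rplus" and \<pi>: "\<pi> \<in> unit_couplings \<mu>" and \<nu>: "mixture \<gamma> \<pi> = \<nu>"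
    and lt: "rel_entropy \<pi> (unit_prod \<mu>) + I \<gamma> < c" by auto
  have \<gamma>: "\<gamma> \<in> M1 Rplus" using \<gamma>1 by (rule M11_Rplus_subset)
  let ?\<rho> = "distr \<pi> (Rplus \<Otimes>\<^sub>M borel) (quantile_pair \<gamma>)"
  have "?\<rho> \<in> M11"
    using \<gamma>1 prob_space.prob_space_distr[OF unit_couplingsD(1)[OF \<pi>] quantile_pair_measurable[OF unit_couplingsD(2)[OF \<pi>] \<gamma>]]
    by (simp add: M11_def space_prob_algebra marg_quantile_pair[OF \<pi> \<gamma>] M11_Rplus_def)
  moreover have "F_map ?\<rho> = \<nu>" using F_map_quantile_pair[OF unit_couplingsD(2)[OF \<pi>] \<gamma>] \<nu> by simp
  ultimately have "K_rate I \<mu> \<nu> \<le> J_rate I \<mu> ?\<rho>" unfolding K_rate_def by (intro INF_lower) auto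
  also have "\<dots> \<le> rel_entropy \<pi> (unit_prod \<mu>) + I \<gamma>"
    using rel_entropy_quantile_pair_le[OF \<pi> \<gamma>] by (simp add: J_rate_def marg_quantile_pair[OF \<pi> \<gamma>] add_right_mono)
  also have "\<dots> < c" by (rule lt)
  finally show "K_rate I \<mu> \<nu> < c" .
qed

lemma K_rate_mixture_le:
  assumes "\<gamma> \<in> M11_Rplus" "\<pi> \<in> unit_couplings \<mu>"
  shows "K_rate I \<mu> (mixture \<gamma> \<pi>) \<le> rel_entropy \<pi> (unit_prod \<mu>) + I \<gamma>"
proof (rule ccontr)
  assume "\<not> ?thesis"
  then show False using K_rate_less_iff[of I "mixture \<gamma> \<pi>" "K_rate I \<mu> (mixture \<gamma> \<pi>)"] assms
    by (auto simp: not_le)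
qed

end

section \<open>Goodness of the rate function\<close>

text \<open>Dominated convergence; the dominating function is the quantile itself, whose integral is
  one.\<close>

lemma quantile_truncation:
  assumes "\<gamma> \<in> M11_Rplus" "0 < e"
  obtains k :: nat where "(\<integral>\<^sup>+u. ennreal \<bar>quantile \<gamma> u - min (quantile \<gamma> u) (real k)\<bar> \<partial>unit_interval) \<le> ennreal e"
proof -
  have \<gamma>: "\<gamma> \<in> M1 Rplus" using assms(1) by (rule M11_Rplus_subset)
  note [measurable] = measurable_quantile_borel[OF \<gamma>]
  have "(\<lambda>k. \<integral>\<^sup>+u. ennreal \<bar>quantile \<gamma> u - min (quantile \<gamma> u) (real k)\<bar> \<partial>unit_interval) \<longlonglongrightarrow> (\<integral>\<^sup>+u. 0 \<partial>unit_interval)"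
  proof (rule nn_integral_dominated_convergence[where w="\<lambda>u. ennreal (quantile \<gamma> u)"])
    show "AE u in unit_interval. ennreal \<bar>quantile \<gamma> u - min (quantile \<gamma> u) (real k)\<bar> \<le> ennreal (quantile \<gamma> u)" for k
      using quantile_nonneg[of \<gamma>] by (auto intro!: ennreal_leI AE_I2)
    show "AE u in unit_interval. (\<lambda>k. ennreal \<bar>quantile \<gamma> u - min (quantile \<gamma> u) (real k)\<bar>) \<longlonglongrightarrow> 0"
    proof (rule AE_I2)
      fix u
      have "eventually (\<lambda>k. quantile \<gamma> u < real k) sequentially"
        using filterlim_at_top_dense[THEN iffD1, OF filterlim_real_sequentially] by blast
      then have "eventually (\<lambda>k. ennreal \<bar>quantile \<gamma> u - min (quantile \<gamma> u) (real k)\<bar> = 0) sequentially"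
        by eventually_elim simp
      then show "(\<lambda>k. ennreal \<bar>quantile \<gamma> u - min (quantile \<gamma> u) (real k)\<bar>) \<longlonglongrightarrow> 0"
        by (rule tendsto_eventually)
    qed
  qed (use assms(1) in \<open>auto simp: nn_integral_quantile\<close>)
  then have "eventually (\<lambda>k. (\<integral>\<^sup>+u. ennreal \<bar>quantile \<gamma> u - min (quantile \<gamma> u) (real k)\<bar> \<partial>unit_interval) < ennreal e) sequentially"
    using assms(2) by (intro order_tendstoD(2)[where y=0]) auto
  then show thesis using that by (auto simp: eventually_sequentially intro: less_imp_le)
qed

context
  fixes \<mu> :: "'a::metric_space measure"
  assumes \<mu>: "\<mu> \<in> M1 borel"
begin

definition entropic_couplings :: "real \<Rightarrow> (real \<times> 'a) measure set" where
  "entropic_couplings b = {\<pi> \<in> unit_couplings \<mu>. rel_entropy \<pi> (unit_prod \<mu>) \<le> ennreal b}"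

text \<open>Expresses the two marginals by values on rectangles, that is, by coordinates of the
  setwise topology, so that they define closed sets.\<close>

lemma unit_couplings_iff:
  "\<pi> \<in> unit_couplings \<mu> \<longleftrightarrow> prob_space \<pi> \<and> sets \<pi> = sets (unit_prod \<mu>) \<and>
    (\<forall>A\<in>sets unit_interval. measure \<pi> (A \<times> UNIV) = measure unit_interval A) \<and>
    (\<forall>B\<in>sets borel. measure \<pi> ({0<..<1} \<times> B) = measure \<mu> B)"
proof (cases "prob_space \<pi> \<and> sets \<pi> = sets (unit_prod \<mu>)")
  case True
  then have \<pi>: "prob_space \<pi>" "sets \<pi> = sets (unit_prod \<mu>)" by auto
  interpret P: prob_space \<pi> by fact
  interpret U: prob_space unit_interval by (rule prob_space_unit_interval)
  interpret M: prob_space \<mu> by (rule prob_space_M1_borel[OF \<mu>])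
  have sp: "space \<pi> = {0<..<1} \<times> UNIV"
    using sets_eq_imp_space_eq[OF \<pi>(2)] space_unit_prod[OF \<mu>] by simp
  have snd_m: "snd \<in> \<pi> \<rightarrow>\<^sub>M \<mu>"
    using snd_measurable_unit_prod[OF \<mu> \<pi>(2)] sets_M1_borel[OF \<mu>] by (simp cong: measurable_cong_sets)
  have 1: "emeasure (distr \<pi> unit_interval fst) A = ennreal (measure \<pi> (A \<times> UNIV))" if "A \<in> sets unit_interval" for A
  proof -
    have "fst -` A \<inter> space \<pi> = A \<times> UNIV" using sets.sets_into_space[OF that] sp by (auto simp: space_unit_interval)
    then show ?thesis using that fst_measurable_unit_prod[OF \<mu> \<pi>(2)] by (simp add: emeasure_distr P.emeasure_eq_measure)
  qed
  have 2: "emeasure (distr \<pi> \<mu> snd) B = ennreal (measure \<pi> ({0<..<1} \<times> B))" if "B \<in> sets borel" for B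
  proof -
    have "snd -` B \<inter> space \<pi> = {0<..<1} \<times> B" using sp by auto
    then show ?thesis using that snd_m sets_M1_borel[OF \<mu>] by (simp add: emeasure_distr P.emeasure_eq_measure)
  qed
  have "distr \<pi> unit_interval fst = unit_interval \<longleftrightarrow>
    (\<forall>A\<in>sets unit_interval. measure \<pi> (A \<times> UNIV) = measure unit_interval A)" (is "?a = ?b")
  proof
    assume ?a then show ?b using 1 by (metis U.emeasure_eq_measure ennreal_inj measure_nonneg)
  next
    assume ?b then show ?a by (intro measure_eqI) (auto simp: 1 U.emeasure_eq_measure)
  qed
  moreover have "distr \<pi> \<mu> snd = \<mu> \<longleftrightarrow> (\<forall>B\<in>sets borel. measure \<pi> ({0<..<1} \<times> B) = measure \<mu> B)" (is "?a = ?b")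
  proof
    assume ?a then show ?b using 2 by (metis M.emeasure_eq_measure ennreal_inj measure_nonneg)
  next
    assume ?b then show ?a using sets_M1_borel[OF \<mu>] by (intro measure_eqI) (auto simp: 2 M.emeasure_eq_measure)
  qed
  ultimately show ?thesis using \<pi> by (simp add: unit_couplings_def)
qed (auto simp: unit_couplings_def)

text \<open>The marginal constraints are closed, so they cut a compact set out of the compact
  entropy ball.\<close>

lemma compactin_entropic_couplings:
  assumes "0 \<le> b"
  shows "compactin (setwise_topology (unit_prod \<mu>)) (set_function (unit_prod \<mu>) ` entropic_couplings b)"
proof -
  let ?X = "setwise_topology (unit_prod \<mu>)"
  define C1 where "C1 A = {p \<in> topspace ?X. p (A \<times> UNIV) \<in> {measure unit_interval A}}" for A
  define C2 where "C2 B = {p \<in> topspace ?X. p ({0<..<1} \<times> B) \<in> {measure \<mu> B}}" for B :: "'a set"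
  define K0 where "K0 = set_function (unit_prod \<mu>) ` entropy_ball (unit_prod \<mu>) b"
  have rect: "A \<times> UNIV \<in> sets (unit_prod \<mu>)" "{0<..<1} \<times> B \<in> sets (unit_prod \<mu>)"
    if "A \<in> sets unit_interval" "B \<in> sets borel" for A B
    using that sets_M1_borel[OF \<mu>] by (auto intro!: pair_measureI simp: sets_restrict_space_iff)
  have K0: "compactin ?X K0"
    unfolding K0_def using assms by (intro compactin_entropy_ball prob_space_unit_prod' \<mu>)
  have H: "Hausdorff_space ?X" by (simp add: Hausdorff_space_product_topology)
  define \<K> where "\<K> = insert K0 (C1 ` sets unit_interval \<union> C2 ` sets borel)"
  have "compactin ?X (\<Inter>\<K>)"
  proof (rule closed_compactin_Inter[OF K0])
    fix K assume "K \<in> \<K>"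
    moreover have "closedin ?X K0" using compactin_imp_closedin[OF H K0] .
    moreover have "closedin ?X (C1 A)" if "A \<in> sets unit_interval" for A
      unfolding C1_def using rect(1)[OF that, of "{}"]
      by (intro closedin_continuous_map_preimage[where Y=euclideanreal] continuous_map_product_projection) auto
    moreover have "closedin ?X (C2 A)" if "A \<in> sets borel" for A
      unfolding C2_def using rect(2)[of "{}", OF _ that]
      by (intro closedin_continuous_map_preimage[where Y=euclideanreal] continuous_map_product_projection) auto
    ultimately show "closedin ?X K" by (auto simp: \<K>_def)
  qed (simp add: \<K>_def)
  moreover have "\<Inter>\<K> = set_function (unit_prod \<mu>) ` entropic_couplings b"
  proof -
    have c1: "set_function (unit_prod \<mu>) \<pi> \<in> C1 A \<longleftrightarrow> measure \<pi> (A \<times> UNIV) = measure unit_interval A"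
      if "A \<in> sets unit_interval" for A and \<pi> :: "(real \<times> 'a) measure"
      using rect(1)[OF that, of "{}"] by (simp add: C1_def set_function_def)
    have c2: "set_function (unit_prod \<mu>) \<pi> \<in> C2 B \<longleftrightarrow> measure \<pi> ({0<..<1} \<times> B) = measure \<mu> B"
      if "B \<in> sets borel" for B and \<pi> :: "(real \<times> 'a) measure"
      using rect(2)[of "{}", OF _ that] by (simp add: C2_def set_function_def)
    have "entropic_couplings b = {\<pi> \<in> entropy_ball (unit_prod \<mu>) b.
      (\<forall>A\<in>sets unit_interval. set_function (unit_prod \<mu>) \<pi> \<in> C1 A) \<and>
      (\<forall>B\<in>sets borel. set_function (unit_prod \<mu>) \<pi> \<in> C2 B)}"
      unfolding entropic_couplings_def unit_couplings_iff entropy_ball_def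
      by (simp add: c1 c2 conj_ac cong: ball_cong conj_cong)
    then show ?thesis unfolding \<K>_def K0_def by auto
  qed
  ultimately show ?thesis by simp
qed

definition rate_image :: "(real measure \<Rightarrow> ennreal) \<Rightarrow> real \<Rightarrow> real \<Rightarrow> 'a measure set" where
  "rate_image I a b = (\<lambda>(\<gamma>, \<pi>). mixture \<gamma> \<pi>) ` ({\<gamma> \<in> M11_Rplus. I \<gamma> \<le> ennreal a} \<times> entropic_couplings b)"

text \<open>A continuous image of a product of compact sets. For fixed \<gamma> the integrals of the
  mixture are uniform limits of integrals of bounded functions; in \<gamma> they are Lipschitz with
  a constant independent of the coupling. Together this gives joint continuity.\<close>

lemma compactin_rate_image:
  assumes I: "good wasserstein_topology I" and "0 \<le> a" "0 \<le> b"
  shows "compactin weak_topology (rate_image I a b)"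
proof -
  let ?m = "unit_prod \<mu>"
  let ?Y = "subtopology (setwise_topology ?m) (set_function ?m ` entropic_couplings b)"
  let ?X = "prod_topology wasserstein_topology ?Y"
  let ?f = "\<lambda>(\<gamma>, p). mixture \<gamma> (measure_of_fun ?m p)"
  let ?K = "{\<gamma> \<in> M11_Rplus. I \<gamma> \<le> ennreal a} \<times> set_function ?m ` entropic_couplings b"
  have mof: "measure_of_fun ?m (set_function ?m \<pi>) = \<pi>" if "\<pi> \<in> entropic_couplings b" for \<pi>
    using that by (intro measure_of_fun_set_function)
      (auto simp: entropic_couplings_def unit_couplings_def prob_space.finite_measure)
  have K: "compactin ?X ?K"
    using I compactin_entropic_couplings[OF \<open>0 \<le> b\<close>]
    by (simp add: compactin_Times compactin_subtopology good_def topspace_wasserstein_topology)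
  have tX: "topspace ?X = M11_Rplus \<times> set_function ?m ` entropic_couplings b"
  proof -
    have "set_function ?m ` entropic_couplings b \<subseteq> topspace (setwise_topology ?m)"
      by (auto simp: set_function_def)
    then show ?thesis by (auto simp: topspace_wasserstein_topology)
  qed
  have "continuous_map ?X weak_topology ?f"
  proof (rule continuous_map_weak_topology)
    fix q assume "q \<in> topspace ?X"
    then show "?f q \<in> M1 borel"
      unfolding tX using mof by (auto simp: entropic_couplings_def intro!: mixture_in_M1[OF \<mu>])
  next
    fix g :: "'a \<Rightarrow> real" assume g: "g \<in> bounded_continuous"
    then have gm: "g \<in> borel_measurable borel" by (rule bounded_continuous_measurable)
    obtain B where B: "0 < B" "\<And>x. \<bar>g x\<bar> \<le> B" using bounded_continuous_bounded[OF g] by blast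
    have fix\<gamma>: "continuous_map ?Y euclideanreal (\<lambda>p. \<integral>x. g x \<partial>mixture \<gamma> (measure_of_fun ?m p))"
      if \<gamma>: "\<gamma> \<in> M11_Rplus" for \<gamma>
    proof (rule continuous_map_uniform_approx)
      fix e :: real assume "e > 0"
      \<comment> \<open>Truncation at \<open>k\<close> makes the integrand bounded; multiplied by
        the bound \<open>B\<close> of \<open>g\<close>, the error is at most \<open>e\<close> for
        every coupling.\<close>
      then obtain k :: nat where k:
        "(\<integral>\<^sup>+u. ennreal \<bar>quantile \<gamma> u - min (quantile \<gamma> u) (real k)\<bar> \<partial>unit_interval) \<le> ennreal (e / B)"
        using quantile_truncation[OF \<gamma>, of "e / B"] B(1) by auto
      define \<phi> where "\<phi> z = min (quantile \<gamma> (fst z)) (real k) * g (snd z)" for z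
      note [measurable] = quantile_fst_measurable[OF \<mu> refl M11_Rplus_subset[OF \<gamma>]]
        snd_measurable_unit_prod[OF \<mu> refl] gm measurable_quantile_borel[OF M11_Rplus_subset[OF \<gamma>]]
      have "\<phi> \<in> borel_measurable ?m" unfolding \<phi>_def by measurable
      moreover have "\<bar>\<phi> z\<bar> \<le> real k * B" for z
        unfolding \<phi>_def abs_mult using B quantile_nonneg[of \<gamma> "fst z"] by (intro mult_mono) auto
      ultimately have "continuous_map ?Y euclideanreal (\<lambda>p. \<integral>z. \<phi> z \<partial>measure_of_fun ?m p)"
        by (rule continuous_map_integral_bounded) (auto simp: entropic_couplings_def unit_couplings_def)
      moreover have "\<bar>(\<integral>x. g x \<partial>mixture \<gamma> (measure_of_fun ?m p)) - (\<integral>z. \<phi> z \<partial>measure_of_fun ?m p)\<bar> \<le> e"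
        if "p \<in> topspace ?Y" for p
      proof -
        obtain \<pi> where p: "p = set_function ?m \<pi>" and \<pi>: "\<pi> \<in> entropic_couplings b" using \<open>p \<in> topspace ?Y\<close> by auto
        then have \<pi>': "\<pi> \<in> unit_couplings \<mu>" by (simp add: entropic_couplings_def)
        interpret P: prob_space \<pi> using unit_couplingsD[OF \<mu> \<pi>'] by simp
        note [measurable] = fst_measurable_unit_prod[OF \<mu> unit_couplingsD(2)[OF \<mu> \<pi>']]
        have "integrable \<pi> (\<lambda>z. min (quantile \<gamma> (fst z)) (real k))"
          using quantile_nonneg[of \<gamma>] by (intro P.integrable_const_bound[where B="real k"]) auto
        then have "\<bar>(\<integral>z. quantile \<gamma> (fst z) * g (snd z) \<partial>\<pi>) - (\<integral>z. min (quantile \<gamma> (fst z)) (real k) * g (snd z) \<partial>\<pi>)\<bar> \<le> B * (e / B)"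
          using k B \<open>e > 0\<close> integrable_quantile_fst[OF \<mu> \<pi>' \<gamma>] gm
          by (intro integral_coupling_diff_le[OF \<mu> \<pi>', where h'="\<lambda>u. min (quantile \<gamma> u) (real k)"]) auto
        then show ?thesis using B(1) unfolding p mof[OF \<pi>] integral_mixture[OF \<mu> \<pi>' \<gamma> gm] \<phi>_def by simp
      qed
      ultimately show "\<exists>g'. continuous_map ?Y euclideanreal g' \<and>
        (\<forall>p\<in>topspace ?Y. \<bar>(\<integral>x. g x \<partial>mixture \<gamma> (measure_of_fun ?m p)) - g' p\<bar> \<le> e)" by blast
    qed
    show "continuous_map ?X euclideanreal (\<lambda>q. \<integral>x. g x \<partial>?f q)"
    proof (rule continuous_map_local_approx)
      fix q and e :: real assume q: "q \<in> topspace ?X" and "e > 0"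
      then obtain \<gamma> p where q': "q = (\<gamma>, p)" "\<gamma> \<in> M11_Rplus" "p \<in> set_function ?m ` entropic_couplings b"
        unfolding tX by auto
      define U where "U = {\<gamma>' \<in> M11_Rplus. cdf_dist \<gamma> \<gamma>' < ennreal (e / B)} \<times> topspace ?Y"
      have "openin ?X U" unfolding U_def using q'(2)
        by (intro openin_prod_Times_iff[THEN iffD2] disjI2 conjI openin_cdf_dist_ball openin_topspace)
      moreover have "q \<in> U" using q' q \<open>e > 0\<close> B(1) by (auto simp: U_def cdf_dist_self)
      moreover have "continuous_map ?X euclideanreal (\<lambda>q. \<integral>x. g x \<partial>mixture \<gamma> (measure_of_fun ?m (snd q)))"
        using continuous_map_compose[OF continuous_map_snd fix\<gamma>[OF q'(2)]] by (simp add: comp_def)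
      moreover have "\<bar>(\<integral>x. g x \<partial>?f r) - (\<integral>x. g x \<partial>mixture \<gamma> (measure_of_fun ?m (snd r)))\<bar> \<le> e" if "r \<in> U" for r
      proof -
        obtain \<gamma>' \<pi> where r: "r = (\<gamma>', set_function ?m \<pi>)" "\<gamma>' \<in> M11_Rplus" "cdf_dist \<gamma> \<gamma>' < ennreal (e / B)"
          "\<pi> \<in> entropic_couplings b" using \<open>r \<in> U\<close> unfolding U_def by auto
        then have \<pi>': "\<pi> \<in> unit_couplings \<mu>" by (simp add: entropic_couplings_def)
        have "\<bar>(\<integral>x. g x \<partial>mixture \<gamma>' \<pi>) - (\<integral>x. g x \<partial>mixture \<gamma> \<pi>)\<bar> \<le> B * (e / B)"
          using r B \<open>e > 0\<close> q'(2) gm by (intro integral_mixture_diff_le[OF \<mu> \<pi>']) (auto simp: cdf_dist_commute)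
        then show ?thesis using B(1) r by (simp add: mof)
      qed
      ultimately show "\<exists>g' U. continuous_map ?X euclideanreal g' \<and> openin ?X U \<and> q \<in> U \<and> (\<forall>y\<in>U. \<bar>(\<integral>x. g x \<partial>?f y) - g' y\<bar> \<le> e)"
        by blast
    qed
  qed
  from image_compactin[OF K this] have "compactin weak_topology (?f ` ?K)" .
  moreover have "?f ` ?K = rate_image I a b"
    unfolding rate_image_def by (force simp: mof image_iff)
  ultimately show ?thesis by simp
qed

lemma rate_image_K_rate:
  assumes "\<nu> \<in> rate_image I a b" "0 \<le> a" "0 \<le> b"
  shows "\<nu> \<in> M1 borel" "K_rate I \<mu> \<nu> \<le> ennreal (a + b)"
proof -
  obtain \<gamma> \<pi> where h: "\<gamma> \<in> M11_Rplus" "I \<gamma> \<le> ennreal a" "\<pi> \<in> unit_couplings \<mu>"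
    "rel_entropy \<pi> (unit_prod \<mu>) \<le> ennreal b" "\<nu> = mixture \<gamma> \<pi>"
    using assms(1) by (auto simp: rate_image_def entropic_couplings_def)
  show "\<nu> \<in> M1 borel" unfolding h(5) by (rule mixture_in_M1[OF \<mu> h(3,1)])
  have "K_rate I \<mu> \<nu> \<le> ennreal b + ennreal a"
    unfolding h(5) using K_rate_mixture_le[OF \<mu> h(1,3)] add_mono[OF h(4,2)] by (rule order_trans)
  then show "K_rate I \<mu> \<nu> \<le> ennreal (a + b)" using assms by (simp add: ennreal_plus[symmetric] add.commute del: ennreal_plus)
qed

theorem good_K_rate:
  assumes I: "good wasserstein_topology I"
  shows "good weak_topology (K_rate I \<mu>)"
  unfolding good_def topspace_weak_topology
proof (intro allI impI)
  fix \<alpha> :: ennreal assume "\<alpha> < \<infinity>"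
  then obtain a where a: "0 \<le> a" "\<alpha> = ennreal a" by (cases \<alpha>) auto
  define e where "e N = 1 / real (Suc N)" for N
  have e: "0 < e N" for N by (simp add: e_def)
  \<comment> \<open>The budget \<open>a + 2 * e N\<close> leaves one \<open>e N\<close> for the
    strict inequality of \<open>K_rate_less_iff\<close> and one for rounding the cost of \<gamma> up
    to a multiple of \<open>e N\<close>. Membership in \<open>cells N\<close> keeps the remainder
    left for the entropy nonnegative.\<close>
  define cells where "cells N = {i. real i * e N \<le> a + 2 * e N}" for N
  have fin: "finite (cells N)" for N
  proof -
    have "i \<le> nat \<lceil>(a + 2 * e N) / e N\<rceil>" if "i \<in> cells N" for i
    proof -
      have "real i \<le> (a + 2 * e N) / e N" using that e[of N] by (simp add: cells_def field_simps)
      then show ?thesis by linarith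
    qed
    then show ?thesis by (meson finite_nat_set_iff_bounded_le)
  qed
  \<comment> \<open>the sublevel set of the sum of two rate functions is squeezed between finite unions of products\<close>
  define \<U> where "\<U> N = (\<Union>i\<in>cells N. rate_image I (real i * e N) (a + 2 * e N - real i * e N))" for N
  have comp: "compactin weak_topology (\<U> N)" for N
    unfolding \<U>_def using e[of N] fin[of N]
    by (intro compactin_Union) (auto intro!: compactin_rate_image[OF I] simp: cells_def)
  have "{\<nu> \<in> M1 borel. K_rate I \<mu> \<nu> \<le> \<alpha>} = \<Inter>(range \<U>)"
  proof (intro set_eqI iffI)
    fix \<nu> assume "\<nu> \<in> {\<nu> \<in> M1 borel. K_rate I \<mu> \<nu> \<le> \<alpha>}"
    then have \<nu>: "K_rate I \<mu> \<nu> \<le> ennreal a" using a by auto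
    have "\<nu> \<in> \<U> N" for N
    proof -
      have "ennreal a < ennreal (a + e N)" using e[of N] a by (simp add: ennreal_less_iff)
      then have "K_rate I \<mu> \<nu> < ennreal (a + e N)" using \<nu> by (rule order_le_less_trans[rotated])
      then obtain \<gamma> \<pi> where h: "\<gamma> \<in> M11_Rplus" "\<pi> \<in> unit_couplings \<mu>" "mixture \<gamma> \<pi> = \<nu>"
        "rel_entropy \<pi> (unit_prod \<mu>) + I \<gamma> < ennreal (a + e N)"
        using K_rate_less_iff[OF \<mu>, of I \<nu>] by auto
      have lt: "rel_entropy \<pi> (unit_prod \<mu>) < top" "I \<gamma> < top"
        using h(4) by (auto simp: less_top[symmetric])
      obtain r where r: "0 \<le> r" "rel_entropy \<pi> (unit_prod \<mu>) = ennreal r" using lt(1) by (cases "rel_entropy \<pi> (unit_prod \<mu>)") auto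
      obtain s where s: "0 \<le> s" "I \<gamma> = ennreal s" using lt(2) by (cases "I \<gamma>") auto
      have rs: "r + s < a + e N" using h(4) r s e[of N] a
        by (simp add: ennreal_plus[symmetric] ennreal_less_iff del: ennreal_plus)
      define i where "i = nat \<lceil>s / e N\<rceil>"
      have "s / e N \<le> real i" "real i \<le> s / e N + 1"
        using s(1) e[of N] by (auto simp: i_def of_nat_nat ceiling_divide_lower)
      then have i: "s \<le> real i * e N" "real i * e N \<le> s + e N"
        using e[of N] by (simp_all add: field_simps)
      have "i \<in> cells N" using i rs r by (simp add: cells_def)
      moreover have "\<nu> \<in> rate_image I (real i * e N) (a + 2 * e N - real i * e N)"
        unfolding rate_image_def entropic_couplings_def using h r s i rs
        by (intro image_eqI[where x="(\<gamma>, \<pi>)"]) (auto intro!: ennreal_leI)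
      ultimately show ?thesis unfolding \<U>_def by blast
    qed
    then show "\<nu> \<in> \<Inter>(range \<U>)" by blast
  next
    fix \<nu> assume \<nu>: "\<nu> \<in> \<Inter>(range \<U>)"
    have *: "\<nu> \<in> M1 borel \<and> K_rate I \<mu> \<nu> \<le> ennreal (a + 2 * e N)" for N
    proof -
      obtain i where i: "i \<in> cells N" "\<nu> \<in> rate_image I (real i * e N) (a + 2 * e N - real i * e N)"
        using \<nu> unfolding \<U>_def by blast
      show ?thesis using rate_image_K_rate[OF i(2)] i(1) e[of N] by (auto simp: cells_def)
    qed
    have "(\<lambda>N. ennreal (a + 2 * e N)) \<longlonglongrightarrow> ennreal (a + 2 * 0)"
      unfolding e_def by (intro tendsto_ennrealI tendsto_intros LIMSEQ_Suc[OF lim_1_over_n])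
    then have "K_rate I \<mu> \<nu> \<le> ennreal (a + 2 * 0)"
      by (rule LIMSEQ_le_const) (use * in auto)
    then show "\<nu> \<in> {\<nu> \<in> M1 borel. K_rate I \<mu> \<nu> \<le> \<alpha>}" using * a by auto
  qed
  moreover have "compactin weak_topology (\<Inter>(range \<U>))"
    using compactin_imp_closedin[OF Hausdorff_weak_topology comp]
    by (intro closed_compactin_Inter[OF comp[of 0]]) auto
  ultimately show "compactin weak_topology {\<nu> \<in> M1 borel. K_rate I \<mu> \<nu> \<le> \<alpha>}" by simp
qed

text \<open>Compact sublevel sets are closed in a Hausdorff space; at level \<infinity> the sublevel
  set is the whole space.\<close>

lemma lower_semicontinuous_K_rate:
  assumes I: "good wasserstein_topology I"
  shows "lower_semicontinuous_on weak_topology (K_rate I \<mu>)"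
  unfolding lower_semicontinuous_on_def
proof
  fix \<alpha>
  show "closedin weak_topology {\<nu> \<in> topspace weak_topology. K_rate I \<mu> \<nu> \<le> \<alpha>}"
  proof (cases "\<alpha> = \<infinity>")
    case False
    then have "compactin weak_topology {\<nu> \<in> topspace weak_topology. K_rate I \<mu> \<nu> \<le> \<alpha>}"
      using good_K_rate[OF I] by (simp add: good_def top.not_eq_extremum)
    then show ?thesis by (rule compactin_imp_closedin[OF Hausdorff_weak_topology])
  qed simp
qed

end

section \<open>The kernel form of the rate function\<close>

lemma M11D:
  assumes "\<rho> \<in> M11"
  shows "prob_space \<rho>" "sets \<rho> = sets (Rplus \<Otimes>\<^sub>M borel)" "marg1 \<rho> \<in> M11_Rplus"
    "fst \<in> \<rho> \<rightarrow>\<^sub>M Rplus" "snd \<in> \<rho> \<rightarrow>\<^sub>M borel"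
proof -
  show ps: "prob_space \<rho>" and sets: "sets \<rho> = sets (Rplus \<Otimes>\<^sub>M borel)"
    using assms by (auto simp: M11_def space_prob_algebra)
  show fst: "fst \<in> \<rho> \<rightarrow>\<^sub>M Rplus" and "snd \<in> \<rho> \<rightarrow>\<^sub>M borel"
    using sets by (auto cong: measurable_cong_sets)
  show "marg1 \<rho> \<in> M11_Rplus"
    using assms prob_space.prob_space_distr[OF ps fst]
    by (simp add: M11_def M11_Rplus_def marg1_def space_prob_algebra)
qed

text \<open>Jensen's inequality for the logarithm, from its tangent at the mean. The lower bound
  \<open>a\<close> keeps the mean positive.\<close>

lemma integral_ln_le:
  assumes "prob_space m" and i: "integrable m Y" and lo: "\<And>x. a \<le> Y x" and "0 < (a::real)"
    and il: "integrable m (\<lambda>x. ln (Y x))"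
  shows "(\<integral>x. ln (Y x) \<partial>m) \<le> ln (\<integral>x. Y x \<partial>m)"
proof -
  interpret prob_space m by fact
  define c where "c = (\<integral>x. Y x \<partial>m)"
  have "(\<integral>x. a \<partial>m) \<le> c" unfolding c_def using i lo by (intro integral_mono) auto
  then have c: "0 < c" using \<open>0 < a\<close> by (simp add: prob_space)
  have "ln (Y x) \<le> ln c + (Y x / c - 1)" for x
  proof -
    have "0 < Y x" using lo[of x] \<open>0 < a\<close> by linarith
    then show ?thesis using ln_le_minus_one[of "Y x / c"] c by (simp add: ln_div)
  qed
  then have "(\<integral>x. ln (Y x) \<partial>m) \<le> (\<integral>x. ln c + (Y x / c - 1) \<partial>m)" using i il by (intro integral_mono) auto
  also have "\<dots> = ln c" using i c by (simp add: prob_space c_def[symmetric])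
  finally show ?thesis by (simp add: c_def)
qed

context
  fixes \<mu> :: "'a::topological_space measure"
  assumes \<mu>: "\<mu> \<in> M1 borel"
begin

lemma marg2_kernel_prod:
  assumes \<kappa>: "\<kappa> \<in> borel \<rightarrow>\<^sub>M prob_algebra Rplus" and M11: "kernel_prod \<kappa> \<mu> \<in> M11"
  shows "marg2 (kernel_prod \<kappa> \<mu>) = \<mu>"
proof (rule measure_eqI)
  show "sets (marg2 (kernel_prod \<kappa> \<mu>)) = sets \<mu>" by (simp add: marg2_def sets_M1_borel[OF \<mu>])
  fix B assume "B \<in> sets (marg2 (kernel_prod \<kappa> \<mu>))"
  then have B: "B \<in> sets borel" by (simp add: marg2_def)
  have "snd -` B \<inter> space (kernel_prod \<kappa> \<mu>) = {0..} \<times> B"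
    using sets_eq_imp_space_eq[OF M11D(2)[OF M11]] by (auto simp: space_pair_measure space_restrict_space)
  then have "emeasure (marg2 (kernel_prod \<kappa> \<mu>)) B = emeasure (kernel_prod \<kappa> \<mu>) ({0..} \<times> B)"
    using M11D(5)[OF M11] B by (simp add: marg2_def emeasure_distr)
  also have "\<dots> = (\<integral>\<^sup>+ x. emeasure (\<kappa> x) {0..} * indicator B x \<partial>\<mu>)"
    by (rule emeasure_kernel_prod[OF \<mu> \<kappa> _ B]) (auto simp: sets_restrict_space_iff)
  also have "\<dots> = (\<integral>\<^sup>+ x. indicator B x \<partial>\<mu>)"
  proof (rule nn_integral_cong)
    fix x
    have "\<kappa> x \<in> M1 Rplus" using measurable_space[OF \<kappa>, of x] by simp
    then show "emeasure (\<kappa> x) {0..} * indicator B x = (indicator B x :: ennreal)"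
      using prob_space.emeasure_space_1[OF prob_space_M1_Rplus] space_M1_Rplus by fastforce
  qed
  finally show "emeasure (marg2 (kernel_prod \<kappa> \<mu>)) B = emeasure \<mu> B"
    using B sets_M1_borel[OF \<mu>] by simp
qed

text \<open>The variational formula is applied in each fibre to the section of the test function,
  and Jensen's inequality moves the logarithm out of the integral over \<mu>. This avoids a jointly
  measurable choice of densities of the measures \<open>\<kappa> x\<close>.\<close>

lemma rel_entropy_kernel_prod_le:
  assumes \<kappa>: "\<kappa> \<in> borel \<rightarrow>\<^sub>M prob_algebra Rplus" and M11: "kernel_prod \<kappa> \<mu> \<in> M11" and \<gamma>: "\<gamma> \<in> M1 Rplus"
  shows "rel_entropy (kernel_prod \<kappa> \<mu>) (\<gamma> \<Otimes>\<^sub>M \<mu>) \<le> (\<integral>\<^sup>+x. rel_entropy (\<kappa> x) \<gamma> \<partial>\<mu>)"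
proof (cases "\<integral>\<^sup>+x. rel_entropy (\<kappa> x) \<gamma> \<partial>\<mu>" rule: ennreal_cases)
  case (real s)
  interpret G: prob_space \<gamma> by (rule prob_space_M1_Rplus[OF \<gamma>])
  interpret Mu: prob_space \<mu> by (rule prob_space_M1_borel[OF \<mu>])
  interpret R: prob_space "kernel_prod \<kappa> \<mu>" by (rule M11D(1)[OF M11])
  interpret GM: pair_prob_space \<gamma> \<mu> ..
  have setsGM: "sets (\<gamma> \<Otimes>\<^sub>M \<mu>) = sets (Rplus \<Otimes>\<^sub>M borel)" by (rule sets_pair_M1[OF \<mu> \<gamma>])
  define D where "D x = distr (\<kappa> x) (Rplus \<Otimes>\<^sub>M (borel :: 'a measure)) (\<lambda>w. (w, x))" for x
  have D: "D \<in> borel \<rightarrow>\<^sub>M prob_algebra (Rplus \<Otimes>\<^sub>M borel)"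
    unfolding D_def by (rule measurable_distr_prob_space2[OF \<kappa>]) measurable
  have D': "D \<in> \<mu> \<rightarrow>\<^sub>M subprob_algebra (Rplus \<Otimes>\<^sub>M borel)"
    using measurable_prob_algebraD[OF D] sets_M1_borel[OF \<mu>] by (simp cong: measurable_cong_sets)
  have kp: "kernel_prod \<kappa> \<mu> = \<mu> \<bind> D" by (simp add: kernel_prod_def D_def[abs_def])
  have \<kappa>x: "\<kappa> x \<in> M1 Rplus" for x using measurable_space[OF \<kappa>, of x] by simp
  show ?thesis unfolding real(2)
  proof (rule rel_entropy_le_of_variational)
    fix \<phi> :: "real \<times> 'a \<Rightarrow> real" and C assume "\<phi> \<in> borel_measurable (\<gamma> \<Otimes>\<^sub>M \<mu>)" and C: "\<And>z. \<bar>\<phi> z\<bar> \<le> C"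
    then have \<phi>[measurable]: "\<phi> \<in> borel_measurable (Rplus \<Otimes>\<^sub>M borel)" "\<phi> \<in> borel_measurable (\<gamma> \<Otimes>\<^sub>M \<mu>)"
      using setsGM by (simp_all cong: measurable_cong_sets)
    have m1: "(\<lambda>w. \<phi> (w, x)) \<in> borel_measurable (\<kappa> x)" "(\<lambda>w. \<phi> (w, x)) \<in> borel_measurable \<gamma>" for x
    proof -
      have "(\<lambda>w. \<phi> (w, x)) \<in> borel_measurable Rplus" by measurable
      then show "(\<lambda>w. \<phi> (w, x)) \<in> borel_measurable (\<kappa> x)" "(\<lambda>w. \<phi> (w, x)) \<in> borel_measurable \<gamma>"
        using sets_M1_Rplus[OF \<kappa>x] sets_M1_Rplus[OF \<gamma>] by (simp_all cong: measurable_cong_sets)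
    qed
    have intD: "(\<integral>z. \<phi> z \<partial>D x) = (\<integral>w. \<phi> (w, x) \<partial>\<kappa> x)" for x
      unfolding D_def
      by (rule integral_distr)
         (use sets_M1_Rplus[OF \<kappa>x] in \<open>simp_all cong: measurable_cong_sets\<close>)
    define a where "a x = (\<integral>w. \<phi> (w, x) \<partial>\<kappa> x)" for x
    define Y where "Y x = (\<integral>w. exp (\<phi> (w, x)) \<partial>\<gamma>)" for x
    \<comment> \<open>Integration of \<phi> is a measurable functional on the space of
      subprobabilities; composed with the kernel \<open>D\<close> it is measurable in the
      point.\<close>
    have am: "a \<in> borel_measurable \<mu>"
      unfolding a_def intD[symmetric]
      by (rule measurable_compose[OF D' integral_measurable_subprob_algebra[OF \<phi>(1)]])
    have ab: "\<bar>a x\<bar> \<le> C" for x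
    proof -
      interpret K: prob_space "\<kappa> x" by (rule prob_space_M1_Rplus[OF \<kappa>x])
      have "integrable (\<kappa> x) (\<lambda>w. \<phi> (w, x))" using C m1 by (intro K.integrable_const_bound[where B=C]) auto
      then have "(\<integral>w. \<bar>\<phi> (w, x)\<bar> \<partial>\<kappa> x) \<le> (\<integral>w. C \<partial>\<kappa> x)"
        using C by (intro integral_mono) auto
      moreover have "\<bar>a x\<bar> \<le> (\<integral>w. \<bar>\<phi> (w, x)\<bar> \<partial>\<kappa> x)" unfolding a_def by (rule integral_abs_bound)
      ultimately have "\<bar>a x\<bar> \<le> (\<integral>w. C \<partial>\<kappa> x)" by simp
      then show ?thesis by (simp add: K.prob_space)
    qed
    have Ym: "Y \<in> borel_measurable \<mu>"
    proof -
      have "(\<lambda>(x, w). exp (\<phi> (w, x))) \<in> borel_measurable (\<mu> \<Otimes>\<^sub>M \<gamma>)"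
      proof -
        have "(\<lambda>z. \<phi> (case z of (x, w) \<Rightarrow> (w, x))) \<in> borel_measurable (\<mu> \<Otimes>\<^sub>M \<gamma>)"
          by (rule measurable_compose[OF measurable_pair_swap' \<phi>(2)])
        then have [measurable]: "(\<lambda>z. \<phi> (snd z, fst z)) \<in> borel_measurable (\<mu> \<Otimes>\<^sub>M \<gamma>)"
          by (simp only: split_beta')
        show ?thesis unfolding split_beta' by measurable
      qed
      then show ?thesis unfolding Y_def by (rule G.borel_measurable_lebesgue_integral)
    qed
    have ie: "integrable \<gamma> (\<lambda>w. exp (\<phi> (w, x)))" for x
      using C m1 by (intro G.integrable_const_bound[where B="exp C"]) (auto simp: abs_le_iff)
    have Yb: "exp (- C) \<le> Y x" "Y x \<le> exp C" for x
    proof -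
      have "exp (- C) \<le> exp (\<phi> (w, x))" "exp (\<phi> (w, x)) \<le> exp C" for w using C[of "(w, x)"] by (auto simp: abs_le_iff)
      then have "(\<integral>w. exp (- C) \<partial>\<gamma>) \<le> Y x" "Y x \<le> (\<integral>w. exp C \<partial>\<gamma>)"
        unfolding Y_def by (intro integral_mono ie; simp)+
      then show "exp (- C) \<le> Y x" "Y x \<le> exp C" by (simp_all add: G.prob_space)
    qed
    have iY: "integrable \<mu> Y"
    proof (rule Mu.integrable_const_bound[where B="exp C"])
      have "0 \<le> Y x" for x by (rule order_trans[OF _ Yb(1)]) simp
      then show "AE x in \<mu>. norm (Y x) \<le> exp C" using Yb(2) by simp
    qed (rule Ym)
    have lnYb: "\<bar>ln (Y x)\<bar> \<le> C" for x
    proof -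
      have "0 < Y x" using Yb(1)[of x] exp_gt_zero by (rule less_le_trans[rotated])
      then have "ln (exp (- C)) \<le> ln (Y x)" "ln (Y x) \<le> ln (exp C)" using Yb[of x] by (auto simp del: ln_exp)
      then show ?thesis by simp
    qed
    have ilnY: "integrable \<mu> (\<lambda>x. ln (Y x))"
      using lnYb Ym by (intro Mu.integrable_const_bound[where B=C]) auto
    have ia: "integrable \<mu> a" using ab am by (intro Mu.integrable_const_bound[where B=C]) auto
    have "ennreal (a x - ln (Y x)) \<le> rel_entropy (\<kappa> x) \<gamma>" for x
    proof (cases "rel_entropy (\<kappa> x) \<gamma>" rule: ennreal_cases)
      case (real r)
      have "a x \<le> r + ln (Y x)" unfolding a_def Y_def
        using real C m1 prob_space_M1_Rplus[OF \<kappa>x] sets_M1_Rplus[OF \<kappa>x] sets_M1_Rplus[OF \<gamma>]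
        by (intro rel_entropy_variational[OF G.prob_space_axioms]) auto
      then show ?thesis using real by (simp add: ennreal_leI)
    qed simp
    then have "(\<integral>\<^sup>+x. ennreal (a x - ln (Y x)) \<partial>\<mu>) \<le> ennreal s"
      unfolding real(2)[symmetric] by (intro nn_integral_mono)
    \<comment> \<open>The integrand is signed, while the fibre bound controls its positive part;
      dropping the negative part only enlarges the integral.\<close>
    moreover have "(\<integral>x. a x - ln (Y x) \<partial>\<mu>) \<le> enn2real (\<integral>\<^sup>+x. ennreal (a x - ln (Y x)) \<partial>\<mu>)"
      using ia ilnY by (subst real_lebesgue_integral_def) auto
    ultimately have "(\<integral>x. a x - ln (Y x) \<partial>\<mu>) \<le> s"
      using real(1) by (meson enn2real_leI order_trans)
    then have "(\<integral>x. a x \<partial>\<mu>) \<le> s + (\<integral>x. ln (Y x) \<partial>\<mu>)" using ia ilnY by simp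
    also have "\<dots> \<le> s + ln (\<integral>x. Y x \<partial>\<mu>)"
      using integral_ln_le[OF Mu.prob_space_axioms iY Yb(1) _ ilnY] by simp
    also have "(\<integral>x. Y x \<partial>\<mu>) = (\<integral>z. exp (\<phi> z) \<partial>(\<gamma> \<Otimes>\<^sub>M \<mu>))"
      unfolding Y_def
      using C by (subst GM.integral_snd[where f="\<lambda>w x. exp (\<phi> (w, x))"])
        (auto simp: split_beta' abs_le_iff intro!: GM.integrable_const_bound[where B="exp C"])
    also have "(\<integral>x. a x \<partial>\<mu>) = (\<integral>z. \<phi> z \<partial>kernel_prod \<kappa> \<mu>)"
      unfolding kp a_def intD[symmetric] using C
      by (intro integral_bind[symmetric, where B=C and B'=1 and K="Rplus \<Otimes>\<^sub>M borel"])
         (auto simp: D' Mu.finite_measure_axioms intro!: subprob_space.emeasure_space_le_1 subprob_space_kernel[OF D'])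
    finally show "(\<integral>z. \<phi> z \<partial>kernel_prod \<kappa> \<mu>) \<le> s + ln (\<integral>z. exp (\<phi> z) \<partial>(\<gamma> \<Otimes>\<^sub>M \<mu>))" .
  qed (use real M11D[OF M11] setsGM GM.prob_space_axioms in auto)
qed simp

text \<open>Finite entropy gives a density \<open>f\<close> of the pair law, and its sections
  \<open>f (_, x)\<close> are an explicit disintegration. Integrating the fibre entropies is then
  Fubini's theorem for \<open>f * ln f\<close>.\<close>

lemma kernel_of_pair_law:
  assumes \<rho>: "\<rho> \<in> M11" "marg2 \<rho> = \<mu>" and fin: "rel_entropy \<rho> (marg1 \<rho> \<Otimes>\<^sub>M \<mu>) < \<infinity>"
  obtains \<kappa> where "\<kappa> \<in> borel \<rightarrow>\<^sub>M prob_algebra Rplus" "kernel_prod \<kappa> \<mu> = \<rho>"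
    "(\<integral>\<^sup>+x. rel_entropy (\<kappa> x) (marg1 \<rho>) \<partial>\<mu>) \<le> rel_entropy \<rho> (marg1 \<rho> \<Otimes>\<^sub>M \<mu>)"
proof -
  define \<gamma> where "\<gamma> = marg1 \<rho>"
  have \<gamma>: "\<gamma> \<in> M1 Rplus" unfolding \<gamma>_def by (intro M11_Rplus_subset M11D \<rho>)
  interpret G: prob_space \<gamma> by (rule prob_space_M1_Rplus[OF \<gamma>])
  interpret Mu: prob_space \<mu> by (rule prob_space_M1_borel[OF \<mu>])
  interpret R: prob_space \<rho> by (rule M11D(1)[OF \<rho>(1)])
  interpret GM: pair_prob_space \<gamma> \<mu> ..
  have setsGM: "sets (\<gamma> \<Otimes>\<^sub>M \<mu>) = sets (Rplus \<Otimes>\<^sub>M borel)" by (rule sets_pair_M1[OF \<mu> \<gamma>])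
  have seq: "sets \<rho> = sets (\<gamma> \<Otimes>\<^sub>M \<mu>)" using M11D(2)[OF \<rho>(1)] setsGM by simp
  have fin': "rel_entropy \<rho> (\<gamma> \<Otimes>\<^sub>M \<mu>) < \<infinity>" using fin by (simp only: \<gamma>_def)
  obtain f :: "real \<times> 'a \<Rightarrow> real" where f[measurable]: "f \<in> borel_measurable (\<gamma> \<Otimes>\<^sub>M \<mu>)" and nn: "\<And>z. 0 \<le> f z"
    and \<rho>f: "\<rho> = density (\<gamma> \<Otimes>\<^sub>M \<mu>) (\<lambda>z. ennreal (f z))"
    and ii: "integrable (\<gamma> \<Otimes>\<^sub>M \<mu>) (\<lambda>z. f z * ln (f z))"
    and H: "rel_entropy \<rho> (\<gamma> \<Otimes>\<^sub>M \<mu>) = ennreal (\<integral>z. f z * ln (f z) \<partial>(\<gamma> \<Otimes>\<^sub>M \<mu>))"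
    using rel_entropy_finiteE[OF GM.prob_space_axioms R.prob_space_axioms seq fin'] by blast
  have f': "f \<in> borel_measurable (Rplus \<Otimes>\<^sub>M borel)" using f setsGM by (simp cong: measurable_cong_sets)
  have fx[measurable]: "(\<lambda>w. f (w, x)) \<in> borel_measurable \<gamma>" for x
  proof -
    have "(\<lambda>w. f (w, x)) \<in> borel_measurable Rplus" using f' by measurable
    then show ?thesis using sets_M1_Rplus[OF \<gamma>] by (simp cong: measurable_cong_sets)
  qed
  define h where "h x = (\<integral>\<^sup>+w. ennreal (f (w, x)) \<partial>\<gamma>)" for x
  have sw: "(\<lambda>(x, w). ennreal (f (w, x)) * indicator A w) \<in> borel_measurable (\<mu> \<Otimes>\<^sub>M \<gamma>)" if "A \<in> sets \<gamma>" for A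
  proof -
    have [measurable]: "A \<in> sets \<gamma>" by fact
    have "(\<lambda>z. f (case z of (x, w) \<Rightarrow> (w, x))) \<in> borel_measurable (\<mu> \<Otimes>\<^sub>M \<gamma>)"
      by (rule measurable_compose[OF measurable_pair_swap' f])
    then have [measurable]: "(\<lambda>z. f (snd z, fst z)) \<in> borel_measurable (\<mu> \<Otimes>\<^sub>M \<gamma>)"
      by (simp only: split_beta')
    show ?thesis unfolding split_beta' by measurable
  qed
  have hA[measurable]: "(\<lambda>x. \<integral>\<^sup>+w. ennreal (f (w, x)) * indicator A w \<partial>\<gamma>) \<in> borel_measurable \<mu>" if "A \<in> sets \<gamma>" for A
    by (rule G.borel_measurable_nn_integral[OF sw[OF that]])
  have hm[measurable]: "h \<in> borel_measurable \<mu>"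
    using hA[OF sets.top] unfolding h_def by (rule measurable_cong[THEN iffD1, rotated]) (auto intro!: nn_integral_cong)
  have rect: "emeasure \<rho> (A \<times> B) = (\<integral>\<^sup>+x. (\<integral>\<^sup>+w. ennreal (f (w, x)) * indicator A w \<partial>\<gamma>) * indicator B x \<partial>\<mu>)"
    if A: "A \<in> sets \<gamma>" and B: "B \<in> sets \<mu>" for A B
  proof -
    have "emeasure \<rho> (A \<times> B) = (\<integral>\<^sup>+z. ennreal (f z) * indicator (A \<times> B) z \<partial>(\<gamma> \<Otimes>\<^sub>M \<mu>))"
      unfolding \<rho>f using A B by (subst emeasure_density) auto
    also have "\<dots> = (\<integral>\<^sup>+x. (\<integral>\<^sup>+w. ennreal (f (w, x)) * indicator (A \<times> B) (w, x) \<partial>\<gamma>) \<partial>\<mu>)"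
      using A B by (intro GM.nn_integral_snd[symmetric, where f="\<lambda>z. ennreal (f z) * indicator (A \<times> B) z"]) auto
    also have "\<dots> = (\<integral>\<^sup>+x. (\<integral>\<^sup>+w. ennreal (f (w, x)) * indicator A w \<partial>\<gamma>) * indicator B x \<partial>\<mu>)"
      by (intro nn_integral_cong) (auto simp: indicator_def)
    finally show ?thesis .
  qed
  have AEh: "AE x in \<mu>. h x = 1"
  proof (rule Mu.density_unique)
    have "density \<mu> h = distr \<rho> \<mu> snd"
      unfolding \<rho>f h_def[abs_def] by (rule GM.distr_snd_density[symmetric]) measurable
    also have "\<dots> = marg2 \<rho>" using sets_M1_borel[OF \<mu>] by (simp add: marg2_def cong: distr_cong)
    finally show "density \<mu> h = density \<mu> (\<lambda>_. 1)" by (simp add: \<rho>(2) density_1)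
  qed auto
  \<comment> \<open>Sections have mass 1 only almost everywhere; the default \<gamma> elsewhere
    makes every \<open>\<kappa> x\<close> a probability measure.\<close>
  define \<kappa> where "\<kappa> x = (if h x = 1 then density \<gamma> (\<lambda>w. ennreal (f (w, x))) else \<gamma>)" for x
  have \<kappa>p: "prob_space (\<kappa> x)" for x
  proof (cases "h x = 1")
    case True
    then have "emeasure (\<kappa> x) (space (\<kappa> x)) = 1"
      by (simp add: \<kappa>_def emeasure_density h_def cong: nn_integral_cong)
    then show ?thesis by (rule prob_spaceI)
  qed (simp add: \<kappa>_def G.prob_space_axioms)
  have \<kappa>e: "emeasure (\<kappa> x) A = (if h x = 1 then (\<integral>\<^sup>+w. ennreal (f (w, x)) * indicator A w \<partial>\<gamma>) else emeasure \<gamma> A)"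
    if "A \<in> sets \<gamma>" for x A using that by (simp add: \<kappa>_def emeasure_density)
  have \<kappa>: "\<kappa> \<in> borel \<rightarrow>\<^sub>M prob_algebra Rplus"
  proof (rule measurable_prob_algebraI[OF \<kappa>p measurable_subprob_algebra])
    show "subprob_space (\<kappa> x)" for x using \<kappa>p by (rule prob_space_imp_subprob_space)
    show "sets (\<kappa> x) = sets Rplus" for x using sets_M1_Rplus[OF \<gamma>] by (simp add: \<kappa>_def)
    fix A assume "A \<in> sets Rplus"
    then have A: "A \<in> sets \<gamma>" using sets_M1_Rplus[OF \<gamma>] by simp
    have "(\<lambda>x. emeasure (\<kappa> x) A) \<in> borel_measurable \<mu>" unfolding \<kappa>e[OF A] using hA[OF A] by measurable
    then show "(\<lambda>x. emeasure (\<kappa> x) A) \<in> borel_measurable borel"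
      using sets_M1_borel[OF \<mu>] by (simp cong: measurable_cong_sets)
  qed
  have kp: "kernel_prod \<kappa> \<mu> = \<rho>"
  proof (rule measure_eqI_generator_eq)
    let ?E = "{A \<times> B | A B. A \<in> sets Rplus \<and> B \<in> sets (borel :: 'a measure)}"
    let ?\<Omega> = "space Rplus \<times> space (borel :: 'a measure)"
    show "Int_stable ?E" by (rule Int_stable_pair_measure_generator)
    show "?E \<subseteq> Pow ?\<Omega>" by (rule pair_measure_closed)
    have D: "(\<lambda>x. distr (\<kappa> x) (Rplus \<Otimes>\<^sub>M (borel :: 'a measure)) (\<lambda>w. (w, x))) \<in> borel \<rightarrow>\<^sub>M prob_algebra (Rplus \<Otimes>\<^sub>M borel)"
      by (rule measurable_distr_prob_space2[OF \<kappa>]) measurable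
    have "sets (kernel_prod \<kappa> \<mu>) = sets (Rplus \<Otimes>\<^sub>M borel)"
      unfolding kernel_prod_def using Mu.not_empty by (intro sets_bind) auto
    then show "sets (kernel_prod \<kappa> \<mu>) = sigma_sets ?\<Omega> ?E" by (simp add: sets_pair_measure)
    show "sets \<rho> = sigma_sets ?\<Omega> ?E" using M11D(2)[OF \<rho>(1)] by (simp add: sets_pair_measure)
    fix X assume "X \<in> ?E"
    then obtain A B where X: "X = A \<times> B" "A \<in> sets Rplus" "B \<in> sets borel" by auto
    then have A: "A \<in> sets \<gamma>" and B: "B \<in> sets \<mu>" using sets_M1_Rplus[OF \<gamma>] sets_M1_borel[OF \<mu>] by auto
    have "emeasure (kernel_prod \<kappa> \<mu>) (A \<times> B) = (\<integral>\<^sup>+ x. emeasure (\<kappa> x) A * indicator B x \<partial>\<mu>)"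
      by (rule emeasure_kernel_prod[OF \<mu> \<kappa> X(2,3)])
    also have "\<dots> = emeasure \<rho> (A \<times> B)"
      unfolding rect[OF A B] \<kappa>e[OF A] using AEh by (intro nn_integral_cong_AE) auto
    finally show "emeasure (kernel_prod \<kappa> \<mu>) X = emeasure \<rho> X" by (simp add: X)
  next
    show "range (\<lambda>_::nat. space Rplus \<times> space (borel :: 'a measure)) \<subseteq> {A \<times> B | A B. A \<in> sets Rplus \<and> B \<in> sets (borel :: 'a measure)}"
      by blast
    have "emeasure (kernel_prod \<kappa> \<mu>) (space Rplus \<times> space borel) = (\<integral>\<^sup>+ x. emeasure (\<kappa> x) (space Rplus) * indicator (space borel) x \<partial>\<mu>)"
      by (rule emeasure_kernel_prod[OF \<mu> \<kappa> sets.top sets.top])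
    also have "\<dots> \<le> (\<integral>\<^sup>+ x. 1 \<partial>\<mu>)"
      using prob_space.measure_le_1[OF \<kappa>p] by (intro nn_integral_mono) (auto simp: prob_space.emeasure_le_1[OF \<kappa>p] indicator_def)
    finally show "emeasure (kernel_prod \<kappa> \<mu>) (space Rplus \<times> space (borel :: 'a measure)) \<noteq> \<infinity>"
      by (simp add: Mu.emeasure_space_1 order_le_less_trans top.not_eq_extremum)
  qed auto
  have AEi: "AE x in \<mu>. integrable \<gamma> (\<lambda>w. f (w, x) * ln (f (w, x)))"
    using GM.AE_integrable_snd[of "\<lambda>w x. f (w, x) * ln (f (w, x))"] ii by (simp add: split_beta')
  have "(\<integral>\<^sup>+x. rel_entropy (\<kappa> x) \<gamma> \<partial>\<mu>) = (\<integral>\<^sup>+x. ennreal (\<integral>w. f (w, x) * ln (f (w, x)) \<partial>\<gamma>) \<partial>\<mu>)"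
  proof (rule nn_integral_cong_AE)
    show "AE x in \<mu>. rel_entropy (\<kappa> x) \<gamma> = ennreal (\<integral>w. f (w, x) * ln (f (w, x)) \<partial>\<gamma>)"
      using AEh AEi
    proof eventually_elim
      case (elim x)
      then show ?case
        using rel_entropy_density[OF G.prob_space_axioms fx[of x] nn] by (simp add: \<kappa>_def)
    qed
  qed
  also have "\<dots> = ennreal (\<integral>x. (\<integral>w. f (w, x) * ln (f (w, x)) \<partial>\<gamma>) \<partial>\<mu>)"
  proof (rule nn_integral_eq_integral)
    show "integrable \<mu> (\<lambda>x. \<integral>w. f (w, x) * ln (f (w, x)) \<partial>\<gamma>)"
      using GM.integrable_snd[of "\<lambda>w x. f (w, x) * ln (f (w, x))"] ii by (simp add: split_beta')
    \<comment> \<open>Almost every fibre entropy is nonnegative, so that the coercion to the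
      extended nonnegative reals commutes with the outer integral.\<close>
    show "AE x in \<mu>. 0 \<le> (\<integral>w. f (w, x) * ln (f (w, x)) \<partial>\<gamma>)"
      using AEh AEi
    proof eventually_elim
      case (elim x)
      have i1: "integrable \<gamma> (\<lambda>w. f (w, x))"
        using elim(1) nn by (intro integrableI_nonneg) (auto simp: h_def)
      have "ennreal (\<integral>w. f (w, x) \<partial>\<gamma>) = 1"
        using elim(1) nn nn_integral_eq_integral[OF i1] by (simp add: h_def)
      then have one: "(\<integral>w. f (w, x) \<partial>\<gamma>) = 1" by simp
      have "f (w, x) - 1 \<le> f (w, x) * ln (f (w, x))" for w by (rule diff_one_le_mult_ln[OF nn])
      then have "(\<integral>w. f (w, x) - 1 \<partial>\<gamma>) \<le> (\<integral>w. f (w, x) * ln (f (w, x)) \<partial>\<gamma>)"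
        using i1 elim(2) by (intro integral_mono) auto
      then show ?case using i1 one by (simp add: G.prob_space)
    qed
  qed
  also have "(\<integral>x. (\<integral>w. f (w, x) * ln (f (w, x)) \<partial>\<gamma>) \<partial>\<mu>) = (\<integral>z. f z * ln (f z) \<partial>(\<gamma> \<Otimes>\<^sub>M \<mu>))"
    using GM.integral_snd[of "\<lambda>w x. f (w, x) * ln (f (w, x))"] ii by (simp add: split_beta')
  finally show thesis using that[OF \<kappa> kp] H by (simp add: \<gamma>_def)
qed

text \<open>Pair laws with infinite entropy or a wrong second marginal cost \<infinity> and satisfy
  the inequality trivially; all others come from a kernel that costs no more.\<close>

theorem K_rate_eq_kernel: "K_rate I \<mu> \<nu> = K_rate_kernel I \<mu> \<nu>"
proof (rule antisym)
  show "K_rate I \<mu> \<nu> \<le> K_rate_kernel I \<mu> \<nu>"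
    unfolding K_rate_kernel_def
  proof (rule INF_greatest)
    fix \<kappa> assume "\<kappa> \<in> {\<kappa> \<in> borel \<rightarrow>\<^sub>M prob_algebra Rplus. kernel_prod \<kappa> \<mu> \<in> M11 \<and> F_map (kernel_prod \<kappa> \<mu>) = \<nu>}"
    then have \<kappa>: "\<kappa> \<in> borel \<rightarrow>\<^sub>M prob_algebra Rplus" "kernel_prod \<kappa> \<mu> \<in> M11" "F_map (kernel_prod \<kappa> \<mu>) = \<nu>"
      by auto
    have "K_rate I \<mu> \<nu> \<le> J_rate I \<mu> (kernel_prod \<kappa> \<mu>)"
      unfolding K_rate_def using \<kappa> by (intro INF_lower) auto
    also have "\<dots> = rel_entropy (kernel_prod \<kappa> \<mu>) (marg1 (kernel_prod \<kappa> \<mu>) \<Otimes>\<^sub>M \<mu>) + I (marg1 (kernel_prod \<kappa> \<mu>))"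
      using marg2_kernel_prod[OF \<kappa>(1,2)] by (simp add: J_rate_def)
    also have "\<dots> \<le> (\<integral>\<^sup>+ x. rel_entropy (\<kappa> x) (marg1 (kernel_prod \<kappa> \<mu>)) \<partial>\<mu>) + I (marg1 (kernel_prod \<kappa> \<mu>))"
      by (intro add_right_mono rel_entropy_kernel_prod_le \<kappa> M11_Rplus_subset M11D)
    finally show "K_rate I \<mu> \<nu> \<le> (\<integral>\<^sup>+ x. rel_entropy (\<kappa> x) (marg1 (kernel_prod \<kappa> \<mu>)) \<partial>\<mu>) + I (marg1 (kernel_prod \<kappa> \<mu>))" .
  qed
  show "K_rate_kernel I \<mu> \<nu> \<le> K_rate I \<mu> \<nu>"
    unfolding K_rate_def
  proof (rule INF_greatest)
    fix \<rho> :: "(real \<times> 'a) measure" assume "\<rho> \<in> {\<rho> \<in> M11. F_map \<rho> = \<nu>}"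
    then have \<rho>: "\<rho> \<in> M11" "F_map \<rho> = \<nu>" by auto
    show "K_rate_kernel I \<mu> \<nu> \<le> J_rate I \<mu> \<rho>"
    proof (cases "marg2 \<rho> = \<mu> \<and> rel_entropy \<rho> (marg1 \<rho> \<Otimes>\<^sub>M \<mu>) < \<infinity>")
      case True
      then obtain \<kappa> where \<kappa>: "\<kappa> \<in> borel \<rightarrow>\<^sub>M prob_algebra Rplus" "kernel_prod \<kappa> \<mu> = \<rho>"
        "(\<integral>\<^sup>+x. rel_entropy (\<kappa> x) (marg1 \<rho>) \<partial>\<mu>) \<le> rel_entropy \<rho> (marg1 \<rho> \<Otimes>\<^sub>M \<mu>)"
        using kernel_of_pair_law[OF \<rho>(1)] by metis
      have "K_rate_kernel I \<mu> \<nu> \<le> (\<integral>\<^sup>+ x. rel_entropy (\<kappa> x) (marg1 (kernel_prod \<kappa> \<mu>)) \<partial>\<mu>) + I (marg1 (kernel_prod \<kappa> \<mu>))"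
        unfolding K_rate_kernel_def using \<kappa> \<rho> by (intro INF_lower) auto
      also have "\<dots> \<le> J_rate I \<mu> \<rho>" using \<kappa>(2,3) True by (simp add: J_rate_def add_right_mono)
      finally show ?thesis .
    qed (auto simp: J_rate_def less_top[symmetric])
  qed
qed

end

section \<open>Counting permutations with a given contingency table\<close>

text \<open>The contingency table of a matching \<sigma>: \<open>l\<close> labels the points,
  \<open>l'\<close> labels the positions they are sent to.\<close>

definition table_of :: "('j \<Rightarrow> 'a) \<Rightarrow> ('i \<Rightarrow> 'b) \<Rightarrow> 'j set \<Rightarrow> ('j \<Rightarrow> 'i) \<Rightarrow> 'a \<times> 'b \<Rightarrow> nat" where
  "table_of l l' J \<sigma> z = card {j\<in>J. l j = fst z \<and> l' (\<sigma> j) = snd z}"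

definition class_size :: "('j \<Rightarrow> 'a) \<Rightarrow> 'j set \<Rightarrow> 'a \<Rightarrow> nat" where
  "class_size l J a = card {j\<in>J. l j = a}"

text \<open>Two index sets, so that an induction can remove a point from one and its image from the
  other; extensional functions make the set finite.\<close>

definition table_bijections ::
  "('j \<Rightarrow> 'a) \<Rightarrow> ('i \<Rightarrow> 'b) \<Rightarrow> 'j set \<Rightarrow> 'i set \<Rightarrow> ('a \<times> 'b) set \<Rightarrow> ('a \<times> 'b \<Rightarrow> nat) \<Rightarrow> ('j \<Rightarrow> 'i) set" where
  "table_bijections l l' J J' Z N =
     {\<sigma> \<in> J \<rightarrow>\<^sub>E J'. bij_betw \<sigma> J J' \<and> (\<forall>z\<in>Z. table_of l l' J \<sigma> z = N z)}"

lemma table_of_insert: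
  assumes "finite J" "j \<notin> J"
  shows "table_of l l' (insert j J) \<sigma> z = table_of l l' J \<sigma> z + (if z = (l j, l' (\<sigma> j)) then 1 else 0)"
proof -
  have "{k\<in>insert j J. l k = fst z \<and> l' (\<sigma> k) = snd z} = (if z = (l j, l' (\<sigma> j))
    then insert j {k\<in>J. l k = fst z \<and> l' (\<sigma> k) = snd z} else {k\<in>J. l k = fst z \<and> l' (\<sigma> k) = snd z})"
    by (auto simp: prod_eq_iff)
  then show ?thesis using assms by (simp add: table_of_def)
qed

lemma table_of_cong: "(\<And>j. j \<in> J \<Longrightarrow> \<sigma> j = \<sigma>' j) \<Longrightarrow> table_of l l' J \<sigma> = table_of l l' J \<sigma>'"
  unfolding table_of_def by (intro ext arg_cong[where f=card]) auto

lemma class_size_insert: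
  assumes "finite J" "j \<notin> J"
  shows "class_size l (insert j J) a = class_size l J a + (if a = l j then 1 else 0)"
proof -
  have "{k\<in>insert j J. l k = a} = (if a = l j then insert j {k\<in>J. l k = a} else {k\<in>J. l k = a})" by auto
  then show ?thesis using assms by (simp add: class_size_def)
qed

lemma finite_table_bijections: "finite J \<Longrightarrow> finite J' \<Longrightarrow> finite (table_bijections l l' J J' Z N)"
  unfolding table_bijections_def by (rule finite_subset[of _ "J \<rightarrow>\<^sub>E J'"]) (auto intro: finite_PiE)

lemma card_table_bijections_insert:
  assumes fin: "finite J" "j \<notin> J" "finite J'"
  shows "card (table_bijections l l' (insert j J) J' Z N) =
    (\<Sum>i\<in>J'. card {\<sigma> \<in> table_bijections l l' (insert j J) J' Z N. \<sigma> j = i})"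
proof -
  have "table_bijections l l' (insert j J) J' Z N = (\<Union>i\<in>J'. {\<sigma> \<in> table_bijections l l' (insert j J) J' Z N. \<sigma> j = i})"
    by (auto simp: table_bijections_def)
  then show ?thesis
    using fin finite_table_bijections[of "insert j J" J' l l' Z N]
    by (subst card_UN_disjoint[symmetric]) (auto intro: finite_subset)
qed

text \<open>Deleting \<open>j\<close> together with its image \<open>i\<close> lowers exactly one
  entry of the table by one, and can be undone.\<close>

lemma card_table_bijections_fixed:
  assumes fin: "finite J" "j \<notin> J" "finite J'" "i \<in> J'" and z: "(l j, l' i) \<in> Z" "0 < N (l j, l' i)"
  shows "card {\<sigma> \<in> table_bijections l l' (insert j J) J' Z N. \<sigma> j = i} =
    card (table_bijections l l' J (J' - {i}) Z (N((l j, l' i) := N (l j, l' i) - 1)))"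
proof (rule bij_betw_same_card[of "\<lambda>\<sigma>. restrict \<sigma> J"])
  let ?z = "(l j, l' i)"
  show "bij_betw (\<lambda>\<sigma>. restrict \<sigma> J) {\<sigma> \<in> table_bijections l l' (insert j J) J' Z N. \<sigma> j = i}
     (table_bijections l l' J (J' - {i}) Z (N(?z := N ?z - 1)))"
  proof (rule bij_betw_byWitness[where f'="\<lambda>\<tau>. \<tau>(j := i)"])
    show "\<forall>\<sigma>\<in>{\<sigma> \<in> table_bijections l l' (insert j J) J' Z N. \<sigma> j = i}. (restrict \<sigma> J)(j := i) = \<sigma>"
      by (auto simp: table_bijections_def fun_eq_iff PiE_iff extensional_def)
    show "\<forall>\<tau>\<in>table_bijections l l' J (J' - {i}) Z (N(?z := N ?z - 1)). restrict (\<tau>(j := i)) J = \<tau>"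
      using fin(2) by (auto simp: table_bijections_def fun_eq_iff PiE_iff extensional_def)
    show "(\<lambda>\<sigma>. restrict \<sigma> J) ` {\<sigma> \<in> table_bijections l l' (insert j J) J' Z N. \<sigma> j = i}
      \<subseteq> table_bijections l l' J (J' - {i}) Z (N(?z := N ?z - 1))"
    proof clarify
      fix \<sigma> assume \<sigma>: "\<sigma> \<in> table_bijections l l' (insert j J) J' Z N" "i = \<sigma> j"
      then have b: "bij_betw \<sigma> (insert j J) J'" and t: "\<And>z. z \<in> Z \<Longrightarrow> table_of l l' (insert j J) \<sigma> z = N z"
        by (auto simp: table_bijections_def)
      have "bij_betw \<sigma> J (J' - {\<sigma> j})"
        using b fin(2) by (auto simp: bij_betw_def inj_on_def)
      then have b': "bij_betw (restrict \<sigma> J) J (J' - {i})" using \<sigma>(2) by simp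
      have "table_of l l' J (restrict \<sigma> J) z = (N(?z := N ?z - 1)) z" if "z \<in> Z" for z
      proof -
        have "table_of l l' J (restrict \<sigma> J) z = table_of l l' J \<sigma> z" by (rule fun_cong[OF table_of_cong]) simp
        then show ?thesis using t[OF that] table_of_insert[OF fin(1,2), of l l' \<sigma> z] \<sigma>(2) by auto
      qed
      then show "restrict \<sigma> J \<in> table_bijections l l' J (J' - {\<sigma> j}) Z (N((l j, l' (\<sigma> j)) := N (l j, l' (\<sigma> j)) - 1))"
        using b' \<sigma>(2) by (auto simp: table_bijections_def bij_betw_def)
    qed
    show "(\<lambda>\<tau>. \<tau>(j := i)) ` table_bijections l l' J (J' - {i}) Z (N(?z := N ?z - 1))
      \<subseteq> {\<sigma> \<in> table_bijections l l' (insert j J) J' Z N. \<sigma> j = i}"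
    proof clarify
      fix \<tau> assume \<tau>: "\<tau> \<in> table_bijections l l' J (J' - {i}) Z (N(?z := N ?z - 1))"
      then have b: "bij_betw \<tau> J (J' - {i})" and t: "\<And>z. z \<in> Z \<Longrightarrow> table_of l l' J \<tau> z = (N(?z := N ?z - 1)) z"
        and P: "\<tau> \<in> J \<rightarrow>\<^sub>E (J' - {i})"
        by (auto simp: table_bijections_def)
      have "bij_betw (\<tau>(j := i)) (insert j J) J'"
        using b fin(2,4) by (auto simp: bij_betw_def inj_on_def image_iff)
      moreover have "table_of l l' (insert j J) (\<tau>(j := i)) z = N z" if "z \<in> Z" for z
      proof -
        have "table_of l l' J (\<tau>(j := i)) z = table_of l l' J \<tau> z"
          using fin(2) by (intro fun_cong[OF table_of_cong]) auto
        then show ?thesis using t[OF that] table_of_insert[OF fin(1,2), of l l' "\<tau>(j := i)" z] z(2) by auto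
      qed
      moreover have "\<tau>(j := i) \<in> insert j J \<rightarrow>\<^sub>E J'" using P fin(4) by (auto simp: PiE_iff extensional_def)
      ultimately show "\<tau>(j := i) \<in> table_bijections l l' (insert j J) J' Z N \<and> (\<tau>(j := i)) j = i"
        by (auto simp: table_bijections_def)
    qed
  qed
qed

lemma table_bijections_fixed_empty:
  assumes "finite J" "j \<notin> J" "(l j, l' i) \<in> Z" "N (l j, l' i) = 0"
  shows "{\<sigma> \<in> table_bijections l l' (insert j J) J' Z N. \<sigma> j = i} = {}"
proof -
  have False if "\<sigma> \<in> table_bijections l l' (insert j J) J' Z N" "\<sigma> j = i" for \<sigma>
  proof -
    have "table_of l l' (insert j J) \<sigma> (l j, l' i) = 0" using that assms by (auto simp: table_bijections_def)
    then show False using table_of_insert[OF assms(1,2), of l l' \<sigma> "(l j, l' i)"] that(2) by simp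
  qed
  then show ?thesis by blast
qed

lemma prod_fact_update:
  assumes "finite Z" "z \<in> Z" "0 < N z"
  shows "(\<Prod>y\<in>Z. fact (N y) :: real) = real (N z) * (\<Prod>y\<in>Z. fact ((N(z := N z - 1)) y))"
proof -
  have "(\<Prod>y\<in>Z. fact ((N(z := N z - 1)) y) :: real) = fact (N z - 1) * (\<Prod>y\<in>Z - {z}. fact (N y))"
    using assms by (subst prod.remove[of Z z]) (auto intro!: prod.cong)
  moreover have "(\<Prod>y\<in>Z. fact (N y) :: real) = fact (N z) * (\<Prod>y\<in>Z - {z}. fact (N y))"
    using assms by (subst prod.remove[of Z z]) auto
  moreover have "(fact (N z) :: real) = real (N z) * fact (N z - 1)"
    using assms(3) by (rule fact_reduce)
  ultimately show ?thesis by simp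
qed

text \<open>The multinomial count, written without division. The induction removes one point
  \<open>j\<close> together with its image \<open>i\<close>: each factorial that changes loses its
  leading factor, namely the row size, the column size and the entry of the cell.\<close>

theorem card_table_bijections:
  fixes l :: "'j \<Rightarrow> 'a" and l' :: "'i \<Rightarrow> 'b"
  assumes "finite J" "finite J'" "finite A" "finite B" "l ` J \<subseteq> A" "l' ` J' \<subseteq> B"
    and "\<And>a. a \<in> A \<Longrightarrow> (\<Sum>b\<in>B. N (a, b)) = class_size l J a"
    and "\<And>b. b \<in> B \<Longrightarrow> (\<Sum>a\<in>A. N (a, b)) = class_size l' J' b"
  shows "real (card (table_bijections l l' J J' (A \<times> B) N)) * (\<Prod>z\<in>A \<times> B. fact (N z)) =
    (\<Prod>a\<in>A. fact (class_size l J a)) * (\<Prod>b\<in>B. fact (class_size l' J' b))"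
  using assms
proof (induction J arbitrary: J' N rule: finite_induct)
  case empty
  have zero: "class_size l' J' b = 0" if "b \<in> B" for b
  proof -
    have "N (a, b) = 0" if "a \<in> A" for a
      using empty.prems(6)[OF that] \<open>b \<in> B\<close> empty.prems(3) by (simp add: class_size_def)
    then show ?thesis using empty.prems(7)[OF that] by simp
  qed
  have "J' = {}"
  proof (rule ccontr)
    assume "J' \<noteq> {}"
    then obtain i where i: "i \<in> J'" by auto
    then have "l' i \<in> B" using empty.prems by auto
    from zero[OF this] i show False using empty.prems(1) by (auto simp: class_size_def)
  qed
  moreover have N0: "N z = 0" if "z \<in> A \<times> B" for z
    using empty.prems(6) empty.prems(3) that by (auto simp: class_size_def)
  ultimately have "table_bijections l l' {} J' (A \<times> B) N = {\<lambda>_. undefined}"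
    by (auto simp: table_bijections_def table_of_def bij_betw_def)
  then show ?case using zero N0 by (simp add: class_size_def)
next
  case (insert j J)
  let ?S = "table_bijections l l' (insert j J) J' (A \<times> B) N"
  let ?c = "class_size l' J'" and ?r = "class_size l (insert j J)"
  let ?FN = "\<Prod>z\<in>A \<times> B. fact (N z) :: real"
  let ?P = "(\<Prod>a\<in>A. fact (?r a)) * (\<Prod>b\<in>B. fact (?c b)) :: real"
  have finZ: "finite (A \<times> B)" using insert.prems by auto
  have lj: "l j \<in> A" using insert.prems by auto
  have rj: "?r (l j) = Suc (class_size l J (l j))" using insert.hyps by (simp add: class_size_insert)
  \<comment> \<open>Multiplying by the row and column sizes avoids quotients of factorials; for an
    empty cell both sides are 0.\<close>
  have main: "real (card {\<sigma> \<in> ?S. \<sigma> j = i}) * ?FN * (real (?r (l j)) * real (?c (l' i))) = real (N (l j, l' i)) * ?P"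
    if i: "i \<in> J'" for i
  proof (cases "N (l j, l' i) = 0")
    case True
    have "(l j, l' i) \<in> A \<times> B" using lj insert.prems(5) i by auto
    then have "{\<sigma> \<in> ?S. \<sigma> j = i} = {}"
      using insert.hyps(1,2) True by (intro table_bijections_fixed_empty)
    then show ?thesis using True by (simp only: card.empty)
  next
    case False
    then have pos: "0 < N (l j, l' i)" by simp
    let ?z = "(l j, l' i)"
    let ?N' = "N(?z := N ?z - 1)"
    have z: "?z \<in> A \<times> B" using lj insert.prems(5) i by auto
    have li: "l' i \<in> B" using z by simp
    have "J' = insert i (J' - {i})" using i by auto
    then have c': "?c b = class_size l' (J' - {i}) b + (if b = l' i then 1 else 0)" for b
      using class_size_insert[of "J' - {i}" i l' b] insert.prems(1) by simp
    have IH: "real (card (table_bijections l l' J (J' - {i}) (A \<times> B) ?N')) * (\<Prod>z\<in>A \<times> B. fact (?N' z)) =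
      (\<Prod>a\<in>A. fact (class_size l J a)) * (\<Prod>b\<in>B. fact (class_size l' (J' - {i}) b))"
    proof (rule insert.IH)
      fix a assume a: "a \<in> A"
      show "(\<Sum>b\<in>B. ?N' (a, b)) = class_size l J a"
      proof (cases "a = l j")
        case True
        have "(\<Sum>b\<in>B. N (l j, b)) = N ?z + (\<Sum>b\<in>B - {l' i}. N (l j, b))"
          using insert.prems(3) li by (rule sum.remove)
        moreover have "(\<Sum>b\<in>B. ?N' (l j, b)) = (N ?z - 1) + (\<Sum>b\<in>B - {l' i}. N (l j, b))"
          using insert.prems(3) li by (subst sum.remove[of B "l' i"]) (auto intro!: sum.cong)
        ultimately show ?thesis using insert.prems(6)[OF lj] rj pos True by simp
      next
        case False
        then show ?thesis using insert.prems(6)[OF a] class_size_insert[OF insert.hyps, of l a] by simp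
      qed
    next
      fix b assume b: "b \<in> B"
      show "(\<Sum>a\<in>A. ?N' (a, b)) = class_size l' (J' - {i}) b"
      proof (cases "b = l' i")
        case True
        have "(\<Sum>a\<in>A. N (a, l' i)) = N ?z + (\<Sum>a\<in>A - {l j}. N (a, l' i))"
          using insert.prems(2) lj by (rule sum.remove)
        moreover have "(\<Sum>a\<in>A. ?N' (a, l' i)) = (N ?z - 1) + (\<Sum>a\<in>A - {l j}. N (a, l' i))"
          using insert.prems(2) lj by (subst sum.remove[of A "l j"]) (auto intro!: sum.cong)
        ultimately show ?thesis using insert.prems(7)[OF li] c'[of "l' i"] pos True by simp
      next
        case False
        then show ?thesis using insert.prems(7)[OF b] c'[of b] by simp
      qed
    qed (use insert.prems in auto)
    have card: "card {\<sigma> \<in> ?S. \<sigma> j = i} = card (table_bijections l l' J (J' - {i}) (A \<times> B) ?N')"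
      using insert.hyps(1,2) insert.prems(1) i z pos by (intro card_table_bijections_fixed)
    have fN: "?FN = real (N ?z) * (\<Prod>z\<in>A \<times> B. fact (?N' z))"
      using finZ z pos by (rule prod_fact_update)
    have "class_size l J = ?r(l j := ?r (l j) - 1)"
      using class_size_insert[OF insert.hyps, of l] by (auto simp: fun_eq_iff)
    then have fr: "(\<Prod>a\<in>A. fact (?r a) :: real) = real (?r (l j)) * (\<Prod>a\<in>A. fact (class_size l J a))"
      using prod_fact_update[OF insert.prems(2) lj, of ?r] rj by simp
    have "class_size l' (J' - {i}) = ?c(l' i := ?c (l' i) - 1)"
      using c' by (auto simp: fun_eq_iff)
    then have fc: "(\<Prod>b\<in>B. fact (?c b) :: real) = real (?c (l' i)) * (\<Prod>b\<in>B. fact (class_size l' (J' - {i}) b))"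
      using prod_fact_update[OF insert.prems(3) li, of ?c] c'[of "l' i"] by simp
    show ?thesis unfolding card fN fr fc using IH by (simp add: algebra_simps)
  qed
  have cpos: "0 < ?c (l' i)" if "i \<in> J'" for i
    using that insert.prems(1) by (auto simp: class_size_def card_gt_0_iff)
  have "real (card {\<sigma> \<in> ?S. \<sigma> j = i}) * ?FN * real (?r (l j)) = real (N (l j, l' i)) / real (?c (l' i)) * ?P" if "i \<in> J'" for i
    using main[OF that] cpos[OF that] by (simp add: field_simps)
  then have "(\<Sum>i\<in>J'. real (card {\<sigma> \<in> ?S. \<sigma> j = i}) * ?FN * real (?r (l j)))
    = (\<Sum>i\<in>J'. real (N (l j, l' i)) / real (?c (l' i))) * ?P"
    by (simp add: sum_distrib_right)
  also have "(\<Sum>i\<in>J'. real (N (l j, l' i)) / real (?c (l' i)))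
    = (\<Sum>b\<in>B. \<Sum>i\<in>{i\<in>J'. l' i = b}. real (N (l j, l' i)) / real (?c (l' i)))"
    by (rule sum.group[symmetric]) (use insert.prems in auto)
  \<comment> \<open>All \<open>i\<close> with label \<open>b\<close> give the same term, and there
    are \<open>?c b\<close> of them; a class of size 0 forces the entry 0. The sum over
    \<open>b\<close> is then the row size of \<open>l j\<close>, which cancels on both
    sides.\<close>
  also have "\<dots> = (\<Sum>b\<in>B. real (N (l j, b)))"
  proof (rule sum.cong)
    fix b assume b: "b \<in> B"
    have "(\<Sum>i\<in>{i\<in>J'. l' i = b}. real (N (l j, l' i)) / real (?c (l' i))) = real (?c b) * (real (N (l j, b)) / real (?c b))"
      by (simp add: class_size_def)
    also have "\<dots> = real (N (l j, b))"
    proof (cases "?c b = 0")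
      case True
      then have "N (l j, b) = 0" using insert.prems(7)[OF b] insert.prems(2) lj by simp
      then show ?thesis by simp
    qed simp
    finally show "(\<Sum>i\<in>{i\<in>J'. l' i = b}. real (N (l j, l' i)) / real (?c (l' i))) = real (N (l j, b))" .
  qed simp
  also have "\<dots> = real (?r (l j))" using insert.prems(6)[OF lj] by (simp flip: of_nat_sum)
  also have "(\<Sum>i\<in>J'. real (card {\<sigma> \<in> ?S. \<sigma> j = i}) * ?FN * real (?r (l j))) = real (card ?S) * ?FN * real (?r (l j))"
    unfolding card_table_bijections_insert[OF insert.hyps(1,2) insert.prems(1)] by (simp add: sum_distrib_right)
  finally show ?case using rj by simp
qed

definition table_permutations ::
  "('j \<Rightarrow> 'a) \<Rightarrow> ('j \<Rightarrow> 'b) \<Rightarrow> 'j set \<Rightarrow> ('a \<times> 'b) set \<Rightarrow> ('a \<times> 'b \<Rightarrow> nat) \<Rightarrow> ('j \<Rightarrow> 'j) set" where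
  "table_permutations l l' J Z N = {\<sigma>. \<sigma> permutes J \<and> (\<forall>z\<in>Z. table_of l l' J \<sigma> z = N z)}"

text \<open>Permutations fix everything outside \<open>J\<close>, extensional bijections are
  \<open>undefined\<close> there; restriction to \<open>J\<close> passes from one to the
  other.\<close>

lemma card_table_permutations:
  assumes "finite J"
  shows "card (table_permutations l l' J Z N) = card (table_bijections l l' J J Z N)"
proof (rule bij_betw_same_card[of "\<lambda>\<sigma>. restrict \<sigma> J"])
  show "bij_betw (\<lambda>\<sigma>. restrict \<sigma> J) (table_permutations l l' J Z N) (table_bijections l l' J J Z N)"
  proof (rule bij_betw_byWitness[where f'="\<lambda>\<tau> i. if i \<in> J then \<tau> i else i"])
    show "\<forall>\<sigma>\<in>table_permutations l l' J Z N. (\<lambda>i. if i \<in> J then restrict \<sigma> J i else i) = \<sigma>"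
      by (auto simp: table_permutations_def fun_eq_iff permutes_not_in)
    show "\<forall>\<tau>\<in>table_bijections l l' J J Z N. restrict (\<lambda>i. if i \<in> J then \<tau> i else i) J = \<tau>"
      by (auto simp: table_bijections_def fun_eq_iff PiE_iff extensional_def)
    show "(\<lambda>\<sigma>. restrict \<sigma> J) ` table_permutations l l' J Z N \<subseteq> table_bijections l l' J J Z N"
    proof clarify
      fix \<sigma> assume "\<sigma> \<in> table_permutations l l' J Z N"
      then have p: "\<sigma> permutes J" "\<And>z. z \<in> Z \<Longrightarrow> table_of l l' J \<sigma> z = N z" by (auto simp: table_permutations_def)
      have "table_of l l' J (restrict \<sigma> J) = table_of l l' J \<sigma>" by (rule table_of_cong) simp
      then show "restrict \<sigma> J \<in> table_bijections l l' J J Z N"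
        using p permutes_imp_bij[OF p(1)] permutes_in_image[OF p(1)] by (auto simp: table_bijections_def)
    qed
    show "(\<lambda>\<tau> i. if i \<in> J then \<tau> i else i) ` table_bijections l l' J J Z N \<subseteq> table_permutations l l' J Z N"
    proof clarify
      fix \<tau> assume "\<tau> \<in> table_bijections l l' J J Z N"
      then have p: "bij_betw \<tau> J J" "\<And>z. z \<in> Z \<Longrightarrow> table_of l l' J \<tau> z = N z" by (auto simp: table_bijections_def)
      have "bij_betw (\<lambda>i. if i \<in> J then \<tau> i else i) J J"
        using p(1) by (rule bij_betw_cong[THEN iffD1, rotated]) simp
      then have "(\<lambda>i. if i \<in> J then \<tau> i else i) permutes J" by (rule bij_imp_permutes) simp
      moreover have "table_of l l' J (\<lambda>i. if i \<in> J then \<tau> i else i) = table_of l l' J \<tau>"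
        by (rule table_of_cong) simp
      ultimately show "(\<lambda>i. if i \<in> J then \<tau> i else i) \<in> table_permutations l l' J Z N"
        using p(2) by (simp add: table_permutations_def)
    qed
  qed
qed

section \<open>Entropy of contingency tables\<close>

definition xlnx :: "real \<Rightarrow> real" where "xlnx t = t * ln t"

text \<open>For a table of total mass 1 this is the entropy relative to the product of its margins.
  Splitting the logarithm keeps it continuous where entries or margins vanish, since
  \<open>xlnx\<close> is continuous at 0.\<close>

definition table_entropy :: "'a set \<Rightarrow> 'b set \<Rightarrow> ('a \<times> 'b \<Rightarrow> real) \<Rightarrow> real" where
  "table_entropy A B p = (\<Sum>z\<in>A \<times> B. xlnx (p z)) - (\<Sum>a\<in>A. xlnx (\<Sum>b\<in>B. p (a, b)))
     - (\<Sum>b\<in>B. xlnx (\<Sum>a\<in>A. p (a, b)))"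

lemma xlnx_0 [simp]: "xlnx 0 = 0" by (simp add: xlnx_def)

text \<open>The critical point is 0, where \<open>x * ln x\<close> is at most
  \<open>2 * sqrt x\<close> in absolute value, by \<open>ln y \<le> y - 1\<close> at
  \<open>y = 1 / sqrt x\<close>.\<close>

lemma continuous_on_xlnx: "continuous_on {0..} xlnx"
proof (rule continuous_on_eq_continuous_within[THEN iffD2], rule ballI)
  fix t :: real assume "t \<in> {0..}"
  show "continuous (at t within {0..}) xlnx"
  proof (cases "t = 0")
    case False
    then have "0 < t" using \<open>t \<in> {0..}\<close> by simp
    then have "isCont xlnx t" unfolding xlnx_def by (intro continuous_intros) auto
    then show ?thesis by (rule continuous_at_imp_continuous_at_within)
  next
    case True
    have bnd: "norm (xlnx x) \<le> 2 * sqrt x" if "0 \<le> x" "x < 1" for x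
    proof (cases "x = 0")
      case False
      then have "0 < x" using that by simp
      then have "ln (1 / sqrt x) \<le> 1 / sqrt x - 1" by (intro ln_le_minus_one) auto
      then have "- ln x \<le> 2 / sqrt x" using \<open>0 < x\<close> by (simp add: ln_div ln_sqrt)
      then have "x * - ln x \<le> x * (2 / sqrt x)" using \<open>0 < x\<close> by (intro mult_left_mono) auto
      also have "x * (2 / sqrt x) = 2 * (x / sqrt x)" by simp
      also have "x / sqrt x = sqrt x" using \<open>0 < x\<close> by (simp add: real_div_sqrt)
      finally have "x * - ln x \<le> 2 * sqrt x" .
      moreover have "x * ln x \<le> 0" using \<open>0 < x\<close> that by (simp add: mult_nonneg_nonpos)
      ultimately show ?thesis by (simp add: xlnx_def)
    qed simp
    have "eventually (\<lambda>x. norm (xlnx x) \<le> 2 * sqrt x) (at 0 within {0..})"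
      unfolding eventually_at by (intro exI[of _ 1] conjI ballI impI bnd) (simp_all add: dist_real_def)
    moreover have "((\<lambda>x. 2 * sqrt x) \<longlongrightarrow> 2 * sqrt 0) (at 0 within {0..})" by (intro tendsto_intros)
    then have "((\<lambda>x. 2 * sqrt x) \<longlongrightarrow> 0) (at 0 within {0..})" by simp
    ultimately have "(xlnx \<longlongrightarrow> 0) (at 0 within {0..})" by (rule Lim_null_comparison)
    then show ?thesis using True by (simp add: continuous_within)
  qed
qed

lemma tendsto_xlnx:
  assumes "f \<longlonglongrightarrow> y" "\<And>n. 0 \<le> f n"
  shows "(\<lambda>n. xlnx (f n)) \<longlonglongrightarrow> xlnx y"
proof (rule continuous_on_tendsto_compose[OF continuous_on_xlnx assms(1)])
  show "y \<in> {0..}" using LIMSEQ_le_const[OF assms(1), of 0] assms(2) by auto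
qed (use assms(2) in auto)

lemma tendsto_table_entropy:
  assumes "\<And>z. z \<in> A \<times> B \<Longrightarrow> (\<lambda>n. p n z) \<longlonglongrightarrow> q z" "\<And>n z. 0 \<le> p n z"
  shows "(\<lambda>n. table_entropy A B (p n)) \<longlonglongrightarrow> table_entropy A B q"
  unfolding table_entropy_def using assms
  by (intro tendsto_intros tendsto_xlnx sum_nonneg) auto

text \<open>Sequential continuity turned into a uniform neighbourhood: tables violating the claim at
  radius \<open>1 / Suc k\<close> for every \<open>k\<close> would converge to
  \<open>q\<close>.\<close>

lemma table_entropy_near:
  assumes "0 < e"
  obtains d where "0 < (d::real)" "\<And>p. (\<And>z. 0 \<le> p z) \<Longrightarrow> (\<And>z. z \<in> A \<times> B \<Longrightarrow> \<bar>p z - q z\<bar> \<le> d) \<Longrightarrow>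
    table_entropy A B p < table_entropy A B q + e"
proof (rule ccontr)
  assume nt: "\<not> thesis"
  have "\<exists>p. (\<forall>z. 0 \<le> p z) \<and> (\<forall>z\<in>A \<times> B. \<bar>p z - q z\<bar> \<le> 1 / real (Suc k)) \<and>
    \<not> table_entropy A B p < table_entropy A B q + e" for k :: nat
  proof (rule ccontr)
    assume no: "\<not> ?thesis"
    have thesis
    proof (rule that[of "1 / real (Suc k)"])
      fix p :: "'a \<times> 'b \<Rightarrow> real"
      assume "\<And>z. 0 \<le> p z" "\<And>z. z \<in> A \<times> B \<Longrightarrow> \<bar>p z - q z\<bar> \<le> 1 / real (Suc k)"
      then show "table_entropy A B p < table_entropy A B q + e" using no by blast
    qed simp
    with nt show False by blast
  qed
  then obtain p where p: "\<And>k z. 0 \<le> p k z" "\<And>k z. z \<in> A \<times> B \<Longrightarrow> \<bar>p k z - q z\<bar> \<le> 1 / real (Suc k)"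
    "\<And>k::nat. \<not> table_entropy A B (p k) < table_entropy A B q + e" by metis
  have "(\<lambda>k. p k z) \<longlonglongrightarrow> q z" if "z \<in> A \<times> B" for z
  proof (rule LIM_zero_cancel, rule Lim_null_comparison[where g="\<lambda>k. 1 / real (Suc k)"])
    show "eventually (\<lambda>k. norm (p k z - q z) \<le> 1 / real (Suc k)) sequentially" using p(2)[OF that] by simp
  qed (rule LIMSEQ_Suc[OF lim_1_over_n])
  then have "(\<lambda>k. table_entropy A B (p k)) \<longlonglongrightarrow> table_entropy A B q"
    using p(1) by (rule tendsto_table_entropy)
  then have "eventually (\<lambda>k. table_entropy A B (p k) < table_entropy A B q + e) sequentially"
    using assms by (intro order_tendstoD) auto
  then show False using p(3) by (auto simp: eventually_sequentially)
qed

section \<open>Stirling bounds and the proportion of permutations with a given table\<close>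

definition log_error :: "nat \<Rightarrow> real" where "log_error n = 1 + ln (real n + 1)"

lemma log_error_nonneg: "0 \<le> log_error n" by (simp add: log_error_def)

lemma log_error_mono: "m \<le> n \<Longrightarrow> log_error m \<le> log_error n"
  by (simp add: log_error_def)

text \<open>Any fixed number of Stirling errors is negligible on the exponential scale.\<close>

lemma log_error_lim: "(\<lambda>n. c * log_error n / real n) \<longlonglongrightarrow> 0"
proof -
  have "(\<lambda>n. ln (real (Suc n)) / real (Suc n)) \<longlonglongrightarrow> 0"
    using LIMSEQ_Suc[OF filterlim_compose[OF ln_x_over_x_tendsto_0 filterlim_real_sequentially]] by simp
  moreover have "(\<lambda>n. real (Suc n) / real n) \<longlonglongrightarrow> 1" by (rule LIMSEQ_Suc_n_over_n)
  ultimately have "(\<lambda>n. ln (real (Suc n)) / real (Suc n) * (real (Suc n) / real n)) \<longlonglongrightarrow> 0 * 1"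
    by (rule tendsto_mult)
  then have "(\<lambda>n. ln (real n + 1) / real n) \<longlonglongrightarrow> 0"
    by (simp add: add.commute)
  then have "(\<lambda>n. c * (1 / real n + ln (real n + 1) / real n)) \<longlonglongrightarrow> c * (0 + 0)"
    by (intro tendsto_intros lim_1_over_n)
  then show ?thesis by (simp add: log_error_def add_divide_distrib[symmetric])
qed

text \<open>By induction, with the increment of the logarithm from \<open>n\<close> to
  \<open>n + 1\<close> squeezed between \<open>1 / (n + 1)\<close> and \<open>1 / n\<close>. The
  \<open>+ 1\<close> inside \<open>log_error\<close> covers \<open>n = 0\<close>.\<close>

lemma ln_fact_lower: "xlnx (real n) - real n \<le> ln (fact n)"
  and ln_fact_upper: "ln (fact n) \<le> xlnx (real n) - real n + log_error n"
proof -
  have *: "xlnx (real n) - real n \<le> ln (fact n) \<and> ln (fact n) \<le> xlnx (real n) - real n + 1 + ln (real n)" if "n \<ge> 1" for n :: nat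
    using that
  proof (induction n rule: nat_induct_at_least)
    case (Suc n)
    have n: "0 < real n" using Suc by simp
    have "ln (1 + 1 / real n) \<le> 1 / real n" using ln_le_minus_one[of "1 + 1 / real n"] n by (simp add: add_pos_pos)
    moreover have eq: "1 + 1 / real n = (real n + 1) / real n" using n by (simp add: field_simps)
    ultimately have up: "ln (real n + 1) - ln (real n) \<le> 1 / real n" using n by (simp add: ln_div)
    have "ln (real n / (real n + 1)) \<le> real n / (real n + 1) - 1" using n by (intro ln_le_minus_one) auto
    also have "\<dots> = - (1 / (real n + 1))" using n by (simp add: field_simps)
    finally have lo: "1 / (real n + 1) \<le> ln (real n + 1) - ln (real n)" using n by (simp add: ln_div)
    have u: "real n * (ln (real n + 1) - ln (real n)) \<le> 1" using up n by (simp add: field_simps)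
    have l: "1 \<le> (real n + 1) * (ln (real n + 1) - ln (real n))" using lo n by (simp add: field_simps)
    have f: "ln (fact (Suc n)) = ln (real n + 1) + ln (fact n :: real)"
      using n by (simp add: ln_mult add.commute)
    show ?case using Suc.IH u l unfolding f xlnx_def by (simp add: algebra_simps)
  qed (simp add: xlnx_def)
  have "xlnx (real n) - real n \<le> ln (fact n) \<and> ln (fact n) \<le> xlnx (real n) - real n + log_error n"
  proof (cases "n = 0")
    case False
    then have "ln (real n) \<le> ln (real n + 1)" by simp
    moreover have "n \<ge> 1" using False by simp
    ultimately show ?thesis using *[of n] unfolding log_error_def by linarith
  qed (simp add: log_error_def)
  then show "xlnx (real n) - real n \<le> ln (fact n)" "ln (fact n) \<le> xlnx (real n) - real n + log_error n"
    by auto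
qed

lemma xlnx_scale: "0 < c \<Longrightarrow> 0 \<le> t \<Longrightarrow> xlnx (c * t) = c * xlnx t + t * xlnx c"
  by (cases "t = 0") (simp_all add: xlnx_def ln_mult algebra_simps)

text \<open>Frequencies replace counts: the extra terms \<open>xlnx n - n\<close> depend on the
  total only and cancel between rows, columns, cells and \<open>n\<close> itself in the count of
  permutations.\<close>

lemma sum_ln_fact_bounds:
  fixes N :: "'a \<Rightarrow> nat"
  assumes "finite Z" "(\<Sum>z\<in>Z. N z) = n" "n \<ge> 1"
  shows "real n * (\<Sum>z\<in>Z. xlnx (real (N z) / real n)) + xlnx (real n) - real n \<le> (\<Sum>z\<in>Z. ln (fact (N z)))"
    "(\<Sum>z\<in>Z. ln (fact (N z))) \<le> real n * (\<Sum>z\<in>Z. xlnx (real (N z) / real n)) + xlnx (real n) - real n + real (card Z) * log_error n"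
proof -
  have n: "0 < real n" using assms(3) by simp
  have sN: "(\<Sum>z\<in>Z. real (N z)) = real n" using assms(2) by (simp flip: of_nat_sum)
  have x: "xlnx (real (N z)) = real n * xlnx (real (N z) / real n) + real (N z) / real n * xlnx (real n)" for z
    using xlnx_scale[OF n, of "real (N z) / real n"] n by simp
  have "(\<Sum>z\<in>Z. xlnx (real (N z)) - real (N z)) = real n * (\<Sum>z\<in>Z. xlnx (real (N z) / real n))
    + (\<Sum>z\<in>Z. real (N z)) / real n * xlnx (real n) - (\<Sum>z\<in>Z. real (N z))"
    unfolding x by (simp add: sum.distrib sum_subtractf sum_distrib_left sum_divide_distrib sum_distrib_right)
  then have eq: "(\<Sum>z\<in>Z. xlnx (real (N z)) - real (N z)) = real n * (\<Sum>z\<in>Z. xlnx (real (N z) / real n)) + xlnx (real n) - real n"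
    unfolding sN using n by simp
  show "real n * (\<Sum>z\<in>Z. xlnx (real (N z) / real n)) + xlnx (real n) - real n \<le> (\<Sum>z\<in>Z. ln (fact (N z)))"
    unfolding eq[symmetric] by (intro sum_mono ln_fact_lower)
  have "N z \<le> n" if "z \<in> Z" for z using assms(1,2) that member_le_sum[of z Z N] by simp
  then have "(\<Sum>z\<in>Z. ln (fact (N z))) \<le> (\<Sum>z\<in>Z. xlnx (real (N z)) - real (N z) + log_error n)"
    by (intro sum_mono order_trans[OF ln_fact_upper] add_left_mono log_error_mono)
  also have "\<dots> = (\<Sum>z\<in>Z. xlnx (real (N z)) - real (N z)) + real (card Z) * log_error n"
    by (simp add: sum.distrib)
  finally show "(\<Sum>z\<in>Z. ln (fact (N z))) \<le> real n * (\<Sum>z\<in>Z. xlnx (real (N z) / real n)) + xlnx (real n) - real n + real (card Z) * log_error n"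
    unfolding eq .
qed

lemma sum_class_size:
  assumes "finite J" "finite A" "l ` J \<subseteq> A" shows "(\<Sum>a\<in>A. class_size l J a) = card J"
  using sum.group[OF assms, of "\<lambda>_. 1::nat"] by (simp add: class_size_def)

text \<open>The logarithm of the product formula. The constant counts the factorials involved: one
  for each row, each column and each cell, and one for \<open>n\<close>.\<close>

theorem table_permutations_fraction:
  fixes l :: "'j \<Rightarrow> 'a" and l' :: "'j \<Rightarrow> 'b"
  assumes fin: "finite J" "finite A" "finite B" and lab: "l ` J \<subseteq> A" "l' ` J \<subseteq> B" and n: "card J = n" "n \<ge> 1"
    and N: "\<And>a. a \<in> A \<Longrightarrow> (\<Sum>b\<in>B. N (a, b)) = class_size l J a"
      "\<And>b. b \<in> B \<Longrightarrow> (\<Sum>a\<in>A. N (a, b)) = class_size l' J b"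
  shows "0 < card (table_permutations l l' J (A \<times> B) N)"
    "\<bar>ln (real (card (table_permutations l l' J (A \<times> B) N)) / fact n)
      + real n * table_entropy A B (\<lambda>z. real (N z) / real n)\<bar>
      \<le> real (card A + card B + card A * card B + 1) * log_error n"
proof -
  let ?S = "table_permutations l l' J (A \<times> B) N"
  let ?r = "class_size l J" and ?c = "class_size l' J"
  have eq: "real (card ?S) * (\<Prod>z\<in>A \<times> B. fact (N z)) = (\<Prod>a\<in>A. fact (?r a)) * (\<Prod>b\<in>B. fact (?c b))"
    unfolding card_table_permutations[OF fin(1)] using assms by (intro card_table_bijections)
  have pos: "0 < (\<Prod>z\<in>A \<times> B. fact (N z) :: real)" "0 < (\<Prod>a\<in>A. fact (?r a) :: real)" "0 < (\<Prod>b\<in>B. fact (?c b) :: real)"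
    by (auto intro!: prod_pos)
  have "0 < real (card ?S)" using eq pos by (metis mult_pos_pos zero_less_mult_pos2)
  then show "0 < card ?S" by simp
  have "ln (real (card ?S)) + (\<Sum>z\<in>A \<times> B. ln (fact (N z))) = (\<Sum>a\<in>A. ln (fact (?r a))) + (\<Sum>b\<in>B. ln (fact (?c b)))"
  proof -
    have "ln (real (card ?S) * (\<Prod>z\<in>A \<times> B. fact (N z))) = ln (real (card ?S)) + (\<Sum>z\<in>A \<times> B. ln (fact (N z)))"
      using \<open>0 < real (card ?S)\<close> pos fin by (simp add: ln_mult ln_prod)
    moreover have "ln ((\<Prod>a\<in>A. fact (?r a)) * (\<Prod>b\<in>B. fact (?c b) :: real)) = (\<Sum>a\<in>A. ln (fact (?r a))) + (\<Sum>b\<in>B. ln (fact (?c b)))"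
      using pos fin by (simp add: ln_mult ln_prod)
    ultimately show ?thesis using eq by simp
  qed
  then have main: "ln (real (card ?S) / fact n) = (\<Sum>a\<in>A. ln (fact (?r a))) + (\<Sum>b\<in>B. ln (fact (?c b)))
    - (\<Sum>z\<in>A \<times> B. ln (fact (N z))) - ln (fact n)"
    using \<open>0 < real (card ?S)\<close> by (simp add: ln_div)
  have sr: "(\<Sum>a\<in>A. ?r a) = n" "(\<Sum>b\<in>B. ?c b) = n" using sum_class_size fin lab n by auto
  have sN: "(\<Sum>z\<in>A \<times> B. N z) = n"
    using sr(1) N(1) by (simp add: sum.cartesian_product')
  have te: "table_entropy A B (\<lambda>z. real (N z) / real n) = (\<Sum>z\<in>A \<times> B. xlnx (real (N z) / real n))
    - (\<Sum>a\<in>A. xlnx (real (?r a) / real n)) - (\<Sum>b\<in>B. xlnx (real (?c b) / real n))"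
    unfolding table_entropy_def using N by (simp add: sum_divide_distrib[symmetric] flip: of_nat_sum)
  have finZ: "finite (A \<times> B)" using fin by simp
  note b1 = sum_ln_fact_bounds[OF fin(2) sr(1) n(2)] and b2 = sum_ln_fact_bounds[OF fin(3) sr(2) n(2)]
    and b3 = sum_ln_fact_bounds[OF finZ sN n(2)] and b4 = ln_fact_lower[of n] ln_fact_upper[of n]
  have cards: "real (card (A \<times> B)) = real (card A * card B)" by (simp add: card_cartesian_product)
  have e0: "0 \<le> real (card A) * log_error n" "0 \<le> real (card B) * log_error n" "0 \<le> real (card A * card B) * log_error n"
    using log_error_nonneg by auto
  show "\<bar>ln (real (card ?S) / fact n) + real n * table_entropy A B (\<lambda>z. real (N z) / real n)\<bar>
      \<le> real (card A + card B + card A * card B + 1) * log_error n"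
    unfolding main te right_diff_distrib of_nat_add distrib_right of_nat_1 mult_1 using b1 b2 b3[unfolded cards] b4 e0 log_error_nonneg[of n]
    by linarith
qed

section \<open>Integer tables with prescribed margins\<close>

lemma table_of_margins:
  assumes fin: "finite J" "finite A" "finite B" and lab: "l ` J \<subseteq> A" "l' ` J \<subseteq> B" and \<sigma>: "\<sigma> permutes J"
  shows "a \<in> A \<Longrightarrow> (\<Sum>b\<in>B. table_of l l' J \<sigma> (a, b)) = class_size l J a"
    "b \<in> B \<Longrightarrow> (\<Sum>a\<in>A. table_of l l' J \<sigma> (a, b)) = class_size l' J b"
proof -
  assume "a \<in> A"
  have "(\<Sum>b\<in>B. \<Sum>j\<in>{j\<in>{j\<in>J. l j = a}. l' (\<sigma> j) = b}. 1) = (\<Sum>j\<in>{j\<in>J. l j = a}. 1::nat)"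
    using fin lab permutes_in_image[OF \<sigma>] by (intro sum.group) auto
  then show "(\<Sum>b\<in>B. table_of l l' J \<sigma> (a, b)) = class_size l J a"
    by (simp add: table_of_def class_size_def conj_assoc)
next
  assume "b \<in> B"
  have "(\<Sum>a\<in>A. \<Sum>j\<in>{j\<in>{j\<in>J. l' (\<sigma> j) = b}. l j = a}. 1) = (\<Sum>j\<in>{j\<in>J. l' (\<sigma> j) = b}. 1::nat)"
    using fin lab by (intro sum.group) auto
  moreover have "card {j\<in>J. l' (\<sigma> j) = b} = class_size l' J b"
    unfolding class_size_def
  proof (rule bij_betw_same_card[of \<sigma>])
    show "bij_betw \<sigma> {j\<in>J. l' (\<sigma> j) = b} {j\<in>J. l' j = b}"
      using permutes_inj[OF \<sigma>] permutes_in_image[OF \<sigma>] permutes_image[OF \<sigma>]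
      by (auto simp: bij_betw_def inj_on_def inj_def)
  qed
  ultimately show "(\<Sum>a\<in>A. table_of l l' J \<sigma> (a, b)) = class_size l' J b"
    by (simp add: table_of_def conj_ac)
qed

text \<open>Take one unit from a row and a column that are both nonzero, and induct on the
  total.\<close>

lemma table_with_margins_exists:
  fixes r :: "'a \<Rightarrow> nat" and c :: "'b \<Rightarrow> nat"
  assumes "finite A" "finite B" "(\<Sum>a\<in>A. r a) = (\<Sum>b\<in>B. c b)"
  shows "\<exists>N. (\<forall>a\<in>A. (\<Sum>b\<in>B. N (a, b)) = r a) \<and> (\<forall>b\<in>B. (\<Sum>a\<in>A. N (a, b)) = c b)"
  using assms
proof (induction "\<Sum>a\<in>A. r a" arbitrary: r c)
  case 0
  then show ?case by (intro exI[of _ "\<lambda>_. 0"]) auto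
next
  case (Suc m)
  obtain a0 where a0: "a0 \<in> A" "0 < r a0" using Suc(2) by (metis (no_types, lifting) gr0I nat.distinct(1) sum.neutral)
  have "(\<Sum>b\<in>B. c b) \<noteq> 0" using Suc(2) Suc.prems(3) by linarith
  then have "\<exists>b\<in>B. c b \<noteq> 0" by (meson sum.neutral)
  then obtain b0 where b0: "b0 \<in> B" "0 < c b0" by auto
  let ?r = "r(a0 := r a0 - 1)" and ?c = "c(b0 := c b0 - 1)"
  have sr: "(\<Sum>a\<in>A. r a) = Suc (\<Sum>a\<in>A. ?r a)"
    using a0 Suc.prems(1) by (simp add: sum.remove[of A a0])
  have sc: "(\<Sum>b\<in>B. c b) = Suc (\<Sum>b\<in>B. ?c b)"
    using b0 Suc.prems(2) by (simp add: sum.remove[of B b0])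
  have "m = (\<Sum>a\<in>A. ?r a)" "(\<Sum>a\<in>A. ?r a) = (\<Sum>b\<in>B. ?c b)" using sr sc Suc by auto
  from Suc.hyps(1)[OF this(1) Suc.prems(1,2) this(2)] obtain N where
    N: "\<And>a. a \<in> A \<Longrightarrow> (\<Sum>b\<in>B. N (a, b)) = ?r a" "\<And>b. b \<in> B \<Longrightarrow> (\<Sum>a\<in>A. N (a, b)) = ?c b" by blast
  let ?N = "\<lambda>z. N z + (if z = (a0, b0) then 1 else 0)"
  have "(\<Sum>b\<in>B. ?N (a, b)) = r a" if "a \<in> A" for a
  proof -
    have "(\<Sum>b\<in>B. ?N (a, b)) = (\<Sum>b\<in>B. N (a, b)) + (\<Sum>b\<in>B. if b = b0 then (if a = a0 then 1 else 0) else 0)"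
      unfolding sum.distrib[symmetric] by (intro sum.cong) auto
    then show ?thesis using N(1)[OF that] a0 b0 Suc.prems(2) by simp
  qed
  moreover have "(\<Sum>a\<in>A. ?N (a, b)) = c b" if "b \<in> B" for b
  proof -
    have "(\<Sum>a\<in>A. ?N (a, b)) = (\<Sum>a\<in>A. N (a, b)) + (\<Sum>a\<in>A. if a = a0 then (if b = b0 then 1 else 0) else 0)"
      unfolding sum.distrib[symmetric] by (intro sum.cong) auto
    then show ?thesis using N(2)[OF that] a0 b0 Suc.prems(1) by simp
  qed
  ultimately show ?case by (intro exI[of _ ?N]) blast
qed

text \<open>Rounding has to meet the margins exactly. Shrinking \<open>p\<close> by the factor
  \<open>1 - e\<close> before rounding down leaves room in every row and column, and the small
  remainder is filled in by any table with the remaining margins.\<close>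

lemma table_rounding:
  fixes p :: "'a \<times> 'b \<Rightarrow> real" and r :: "nat \<Rightarrow> 'a \<Rightarrow> nat" and c :: "nat \<Rightarrow> 'b \<Rightarrow> nat"
  assumes fin: "finite A" "finite B" and p: "\<And>z. 0 \<le> p z" "(\<Sum>z\<in>A \<times> B. p z) = 1"
    and r: "\<And>n. n \<ge> 1 \<Longrightarrow> (\<Sum>a\<in>A. r n a) = n" "\<And>a. a \<in> A \<Longrightarrow> (\<lambda>n. real (r n a) / real n) \<longlonglongrightarrow> (\<Sum>b\<in>B. p (a, b))"
    and c: "\<And>n. n \<ge> 1 \<Longrightarrow> (\<Sum>b\<in>B. c n b) = n" "\<And>b. b \<in> B \<Longrightarrow> (\<lambda>n. real (c n b) / real n) \<longlonglongrightarrow> (\<Sum>a\<in>A. p (a, b))"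
    and "0 < d"
  shows "\<forall>\<^sub>F n in sequentially. \<exists>N. (\<forall>a\<in>A. (\<Sum>b\<in>B. N (a, b)) = r n a) \<and> (\<forall>b\<in>B. (\<Sum>a\<in>A. N (a, b)) = c n b) \<and>
    (\<forall>z\<in>A \<times> B. \<bar>real (N z) / real n - p z\<bar> \<le> d)"
proof -
  \<comment> \<open>Half of \<open>d\<close> pays for the shrinking, the other half for the rounding
    of all cells, which is of order \<open>1 / n\<close>; \<open>e < 1\<close> keeps the shrunken
    table nonnegative.\<close>
  define e where "e = min (d / 2) (1 / 2)"
  have e: "0 < e" "e < 1" "e \<le> d / 2" using \<open>0 < d\<close> by (auto simp: e_def)
  let ?pa = "\<lambda>a. \<Sum>b\<in>B. p (a, b)" and ?pb = "\<lambda>b. \<Sum>a\<in>A. p (a, b)"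
  \<comment> \<open>For \<open>q > 0\<close> the shrunken margin lies strictly below the limit; for
    \<open>q = 0\<close> it is 0.\<close>
  have ev_ge: "\<forall>\<^sub>F n in sequentially. (1 - e) * q \<le> real (s n) / real n"
    if "(\<lambda>n. real (s n) / real n) \<longlonglongrightarrow> q" "0 \<le> q" for s :: "nat \<Rightarrow> nat" and q
  proof (cases "q = 0")
    case False
    then have "(1 - e) * q < q" using e that(2) by simp
    from order_tendstoD(1)[OF that(1) this] show ?thesis by eventually_elim simp
  qed simp
  have "\<forall>\<^sub>F n in sequentially. \<forall>a\<in>A. (1 - e) * ?pa a \<le> real (r n a) / real n"
    using fin(1) r(2) p(1) by (auto simp: eventually_ball_finite_distrib intro!: ev_ge sum_nonneg)
  moreover have "\<forall>\<^sub>F n in sequentially. \<forall>b\<in>B. (1 - e) * ?pb b \<le> real (c n b) / real n"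
    using fin(2) c(2) p(1) by (auto simp: eventually_ball_finite_distrib intro!: ev_ge sum_nonneg)
  moreover have "\<forall>\<^sub>F n in sequentially. (real (card (A \<times> B)) + 1) / real n < d / 2"
    using \<open>0 < d\<close> by (intro order_tendstoD(2)[OF lim_const_over_n]) auto
  moreover have "\<forall>\<^sub>F n in sequentially. n \<ge> (1::nat)" by (rule eventually_ge_at_top)
  ultimately show ?thesis
  proof eventually_elim
    case (elim n)
    have n: "0 < real n" using elim(4) by simp
    define M where "M z = nat \<lfloor>(1 - e) * real n * p z\<rfloor>" for z
    have nnp: "0 \<le> (1 - e) * real n * p z" for z using e n p(1) by simp
    have M1: "real (M z) \<le> (1 - e) * real n * p z" "(1 - e) * real n * p z - 1 \<le> real (M z)" for z
      using nnp[of z] unfolding M_def by linarith+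
    have rle: "(\<Sum>b\<in>B. M (a, b)) \<le> r n a" if "a \<in> A" for a
    proof -
      have "real (\<Sum>b\<in>B. M (a, b)) \<le> (\<Sum>b\<in>B. (1 - e) * real n * p (a, b))" using M1(1) by (simp add: sum_mono)
      also have "\<dots> = real n * ((1 - e) * ?pa a)" by (simp add: sum_distrib_left mult_ac)
      also have "\<dots> \<le> real n * (real (r n a) / real n)" using elim(1) that n by (intro mult_left_mono) auto
      also have "\<dots> = real (r n a)" using n by simp
      finally show ?thesis by (simp only: of_nat_le_iff)
    qed
    have cle: "(\<Sum>a\<in>A. M (a, b)) \<le> c n b" if "b \<in> B" for b
    proof -
      have "real (\<Sum>a\<in>A. M (a, b)) \<le> (\<Sum>a\<in>A. (1 - e) * real n * p (a, b))" using M1(1) by (simp add: sum_mono)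
      also have "\<dots> = real n * ((1 - e) * ?pb b)" by (simp add: sum_distrib_left mult_ac)
      also have "\<dots> \<le> real n * (real (c n b) / real n)" using elim(2) that n by (intro mult_left_mono) auto
      also have "\<dots> = real (c n b)" using n by simp
      finally show ?thesis by (simp only: of_nat_le_iff)
    qed
    let ?r = "\<lambda>a. r n a - (\<Sum>b\<in>B. M (a, b))" and ?c = "\<lambda>b. c n b - (\<Sum>a\<in>A. M (a, b))"
    have sr: "(\<Sum>a\<in>A. ?r a) = n - (\<Sum>z\<in>A \<times> B. M z)"
      using rle r(1)[OF elim(4)] by (subst sum_subtractf_nat) (auto simp: sum.cartesian_product')
    have "(\<Sum>b\<in>B. \<Sum>a\<in>A. M (a, b)) = (\<Sum>z\<in>A \<times> B. M z)"
      by (subst sum.swap) (simp add: sum.cartesian_product)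
    then have sc: "(\<Sum>b\<in>B. ?c b) = n - (\<Sum>z\<in>A \<times> B. M z)"
      using cle c(1)[OF elim(4)] by (subst sum_subtractf_nat) auto
    obtain L where L: "\<forall>a\<in>A. (\<Sum>b\<in>B. L (a, b)) = ?r a" "\<forall>b\<in>B. (\<Sum>a\<in>A. L (a, b)) = ?c b"
      using table_with_margins_exists[OF fin, of ?r ?c] sr sc by auto
    have sL: "(\<Sum>z\<in>A \<times> B. L z) = n - (\<Sum>z\<in>A \<times> B. M z)"
      using L(1) sr by (simp add: sum.cartesian_product')
    have "\<bar>real (M z + L z) / real n - p z\<bar> \<le> d" if z: "z \<in> A \<times> B" for z
    proof -
      have "(\<Sum>z\<in>A \<times> B. (1 - e) * real n * p z - 1) \<le> (\<Sum>z\<in>A \<times> B. real (M z))" using M1(2) by (rule sum_mono)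
      then have SM: "(1 - e) * real n - real (card (A \<times> B)) \<le> (\<Sum>z\<in>A \<times> B. real (M z))"
        using p(2) by (simp add: sum_subtractf sum_distrib_left[symmetric])
      have "L z \<le> (\<Sum>z\<in>A \<times> B. L z)" using z fin by (intro member_le_sum) auto
      then have "real (L z) \<le> real (n - (\<Sum>z\<in>A \<times> B. M z))" using sL by simp
      also have "\<dots> = real n - (\<Sum>z\<in>A \<times> B. real (M z))"
        using rle r(1)[OF elim(4)] sum_mono[of A "\<lambda>a. \<Sum>b\<in>B. M (a, b)" "r n"]
        by (subst of_nat_diff) (auto simp: sum.cartesian_product')
      finally have Lz: "real (L z) \<le> e * real n + real (card (A \<times> B))" using SM by (simp add: algebra_simps)
      have "p z \<le> (\<Sum>z\<in>A \<times> B. p z)" using z fin p(1) by (intro member_le_sum) auto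
      then have pz: "p z \<le> 1" using p(2) by simp
      have "e * p z \<le> e * 1" using e pz by (intro mult_left_mono) auto
      then have "real n * (e * p z) \<le> real n * e" using n by (intro mult_left_mono) auto
      then have low: "real n * p z - real n * e - 1 \<le> real (M z + L z)"
        using M1(2)[of z] by (simp add: algebra_simps)
      have "0 \<le> real n * (e * p z)" using n e p(1) by simp
      then have up: "real (M z + L z) \<le> real n * p z + e * real n + real (card (A \<times> B))"
        using M1(1)[of z] Lz by (simp add: algebra_simps)
      have "p z - e - 1 / real n \<le> real (M z + L z) / real n"
        using divide_right_mono[OF low, of "real n"] n by (simp add: diff_divide_distrib)
      moreover have "real (M z + L z) / real n \<le> p z + e + real (card (A \<times> B)) / real n"
        using divide_right_mono[OF up, of "real n"] n by (simp add: add_divide_distrib)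
      moreover have "1 / real n \<le> d / 2" "real (card (A \<times> B)) / real n \<le> d / 2"
      proof -
        have "1 / real n \<le> (real (card (A \<times> B)) + 1) / real n" "real (card (A \<times> B)) / real n \<le> (real (card (A \<times> B)) + 1) / real n"
          using n by (intro divide_right_mono; simp)+
        then show "1 / real n \<le> d / 2" "real (card (A \<times> B)) / real n \<le> d / 2" using elim(3) by linarith+
      qed
      ultimately show ?thesis using e(3) by linarith
    qed
    then show ?case using L rle cle by (intro exI[of _ "\<lambda>z. M z + L z"]) (auto simp: sum.distrib)
  qed
qed

text \<open>Bolzano-Weierstrass one coordinate at a time, refining the subsequence.\<close>

lemma finite_bounded_convergent_subseq:
  fixes f :: "nat \<Rightarrow> 'z \<Rightarrow> real"
  assumes "finite Z" "\<And>n z. \<bar>f n z\<bar> \<le> C"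
  shows "\<exists>s q. strict_mono (s :: nat \<Rightarrow> nat) \<and> (\<forall>z\<in>Z. (\<lambda>n. f (s n) z) \<longlonglongrightarrow> q z)"
  using assms(1)
proof induction
  case empty
  show ?case by (intro exI[of _ id]) (auto simp: strict_mono_id)
next
  case (insert z Z)
  then obtain s q where s: "strict_mono (s :: nat \<Rightarrow> nat)" "\<And>y. y \<in> Z \<Longrightarrow> (\<lambda>n. f (s n) y) \<longlonglongrightarrow> q y" by auto
  have "bounded (range (\<lambda>n. f (s n) z))" using assms(2) by (auto simp: bounded_iff)
  then obtain t L where t: "strict_mono (t :: nat \<Rightarrow> nat)" "((\<lambda>n. f (s n) z) \<circ> t) \<longlonglongrightarrow> L"
    using bounded_imp_convergent_subsequence by blast
  have "\<forall>y\<in>insert z Z. (\<lambda>n. f ((s \<circ> t) n) y) \<longlonglongrightarrow> (if y = z then L else q y)"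
    using t(2) LIMSEQ_subseq_LIMSEQ[OF s(2) t(1)] by (auto simp: comp_def)
  then show ?case using strict_mono_o[OF s(1) t(1)]
    by (intro exI[of _ "s \<circ> t"] exI[of _ "\<lambda>y. if y = z then L else q y"] conjI)
qed

section \<open>Cells of continuity\<close>

definition clamp01 :: "real \<Rightarrow> real" where "clamp01 t = min 1 (max 0 t)"

lemma clamp01_bounds: "0 \<le> clamp01 t" "clamp01 t \<le> 1"
  by (auto simp: clamp01_def)

lemma clamp01_lim_pos: "(\<lambda>k. clamp01 (real k * v)) \<longlonglongrightarrow> indicator {0<..} v"
proof (cases "0 < v")
  case True
  have "eventually (\<lambda>k. 1 / v < real k) sequentially"
    using filterlim_at_top_dense[THEN iffD1, OF filterlim_real_sequentially] by blast
  then have "eventually (\<lambda>k. clamp01 (real k * v) = 1) sequentially"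
    by eventually_elim (use True in \<open>auto simp: clamp01_def field_simps\<close>)
  then show ?thesis using True by (simp add: tendsto_eventually)
next
  case False
  then have "clamp01 (real k * v) = 0" for k by (simp add: clamp01_def mult_nonneg_nonpos)
  then show ?thesis using False by simp
qed

lemma clamp01_lim_nonneg: "(\<lambda>k. clamp01 (1 + real k * v)) \<longlonglongrightarrow> indicator {0..} v"
proof (cases "0 \<le> v")
  case True
  then have "clamp01 (1 + real k * v) = 1" for k by (simp add: clamp01_def)
  then show ?thesis using True by simp
next
  case False
  have "eventually (\<lambda>k. 1 / (- v) < real k) sequentially"
    using filterlim_at_top_dense[THEN iffD1, OF filterlim_real_sequentially] by blast
  then have "eventually (\<lambda>k. clamp01 (1 + real k * v) = 0) sequentially"
    by eventually_elim (use False in \<open>auto simp: clamp01_def field_simps\<close>)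
  then show ?thesis using False by (simp add: tendsto_eventually)
qed

context
  fixes \<mu> :: "'a::topological_space measure" and x :: "nat \<Rightarrow> nat \<Rightarrow> 'a"
  assumes \<mu>: "\<mu> \<in> M1 borel"
    and conv: "\<And>f. f \<in> bounded_continuous \<Longrightarrow> (\<lambda>n. (\<Sum>i=1..n. f (x n i)) / real n) \<longlonglongrightarrow> (\<integral>y. f y \<partial>\<mu>)"
begin

text \<open>The portmanteau theorem for sets squeezed between
  \<open>{y. \<forall>g\<in>G. 0 < v g y}\<close> and its version with \<open>\<le>\<close>.
  Products of clamped functions give continuous bounds from both sides, whose limits agree off the
  null sets where some \<open>v g\<close> vanishes.\<close>

lemma continuity_set_frequency:
  fixes v :: "'g \<Rightarrow> 'a \<Rightarrow> real"
  assumes G: "finite G" "\<And>g. g \<in> G \<Longrightarrow> continuous_on UNIV (v g)"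
    and null: "\<And>g. g \<in> G \<Longrightarrow> measure \<mu> {y. v g y = 0} = 0"
    and A: "A \<in> sets borel" "\<And>y. (\<And>g. g \<in> G \<Longrightarrow> 0 < v g y) \<Longrightarrow> y \<in> A" "\<And>y g. y \<in> A \<Longrightarrow> g \<in> G \<Longrightarrow> 0 \<le> v g y"
  shows "(\<lambda>n. real (card {i\<in>{1..n}. x n i \<in> A}) / real n) \<longlonglongrightarrow> measure \<mu> A"
proof -
  interpret prob_space \<mu> by (rule prob_space_M1_borel[OF \<mu>])
  have [simp]: "sets \<mu> = sets borel" by (rule sets_M1_borel[OF \<mu>])
  define lo where "lo k y = (\<Prod>g\<in>G. clamp01 (real k * v g y))" for k y
  define up where "up k y = (\<Prod>g\<in>G. clamp01 (1 + real k * v g y))" for k y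
  have bc: "lo k \<in> bounded_continuous" "up k \<in> bounded_continuous" for k
  proof -
    have "\<bar>lo k y\<bar> \<le> 1" "\<bar>up k y\<bar> \<le> 1" for y
      unfolding lo_def up_def abs_prod using clamp01_bounds by (auto intro!: prod_le_1)
    then show "lo k \<in> bounded_continuous" "up k \<in> bounded_continuous"
      unfolding bounded_continuous_def bounded_iff lo_def[abs_def] up_def[abs_def] clamp01_def
      using G by (auto intro!: continuous_intros)
  qed
  have bnd: "norm (lo k y) \<le> 1" "norm (up k y) \<le> 1" for k y
    unfolding lo_def up_def real_norm_def abs_prod using clamp01_bounds by (auto intro!: prod_le_1)
  have meas: "lo k \<in> borel_measurable \<mu>" "up k \<in> borel_measurable \<mu>" for k
    using bc[THEN bounded_continuous_measurable] by (simp_all cong: measurable_cong_sets)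
  have int: "integrable \<mu> (lo k)" "integrable \<mu> (up k)" for k
    using meas bnd by (auto intro!: integrable_const_bound[where B=1])
  have iA: "integrable \<mu> (indicator A :: 'a \<Rightarrow> real)" using A(1) by (simp add: emeasure_eq_measure)
  have le: "lo k y \<le> indicator A y" "indicator A y \<le> up k y" for k y
  proof -
    show "lo k y \<le> indicator A y"
    proof (cases "y \<in> A")
      case True
      then show ?thesis using bnd(1)[of k y] by simp
    next
      case False
      then obtain g where "g \<in> G" "v g y \<le> 0" using A(2) not_less by blast
      then have "clamp01 (real k * v g y) = 0" by (simp add: clamp01_def mult_nonneg_nonpos)
      then have "lo k y = 0" using \<open>g \<in> G\<close> G(1) by (auto simp: lo_def intro: prod_zero)
      then show ?thesis by simp
    qed
    show "indicator A y \<le> up k y"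
    proof (cases "y \<in> A")
      case True
      then have "clamp01 (1 + real k * v g y) = 1" if "g \<in> G" for g using A(3)[OF True that] by (simp add: clamp01_def)
      then show ?thesis by (simp add: up_def)
    next
      case False
      then show ?thesis using clamp01_bounds by (simp add: up_def prod_nonneg)
    qed
  qed
  have AEne: "AE y in \<mu>. \<forall>g\<in>G. v g y \<noteq> 0"
  proof (rule AE_finite_allI[OF G(1)])
    fix g assume g: "g \<in> G"
    have "v g \<in> borel_measurable \<mu>"
      using borel_measurable_continuous_onI[OF G(2)[OF g]] by (simp cong: measurable_cong_sets)
    then have "{y\<in>space \<mu>. v g y = 0} \<in> sets \<mu>" by measurable
    then show "AE y in \<mu>. v g y \<noteq> 0"
      using null[OF g] space_M1_borel[OF \<mu>] by (subst AE_iff_measurable[of "{y. v g y = 0}"]) (auto simp: emeasure_eq_measure)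
  qed
  have "(\<lambda>k. \<integral>y. up k y - lo k y \<partial>\<mu>) \<longlonglongrightarrow> (\<integral>y. 0 \<partial>\<mu>)"
  proof (rule integral_dominated_convergence[where w="\<lambda>_. 2"])
    show "AE y in \<mu>. (\<lambda>k. up k y - lo k y) \<longlonglongrightarrow> 0"
      using AEne
    proof eventually_elim
      case (elim y)
      have "(\<lambda>k. up k y - lo k y) \<longlonglongrightarrow> (\<Prod>g\<in>G. indicator {0..} (v g y)) - (\<Prod>g\<in>G. indicator {0<..} (v g y))"
        unfolding up_def lo_def by (intro tendsto_intros clamp01_lim_pos clamp01_lim_nonneg)
      moreover have "(\<Prod>g\<in>G. indicator {0..} (v g y)) = (\<Prod>g\<in>G. indicator {0<..} (v g y) :: real)"
        using elim by (intro prod.cong) (auto simp: indicator_def)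
      ultimately show ?case by simp
    qed
    show "AE y in \<mu>. norm (up k y - lo k y) \<le> 2" for k
    proof (rule AE_I2)
      fix y show "norm (up k y - lo k y) \<le> 2" using bnd[of k y] unfolding real_norm_def by arith
    qed
  qed (use meas in auto)
  then have gap: "(\<lambda>k. (\<integral>y. up k y \<partial>\<mu>) - (\<integral>y. lo k y \<partial>\<mu>)) \<longlonglongrightarrow> 0" using int by simp
  show ?thesis
  proof (rule tendstoI)
    fix e :: real assume "0 < e"
    obtain k where k: "(\<integral>y. up k y \<partial>\<mu>) - (\<integral>y. lo k y \<partial>\<mu>) < e / 2"
      using order_tendstoD(2)[OF gap, of "e / 2"] \<open>0 < e\<close> by (auto simp: eventually_sequentially)
    have I: "(\<integral>y. lo k y \<partial>\<mu>) \<le> measure \<mu> A" "measure \<mu> A \<le> (\<integral>y. up k y \<partial>\<mu>)"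
      using integral_mono[OF int(1) iA le(1)] integral_mono[OF iA int(2) le(2)] A(1) by auto
    have "\<forall>\<^sub>F n in sequentially. (\<integral>y. lo k y \<partial>\<mu>) - e / 2 < (\<Sum>i=1..n. lo k (x n i)) / real n"
      using \<open>0 < e\<close> by (intro order_tendstoD(1)[OF conv[OF bc(1)]]) auto
    moreover have "\<forall>\<^sub>F n in sequentially. (\<Sum>i=1..n. up k (x n i)) / real n < (\<integral>y. up k y \<partial>\<mu>) + e / 2"
      using \<open>0 < e\<close> by (intro order_tendstoD(2)[OF conv[OF bc(2)]]) auto
    ultimately show "\<forall>\<^sub>F n in sequentially. dist (real (card {i\<in>{1..n}. x n i \<in> A}) / real n) (measure \<mu> A) < e"
    proof eventually_elim
      case (elim n)
      have "real (card {i\<in>{1..n}. x n i \<in> A}) = (\<Sum>i=1..n. indicator A (x n i))"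
        by (simp add: indicator_def sum.If_cases Int_def)
      then have "(\<Sum>i=1..n. lo k (x n i)) \<le> real (card {i\<in>{1..n}. x n i \<in> A})"
        "real (card {i\<in>{1..n}. x n i \<in> A}) \<le> (\<Sum>i=1..n. up k (x n i))"
        using le by (simp_all add: sum_mono)
      then have "(\<Sum>i=1..n. lo k (x n i)) / real n \<le> real (card {i\<in>{1..n}. x n i \<in> A}) / real n"
        "real (card {i\<in>{1..n}. x n i \<in> A}) / real n \<le> (\<Sum>i=1..n. up k (x n i)) / real n"
        by (simp_all add: divide_right_mono)
      then show ?case using elim I k unfolding dist_real_def by linarith
    qed
  qed
qed

end

text \<open>
  The cells are the joint level strips of the test functions. Their corners are shifted off the
  countably many values that some test function takes with positive probability.
\<close>

definition cell_label :: "('a \<Rightarrow> real) set \<Rightarrow> real \<Rightarrow> real \<Rightarrow> 'a \<Rightarrow> ('a \<Rightarrow> real) \<Rightarrow> int" where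
  "cell_label G s d y = restrict (\<lambda>g. \<lfloor>(g y - s) / d\<rfloor>) G"

lemma cell_label_approx:
  assumes "g \<in> G" "0 < d" shows "\<bar>g y - (s + d * of_int (cell_label G s d y g))\<bar> \<le> d"
proof -
  define q where "q = (g y - s) / d"
  have q: "g y - s = q * d" using assms(2) by (simp add: q_def)
  have "of_int \<lfloor>q\<rfloor> * d \<le> q * d" "q * d \<le> (of_int \<lfloor>q\<rfloor> + 1) * d"
    using assms(2) by (intro mult_right_mono; linarith)+
  then show ?thesis using assms q by (simp add: cell_label_def q_def[symmetric] algebra_simps)
qed

lemma measurable_cell_label:
  fixes G :: "('a::topological_space \<Rightarrow> real) set"
  assumes "G \<subseteq> bounded_continuous" "finite G" shows "{y. cell_label G s d y = b} \<in> sets borel"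
proof (cases "b \<in> extensional G")
  case True
  have eq: "{y. cell_label G s d y = b} = {y\<in>space borel. \<forall>g\<in>G. \<lfloor>(g y - s) / d\<rfloor> = b g}"
    using True by (auto simp: cell_label_def fun_eq_iff extensional_def)
  have "{y\<in>space borel. \<lfloor>(g y - s) / d\<rfloor> = b g} \<in> sets borel" if "g \<in> G" for g
  proof -
    have [measurable]: "g \<in> borel_measurable borel"
      using that assms bounded_continuous_measurable by blast
    show ?thesis by measurable
  qed
  then show ?thesis unfolding eq by (intro sets.sets_Collect_finite_All assms(2))
next
  case False
  then have "{y. cell_label G s d y = b} = {}" by (auto simp: cell_label_def)
  then show ?thesis by simp
qed

lemma cell_shift_exists:
  fixes \<mu> :: "'a::topological_space measure"
  assumes \<mu>: "\<mu> \<in> M1 borel" and G: "finite G" "G \<subseteq> bounded_continuous" and "0 < d"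
  obtains s where "\<And>g z. g \<in> G \<Longrightarrow> measure \<mu> {y. (g y - s) / d = of_int z} = 0"
proof -
  interpret prob_space \<mu> by (rule prob_space_M1_borel[OF \<mu>])
  \<comment> \<open>A shift is bad if it makes an atom of the law of some test function a corner
    \<open>s + d * z\<close>. Bad shifts are countable, the reals are not.\<close>
  define bad where "bad = (\<Union>g\<in>G. \<Union>z::int. (\<lambda>c. c - d * of_int z) ` {c. measure (distr \<mu> borel g) {c} \<noteq> 0})"
  have gm: "g \<in> borel_measurable \<mu>" if "g \<in> G" for g
    using bounded_continuous_measurable[of g] that G(2) sets_M1_borel[OF \<mu>] by (auto cong: measurable_cong_sets)
  have "countable {c. measure (distr \<mu> borel g) {c} \<noteq> 0}" if "g \<in> G" for g
    using finite_measure.countable_support[OF prob_space.finite_measure[OF prob_space_distr[OF gm[OF that]]]] .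
  then have "countable bad" unfolding bad_def using G(1) by (intro countable_UN) (auto intro: countable_finite)
  then have "bad \<noteq> UNIV" using uncountable_UNIV_real by auto
  then obtain s where s: "s \<notin> bad" by auto
  show thesis
  proof (rule that)
    fix g z assume g: "g \<in> G"
    show "measure \<mu> {y. (g y - s) / d = of_int z} = 0"
    proof -
      have "measure (distr \<mu> borel g) {s + d * of_int z} = 0"
      proof (rule ccontr)
        assume "measure (distr \<mu> borel g) {s + d * of_int z} \<noteq> 0"
        then have "s \<in> bad" unfolding bad_def using g by (force intro!: bexI[of _ g] exI[of _ z] image_eqI[where x="s + d * of_int z"])
        then show False using s by simp
      qed
      moreover have "{y. (g y - s) / d = of_int z} = g -` {s + d * of_int z} \<inter> space \<mu>"
        using \<open>0 < d\<close> space_M1_borel[OF \<mu>] by (auto simp: field_simps)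
      ultimately show ?thesis using gm[OF g] by (simp add: measure_distr)
    qed
  qed
qed

lemma cell_frequency:
  fixes \<mu> :: "'a::topological_space measure" and x :: "nat \<Rightarrow> nat \<Rightarrow> 'a"
  assumes \<mu>: "\<mu> \<in> M1 borel"
    and conv: "\<And>f. f \<in> bounded_continuous \<Longrightarrow> (\<lambda>n. (\<Sum>i=1..n. f (x n i)) / real n) \<longlonglongrightarrow> (\<integral>y. f y \<partial>\<mu>)"
    and G: "finite G" "G \<subseteq> bounded_continuous" and "0 < d"
    and s: "\<And>g z. g \<in> G \<Longrightarrow> measure \<mu> {y. (g y - s) / d = of_int z} = 0"
  shows "(\<lambda>n. real (class_size (\<lambda>i. cell_label G s d (x n i)) {1..n} b) / real n)
    \<longlonglongrightarrow> measure \<mu> {y. cell_label G s d y = b}"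
proof (cases "b \<in> extensional G")
  case False
  then have "{y. cell_label G s d y = b} = {}" "\<And>n. {i\<in>{1..n}. cell_label G s d (x n i) = b} = {}"
    by (auto simp: cell_label_def)
  then show ?thesis unfolding class_size_def by simp
next
  case True
  interpret prob_space \<mu> by (rule prob_space_M1_borel[OF \<mu>])
  \<comment> \<open>The signed distance, in units of \<open>d\<close>, to the nearer end of the
    strip: positive inside, nonnegative on the half-open strip, zero only at corners.\<close>
  define v where "v g y = min ((g y - s) / d - of_int (b g)) (of_int (b g) + 1 - (g y - s) / d)" for g y
  have "(\<lambda>n. real (card {i\<in>{1..n}. x n i \<in> {y. cell_label G s d y = b}}) / real n)
    \<longlonglongrightarrow> measure \<mu> {y. cell_label G s d y = b}"
  proof (rule continuity_set_frequency[OF \<mu> conv G(1), of v])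
    fix g assume g: "g \<in> G"
    then have cont: "continuous_on UNIV g" using G(2) by (auto simp: bounded_continuous_def)
    then show "continuous_on UNIV (v g)" unfolding v_def using \<open>0 < d\<close> by (intro continuous_intros) auto
    have gm[measurable]: "g \<in> borel_measurable borel" by (rule borel_measurable_continuous_onI[OF cont])
    have m: "{y. (g y - s) / d = of_int z} \<in> sets borel" for z by measurable
    have "measure \<mu> {y. v g y = 0} \<le> measure \<mu> ({y. (g y - s) / d = of_int (b g)} \<union> {y. (g y - s) / d = of_int (b g + 1)})"
      using m sets_M1_borel[OF \<mu>] by (intro finite_measure_mono) (auto simp: v_def min_def split: if_splits)
    also have "\<dots> \<le> 0"
      using measure_Un_le[of "{y. (g y - s) / d = of_int (b g)}" \<mu> "{y. (g y - s) / d = of_int (b g + 1)}"]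
        m sets_M1_borel[OF \<mu>] s[OF g, of "b g"] s[OF g, of "b g + 1"] by simp
    finally show "measure \<mu> {y. v g y = 0} = 0" using measure_nonneg[of \<mu> "{y. v g y = 0}"] by linarith
  next
    show "{y. cell_label G s d y = b} \<in> sets borel" by (rule measurable_cell_label[OF G(2,1)])
    fix y assume "\<And>g. g \<in> G \<Longrightarrow> 0 < v g y"
    then have "\<lfloor>(g y - s) / d\<rfloor> = b g" if "g \<in> G" for g
      using that by (intro floor_unique) (force simp: v_def)+
    then show "y \<in> {y. cell_label G s d y = b}"
      using True by (auto simp: cell_label_def fun_eq_iff extensional_def)
  next
    fix y g assume "y \<in> {y. cell_label G s d y = b}" "g \<in> G"
    then have "\<lfloor>(g y - s) / d\<rfloor> = b g" by (auto simp: cell_label_def)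
    then show "0 \<le> v g y" unfolding v_def by linarith
  qed
  then show ?thesis by (simp add: class_size_def)
qed

lemma cell_label_range:
  fixes G :: "('a::topological_space \<Rightarrow> real) set"
  assumes G: "finite G" "G \<subseteq> bounded_continuous" and "0 < d"
  obtains L where "finite L" "\<And>y. cell_label G s d y \<in> L"
proof -
  have "\<exists>B. \<forall>y. \<bar>g y\<bar> \<le> B" if "g \<in> G" for g
    using bounded_continuous_bounded[of g] that G(2) by blast
  then obtain B where B: "\<And>g y. g \<in> G \<Longrightarrow> \<bar>g y\<bar> \<le> B g" by metis
  let ?L = "PiE G (\<lambda>g. {\<lfloor>(- B g - s) / d\<rfloor>..\<lfloor>(B g - s) / d\<rfloor>})"
  show thesis
  proof (rule that[of ?L])
    show "finite ?L" using G(1) by (intro finite_PiE) auto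
    show "cell_label G s d y \<in> ?L" for y
    proof -
      have "\<lfloor>(- B g - s) / d\<rfloor> \<le> \<lfloor>(g y - s) / d\<rfloor> \<and> \<lfloor>(g y - s) / d\<rfloor> \<le> \<lfloor>(B g - s) / d\<rfloor>" if "g \<in> G" for g
        using B[OF that, of y] \<open>0 < d\<close> by (auto intro!: floor_mono divide_right_mono simp: abs_le_iff)
      then show ?thesis by (auto simp: cell_label_def)
    qed
  qed
qed

section \<open>Blocks of the unit interval\<close>

text \<open>The ceiling makes the blocks open on the left and closed on the right, in line with the
  left continuity of quantiles; for \<open>k = n\<close> the point \<open>j / n\<close> belongs to
  block \<open>j\<close>.\<close>

definition blk :: "nat \<Rightarrow> real \<Rightarrow> nat" where "blk k u = nat \<lceil>real k * u\<rceil>"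

lemma blk_eq_iff:
  assumes "1 \<le> k" "1 \<le> a" shows "blk k u = a \<longleftrightarrow> (real a - 1) / real k < u \<and> u \<le> real a / real k"
proof -
  have "blk k u = a \<longleftrightarrow> \<lceil>real k * u\<rceil> = int a" using assms(2) by (auto simp: blk_def)
  also have "\<dots> \<longleftrightarrow> real a - 1 < real k * u \<and> real k * u \<le> real a" by (simp add: ceiling_eq_iff)
  also have "\<dots> \<longleftrightarrow> (real a - 1) / real k < u \<and> u \<le> real a / real k"
    using assms(1) by (simp add: divide_less_eq le_divide_eq mult.commute)
  finally show ?thesis .
qed

lemma blk_range: "1 \<le> k \<Longrightarrow> 0 < u \<Longrightarrow> u \<le> 1 \<Longrightarrow> blk k u \<in> {1..k}"
proof -
  assume h: "1 \<le> k" "0 < u" "u \<le> 1"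
  have "0 < real k * u" "real k * u \<le> real k" using h mult_left_mono[of u 1 "real k"] by auto
  then have "0 < \<lceil>real k * u\<rceil>" "\<lceil>real k * u\<rceil> \<le> int k" by (auto simp: ceiling_le_iff)
  moreover have "nat c \<in> {1..k}" if "0 < c" "c \<le> int k" for c using that by auto
  ultimately show ?thesis unfolding blk_def by blast
qed

lemma blk_mono: "u \<le> v \<Longrightarrow> blk k u \<le> blk k v"
  unfolding blk_def by (intro nat_mono ceiling_mono mult_left_mono) auto

lemma measurable_blk: "blk k \<in> unit_interval \<rightarrow>\<^sub>M count_space UNIV"
proof -
  have "(\<lambda>u::real. \<lceil>real k * u\<rceil>) \<in> borel \<rightarrow>\<^sub>M count_space UNIV" by measurable
  then have "(\<lambda>u. nat \<lceil>real k * u\<rceil>) \<in> borel \<rightarrow>\<^sub>M count_space UNIV" by measurable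
  then show ?thesis unfolding blk_def[abs_def] by (intro measurable_restrict_space1) simp
qed

text \<open>The last block would contain the end point 1, which the open interval omits; it is a
  null set.\<close>

lemma emeasure_block:
  assumes "1 \<le> k" "a \<in> {1..k}"
  shows "emeasure unit_interval {u\<in>{0<..<1}. blk k u = a} = ennreal (1 / real k)"
proof -
  have a: "1 \<le> a" "a \<le> k" using assms by auto
  have k: "0 < real k" using assms by simp
  have "0 \<le> (real a - 1) / real k" "real a / real k \<le> 1" using a k by simp_all
  have eq: "{u\<in>{0<..<1}. blk k u = a} = {(real a - 1) / real k<..real a / real k} \<inter> {0<..<1}"
    by (intro set_eqI) (simp only: blk_eq_iff[OF assms(1) a(1)] mem_Collect_eq Int_iff greaterThanAtMost_iff conj_commute)
  have "emeasure unit_interval {u\<in>{0<..<1}. blk k u = a} = emeasure lborel ({(real a - 1) / real k<..real a / real k} \<inter> {0<..<1})"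
    unfolding eq by (subst emeasure_restrict_space) auto
  also have "\<dots> = emeasure lborel {(real a - 1) / real k<..real a / real k}"
  proof (rule emeasure_eq_AE)
    have "AE u in lborel. u \<noteq> (1::real)" by (rule AE_lborel_singleton)
    then show "AE u in lborel. u \<in> {(real a - 1) / real k<..real a / real k} \<inter> {0<..<1} \<longleftrightarrow> u \<in> {(real a - 1) / real k<..real a / real k}"
    proof eventually_elim
      case (elim u)
      have "u \<in> {l<..h} \<inter> {0<..<1} \<longleftrightarrow> u \<in> {l<..h}" if "0 \<le> l" "h \<le> 1" for l h :: real
        using that elim by auto
      then show ?case using \<open>0 \<le> (real a - 1) / real k\<close> \<open>real a / real k \<le> 1\<close> by blast
    qed
  qed auto
  also have "\<dots> = ennreal (1 / real k)"
    using k by (simp add: divide_right_mono diff_divide_distrib[symmetric])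
  finally show ?thesis .
qed

lemma nn_integral_blocks:
  fixes \<psi> :: "nat \<Rightarrow> ennreal"
  assumes "1 \<le> k"
  shows "(\<integral>\<^sup>+u. \<psi> (blk k u) \<partial>unit_interval) = (\<Sum>a=1..k. \<psi> a * ennreal (1 / real k))"
proof -
  have m: "{u\<in>{0<..<1}. blk k u = a} \<in> sets unit_interval" for a
  proof -
    have "{u\<in>{0<..<1}. blk k u = a} = blk k -` {a} \<inter> space unit_interval" by (auto simp: space_unit_interval)
    then show ?thesis using measurable_sets[OF measurable_blk, of "{a}" k] by simp
  qed
  have "(\<integral>\<^sup>+u. \<psi> (blk k u) \<partial>unit_interval) = (\<integral>\<^sup>+u. (\<Sum>a=1..k. \<psi> a * indicator {u\<in>{0<..<1}. blk k u = a} u) \<partial>unit_interval)"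
  proof (rule nn_integral_cong)
    fix u assume "u \<in> space unit_interval"
    then have u: "0 < u" "u < 1" by (auto simp: space_unit_interval)
    have "(\<Sum>a=1..k. \<psi> a * indicator {u\<in>{0<..<1}. blk k u = a} u) = (\<Sum>a=1..k. if a = blk k u then \<psi> a else 0)"
      using u by (intro sum.cong) (auto simp: indicator_def)
    also have "\<dots> = \<psi> (blk k u)" using blk_range[OF assms, of u] u by auto
    finally show "\<psi> (blk k u) = (\<Sum>a=1..k. \<psi> a * indicator {u\<in>{0<..<1}. blk k u = a} u)" by simp
  qed
  also have "\<dots> = (\<Sum>a=1..k. \<integral>\<^sup>+u. \<psi> a * indicator {u\<in>{0<..<1}. blk k u = a} u \<partial>unit_interval)"
    using m by (intro nn_integral_sum borel_measurable_times_ennreal) auto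
  also have "\<dots> = (\<Sum>a=1..k. \<psi> a * ennreal (1 / real k))"
    using m emeasure_block[OF assms] by (intro sum.cong) (auto simp: nn_integral_cmult_indicator)
  finally show ?thesis .
qed

lemma sum_ennreal_mult_inverse:
  assumes "\<And>j. j \<in> A \<Longrightarrow> 0 \<le> D j"
  shows "(\<Sum>j\<in>A. ennreal (D j) * ennreal (1 / real n)) = ennreal (\<Sum>j\<in>A. D j / real n)"
  using assms by (subst sum_ennreal[symmetric]) (auto simp: ennreal_mult'[symmetric] intro!: sum.cong)

text \<open>Block \<open>a\<close> contains the \<open>j\<close> with
  \<open>n * (a - 1) < j * k \<le> n * a\<close>; their number is a difference of two integer
  quotients, each within 1 of its real value.\<close>

lemma block_frequency:
  assumes "1 \<le> k" "a \<in> {1..k}"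
  shows "(\<lambda>n. real (class_size (\<lambda>j. blk k (real j / real n)) {1..n} a) / real n) \<longlonglongrightarrow> 1 / real k"
proof -
  have a: "1 \<le> a" "a \<le> k" using assms by auto
  have k: "0 < real k" using assms by simp
  have eq: "class_size (\<lambda>j. blk k (real j / real n)) {1..n} a = n * a div k - n * (a - 1) div k" if n: "1 \<le> n" for n
  proof -
    have iff: "blk k (real j / real n) = a \<longleftrightarrow> n * (a - 1) div k < j \<and> j \<le> n * a div k" for j
    proof -
      have "blk k (real j / real n) = a \<longleftrightarrow> real n * (real a - 1) < real j * real k \<and> real j * real k \<le> real n * real a"
        using blk_eq_iff[OF assms(1) a(1)] k n by (auto simp: field_simps)
      also have "\<dots> \<longleftrightarrow> n * (a - 1) < j * k \<and> j * k \<le> n * a"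
      proof -
        have "real a - 1 = real (a - 1)" using a(1) by (simp add: of_nat_diff)
        then show ?thesis by (simp only: of_nat_mult[symmetric] of_nat_less_iff of_nat_le_iff)
      qed
      also have "\<dots> \<longleftrightarrow> n * (a - 1) div k < j \<and> j \<le> n * a div k"
        using assms(1) by (simp add: div_less_iff_less_mult less_eq_div_iff_mult_less_eq)
      finally show ?thesis .
    qed
    have "{j\<in>{1..n}. blk k (real j / real n) = a} = {n * (a - 1) div k<..n * a div k} \<inter> {1..n}"
      by (intro set_eqI) (simp only: iff mem_Collect_eq Int_iff greaterThanAtMost_iff conj_commute)
    also have "\<dots> = {n * (a - 1) div k<..n * a div k}"
    proof -
      have "n * a div k \<le> n * k div k" using a by (intro div_le_mono mult_le_mono2)
      then have "n * a div k \<le> n" using assms(1) by simp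
      then show ?thesis by auto
    qed
    finally show ?thesis by (simp add: class_size_def)
  qed
  have lim: "(\<lambda>n. real (n * c div k) / real n) \<longlonglongrightarrow> real c / real k" for c
  proof (rule LIM_zero_cancel, rule Lim_null_comparison[where g="\<lambda>n. 1 / real n"])
    have "norm (real (n * c div k) / real n - real c / real k) \<le> 1 / real n" if n: "1 \<le> n" for n
    proof -
      have "real (n * c div k) \<le> real n * real c / real k"
        using of_nat_div_le_of_nat[of "n * c" k] by simp
      moreover have "real n * real c / real k - real (n * c div k) \<le> 1"
      proof -
        have "n * c mod k < k" using assms(1) by simp
        then have "n * c \<le> k * (n * c div k + 1)"
          using mult_div_mod_eq[of k "n * c"] by (simp only: distrib_left mult_1_right)
        then have "real (n * c) \<le> real (k * (n * c div k + 1))" by (simp only: of_nat_le_iff)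
        then have "real n * real c \<le> (real (n * c div k) + 1) * real k"
          by (simp only: of_nat_mult of_nat_add of_nat_1 mult.commute)
        then show ?thesis using k by (simp add: pos_divide_le_eq diff_le_eq add.commute)
      qed
      ultimately have "\<bar>real (n * c div k) - real n * real c / real k\<bar> \<le> 1" by linarith
      moreover have "real (n * c div k) / real n - real c / real k = (real (n * c div k) - real n * real c / real k) / real n"
        using n by (simp add: diff_divide_distrib)
      ultimately show ?thesis using n by (simp add: divide_right_mono)
    qed
    then show "\<forall>\<^sub>F n in sequentially. norm (real (n * c div k) / real n - real c / real k) \<le> 1 / real n"
      by (auto simp: eventually_sequentially)
  qed (rule lim_1_over_n)
  have "(\<lambda>n. real (n * a div k) / real n - real (n * (a - 1) div k) / real n) \<longlonglongrightarrow> real a / real k - real (a - 1) / real k"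
    by (intro tendsto_diff lim)
  moreover have "real a / real k - real (a - 1) / real k = 1 / real k"
    using a by (simp add: of_nat_diff diff_divide_distrib)
  moreover have "\<forall>\<^sub>F n in sequentially. real (n * a div k) / real n - real (n * (a - 1) div k) / real n
    = real (class_size (\<lambda>j. blk k (real j / real n)) {1..n} a) / real n"
  proof -
    have le: "n * (a - 1) div k \<le> n * a div k" for n by (intro div_le_mono mult_le_mono2) simp
    show ?thesis
      using eventually_ge_at_top[of 1]
    proof eventually_elim
      case (elim n)
      show ?case unfolding eq[OF elim] of_nat_diff[OF le] by (rule diff_divide_distrib[symmetric])
    qed
  qed
  ultimately show ?thesis by (simp only: Lim_transform_eventually)
qed

section \<open>Order statistics and step approximation\<close>

lemma distribution_function_empirical:
  assumes "1 \<le> n" and w: "\<And>i. i \<in> {1..n} \<Longrightarrow> 0 \<le> w i"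
  shows "distribution_function (empirical Rplus n w) t = real (card {i\<in>{1..n}. w i \<le> t}) / real n"
proof -
  have "emeasure (empirical Rplus n w) {0..t} = (\<Sum>i=1..n. ennreal (1 / real n) * indicator {0..t} (w i))"
    unfolding empirical_def using w Icc_in_sets_Rplus
    by (subst emeasure_weighted_empirical) (auto simp: space_restrict_space)
  also have "\<dots> = (\<Sum>i=1..n. ennreal (if w i \<le> t then 1 / real n else 0))"
    using w by (intro sum.cong) (auto simp: indicator_def)
  also have "\<dots> = ennreal (\<Sum>i=1..n. if w i \<le> t then 1 / real n else 0)" by (intro sum_ennreal) auto
  also have "(\<Sum>i=1..n. if w i \<le> t then 1 / real n else 0) = real (card {i\<in>{1..n}. w i \<le> t}) / real n"
    by (simp add: sum.If_cases Int_def)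
  finally show ?thesis by (simp add: distribution_function_def measure_def)
qed

lemma empirical_in_M11:
  assumes "1 \<le> n" "w \<in> weight_simplex n"
  shows "empirical Rplus n w \<in> M11_Rplus"
proof -
  have w: "\<And>i. i \<in> {1..n} \<Longrightarrow> 0 \<le> w i" "(\<Sum>i=1..n. w i) = real n" using assms by (auto simp: weight_simplex_def)
  have "emeasure (empirical Rplus n w) (space Rplus) = (\<Sum>i=1..n. ennreal (1 / real n))"
    unfolding empirical_def using w
    by (subst emeasure_weighted_empirical[OF _ sets.top]) (auto simp: space_restrict_space indicator_def intro!: sum.cong)
  also have "\<dots> = 1" using assms(1) by (simp add: ennreal_of_nat_eq_real_of_nat flip: ennreal_mult)
  finally have ps: "prob_space (empirical Rplus n w)"
    by (intro prob_spaceI) (simp add: empirical_def weighted_empirical_def)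
  have "(\<lambda>y. ennreal y) \<in> borel_measurable Rplus" by (intro measurable_restrict_space1) measurable
  then have em: "ennreal \<in> borel_measurable (distr (point_measure {1..n} (\<lambda>i. ennreal (1 / real n))) Rplus w)" by simp
  have "(\<integral>\<^sup>+ y. ennreal y \<partial>empirical Rplus n w) = (\<integral>\<^sup>+ i. ennreal (w i) \<partial>point_measure {1..n} (\<lambda>i. ennreal (1 / real n)))"
    unfolding empirical_def weighted_empirical_def using w
    by (subst nn_integral_distr[OF _ em])
       (auto simp: measurable_def sets_point_measure space_point_measure space_restrict_space)
  also have "\<dots> = (\<Sum>i=1..n. ennreal (1 / real n) * ennreal (w i))"
    by (subst nn_integral_point_measure_finite) auto
  also have "\<dots> = (\<Sum>i=1..n. ennreal (w i) * ennreal (1 / real n))" by (simp add: mult.commute)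
  also have "\<dots> = ennreal (\<Sum>i=1..n. w i / real n)" using w(1) by (rule sum_ennreal_mult_inverse)
  also have "(\<Sum>i=1..n. w i / real n) = 1" using w assms(1) by (simp add: sum_divide_distrib[symmetric])
  finally have "(\<integral>\<^sup>+ y. ennreal y \<partial>empirical Rplus n w) = 1" by simp
  then show ?thesis using ps
    by (simp add: M11_Rplus_def space_prob_algebra empirical_def weighted_empirical_def)
qed

text \<open>By \<open>quantile_le_iff\<close> the claim is that \<open>blk n u\<close> is at most
  the number of weights below \<open>t\<close> exactly if \<open>w (blk n u) \<le> t\<close>, and
  for sorted weights the indices of these weights form an initial segment.\<close>

lemma quantile_empirical_sorted:
  assumes n: "1 \<le> n" and w: "w \<in> weight_simplex n" and sorted: "mono_on {1..n} w" and u: "0 < u" "u < 1"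
  shows "quantile (empirical Rplus n w) u = w (blk n u)"
proof -
  have w0: "\<And>i. i \<in> {1..n} \<Longrightarrow> 0 \<le> w i" using w by (auto simp: weight_simplex_def)
  have M1: "empirical Rplus n w \<in> M1 Rplus" by (rule M11_Rplus_subset[OF empirical_in_M11[OF n w]])
  have b: "blk n u \<in> {1..n}" using blk_range[OF n] u by simp
  have "quantile (empirical Rplus n w) u \<le> t \<longleftrightarrow> w (blk n u) \<le> t" for t
  proof -
    let ?C = "{i\<in>{1..n}. w i \<le> t}"
    have "quantile (empirical Rplus n w) u \<le> t \<longleftrightarrow> u \<le> real (card ?C) / real n"
      unfolding quantile_le_iff[OF M1 u] using distribution_function_empirical[OF n w0] by simp
    also have "\<dots> \<longleftrightarrow> real n * u \<le> real (card ?C)" using n by (simp add: field_simps)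
    also have "\<dots> \<longleftrightarrow> \<lceil>real n * u\<rceil> \<le> int (card ?C)" by (simp add: ceiling_le_iff)
    also have "\<dots> \<longleftrightarrow> blk n u \<le> card ?C" using u n by (simp add: blk_def nat_le_iff)
    also have "\<dots> \<longleftrightarrow> w (blk n u) \<le> t"
    proof
      assume le: "w (blk n u) \<le> t"
      have "i \<in> ?C" if "i \<in> {1..blk n u}" for i
      proof -
        have "w i \<le> w (blk n u)" using that b by (intro mono_onD[OF sorted]) auto
        then show ?thesis using le that b by auto
      qed
      then have "{1..blk n u} \<subseteq> ?C" by blast
      then have "card {1..blk n u} \<le> card ?C" by (intro card_mono) auto
      then show "blk n u \<le> card ?C" by simp
    next
      assume le: "blk n u \<le> card ?C"
      show "w (blk n u) \<le> t"
      proof (rule ccontr)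
        assume gt: "\<not> w (blk n u) \<le> t"
        have "i < blk n u" if "i \<in> ?C" for i
        proof (rule ccontr)
          assume "\<not> i < blk n u"
          then have "w (blk n u) \<le> w i" using that b by (intro mono_onD[OF sorted]) auto
          then show False using gt that by auto
        qed
        then have "?C \<subseteq> {1..<blk n u}" by auto
        then have "card ?C \<le> card {1..<blk n u}" by (intro card_mono) auto
        then show False using le b by auto
      qed
    qed
    finally show ?thesis .
  qed
  then show ?thesis by (meson order_antisym order_refl)
qed

text \<open>Truncate the quantile at \<open>m\<close>, then take its value at the right end of each
  block. On a block the error is at most the increase of \<open>T\<close> over that block, so the
  total telescopes to \<open>m / k\<close>.\<close>

lemma step_approximation:
  assumes "\<gamma> \<in> M11_Rplus" "0 < e"
  obtains k and M :: real and T :: "nat \<Rightarrow> real" where "1 \<le> k" "0 \<le> M" "mono T" "\<And>a. 0 \<le> T a" "\<And>a. T a \<le> M"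
    "(\<integral>\<^sup>+u. ennreal \<bar>quantile \<gamma> u - T (blk k u)\<bar> \<partial>unit_interval) \<le> ennreal e"
proof -
  have \<gamma>: "\<gamma> \<in> M1 Rplus" using assms(1) by (rule M11_Rplus_subset)
  obtain m :: nat where m: "(\<integral>\<^sup>+u. ennreal \<bar>quantile \<gamma> u - min (quantile \<gamma> u) (real m)\<bar> \<partial>unit_interval) \<le> ennreal (e / 2)"
    using quantile_truncation[OF assms(1), of "e / 2"] assms(2) by auto
  obtain k :: nat where k: "2 * real m / e + 1 < real k" using reals_Archimedean2 by blast
  have "0 \<le> 2 * real m / e" using assms(2) by simp
  then have "0 < real k" using k by linarith
  then have k1: "1 \<le> k" by simp
  have mk: "real m / real k \<le> e / 2"
  proof -
    have "2 * real m / e \<le> real k" using k by simp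
    then show ?thesis using assms(2) k1 by (simp add: field_simps)
  qed
  \<comment> \<open>\<open>T 0 = 0\<close> starts the telescoping sum; from block \<open>k\<close>
    on the cap \<open>m\<close> is used, as the right end 1 lies outside the domain of the
    quantile.\<close>
  define T where "T a = (if a = 0 then 0 else if a < k then min (quantile \<gamma> (real a / real k)) (real m) else real m)" for a
  have T0: "0 \<le> T a" "T a \<le> real m" for a using quantile_nonneg[of \<gamma>] by (auto simp: T_def)
  have "mono T"
  proof (rule monoI)
    fix a b :: nat assume ab: "a \<le> b"
    show "T a \<le> T b"
    proof (cases "a = 0 \<or> \<not> b < k")
      case True
      then show ?thesis using T0[of a] T0[of b] ab by (auto simp: T_def)
    next
      case False
      then have "quantile \<gamma> (real a / real k) \<le> quantile \<gamma> (real b / real k)"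
        using ab by (intro mono_onD[OF mono_on_quantile[OF \<gamma>]]) (auto simp: divide_right_mono)
      then show ?thesis using False ab by (auto simp: T_def)
    qed
  qed
  have between: "T (blk k u - 1) \<le> min (quantile \<gamma> u) (real m)" "min (quantile \<gamma> u) (real m) \<le> T (blk k u)"
    if u: "0 < u" "u < 1" for u
  proof -
    let ?a = "blk k u"
    have a: "?a \<in> {1..k}" using blk_range[OF k1] u by simp
    then have ab: "(real ?a - 1) / real k < u" "u \<le> real ?a / real k" using blk_eq_iff[OF k1, of ?a u] by auto
    show "T (?a - 1) \<le> min (quantile \<gamma> u) (real m)"
    proof (cases "?a - 1 = 0")
      case True then show ?thesis using quantile_nonneg[of \<gamma> u] by (simp add: T_def)
    next
      case False
      then have "quantile \<gamma> (real (?a - 1) / real k) \<le> quantile \<gamma> u"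
        using a ab u k1 by (intro mono_onD[OF mono_on_quantile[OF \<gamma>]]) (auto simp: of_nat_diff)
      then show ?thesis using False a by (auto simp: T_def)
    qed
    show "min (quantile \<gamma> u) (real m) \<le> T ?a"
    proof (cases "?a < k")
      case True
      then have "quantile \<gamma> u \<le> quantile \<gamma> (real ?a / real k)"
        using a ab u k1 by (intro mono_onD[OF mono_on_quantile[OF \<gamma>]]) auto
      then show ?thesis using True a by (auto simp: T_def)
    qed (use a in \<open>auto simp: T_def\<close>)
  qed
  note [measurable] = measurable_quantile_borel[OF \<gamma>] measurable_blk
  have Tm[measurable]: "(\<lambda>u. T (blk k u)) \<in> borel_measurable unit_interval" by measurable
  have "(\<integral>\<^sup>+u. ennreal \<bar>min (quantile \<gamma> u) (real m) - T (blk k u)\<bar> \<partial>unit_interval)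
    \<le> (\<integral>\<^sup>+u. ennreal (T (blk k u) - T (blk k u - 1)) \<partial>unit_interval)"
  proof (intro nn_integral_mono ennreal_leI)
    fix u assume "u \<in> space unit_interval"
    then have "0 < u" "u < 1" by (auto simp: space_unit_interval)
    from between[OF this] show "\<bar>min (quantile \<gamma> u) (real m) - T (blk k u)\<bar> \<le> T (blk k u) - T (blk k u - 1)"
      by linarith
  qed
  also have "\<dots> = (\<Sum>a=1..k. ennreal (T a - T (a - 1)) * ennreal (1 / real k))"
    by (rule nn_integral_blocks[OF k1])
  also have "\<dots> = ennreal (\<Sum>a=1..k. (T a - T (a - 1)) / real k)"
    using monoD[OF \<open>mono T\<close>] by (intro sum_ennreal_mult_inverse) auto
  also have "(\<Sum>a=1..k. (T a - T (a - 1)) / real k) = (T k - T 0) / real k"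
    using sum_telescope''[of 0 k T] by (simp add: sum_divide_distrib[symmetric] sum.atLeast1_atMost_eq)
  also have "ennreal ((T k - T 0) / real k) \<le> ennreal (e / 2)"
    using mk k1 by (intro ennreal_leI) (simp add: T_def)
  finally have 2: "(\<integral>\<^sup>+u. ennreal \<bar>min (quantile \<gamma> u) (real m) - T (blk k u)\<bar> \<partial>unit_interval) \<le> ennreal (e / 2)" .
  have "(\<integral>\<^sup>+u. ennreal \<bar>quantile \<gamma> u - T (blk k u)\<bar> \<partial>unit_interval)
    \<le> (\<integral>\<^sup>+u. ennreal \<bar>quantile \<gamma> u - min (quantile \<gamma> u) (real m)\<bar> + ennreal \<bar>min (quantile \<gamma> u) (real m) - T (blk k u)\<bar> \<partial>unit_interval)"
    by (intro nn_integral_mono) (auto simp: ennreal_plus[symmetric] simp del: ennreal_plus intro!: ennreal_leI)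
  also have "\<dots> \<le> ennreal (e / 2) + ennreal (e / 2)"
    using m 2 by (subst nn_integral_add) (auto intro: add_mono)
  also have "\<dots> = ennreal e" using assms(2) by (simp flip: ennreal_plus)
  finally show thesis using that[OF k1 _ \<open>mono T\<close> T0] by simp
qed

text \<open>The three errors are the distance of \<gamma> from the sample, the step approximation,
  and the replacement of a level \<open>u\<close> by the right end \<open>j / n\<close> of its block
  of length \<open>1 / n\<close>. The last one telescopes, since \<open>T\<close> is increasing, and
  is at most \<open>M / n\<close>.\<close>

lemma sorted_weights_step_approx:
  assumes n: "1 \<le> n" and w: "w \<in> weight_simplex n" and sorted: "mono_on {1..n} w"
    and \<gamma>: "\<gamma> \<in> M11_Rplus" and r: "cdf_dist \<gamma> (empirical Rplus n w) \<le> ennreal r" "0 \<le> r"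
    and k: "1 \<le> k" and T: "mono T" "\<And>a. 0 \<le> T a" "\<And>a. T a \<le> M" and "0 \<le> e"
    and approx: "(\<integral>\<^sup>+u. ennreal \<bar>quantile \<gamma> u - T (blk k u)\<bar> \<partial>unit_interval) \<le> ennreal e"
  shows "(\<Sum>j=1..n. \<bar>w j - T (blk k (real j / real n))\<bar>) / real n \<le> r + e + M / real n"
proof -
  have \<gamma>1: "\<gamma> \<in> M1 Rplus" using \<gamma> by (rule M11_Rplus_subset)
  have w1: "empirical Rplus n w \<in> M1 Rplus" by (rule M11_Rplus_subset[OF empirical_in_M11[OF n w]])
  note [measurable] = measurable_quantile_borel[OF \<gamma>1] measurable_quantile_borel[OF w1] measurable_blk
  have M: "0 \<le> M" using T(2,3) order_trans by blast
  let ?S = "\<lambda>j. T (blk k (real j / real n))"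
  have "ennreal ((\<Sum>j=1..n. \<bar>w j - ?S j\<bar>) / real n) = (\<Sum>j=1..n. ennreal \<bar>w j - ?S j\<bar> * ennreal (1 / real n))"
    unfolding sum_divide_distrib by (rule sum_ennreal_mult_inverse[symmetric]) simp
  also have "\<dots> = (\<integral>\<^sup>+u. ennreal \<bar>w (blk n u) - ?S (blk n u)\<bar> \<partial>unit_interval)"
    by (rule nn_integral_blocks[OF n, symmetric])
  also have "\<dots> \<le> (\<integral>\<^sup>+u. ennreal \<bar>quantile \<gamma> u - quantile (empirical Rplus n w) u\<bar> + ennreal \<bar>quantile \<gamma> u - T (blk k u)\<bar>
    + ennreal (?S (blk n u) - ?S (blk n u - 1)) \<partial>unit_interval)"
  proof (rule nn_integral_mono)
    fix u assume "u \<in> space unit_interval"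
    then have u: "0 < u" "u < 1" by (auto simp: space_unit_interval)
    let ?j = "blk n u"
    have j: "?j \<in> {1..n}" using blk_range[OF n] u by simp
    have jb: "(real ?j - 1) / real n < u" "u \<le> real ?j / real n" using blk_eq_iff[OF n, of ?j u] j by auto
    have "real (?j - 1) / real n \<le> u" using jb(1) j by (simp add: of_nat_diff)
    then have "?S (?j - 1) \<le> T (blk k u)" "T (blk k u) \<le> ?S ?j"
      using jb(2) by (auto intro!: monoD[OF T(1)] blk_mono)
    moreover have "quantile (empirical Rplus n w) u = w ?j" by (rule quantile_empirical_sorted[OF n w sorted u])
    ultimately have "\<bar>w ?j - ?S ?j\<bar> \<le> \<bar>quantile \<gamma> u - quantile (empirical Rplus n w) u\<bar> + \<bar>quantile \<gamma> u - T (blk k u)\<bar>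
      + (?S ?j - ?S (?j - 1))" and nn: "0 \<le> ?S ?j - ?S (?j - 1)" by linarith+
    then show "ennreal \<bar>w ?j - ?S ?j\<bar> \<le> ennreal \<bar>quantile \<gamma> u - quantile (empirical Rplus n w) u\<bar> + ennreal \<bar>quantile \<gamma> u - T (blk k u)\<bar>
      + ennreal (?S ?j - ?S (?j - 1))"
    proof -
      have "ennreal y \<le> ennreal a + ennreal b + ennreal c" if "y \<le> a + b + c" "0 \<le> a" "0 \<le> b" "0 \<le> c" for y a b c
        using that by (simp add: ennreal_leI flip: ennreal_plus)
      from this[OF _ abs_ge_zero abs_ge_zero nn] show ?thesis
        using \<open>\<bar>w ?j - ?S ?j\<bar> \<le> _\<close> by blast
    qed
  qed
  also have "\<dots> = cdf_dist \<gamma> (empirical Rplus n w) + (\<integral>\<^sup>+u. ennreal \<bar>quantile \<gamma> u - T (blk k u)\<bar> \<partial>unit_interval)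
    + (\<integral>\<^sup>+u. ennreal (?S (blk n u) - ?S (blk n u - 1)) \<partial>unit_interval)"
    by (simp add: nn_integral_add nn_integral_abs_diff_eq_cdf_dist[OF \<gamma>1 w1])
  also have "(\<integral>\<^sup>+u. ennreal (?S (blk n u) - ?S (blk n u - 1)) \<partial>unit_interval)
    = (\<Sum>j=1..n. ennreal (?S j - ?S (j - 1)) * ennreal (1 / real n))"
    by (rule nn_integral_blocks[OF n])
  also have "\<dots> = ennreal (\<Sum>j=1..n. (?S j - ?S (j - 1)) / real n)"
  proof -
    have nn: "0 \<le> ?S j - ?S (j - 1)" for j
      by (simp add: monoD[OF T(1)] blk_mono divide_right_mono)
    then show ?thesis by (rule sum_ennreal_mult_inverse)
  qed
  also have "(\<Sum>j=1..n. (?S j - ?S (j - 1)) / real n) = (?S n - ?S 0) / real n"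
    using sum_telescope''[of 0 n ?S] by (simp add: sum_divide_distrib[symmetric] sum.atLeast1_atMost_eq)
  also have "cdf_dist \<gamma> (empirical Rplus n w) + (\<integral>\<^sup>+u. ennreal \<bar>quantile \<gamma> u - T (blk k u)\<bar> \<partial>unit_interval)
    + ennreal ((?S n - ?S 0) / real n) \<le> ennreal r + ennreal e + ennreal (M / real n)"
  proof (intro add_mono r(1) approx ennreal_leI divide_right_mono)
    show "?S n - ?S 0 \<le> M" using T(2)[of "blk k (real 0 / real n)"] T(3)[of "blk k (real n / real n)"] by linarith
  qed simp
  also have "\<dots> = ennreal (r + e + M / real n)" using r(2) \<open>0 \<le> e\<close> M by (simp flip: ennreal_plus)
  finally show ?thesis
    by (rule iffD1[OF ennreal_le_iff, rotated]) (use r(2) \<open>0 \<le> e\<close> M in simp)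
qed

section \<open>Discretized couplings\<close>

text \<open>The index lists the label first and the block second, as \<open>table_of\<close> does,
  while in the coupling the unit interval comes first.\<close>

definition pair_cell :: "nat \<Rightarrow> ('a \<Rightarrow> 'l) \<Rightarrow> 'l \<times> nat \<Rightarrow> (real \<times> 'a) set" where
  "pair_cell k lab z = {u\<in>{0<..<1}. blk k u = snd z} \<times> {y. lab y = fst z}"

lemma sum_table_of:
  fixes F :: "'l \<times> 'b \<Rightarrow> real"
  assumes "finite J" "finite Z" "\<And>j. j \<in> J \<Longrightarrow> (l j, l' (\<sigma> j)) \<in> Z"
  shows "(\<Sum>j\<in>J. F (l j, l' (\<sigma> j))) = (\<Sum>z\<in>Z. real (table_of l l' J \<sigma> z) * F z)"
proof -
  have "(\<Sum>z\<in>Z. \<Sum>j\<in>{j\<in>J. (l j, l' (\<sigma> j)) = z}. F (l j, l' (\<sigma> j))) = (\<Sum>j\<in>J. F (l j, l' (\<sigma> j)))"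
    using assms by (intro sum.group) auto
  moreover have "(\<Sum>j\<in>{j\<in>J. (l j, l' (\<sigma> j)) = z}. F (l j, l' (\<sigma> j))) = real (table_of l l' J \<sigma> z) * F z" for z
  proof -
    have "(\<Sum>j\<in>{j\<in>J. (l j, l' (\<sigma> j)) = z}. F (l j, l' (\<sigma> j))) = (\<Sum>j\<in>{j\<in>J. (l j, l' (\<sigma> j)) = z}. F z)"
      by (intro sum.cong) auto
    moreover have "{j\<in>J. (l j, l' (\<sigma> j)) = z} = {j\<in>J. l j = fst z \<and> l' (\<sigma> j) = snd z}" by (auto simp: prod_eq_iff)
    ultimately show ?thesis by (simp add: table_of_def)
  qed
  ultimately show ?thesis by (simp only:)
qed

context
  fixes \<mu> :: "'a::topological_space measure" and lab :: "'a \<Rightarrow> 'l" and A :: "'l set" and k :: nat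
  assumes \<mu>: "\<mu> \<in> M1 borel" and lab: "\<And>a. {y. lab y = a} \<in> sets borel" and A: "finite A" "\<And>y. lab y \<in> A"
    and k: "1 \<le> k"
begin

lemma finite_index: "finite (A \<times> {1..k})" using A by simp

lemma pair_cell_index:
  assumes "y \<in> {0<..<1} \<times> UNIV" shows "(lab (snd y), blk k (fst y)) \<in> A \<times> {1..k}"
  using assms A blk_range[OF k, of "fst y"] by auto

lemma block_set: "{u\<in>{0<..<1}. blk k u = b} \<in> sets unit_interval"
proof -
  have "{u\<in>{0<..<1}. blk k u = b} = blk k -` {b} \<inter> space unit_interval" by (auto simp: space_unit_interval)
  then show ?thesis using measurable_sets[OF measurable_blk, of "{b}" k] by simp
qed

lemma pair_cell_sets: "pair_cell k lab z \<in> sets (unit_prod \<mu>)"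
  unfolding pair_cell_def using block_set lab sets_M1_borel[OF \<mu>] by (intro pair_measureI) auto

text \<open>Functions of label and block are simple over the finite partition into cells;
  measurability and all integrals below reduce to finite sums.\<close>

lemma cell_expansion:
  fixes F :: "'l \<times> nat \<Rightarrow> 'v::semiring_1"
  assumes "y \<in> {0<..<1} \<times> UNIV"
  shows "F (lab (snd y), blk k (fst y)) = (\<Sum>z\<in>A \<times> {1..k}. F z * indicator (pair_cell k lab z) y)"
proof -
  have "(\<Sum>z\<in>A \<times> {1..k}. F z * indicator (pair_cell k lab z) y)
    = (\<Sum>z\<in>A \<times> {1..k}. if z = (lab (snd y), blk k (fst y)) then F z else 0)"
  proof (rule sum.cong[OF refl])
    fix z
    have "y \<in> pair_cell k lab z \<longleftrightarrow> z = (lab (snd y), blk k (fst y))"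
      using assms by (cases z, cases y) (simp add: pair_cell_def, blast)
    then show "F z * indicator (pair_cell k lab z) y = (if z = (lab (snd y), blk k (fst y)) then F z else 0)"
      by (simp add: indicator_def)
  qed
  also have "\<dots> = F (lab (snd y), blk k (fst y))"
    using pair_cell_index[OF assms] finite_index by (simp only: sum.delta if_True)
  finally show ?thesis by simp
qed

lemma measurable_cell_function:
  fixes F :: "'l \<times> nat \<Rightarrow> real"
  shows "(\<lambda>y. F (lab (snd y), blk k (fst y))) \<in> borel_measurable (unit_prod \<mu>)"
proof -
  have "(\<lambda>y. \<Sum>z\<in>A \<times> {1..k}. F z * indicator (pair_cell k lab z) y) \<in> borel_measurable (unit_prod \<mu>)"
    using pair_cell_sets by (intro borel_measurable_sum borel_measurable_times) auto
  then show ?thesis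
    by (rule measurable_cong[THEN iffD1, rotated])
       (rule cell_expansion[symmetric], simp only: space_unit_prod[OF \<mu>])
qed

lemma cell_function_bounded:
  fixes F :: "'l \<times> nat \<Rightarrow> real"
  obtains C where "\<And>y. y \<in> {0<..<1} \<times> UNIV \<Longrightarrow> \<bar>F (lab (snd y), blk k (fst y))\<bar> \<le> C"
proof (rule that[of "\<Sum>z\<in>A \<times> {1..k}. \<bar>F z\<bar>"])
  fix y :: "real \<times> 'a" assume "y \<in> {0<..<1} \<times> UNIV"
  then show "\<bar>F (lab (snd y), blk k (fst y))\<bar> \<le> (\<Sum>z\<in>A \<times> {1..k}. \<bar>F z\<bar>)"
    using finite_index pair_cell_index by (intro member_le_sum[where f="\<lambda>z. \<bar>F z\<bar>"]) auto
qed

lemma integral_cell_function: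
  fixes F :: "'l \<times> nat \<Rightarrow> real"
  assumes "prob_space \<pi>" "sets \<pi> = sets (unit_prod \<mu>)"
  shows "integrable \<pi> (\<lambda>y. F (lab (snd y), blk k (fst y)))"
    "(\<integral>y. F (lab (snd y), blk k (fst y)) \<partial>\<pi>) = (\<Sum>z\<in>A \<times> {1..k}. measure \<pi> (pair_cell k lab z) * F z)"
proof -
  interpret prob_space \<pi> by fact
  have sp: "space \<pi> = {0<..<1} \<times> UNIV"
    using sets_eq_imp_space_eq[OF assms(2)] space_unit_prod[OF \<mu>] by simp
  have cs: "pair_cell k lab z \<in> sets \<pi>" for z using pair_cell_sets assms(2) by simp
  have i: "integrable \<pi> (\<lambda>y. F z * indicator (pair_cell k lab z) y)" for z
    using cs by (intro integrable_mult_right) (auto simp: emeasure_eq_measure)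
  have e: "F (lab (snd y), blk k (fst y)) = (\<Sum>z\<in>A \<times> {1..k}. F z * indicator (pair_cell k lab z) y)" if "y \<in> space \<pi>" for y
    using that by (intro cell_expansion) (simp add: sp)
  have "integrable \<pi> (\<lambda>y. \<Sum>z\<in>A \<times> {1..k}. F z * indicator (pair_cell k lab z) y)" by (intro Bochner_Integration.integrable_sum i)
  then show "integrable \<pi> (\<lambda>y. F (lab (snd y), blk k (fst y)))"
    by (subst Bochner_Integration.integrable_cong[OF refl e])
  have "(\<integral>y. F (lab (snd y), blk k (fst y)) \<partial>\<pi>) = (\<integral>y. (\<Sum>z\<in>A \<times> {1..k}. F z * indicator (pair_cell k lab z) y) \<partial>\<pi>)"
    by (intro Bochner_Integration.integral_cong e) auto
  also have "\<dots> = (\<Sum>z\<in>A \<times> {1..k}. measure \<pi> (pair_cell k lab z) * F z)"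
    using i cs by (subst Bochner_Integration.integral_sum) (auto simp: mult.commute)
  finally show "(\<integral>y. F (lab (snd y), blk k (fst y)) \<partial>\<pi>) = (\<Sum>z\<in>A \<times> {1..k}. measure \<pi> (pair_cell k lab z) * F z)" .
qed

lemma measure_unit_prod_cell:
  assumes "b \<in> {1..k}"
  shows "measure (unit_prod \<mu>) (pair_cell k lab (a, b)) = measure \<mu> {y. lab y = a} / real k"
proof -
  interpret M: prob_space \<mu> by (rule prob_space_M1_borel[OF \<mu>])
  have "emeasure (unit_prod \<mu>) (pair_cell k lab (a, b)) = ennreal (1 / real k) * ennreal (measure \<mu> {y. lab y = a})"
    unfolding pair_cell_def using block_set lab sets_M1_borel[OF \<mu>]
    by (subst M.emeasure_pair_measure_Times)
       (simp_all only: fst_conv snd_conv emeasure_block[OF k assms] M.emeasure_eq_measure)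
  then show ?thesis by (simp add: measure_def enn2real_mult)
qed

lemma sum_measure_label: "(\<Sum>a\<in>A. measure \<mu> {y. lab y = a}) = 1"
proof -
  interpret M: prob_space \<mu> by (rule prob_space_M1_borel[OF \<mu>])
  have "(\<Sum>a\<in>A. measure \<mu> {y. lab y = a}) = measure \<mu> (\<Union>a\<in>A. {y. lab y = a})"
    using lab sets_M1_borel[OF \<mu>] A(1)
    by (intro M.finite_measure_finite_Union[symmetric]) (auto simp: disjoint_family_on_def)
  also have "(\<Union>a\<in>A. {y. lab y = a}) = space \<mu>" using A(2) space_M1_borel[OF \<mu>] by auto
  finally show ?thesis by (simp add: M.prob_space)
qed

section \<open>Couplings with a density constant on cells\<close>

context
  fixes p :: "'l \<times> nat \<Rightarrow> real"
  assumes pnn: "\<And>z. 0 \<le> p z" and p1: "\<And>a. a \<in> A \<Longrightarrow> (\<Sum>b=1..k. p (a, b)) = measure \<mu> {y. lab y = a}"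
    and p2: "\<And>b. b \<in> {1..k} \<Longrightarrow> (\<Sum>a\<in>A. p (a, b)) = 1 / real k"
begin

lemma table_le_margin: "a \<in> A \<Longrightarrow> b \<in> {1..k} \<Longrightarrow> p (a, b) \<le> measure \<mu> {y. lab y = a}"
  unfolding p1[symmetric] using pnn by (intro member_le_sum[where f="\<lambda>b. p (a, b)"]) auto

lemma sum_table: "(\<Sum>z\<in>A \<times> {1..k}. p z) = 1"
  using p1 sum_measure_label by (simp add: sum.cartesian_product')

text \<open>With these margins the split form of the table entropy is the relative entropy with
  respect to the product weights. A label class of probability 0 forces \<open>p = 0\<close> there,
  so no logarithm of 0 contributes.\<close>

lemma table_entropy_eq:
  "table_entropy A {1..k} p = (\<Sum>z\<in>A \<times> {1..k}. p z * ln (p z / (measure \<mu> {y. lab y = fst z} / real k)))"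
proof -
  let ?m = "\<lambda>a. measure \<mu> {y. lab y = a}"
  have k0: "0 < real k" using k by simp
  have "p (a, b) * ln (p (a, b) / (?m a / real k)) = xlnx (p (a, b)) - p (a, b) * ln (?m a) - p (a, b) * ln (1 / real k)"
    if "a \<in> A" "b \<in> {1..k}" for a b
  proof (cases "p (a, b) = 0")
    case False
    then have "0 < p (a, b)" using pnn[of "(a, b)"] by simp
    moreover have "0 < ?m a" using table_le_margin[OF that] \<open>0 < p (a, b)\<close> by linarith
    ultimately show ?thesis using k0 by (simp add: xlnx_def ln_div ln_mult algebra_simps)
  qed simp
  then have "(\<Sum>z\<in>A \<times> {1..k}. p z * ln (p z / (?m (fst z) / real k)))
    = (\<Sum>a\<in>A. \<Sum>b=1..k. xlnx (p (a, b)) - p (a, b) * ln (?m a) - p (a, b) * ln (1 / real k))"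
    by (simp add: sum.cartesian_product')
  also have "\<dots> = (\<Sum>a\<in>A. \<Sum>b=1..k. xlnx (p (a, b))) - (\<Sum>a\<in>A. (\<Sum>b=1..k. p (a, b)) * ln (?m a))
    - (\<Sum>a\<in>A. \<Sum>b=1..k. p (a, b) * ln (1 / real k))"
    by (simp add: sum_subtractf sum_distrib_right)
  also have "(\<Sum>a\<in>A. \<Sum>b=1..k. p (a, b) * ln (1 / real k)) = (\<Sum>b=1..k. (\<Sum>a\<in>A. p (a, b)) * ln (1 / real k))"
    by (subst sum.swap) (simp add: sum_distrib_right)
  finally show ?thesis
    unfolding table_entropy_def using p1 p2 by (simp add: sum.cartesian_product' xlnx_def)
qed

text \<open>A density constant on cells gives a coupling whose entropy is exactly that of the table;
  limits of counted tables thereby become admissible couplings.\<close>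

lemma coupling_of_table:
  obtains \<pi> where "\<pi> \<in> unit_couplings \<mu>" "rel_entropy \<pi> (unit_prod \<mu>) = ennreal (table_entropy A {1..k} p)"
    "\<And>z. z \<in> A \<times> {1..k} \<Longrightarrow> measure \<pi> (pair_cell k lab z) = p z"
proof -
  let ?m = "\<lambda>z. measure \<mu> {y. lab y = fst z} / real k"
  interpret M: prob_space \<mu> by (rule prob_space_M1_borel[OF \<mu>])
  interpret U: prob_space unit_interval by (rule prob_space_unit_interval)
  interpret UM: prob_space "unit_prod \<mu>" by (rule prob_space_unit_prod'[OF \<mu>])
  interpret P: pair_sigma_finite unit_interval \<mu> ..
  have k0: "0 < real k" using k by simp
  \<comment> \<open>Division by 0 gives 0, and a label of probability 0 has \<open>p z = 0\<close>,
    so \<open>F z * ?m z = p z\<close> holds for every cell.\<close>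
  define F where "F z = p z / ?m z" for z
  have Fnn: "0 \<le> F z" for z using pnn by (simp add: F_def)
  have Fm: "F z * ?m z = p z" if "z \<in> A \<times> {1..k}" for z
  proof (cases "?m z = 0")
    case True
    then have "p z = 0" using table_le_margin[of "fst z" "snd z"] that pnn[of z] k0 by (auto intro: antisym)
    then show ?thesis using True by simp
  qed (simp add: F_def)
  define f where "f y = F (lab (snd y), blk k (fst y))" for y :: "real \<times> 'a"
  have fm[measurable]: "f \<in> borel_measurable (unit_prod \<mu>)" unfolding f_def by (rule measurable_cell_function)
  have fnn: "0 \<le> f y" for y by (simp add: f_def Fnn)
  define \<pi> where "\<pi> = density (unit_prod \<mu>) (\<lambda>y. ennreal (f y))"
  \<comment> \<open>The first marginal density is 1 at every \<open>u\<close>, because the column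
    sums of \<open>p\<close> are exactly \<open>1 / k\<close>.\<close>
  have inner1: "(\<integral>\<^sup>+y. ennreal (f (u, y)) \<partial>\<mu>) = 1" if u: "u \<in> {0<..<1}" for u
  proof -
    have b: "blk k u \<in> {1..k}" using blk_range[OF k] u by auto
    have "(\<integral>\<^sup>+y. ennreal (f (u, y)) \<partial>\<mu>) = (\<integral>\<^sup>+y. (\<Sum>a\<in>A. ennreal (F (a, blk k u)) * indicator {y. lab y = a} y) \<partial>\<mu>)"
    proof (rule nn_integral_cong)
      fix y
      have "(\<Sum>a\<in>A. ennreal (F (a, blk k u)) * indicator {y. lab y = a} y) = (\<Sum>a\<in>A. if a = lab y then ennreal (F (a, blk k u)) else 0)"
        by (intro sum.cong) (auto simp: indicator_def)
      then show "ennreal (f (u, y)) = (\<Sum>a\<in>A. ennreal (F (a, blk k u)) * indicator {y. lab y = a} y)"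
        using A by (simp add: f_def)
    qed
    also have "\<dots> = (\<Sum>a\<in>A. ennreal (F (a, blk k u)) * ennreal (measure \<mu> {y. lab y = a}))"
      using lab sets_M1_borel[OF \<mu>]
      by (subst nn_integral_sum) (auto simp: nn_integral_cmult_indicator M.emeasure_eq_measure)
    also have "\<dots> = (\<Sum>a\<in>A. ennreal (real k * p (a, blk k u)))"
    proof (rule sum.cong)
      fix a assume "a \<in> A"
      then have "F (a, blk k u) * measure \<mu> {y. lab y = a} = real k * p (a, blk k u)"
        using Fm[of "(a, blk k u)"] b k0 by (simp add: field_simps)
      then show "ennreal (F (a, blk k u)) * ennreal (measure \<mu> {y. lab y = a}) = ennreal (real k * p (a, blk k u))"
        using Fnn by (simp flip: ennreal_mult)
    qed simp
    also have "\<dots> = ennreal (real k * (\<Sum>a\<in>A. p (a, blk k u)))"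
      using pnn by (subst sum_ennreal) (auto simp: sum_distrib_left)
    also have "\<dots> = 1" using p2[OF b] k0 by simp
    finally show ?thesis .
  qed
  have inner2: "(\<integral>\<^sup>+u. ennreal (f (u, y)) \<partial>unit_interval) = 1" if pos: "measure \<mu> {x. lab x = lab y} \<noteq> 0" for y
  proof -
    have "(\<integral>\<^sup>+u. ennreal (f (u, y)) \<partial>unit_interval) = (\<Sum>b=1..k. ennreal (F (lab y, b)) * ennreal (1 / real k))"
      unfolding f_def fst_conv snd_conv by (rule nn_integral_blocks[OF k])
    also have "\<dots> = ennreal (\<Sum>b=1..k. F (lab y, b) / real k)" using Fnn by (intro sum_ennreal_mult_inverse)
    also have "(\<Sum>b=1..k. F (lab y, b) / real k) = (\<Sum>b=1..k. p (lab y, b) / measure \<mu> {x. lab x = lab y})"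
      using k0 by (intro sum.cong) (auto simp: F_def)
    also have "\<dots> = 1" using p1[of "lab y"] A(2) pos by (simp add: sum_divide_distrib[symmetric])
    finally show ?thesis by simp
  qed
  \<comment> \<open>The integral over \<open>u\<close> is known to be 1 only for labels of positive
    probability; the points with another label form a null set.\<close>
  have AElab: "AE y in \<mu>. measure \<mu> {x. lab x = lab y} \<noteq> 0"
  proof -
    have "AE y in \<mu>. \<forall>a\<in>A. measure \<mu> {x. lab x = a} = 0 \<longrightarrow> lab y \<noteq> a"
    proof (rule AE_finite_allI[OF A(1)])
      fix a
      show "AE y in \<mu>. measure \<mu> {x. lab x = a} = 0 \<longrightarrow> lab y \<noteq> a"
      proof (cases "measure \<mu> {x. lab x = a} = 0")
        case True
        then have "{x. lab x = a} \<in> null_sets \<mu>" using lab sets_M1_borel[OF \<mu>] by (auto simp: M.emeasure_eq_measure)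
        then show ?thesis by (rule AE_I') auto
      qed simp
    qed
    then show ?thesis by eventually_elim (use A(2) in auto)
  qed
  have \<pi>sets: "sets \<pi> = sets (unit_prod \<mu>)" by (simp add: \<pi>_def)
  have fe: "(\<lambda>y. ennreal (f y)) \<in> borel_measurable (unit_prod \<mu>)" by measurable
  have d1: "distr \<pi> unit_interval fst = unit_interval"
  proof -
    have "distr \<pi> unit_interval fst = density unit_interval (\<lambda>_. 1)"
      unfolding \<pi>_def P.distr_fst_density[OF fe] using inner1 M.borel_measurable_nn_integral_fst[OF fe]
      by (intro density_cong AE_I2) (auto simp: space_unit_interval)
    then show ?thesis by (simp add: density_1)
  qed
  moreover have "distr \<pi> \<mu> snd = \<mu>"
  proof -
    have "distr \<pi> \<mu> snd = density \<mu> (\<lambda>_. 1)"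
      unfolding \<pi>_def P.distr_snd_density[OF fe]
      using AElab inner2 U.borel_measurable_nn_integral[of "\<lambda>y u. ennreal (f (u, y))" \<mu>] measurable_pair_swap[OF fe]
      by (intro density_cong) (auto elim!: eventually_mono)
    then show ?thesis by (simp add: density_1)
  qed
  moreover have "prob_space \<pi>"
    using prob_space_distrD[OF fst_measurable_unit_prod[OF \<mu> \<pi>sets]] d1 U.prob_space_axioms by simp
  ultimately have c: "\<pi> \<in> unit_couplings \<mu>" using \<pi>sets by (simp add: unit_couplings_def)
  have m: "measure (unit_prod \<mu>) (pair_cell k lab z) = ?m z" if "z \<in> A \<times> {1..k}" for z
    using measure_unit_prod_cell[of "snd z" "fst z"] that by auto
  have i: "integrable (unit_prod \<mu>) (\<lambda>y. f y * ln (f y))"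
    using integral_cell_function(1)[OF UM.prob_space_axioms refl, of "\<lambda>z. F z * ln (F z)"] by (simp add: f_def)
  have "(\<integral>y. f y * ln (f y) \<partial>unit_prod \<mu>) = (\<Sum>z\<in>A \<times> {1..k}. measure (unit_prod \<mu>) (pair_cell k lab z) * (F z * ln (F z)))"
    using integral_cell_function(2)[OF UM.prob_space_axioms refl, of "\<lambda>z. F z * ln (F z)"] by (simp add: f_def)
  also have "(\<Sum>z\<in>A \<times> {1..k}. measure (unit_prod \<mu>) (pair_cell k lab z) * (F z * ln (F z))) = table_entropy A {1..k} p"
    unfolding table_entropy_eq
  proof (rule sum.cong)
    fix z assume z: "z \<in> A \<times> {1..k}"
    have "measure (unit_prod \<mu>) (pair_cell k lab z) * (F z * ln (F z)) = (F z * ?m z) * ln (F z)"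
      by (simp add: m[OF z])
    then show "measure (unit_prod \<mu>) (pair_cell k lab z) * (F z * ln (F z)) = p z * ln (p z / ?m z)"
      unfolding Fm[OF z] by (simp add: F_def)
  qed simp
  finally have H: "rel_entropy \<pi> (unit_prod \<mu>) = ennreal (table_entropy A {1..k} p)"
    unfolding \<pi>_def using rel_entropy_density[OF UM.prob_space_axioms fm fnn] i by simp
  have "measure \<pi> (pair_cell k lab z) = p z" if z: "z \<in> A \<times> {1..k}" for z
  proof -
    have "emeasure \<pi> (pair_cell k lab z) = (\<integral>\<^sup>+y. ennreal (f y) * indicator (pair_cell k lab z) y \<partial>unit_prod \<mu>)"
      unfolding \<pi>_def using pair_cell_sets by (subst emeasure_density) auto
    also have "\<dots> = (\<integral>\<^sup>+y. ennreal (F z) * indicator (pair_cell k lab z) y \<partial>unit_prod \<mu>)"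
      by (intro nn_integral_cong) (auto simp: indicator_def f_def pair_cell_def)
    also have "\<dots> = ennreal (F z) * ennreal (?m z)"
      using pair_cell_sets m[OF z] by (simp add: nn_integral_cmult_indicator UM.emeasure_eq_measure)
    also have "\<dots> = ennreal (p z)" using Fnn Fm[OF z] by (simp flip: ennreal_mult)
    finally show ?thesis using pnn by (simp add: measure_def)
  qed
  then show thesis using that c H by blast
qed

end

section \<open>Tables of a given coupling\<close>

context
  fixes \<pi> assumes \<pi>: "\<pi> \<in> unit_couplings \<mu>"
begin

lemma coupling_table_margin1:
  assumes "a \<in> A" shows "(\<Sum>b=1..k. measure \<pi> (pair_cell k lab (a, b))) = measure \<mu> {y. lab y = a}"
proof -
  interpret P: prob_space \<pi> by (rule unit_couplingsD[OF \<mu> \<pi>])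
  have sp: "space \<pi> = {0<..<1} \<times> UNIV"
    using sets_eq_imp_space_eq[OF unit_couplingsD(2)[OF \<mu> \<pi>]] space_unit_prod[OF \<mu>] by simp
  have "(\<Sum>b=1..k. measure \<pi> (pair_cell k lab (a, b))) = measure \<pi> (\<Union>b\<in>{1..k}. pair_cell k lab (a, b))"
    using pair_cell_sets unit_couplingsD(2)[OF \<mu> \<pi>]
    by (intro P.finite_measure_finite_Union[symmetric]) (auto simp: disjoint_family_on_def pair_cell_def)
  also have "(\<Union>b\<in>{1..k}. pair_cell k lab (a, b)) = snd -` {y. lab y = a} \<inter> space \<pi>"
    using blk_range[OF k] unfolding sp by (fastforce simp: pair_cell_def)
  also have "measure \<pi> \<dots> = measure (distr \<pi> borel snd) {y. lab y = a}"
    using lab snd_measurable_unit_prod[OF \<mu> unit_couplingsD(2)[OF \<mu> \<pi>]] by (simp add: measure_distr)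
  also have "distr \<pi> borel snd = distr \<pi> \<mu> snd" using sets_M1_borel[OF \<mu>] by (intro distr_cong) auto
  finally show ?thesis by (simp add: unit_couplingsD(4)[OF \<mu> \<pi>])
qed

lemma coupling_table_margin2:
  assumes "b \<in> {1..k}" shows "(\<Sum>a\<in>A. measure \<pi> (pair_cell k lab (a, b))) = 1 / real k"
proof -
  interpret P: prob_space \<pi> by (rule unit_couplingsD[OF \<mu> \<pi>])
  have sp: "space \<pi> = {0<..<1} \<times> UNIV"
    using sets_eq_imp_space_eq[OF unit_couplingsD(2)[OF \<mu> \<pi>]] space_unit_prod[OF \<mu>] by simp
  have "(\<Sum>a\<in>A. measure \<pi> (pair_cell k lab (a, b))) = measure \<pi> (\<Union>a\<in>A. pair_cell k lab (a, b))"
    using pair_cell_sets unit_couplingsD(2)[OF \<mu> \<pi>] A(1)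
    by (intro P.finite_measure_finite_Union[symmetric]) (auto simp: disjoint_family_on_def pair_cell_def)
  also have "(\<Union>a\<in>A. pair_cell k lab (a, b)) = fst -` {u\<in>{0<..<1}. blk k u = b} \<inter> space \<pi>"
    using A(2) unfolding sp by (fastforce simp: pair_cell_def)
  also have "measure \<pi> \<dots> = measure (distr \<pi> unit_interval fst) {u\<in>{0<..<1}. blk k u = b}"
    using block_set fst_measurable_unit_prod[OF \<mu> unit_couplingsD(2)[OF \<mu> \<pi>]] by (simp add: measure_distr)
  finally show ?thesis
    using emeasure_block[OF k assms] by (simp add: unit_couplingsD(3)[OF \<mu> \<pi>] measure_def)
qed

text \<open>Data processing for the partition into cells, obtained from the variational formula with
  the logarithmic density of the table as test function.\<close>

lemma table_entropy_coupling_le: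
  assumes H: "rel_entropy \<pi> (unit_prod \<mu>) \<le> ennreal h" "0 \<le> h"
  shows "table_entropy A {1..k} (\<lambda>z. measure \<pi> (pair_cell k lab z)) \<le> h"
proof (rule field_le_epsilon)
  fix e :: real assume "0 < e"
  let ?p = "\<lambda>z. measure \<pi> (pair_cell k lab z)"
  let ?m = "\<lambda>z. measure \<mu> {y. lab y = fst z} / real k"
  have k0: "0 < real k" using k by simp
  \<comment> \<open>On cells without mass the ideal test value is minus infinity;
    \<open>ln e\<close> takes its place, which adds at most \<open>e\<close> to the exponential
    integral.\<close>
  define F where "F z = (if ?p z = 0 then ln e else ln (?p z / ?m z))" for z
  obtain C where C: "\<And>y. y \<in> {0<..<1} \<times> UNIV \<Longrightarrow> \<bar>F (lab (snd y), blk k (fst y))\<bar> \<le> C"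
    using cell_function_bounded by blast
  define \<phi> where "\<phi> y = (if y \<in> {0<..<1} \<times> UNIV then F (lab (snd y), blk k (fst y)) else 0)" for y
  interpret UM: prob_space "unit_prod \<mu>" by (rule prob_space_unit_prod'[OF \<mu>])
  interpret P: prob_space \<pi> by (rule unit_couplingsD[OF \<mu> \<pi>])
  have sp: "space \<pi> = {0<..<1} \<times> UNIV"
    using sets_eq_imp_space_eq[OF unit_couplingsD(2)[OF \<mu> \<pi>]] space_unit_prod[OF \<mu>] by simp
  have "\<phi> \<in> borel_measurable (unit_prod \<mu>)"
    by (rule measurable_cong[THEN iffD1, OF _ measurable_cell_function[of F]]) (simp only: \<phi>_def space_unit_prod[OF \<mu>] if_True)
  moreover have "\<bar>\<phi> y\<bar> \<le> max C 0" for y using C[of y] by (auto simp: \<phi>_def)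
  ultimately have "(\<integral>y. \<phi> y \<partial>\<pi>) \<le> h + ln (\<integral>y. exp (\<phi> y) \<partial>unit_prod \<mu>)"
    by (rule rel_entropy_variational[OF UM.prob_space_axioms unit_couplingsD(1,2)[OF \<mu> \<pi>] H])
  moreover have "(\<integral>y. \<phi> y \<partial>\<pi>) = (\<integral>y. F (lab (snd y), blk k (fst y)) \<partial>\<pi>)"
    by (intro Bochner_Integration.integral_cong) (simp_all only: \<phi>_def sp if_True)
  moreover have "\<dots> = (\<Sum>z\<in>A \<times> {1..k}. ?p z * F z)"
    by (rule integral_cell_function(2)[OF unit_couplingsD(1,2)[OF \<mu> \<pi>]])
  moreover have "(\<integral>y. exp (\<phi> y) \<partial>unit_prod \<mu>) = (\<integral>y. exp (F (lab (snd y), blk k (fst y))) \<partial>unit_prod \<mu>)"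
    by (intro Bochner_Integration.integral_cong) (simp_all only: \<phi>_def space_unit_prod[OF \<mu>] if_True)
  moreover have "\<dots> = (\<Sum>z\<in>A \<times> {1..k}. measure (unit_prod \<mu>) (pair_cell k lab z) * exp (F z))"
    by (rule integral_cell_function(2)[OF UM.prob_space_axioms refl])
  ultimately have main: "(\<Sum>z\<in>A \<times> {1..k}. ?p z * F z) \<le> h + ln (\<Sum>z\<in>A \<times> {1..k}. measure (unit_prod \<mu>) (pair_cell k lab z) * exp (F z))"
    by simp
  have m: "measure (unit_prod \<mu>) (pair_cell k lab z) = ?m z" if "z \<in> A \<times> {1..k}" for z
    using measure_unit_prod_cell[of "snd z" "fst z"] that by auto
  have msum: "(\<Sum>z\<in>A \<times> {1..k}. ?m z) = 1"
    using sum_measure_label k0 by (simp add: sum.cartesian_product' sum_distrib_left[symmetric])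
  have psum: "(\<Sum>z\<in>A \<times> {1..k}. ?p z) = 1"
    by (rule sum_table[OF _ coupling_table_margin1 coupling_table_margin2]) auto
  have ple: "?p z \<le> measure \<mu> {y. lab y = fst z}" if "z \<in> A \<times> {1..k}" for z
    using table_le_margin[of ?p "fst z" "snd z", OF _ coupling_table_margin1 coupling_table_margin2] that by auto
  have expF: "?m z * exp (F z) \<le> ?p z + e * ?m z" if z: "z \<in> A \<times> {1..k}" for z
  proof (cases "?p z = 0")
    case True
    then show ?thesis using \<open>0 < e\<close> by (simp add: F_def mult.commute)
  next
    case False
    then have p: "0 < ?p z" by (simp add: zero_less_measure_iff)
    then have "0 < measure \<mu> {y. lab y = fst z}" using ple[OF z] by linarith
    then have mp: "0 < ?m z" using k0 by simp
    have "exp (F z) = exp (ln (?p z / ?m z))" using False unfolding F_def by (simp only: if_False)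
    also have "\<dots> = ?p z / ?m z" by (rule exp_ln[OF divide_pos_pos[OF p mp]])
    finally have "exp (F z) = ?p z / ?m z" .
    moreover have "c * (q / c) = q" if "0 < c" for c q :: real using that by simp
    ultimately have "?m z * exp (F z) = ?p z" using mp by (simp only:)
    then show ?thesis using \<open>0 < e\<close> mp by simp
  qed
  have "(\<Sum>z\<in>A \<times> {1..k}. measure (unit_prod \<mu>) (pair_cell k lab z) * exp (F z)) \<le> (\<Sum>z\<in>A \<times> {1..k}. ?p z + e * ?m z)"
    using expF m by (intro sum_mono) simp
  also have "\<dots> = 1 + e" by (simp only: sum.distrib sum_distrib_left[symmetric] psum msum mult_1_right)
  finally have le: "(\<Sum>z\<in>A \<times> {1..k}. measure (unit_prod \<mu>) (pair_cell k lab z) * exp (F z)) \<le> 1 + e" .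
  have "0 < (\<Sum>z\<in>A \<times> {1..k}. measure (unit_prod \<mu>) (pair_cell k lab z) * exp (F z))"
  proof -
    have "\<exists>z\<in>A \<times> {1..k}. measure (unit_prod \<mu>) (pair_cell k lab z) \<noteq> 0"
    proof (rule ccontr)
      assume "\<not> ?thesis"
      then have "(\<Sum>z\<in>A \<times> {1..k}. ?m z) = 0" using m by (intro sum.neutral) force
      then show False using msum by simp
    qed
    then obtain z where "z \<in> A \<times> {1..k}" "0 < measure (unit_prod \<mu>) (pair_cell k lab z)"
      using zero_less_measure_iff by blast
    then show ?thesis using finite_index by (intro sum_pos2[of _ z]) auto
  qed
  then have "ln (\<Sum>z\<in>A \<times> {1..k}. measure (unit_prod \<mu>) (pair_cell k lab z) * exp (F z)) \<le> e"
    using le ln_le_minus_one by (smt (verit, best))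
  moreover have "table_entropy A {1..k} ?p = (\<Sum>z\<in>A \<times> {1..k}. ?p z * F z)"
    by (subst table_entropy_eq[OF _ coupling_table_margin1 coupling_table_margin2])
       (auto simp: F_def intro!: sum.cong)
  ultimately show "table_entropy A {1..k} ?p \<le> h + e" using main by linarith
qed

text \<open>Replacing \<open>g\<close> by its cell values costs \<open>d\<close>, because the
  quantile has mean one; replacing the quantile by the step function costs
  \<open>B * e\<close>.\<close>

lemma integral_mixture_cells:
  fixes g :: "'a \<Rightarrow> real" and gh :: "'l \<Rightarrow> real"
  assumes \<gamma>: "\<gamma> \<in> M11_Rplus" and g: "g \<in> bounded_continuous"
    and gh: "\<And>y. \<bar>g y - gh (lab y)\<bar> \<le> d" "\<And>y. \<bar>gh (lab y)\<bar> \<le> B"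
    and e: "(\<integral>\<^sup>+u. ennreal \<bar>quantile \<gamma> u - T (blk k u)\<bar> \<partial>unit_interval) \<le> ennreal e" "0 \<le> e"
  shows "\<bar>(\<integral>y. g y \<partial>mixture \<gamma> \<pi>) - (\<Sum>z\<in>A \<times> {1..k}. measure \<pi> (pair_cell k lab z) * (T (snd z) * gh (fst z)))\<bar> \<le> d + B * e"
proof -
  have \<gamma>1: "\<gamma> \<in> M1 Rplus" using \<gamma> by (rule M11_Rplus_subset)
  note \<pi>D = unit_couplingsD[OF \<mu> \<pi>]
  interpret P: prob_space \<pi> by (rule \<pi>D)
  have gm: "g \<in> borel_measurable borel" by (rule bounded_continuous_measurable[OF g])
  have ghm: "(\<lambda>y. gh (lab y)) \<in> borel_measurable borel"
  proof -
    have "(\<lambda>y. \<Sum>a\<in>A. gh a * indicator {y. lab y = a} y) \<in> borel_measurable borel"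
      using lab by (intro borel_measurable_sum borel_measurable_times) auto
    moreover have "gh (lab y) = (\<Sum>a\<in>A. gh a * indicator {y. lab y = a} y)" for y
    proof -
      have "(\<Sum>a\<in>A. gh a * indicator {y. lab y = a} y) = (\<Sum>a\<in>A. if a = lab y then gh a else 0)"
        by (intro sum.cong) (auto simp: indicator_def)
      then show ?thesis using A by simp
    qed
    ultimately show ?thesis by simp
  qed
  have iQ: "integrable \<pi> (\<lambda>z. quantile \<gamma> (fst z))" by (rule integrable_quantile_fst[OF \<mu> \<pi> \<gamma>])
  have iT: "integrable \<pi> (\<lambda>z. T (blk k (fst z)))"
    using integral_cell_function(1)[OF \<pi>D(1,2), of "\<lambda>z. T (snd z)"] by simp
  have Tm: "(\<lambda>u. T (blk k u)) \<in> borel_measurable unit_interval"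
    using measurable_compose[OF measurable_blk, of T borel] by simp
  obtain Bg where Bg: "\<And>y. \<bar>g y\<bar> \<le> Bg" using bounded_continuous_bounded[OF g] by blast
  have i1: "integrable \<pi> (\<lambda>z. quantile \<gamma> (fst z) * g (snd z))" by (rule integrable_mult_bounded_snd[OF \<mu> \<pi> iQ gm Bg])
  have i2: "integrable \<pi> (\<lambda>z. quantile \<gamma> (fst z) * gh (lab (snd z)))" by (rule integrable_mult_bounded_snd[OF \<mu> \<pi> iQ ghm gh(2)])
  have Qint: "(\<integral>z. quantile \<gamma> (fst z) \<partial>\<pi>) = 1"
  proof -
    have "(\<integral>\<^sup>+z. ennreal (quantile \<gamma> (fst z)) \<partial>\<pi>) = 1"
      using nn_integral_fst_coupling[OF \<mu> \<pi>, of "\<lambda>u. ennreal (quantile \<gamma> u)"] measurable_quantile_borel[OF \<gamma>1]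
      by (simp add: nn_integral_quantile[OF \<gamma>])
    then show ?thesis using nn_integral_eq_integral[OF iQ] quantile_nonneg by simp
  qed
  have "\<bar>(\<integral>z. quantile \<gamma> (fst z) * g (snd z) \<partial>\<pi>) - (\<integral>z. quantile \<gamma> (fst z) * gh (lab (snd z)) \<partial>\<pi>)\<bar>
    = \<bar>\<integral>z. quantile \<gamma> (fst z) * g (snd z) - quantile \<gamma> (fst z) * gh (lab (snd z)) \<partial>\<pi>\<bar>"
    using i1 i2 by simp
  also have "\<dots> \<le> (\<integral>z. \<bar>quantile \<gamma> (fst z) * g (snd z) - quantile \<gamma> (fst z) * gh (lab (snd z))\<bar> \<partial>\<pi>)"
    by (rule integral_abs_bound)
  also have "\<dots> \<le> (\<integral>z. d * quantile \<gamma> (fst z) \<partial>\<pi>)"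
  proof (intro integral_mono integrable_abs Bochner_Integration.integrable_diff i1 i2 integrable_mult_right iQ)
    fix z
    have "\<bar>quantile \<gamma> (fst z) * g (snd z) - quantile \<gamma> (fst z) * gh (lab (snd z))\<bar> = quantile \<gamma> (fst z) * \<bar>g (snd z) - gh (lab (snd z))\<bar>"
      using quantile_nonneg[of \<gamma> "fst z"] by (simp add: right_diff_distrib[symmetric] abs_mult)
    also have "\<dots> \<le> quantile \<gamma> (fst z) * d" using gh(1) quantile_nonneg by (intro mult_left_mono) auto
    finally show "\<bar>quantile \<gamma> (fst z) * g (snd z) - quantile \<gamma> (fst z) * gh (lab (snd z))\<bar> \<le> d * quantile \<gamma> (fst z)"
      by (simp add: mult.commute)
  qed
  also have "\<dots> = d" using Qint by simp
  finally have 1: "\<bar>(\<integral>z. quantile \<gamma> (fst z) * g (snd z) \<partial>\<pi>) - (\<integral>z. quantile \<gamma> (fst z) * gh (lab (snd z)) \<partial>\<pi>)\<bar> \<le> d" .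
  have 2: "\<bar>(\<integral>z. quantile \<gamma> (fst z) * gh (lab (snd z)) \<partial>\<pi>) - (\<integral>z. T (blk k (fst z)) * gh (lab (snd z)) \<partial>\<pi>)\<bar> \<le> B * e"
    using e by (intro integral_coupling_diff_le[OF \<mu> \<pi> measurable_quantile_borel[OF \<gamma>1] Tm iQ iT ghm gh(2)])
  have 3: "(\<integral>z. T (blk k (fst z)) * gh (lab (snd z)) \<partial>\<pi>) = (\<Sum>z\<in>A \<times> {1..k}. measure \<pi> (pair_cell k lab z) * (T (snd z) * gh (fst z)))"
    using integral_cell_function(2)[OF \<pi>D(1,2), of "\<lambda>z. T (snd z) * gh (fst z)"] by simp
  show ?thesis
    unfolding integral_mixture[OF \<mu> \<pi> \<gamma> gm] using 1 2 3 by linarith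
qed

end

end

text \<open>The discrete counterpart of the cell approximation of a mixture: once weights and test
  function are replaced by their cell values, the sum depends on \<sigma> only through its table.
  The cost \<open>d\<close> again uses that the weights have mean one.\<close>

lemma weighted_sum_cells:
  fixes g :: "'a \<Rightarrow> real" and lab :: "'a \<Rightarrow> 'l" and gh :: "'l \<Rightarrow> real"
  assumes n: "1 \<le> n" and w: "w \<in> weight_simplex n" and \<sigma>: "\<sigma> permutes {1..n}" and k: "1 \<le> k"
    and A: "finite A" "\<And>y. lab y \<in> A"
    and gh: "\<And>y. \<bar>g y - gh (lab y)\<bar> \<le> d" "\<And>y. \<bar>gh (lab y)\<bar> \<le> B"
    and wT: "(\<Sum>j=1..n. \<bar>w j - T (blk k (real j / real n))\<bar>) / real n \<le> c"
  shows "\<bar>(\<Sum>i=1..n. w (\<sigma> i) / real n * g (x i)) - (\<Sum>z\<in>A \<times> {1..k}.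
      real (table_of (\<lambda>i. lab (x i)) (\<lambda>j. blk k (real j / real n)) {1..n} \<sigma> z) / real n * (T (snd z) * gh (fst z)))\<bar> \<le> d + B * c"
proof -
  have n0: "0 < real n" using n by simp
  have w0: "\<And>i. i \<in> {1..n} \<Longrightarrow> 0 \<le> w i" "(\<Sum>i=1..n. w i) = real n" using w by (auto simp: weight_simplex_def)
  have B: "0 \<le> B" using gh(2) abs_ge_zero order_trans by blast
  have perm: "(\<Sum>i=1..n. h (\<sigma> i)) = (\<Sum>i=1..n. h i)" for h :: "nat \<Rightarrow> real"
    using sum.permute[OF \<sigma>, of h] by (simp add: comp_def)
  let ?t = "\<lambda>j. T (blk k (real j / real n))"
  have "(\<Sum>z\<in>A \<times> {1..k}. real (table_of (\<lambda>i. lab (x i)) (\<lambda>j. blk k (real j / real n)) {1..n} \<sigma> z) / real n * (T (snd z) * gh (fst z)))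
    = (\<Sum>z\<in>A \<times> {1..k}. real (table_of (\<lambda>i. lab (x i)) (\<lambda>j. blk k (real j / real n)) {1..n} \<sigma> z) * (T (snd z) * gh (fst z))) / real n"
    by (simp add: sum_divide_distrib)
  also have "\<dots> = (\<Sum>i=1..n. T (blk k (real (\<sigma> i) / real n)) * gh (lab (x i))) / real n"
  proof -
    have "(lab (x j), blk k (real (\<sigma> j) / real n)) \<in> A \<times> {1..k}" if "j \<in> {1..n}" for j
    proof -
      have "\<sigma> j \<in> {1..n}" using that permutes_in_image[OF \<sigma>] by simp
      then show ?thesis using A(2) blk_range[OF k, of "real (\<sigma> j) / real n"] n0 by (auto simp: divide_le_eq)
    qed
    from sum_table_of[of "{1..n}" "A \<times> {1..k}" "\<lambda>i. lab (x i)" "\<lambda>j. blk k (real j / real n)" \<sigma> "\<lambda>z. T (snd z) * gh (fst z)", OF _ _ this]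
    show ?thesis using A(1) by simp
  qed
  also have "(\<Sum>i=1..n. w (\<sigma> i) / real n * g (x i)) - \<dots>
    = (\<Sum>i=1..n. w (\<sigma> i) * (g (x i) - gh (lab (x i))) + (w (\<sigma> i) - ?t (\<sigma> i)) * gh (lab (x i))) / real n"
    by (simp add: sum_divide_distrib sum_subtractf[symmetric] diff_divide_distrib[symmetric] add_divide_distrib[symmetric] algebra_simps)
  finally have eq: "(\<Sum>i=1..n. w (\<sigma> i) / real n * g (x i)) - (\<Sum>z\<in>A \<times> {1..k}.
      real (table_of (\<lambda>i. lab (x i)) (\<lambda>j. blk k (real j / real n)) {1..n} \<sigma> z) / real n * (T (snd z) * gh (fst z)))
    = (\<Sum>i=1..n. w (\<sigma> i) * (g (x i) - gh (lab (x i))) + (w (\<sigma> i) - ?t (\<sigma> i)) * gh (lab (x i))) / real n" .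
  have "\<bar>\<Sum>i=1..n. w (\<sigma> i) * (g (x i) - gh (lab (x i))) + (w (\<sigma> i) - ?t (\<sigma> i)) * gh (lab (x i))\<bar>
    \<le> (\<Sum>i=1..n. w (\<sigma> i) * d + \<bar>w (\<sigma> i) - ?t (\<sigma> i)\<bar> * B)"
  proof (rule order_trans[OF sum_abs], rule sum_mono)
    fix i assume "i \<in> {1..n}"
    then have "0 \<le> w (\<sigma> i)" using w0(1) permutes_in_image[OF \<sigma>] by simp
    have "\<bar>w (\<sigma> i) * (g (x i) - gh (lab (x i))) + (w (\<sigma> i) - ?t (\<sigma> i)) * gh (lab (x i))\<bar>
      \<le> \<bar>w (\<sigma> i) * (g (x i) - gh (lab (x i)))\<bar> + \<bar>(w (\<sigma> i) - ?t (\<sigma> i)) * gh (lab (x i))\<bar>" by (rule abs_triangle_ineq)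
    also have "\<dots> \<le> w (\<sigma> i) * d + \<bar>w (\<sigma> i) - ?t (\<sigma> i)\<bar> * B"
      unfolding abs_mult using \<open>0 \<le> w (\<sigma> i)\<close> gh by (intro add_mono mult_mono) auto
    finally show "\<bar>w (\<sigma> i) * (g (x i) - gh (lab (x i))) + (w (\<sigma> i) - ?t (\<sigma> i)) * gh (lab (x i))\<bar>
      \<le> w (\<sigma> i) * d + \<bar>w (\<sigma> i) - ?t (\<sigma> i)\<bar> * B" .
  qed
  also have "\<dots> = (\<Sum>i=1..n. w i) * d + (\<Sum>i=1..n. \<bar>w i - ?t i\<bar>) * B"
    using perm[of w] perm[of "\<lambda>i. \<bar>w i - ?t i\<bar>"] by (simp add: sum.distrib sum_distrib_right[symmetric])
  finally have "\<bar>\<Sum>i=1..n. w (\<sigma> i) * (g (x i) - gh (lab (x i))) + (w (\<sigma> i) - ?t (\<sigma> i)) * gh (lab (x i))\<bar> / real n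
    \<le> ((\<Sum>i=1..n. w i) * d + (\<Sum>i=1..n. \<bar>w i - ?t i\<bar>) * B) / real n" using n0 by (intro divide_right_mono) auto
  also have "\<dots> = d + (\<Sum>i=1..n. \<bar>w i - ?t i\<bar>) / real n * B" using w0(2) n0 by (simp add: add_divide_distrib)
  also have "\<dots> \<le> d + c * B" using wT B by (intro add_left_mono mult_right_mono)
  finally show ?thesis unfolding eq using n0 by (simp add: mult.commute)
qed

section \<open>Random matching of sorted weights\<close>

definition perm_fraction :: "nat \<Rightarrow> ((nat \<Rightarrow> nat) \<Rightarrow> bool) \<Rightarrow> real" where
  "perm_fraction n P = real (card {\<sigma>. \<sigma> permutes {1..n} \<and> P \<sigma>}) / fact n"

lemma finite_permutes_Collect: "finite {\<sigma>. \<sigma> permutes {1..n::nat} \<and> P \<sigma>}"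
  by (rule finite_subset[OF _ finite_permutations[of "{1..n}"]]) auto

text \<open>A maximal entry is moved to the last place, and the rest is sorted by induction.\<close>

lemma sorting_permutation:
  fixes w :: "nat \<Rightarrow> real"
  shows "\<exists>\<tau>. \<tau> permutes {1..n} \<and> mono_on {1..n} (w \<circ> \<tau>)"
proof (induction n arbitrary: w)
  case 0
  then show ?case by (intro exI[of _ id]) (auto simp: permutes_id mono_on_def)
next
  case (Suc n)
  have "Max (w ` {1..Suc n}) \<in> w ` {1..Suc n}" by (rule Max_in) simp_all
  then obtain m where m: "Max (w ` {1..Suc n}) = w m" "m \<in> {1..Suc n}" by (rule imageE)
  define \<rho> where "\<rho> = Transposition.transpose m (Suc n)"
  have \<rho>: "\<rho> permutes {1..Suc n}" unfolding \<rho>_def using m by (intro permutes_swap_id) auto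
  obtain \<tau> where \<tau>: "\<tau> permutes {1..n}" "mono_on {1..n} ((w \<circ> \<rho>) \<circ> \<tau>)" using Suc.IH[of "w \<circ> \<rho>"] by blast
  have \<tau>': "\<tau> permutes {1..Suc n}" by (rule permutes_subset[OF \<tau>(1)]) auto
  have top: "\<tau> (Suc n) = Suc n" by (rule permutes_not_in[OF \<tau>(1)]) auto
  have "mono_on {1..Suc n} (w \<circ> (\<rho> \<circ> \<tau>))"
  proof (rule mono_onI)
    fix i j :: nat assume ij: "i \<in> {1..Suc n}" "j \<in> {1..Suc n}" "i \<le> j"
    show "(w \<circ> (\<rho> \<circ> \<tau>)) i \<le> (w \<circ> (\<rho> \<circ> \<tau>)) j"
    proof (cases "j = Suc n")
      case True
      have "(\<rho> \<circ> \<tau>) i \<in> {1..Suc n}" using ij(1) permutes_in_image[OF \<rho>] permutes_in_image[OF \<tau>'] by simp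
      then have "w ((\<rho> \<circ> \<tau>) i) \<le> w m" unfolding m(1)[symmetric] by (intro Max_ge) auto
      moreover have "(\<rho> \<circ> \<tau>) j = m" using True top by (simp add: \<rho>_def)
      ultimately show ?thesis by simp
    next
      case False
      then show ?thesis using mono_onD[OF \<tau>(2), of i j] ij by (simp add: comp_def)
    qed
  qed
  then show ?case using permutes_compose[OF \<tau>' \<rho>] by blast
qed

lemma weight_simplex_permute:
  assumes "w \<in> weight_simplex n" "\<tau> permutes {1..n}" shows "w \<circ> \<tau> \<in> weight_simplex n"
  using assms sum.permute[OF assms(2), of w] permutes_in_image[OF assms(2)]
  by (auto simp: weight_simplex_def comp_def)

lemma distribution_function_empirical_permute:
  assumes "1 \<le> n" "w \<in> weight_simplex n" "\<tau> permutes {1..n}"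
  shows "distribution_function (empirical Rplus n (w \<circ> \<tau>)) = distribution_function (empirical Rplus n w)"
proof
  fix t
  have w: "\<And>i. i \<in> {1..n} \<Longrightarrow> 0 \<le> w i" "\<And>i. i \<in> {1..n} \<Longrightarrow> 0 \<le> (w \<circ> \<tau>) i"
    using assms(2) weight_simplex_permute[OF assms(2,3)] by (auto simp: weight_simplex_def)
  have "\<tau> ` {i\<in>{1..n}. (w \<circ> \<tau>) i \<le> t} = {i\<in>\<tau> ` {1..n}. w i \<le> t}" by auto
  then have "bij_betw \<tau> {i\<in>{1..n}. (w \<circ> \<tau>) i \<le> t} {i\<in>{1..n}. w i \<le> t}"
    using permutes_inj_on[OF assms(3)] unfolding permutes_image[OF assms(3)] by (simp add: bij_betw_def)
  then show "distribution_function (empirical Rplus n (w \<circ> \<tau>)) t = distribution_function (empirical Rplus n w) t"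
    using bij_betw_same_card distribution_function_empirical[OF assms(1)] w by fastforce
qed

lemma cdf_dist_empirical_permute:
  assumes "1 \<le> n" "w \<in> weight_simplex n" "\<tau> permutes {1..n}"
  shows "cdf_dist \<gamma> (empirical Rplus n (w \<circ> \<tau>)) = cdf_dist \<gamma> (empirical Rplus n w)"
  using distribution_function_empirical_permute[OF assms] by (simp add: cdf_dist_def)

text \<open>Left translation is a bijection of the permutations, so for a uniformly random matching
  the weights may be assumed sorted.\<close>

lemma perm_fraction_permute:
  assumes "\<tau> permutes {1..n}"
  shows "perm_fraction n (\<lambda>\<sigma>. P (w \<circ> \<tau> \<circ> \<sigma>)) = perm_fraction n (\<lambda>\<sigma>. P (w \<circ> \<sigma>))"
proof -
  have "bij_betw (\<lambda>\<sigma>. \<tau> \<circ> \<sigma>) {\<sigma>. \<sigma> permutes {1..n} \<and> P (w \<circ> \<tau> \<circ> \<sigma>)} {\<sigma>. \<sigma> permutes {1..n} \<and> P (w \<circ> \<sigma>)}"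
  proof (rule bij_betw_byWitness[where f'="\<lambda>\<sigma>. inv \<tau> \<circ> \<sigma>"])
    have l: "inv \<tau> \<circ> (\<tau> \<circ> \<sigma>) = \<sigma>" and r: "\<tau> \<circ> (inv \<tau> \<circ> \<sigma>) = \<sigma>" for \<sigma>
      using permutes_inv_o[OF assms] by (simp_all add: comp_assoc[symmetric])
    then show "\<forall>\<sigma>\<in>{\<sigma>. \<sigma> permutes {1..n} \<and> P (w \<circ> \<tau> \<circ> \<sigma>)}. inv \<tau> \<circ> (\<tau> \<circ> \<sigma>) = \<sigma>"
      "\<forall>\<sigma>\<in>{\<sigma>. \<sigma> permutes {1..n} \<and> P (w \<circ> \<sigma>)}. \<tau> \<circ> (inv \<tau> \<circ> \<sigma>) = \<sigma>" by auto
    show "(\<circ>) \<tau> ` {\<sigma>. \<sigma> permutes {1..n} \<and> P (w \<circ> \<tau> \<circ> \<sigma>)} \<subseteq> {\<sigma>. \<sigma> permutes {1..n} \<and> P (w \<circ> \<sigma>)}"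
      using permutes_compose[OF _ assms] by (auto simp: comp_assoc)
    have "w \<circ> \<tau> \<circ> (inv \<tau> \<circ> \<sigma>) = w \<circ> \<sigma>" for \<sigma> by (simp only: comp_assoc r)
    note r' = this
    show "(\<lambda>\<sigma>. inv \<tau> \<circ> \<sigma>) ` {\<sigma>. \<sigma> permutes {1..n} \<and> P (w \<circ> \<sigma>)} \<subseteq> {\<sigma>. \<sigma> permutes {1..n} \<and> P (w \<circ> \<tau> \<circ> \<sigma>)}"
      using permutes_compose[OF _ permutes_inv[OF assms]] by (intro image_subsetI) (simp only: mem_Collect_eq r')
  qed
  then show ?thesis by (simp add: perm_fraction_def bij_betw_same_card)
qed

text \<open>Pigeonhole: there are at most \<open>(n + 1) ^ card (A \<times> K)\<close> tables, so
  some \<sigma> satisfying \<open>P\<close> has a table whose permutations make up a fraction of at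
  least \<open>exp (- n * b)\<close> up to this polynomial factor, and the count bounds the entropy
  of the table. The factor 2 in the constant adds the pigeonhole loss to the Stirling error.\<close>

lemma table_with_large_class:
  fixes l :: "nat \<Rightarrow> 'l" and l' :: "nat \<Rightarrow> 'b"
  assumes n: "1 \<le> n" and fin: "finite A" "finite K" and lab: "l ` {1..n} \<subseteq> A" "l' ` {1..n} \<subseteq> K"
    and big: "exp (- (real n * b)) \<le> perm_fraction n P"
  obtains \<sigma> where "\<sigma> permutes {1..n}" "P \<sigma>"
    "table_entropy A K (\<lambda>z. real (table_of l l' {1..n} \<sigma> z) / real n)
      \<le> b + real (card A + card K + 2 * card A * card K + 1) * log_error n / real n"
proof -
  have n0: "0 < real n" using n by simp
  let ?Z = "A \<times> K" and ?J = "{1..n}"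
  define E where "E = {\<sigma>. \<sigma> permutes {1..n} \<and> P \<sigma>}"
  have finE: "finite E" unfolding E_def by (rule finite_permutes_Collect)
  define tab where "tab \<sigma> = restrict (table_of l l' ?J \<sigma>) ?Z" for \<sigma>
  have finZ: "finite ?Z" using fin by simp
  have tab_range: "tab ` E \<subseteq> PiE ?Z (\<lambda>_. {0..n})"
  proof -
    have "table_of l l' ?J \<sigma> z \<le> card ?J" for \<sigma> z
      unfolding table_of_def by (intro card_mono) auto
    then have "table_of l l' ?J \<sigma> z \<in> {0..n}" for \<sigma> z by simp
    then show ?thesis unfolding tab_def by (intro image_subsetI) (simp only: restrict_PiE_iff ball_simps, simp)
  qed
  have cardT: "card (tab ` E) \<le> (n + 1) ^ card ?Z"
    using card_mono[OF finite_PiE[OF finZ] tab_range] by (simp add: card_PiE[OF finZ])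
  have Efrac: "exp (- (real n * b)) * fact n \<le> real (card E)"
    using big by (simp add: perm_fraction_def E_def pos_le_divide_eq)
  \<comment> \<open>If every class were smaller, the classes met by \<open>E\<close> could not add
    up to \<open>card E\<close>.\<close>
  have "\<exists>\<sigma>\<in>E. real (card E) \<le> real ((n + 1) ^ card ?Z) * real (card (table_permutations l l' ?J ?Z (table_of l l' ?J \<sigma>)))"
  proof (rule ccontr)
    assume no: "\<not> ?thesis"
    define R where "R = real ((n + 1) ^ card ?Z)"
    have R0: "0 < R" by (simp add: R_def)
    have "0 < exp (- (real n * b)) * fact n" by simp
    then have "0 < real (card E)" using Efrac by linarith
    then have "E \<noteq> {}" by auto
    have "E = (\<Union>N\<in>tab ` E. {\<sigma>\<in>E. tab \<sigma> = N})" by auto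
    then have "card E \<le> (\<Sum>N\<in>tab ` E. card {\<sigma>\<in>E. tab \<sigma> = N})"
      using card_UN_le[of "tab ` E" "\<lambda>N. {\<sigma>\<in>E. tab \<sigma> = N}"] finE by simp
    then have "real (card E) \<le> real (\<Sum>N\<in>tab ` E. card {\<sigma>\<in>E. tab \<sigma> = N})"
      by (simp only: of_nat_le_iff)
    also have "\<dots> < (\<Sum>N\<in>tab ` E. real (card E) / R)"
      unfolding of_nat_sum
    proof (rule sum_strict_mono)
      fix N assume "N \<in> tab ` E"
      then obtain \<sigma> where \<sigma>: "\<sigma> \<in> E" "N = tab \<sigma>" by auto
      have "{\<sigma>'\<in>E. tab \<sigma>' = N} \<subseteq> table_permutations l l' ?J ?Z (table_of l l' ?J \<sigma>)"
        unfolding \<sigma>(2) by (auto simp: table_permutations_def E_def tab_def restrict_def fun_eq_iff split: if_splits)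
      then have "card {\<sigma>'\<in>E. tab \<sigma>' = N} \<le> card (table_permutations l l' ?J ?Z (table_of l l' ?J \<sigma>))"
        by (rule card_mono[rotated]) (unfold table_permutations_def, rule finite_permutes_Collect)
      moreover have "R * real (card (table_permutations l l' ?J ?Z (table_of l l' ?J \<sigma>))) < real (card E)"
        using no \<sigma>(1) unfolding R_def by (simp add: not_le)
      ultimately have "R * real (card {\<sigma>'\<in>E. tab \<sigma>' = N}) < real (card E)"
        using R0 by (meson mult_left_mono less_imp_le of_nat_le_iff order_le_less_trans)
      then show "real (card {\<sigma>'\<in>E. tab \<sigma>' = N}) < real (card E) / R"
        using R0 by (simp add: pos_less_divide_eq mult.commute)
    qed (use finE \<open>E \<noteq> {}\<close> in auto)
    also have "\<dots> = real (card (tab ` E)) * (real (card E) / R)" by simp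
    also have "\<dots> \<le> R * (real (card E) / R)"
      using cardT R0 unfolding R_def by (intro mult_right_mono) (simp_all flip: of_nat_power add: of_nat_le_iff del: of_nat_power of_nat_add)
    also have "\<dots> = real (card E)" using R0 by simp
    finally show False by simp
  qed
  then obtain \<sigma> where \<sigma>: "\<sigma> \<in> E"
    and le: "real (card E) \<le> real ((n + 1) ^ card ?Z) * real (card (table_permutations l l' ?J ?Z (table_of l l' ?J \<sigma>)))" by blast
  have perm: "\<sigma> permutes ?J" "P \<sigma>" using \<sigma> by (auto simp: E_def)
  let ?N = "table_of l l' ?J \<sigma>"
  have cn: "card ?J = n" by simp
  note frac = table_permutations_fraction[OF _ fin lab cn n table_of_margins[OF _ fin lab perm(1)], simplified]
  let ?c = "real (card (table_permutations l l' ?J ?Z ?N))"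
  have c0: "0 < ?c" using frac(1) by simp
  have "exp (- (real n * b)) * fact n \<le> (real n + 1) ^ card ?Z * ?c" using Efrac le by (simp add: add.commute)
  then have "exp (- (real n * b)) \<le> (real n + 1) ^ card ?Z * (?c / fact n)" by (simp add: pos_le_divide_eq)
  then have "ln (exp (- (real n * b))) \<le> ln ((real n + 1) ^ card ?Z * (?c / fact n))"
    using c0 n0 by (subst ln_le_cancel_iff) (auto intro!: mult_pos_pos divide_pos_pos)
  also have "\<dots> = real (card ?Z) * ln (real n + 1) + ln (?c / fact n)"
    using c0 n0 by (subst ln_mult_pos) (auto intro!: divide_pos_pos simp: ln_realpow)
  finally have 1: "- (real n * b) \<le> real (card ?Z) * ln (real n + 1) + ln (?c / fact n)" by simp
  have "real (card ?Z) * ln (real n + 1) \<le> real (card ?Z) * log_error n" by (intro mult_left_mono) (auto simp: log_error_def)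
  moreover have "ln (?c / fact n) + real n * table_entropy A K (\<lambda>z. real (?N z) / real n)
      \<le> real (card A + card K + card A * card K + 1) * log_error n"
    using abs_le_D1[OF frac(2)] by simp
  ultimately have "real n * table_entropy A K (\<lambda>z. real (?N z) / real n)
    \<le> real n * b + real (card ?Z) * log_error n + real (card A + card K + card A * card K + 1) * log_error n"
    using 1 by linarith
  also have "\<dots> = real n * b + real (card A + card K + 2 * card A * card K + 1) * log_error n"
    by (simp add: card_cartesian_product algebra_simps)
  finally have "table_entropy A K (\<lambda>z. real (?N z) / real n)
    \<le> (real n * b + real (card A + card K + 2 * card A * card K + 1) * log_error n) / real n"
    using n0 by (simp add: pos_le_divide_eq mult.commute)
  also have "\<dots> = b + real (card A + card K + 2 * card A * card K + 1) * log_error n / real n"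
    using n0 by (simp add: add_divide_distrib)
  finally show thesis using that[OF perm] by simp
qed

lemma small_factor:
  fixes c :: real
  assumes "0 < d0" "0 < \<eta>" obtains d where "0 < d" "d \<le> d0" "c * d \<le> \<eta>"
proof
  show "0 < min d0 (\<eta> / (\<bar>c\<bar> + 1))" "min d0 (\<eta> / (\<bar>c\<bar> + 1)) \<le> d0"
    using assms by (auto intro!: divide_pos_pos add_nonneg_pos)
  have "c * min d0 (\<eta> / (\<bar>c\<bar> + 1)) \<le> (\<bar>c\<bar> + 1) * (\<eta> / (\<bar>c\<bar> + 1))"
    using assms by (intro mult_mono) auto
  also have "\<dots> = \<eta>" using abs_ge_zero[of c] by (simp add: add_nonneg_pos less_imp_neq[symmetric])
  finally show "c * min d0 (\<eta> / (\<bar>c\<bar> + 1)) \<le> \<eta>" .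
qed

lemma bounded_continuous_finite_bound:
  assumes G: "finite G" "G \<subseteq> bounded_continuous"
  obtains B where "1 \<le> B" "\<And>g y. g \<in> G \<Longrightarrow> \<bar>g y\<bar> \<le> B"
proof -
  have "\<exists>B. \<forall>y. \<bar>g y\<bar> \<le> B" if "g \<in> G" for g
    using bounded_continuous_bounded[of g] that G(2) by blast
  then obtain Bg where Bg: "\<And>g y. g \<in> G \<Longrightarrow> \<bar>g y\<bar> \<le> Bg g" by metis
  have "\<bar>g y\<bar> \<le> 1 + (\<Sum>g\<in>G. \<bar>Bg g\<bar>)" if "g \<in> G" for g y
  proof -
    have "\<bar>Bg g\<bar> \<le> (\<Sum>g\<in>G. \<bar>Bg g\<bar>)" using G(1) that by (intro member_le_sum) auto
    then show ?thesis using Bg[OF that, of y] by linarith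
  qed
  then show thesis using that[of "1 + (\<Sum>g\<in>G. \<bar>Bg g\<bar>)"] by (simp add: sum_nonneg)
qed

section \<open>The fraction of matchings close to a mixture\<close>

context
  fixes \<mu> :: "'a::topological_space measure" and x :: "nat \<Rightarrow> nat \<Rightarrow> 'a"
  assumes \<mu>: "\<mu> \<in> M1 borel"
    and conv: "\<And>f. f \<in> bounded_continuous \<Longrightarrow> (\<lambda>n. (\<Sum>i=1..n. f (x n i)) / real n) \<longlonglongrightarrow> (\<integral>y. f y \<partial>\<mu>)"
begin

text \<open>Collects cells, representatives and limiting frequencies for one shift that avoids
  atoms. Representatives lie within \<open>d\<close> of a value of \<open>g\<close>, hence the bound
  \<open>B + d\<close>.\<close>

lemma cell_labels:
  assumes G: "finite G" "G \<subseteq> bounded_continuous" and B: "\<forall>g\<in>G. \<forall>y. \<bar>g y\<bar> \<le> B" and d: "0 < d"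
  obtains lab :: "'a \<Rightarrow> ('a \<Rightarrow> real) \<Rightarrow> int" and gh where "finite (range lab)" "\<And>a. {y. lab y = a} \<in> sets borel"
    "\<And>g y. g \<in> G \<Longrightarrow> \<bar>g y - gh g (lab y)\<bar> \<le> d" "\<And>g y. g \<in> G \<Longrightarrow> \<bar>gh g (lab y)\<bar> \<le> B + d"
    "\<And>a. (\<lambda>n. real (class_size (\<lambda>i. lab (x n i)) {1..n} a) / real n) \<longlonglongrightarrow> measure \<mu> {y. lab y = a}"
proof -
  obtain s where s: "\<And>g z. g \<in> G \<Longrightarrow> measure \<mu> {y. (g y - s) / d = of_int z} = 0"
    using cell_shift_exists[OF \<mu> G d] by blast
  let ?lab = "cell_label G s d" and ?gh = "\<lambda>(g :: 'a \<Rightarrow> real) a. s + d * of_int (a g)"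
  show thesis
  proof (rule that)
    obtain L where "finite L" "\<And>y. ?lab y \<in> L" using cell_label_range[OF G d, of s] by blast
    then show "finite (range ?lab)" by (meson finite_subset image_subsetI)
    show "{y. ?lab y = a} \<in> sets borel" for a by (rule measurable_cell_label[OF G(2,1)])
    fix g y assume g: "g \<in> G"
    show 1: "\<bar>g y - ?gh g (?lab y)\<bar> \<le> d" by (rule cell_label_approx[OF g d])
    show "\<bar>?gh g (?lab y)\<bar> \<le> B + d" using 1 bspec[OF B g, THEN spec, of y] by linarith
  qed (rule cell_frequency[OF \<mu> conv G d s])
qed

text \<open>The matching sum and the integral of the mixture are each compared with a sum over
  cells; what remains is the difference of the two tables, where every cell carries a factor of at
  most \<open>M * B\<close>.\<close>

lemma matching_error:
  fixes lab :: "'a \<Rightarrow> 'l"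
  assumes lab: "finite (range lab)" "\<And>a. {y. lab y = a} \<in> sets borel" and k: "1 \<le> k" and T: "\<And>a. 0 \<le> T a" "\<And>a. T a \<le> M"
    and \<gamma>: "\<gamma> \<in> M11_Rplus" and \<pi>: "\<pi> \<in> unit_couplings \<mu>"
    and near: "(\<integral>\<^sup>+u. ennreal \<bar>quantile \<gamma> u - T (blk k u)\<bar> \<partial>unit_interval) \<le> ennreal e" "0 \<le> e"
    and g: "g \<in> bounded_continuous" and h: "\<And>y. \<bar>g y - h (lab y)\<bar> \<le> d" "\<And>y. \<bar>h (lab y)\<bar> \<le> B"
    and n: "1 \<le> n" and w: "w \<in> weight_simplex n" and \<sigma>: "\<sigma> permutes {1..n}"
    and wT: "(\<Sum>j=1..n. \<bar>w j - T (blk k (real j / real n))\<bar>) / real n \<le> c"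
    and table: "\<And>z. z \<in> range lab \<times> {1..k} \<Longrightarrow> \<bar>real (table_of (\<lambda>i. lab (y i)) (\<lambda>j. blk k (real j / real n)) {1..n} \<sigma> z) / real n
      - measure \<pi> (pair_cell k lab z)\<bar> \<le> d1"
  shows "\<bar>(\<Sum>i=1..n. w (\<sigma> i) / real n * g (y i)) - (\<integral>y. g y \<partial>mixture \<gamma> \<pi>)\<bar>
    \<le> 2 * d + B * (c + e) + real (card (range lab \<times> {1..k})) * (M * B) * d1"
proof -
  let ?Z = "range lab \<times> {1..k}" and ?p = "\<lambda>z. measure \<pi> (pair_cell k lab z)" and ?v = "\<lambda>z. T (snd z) * h (fst z)"
  let ?q = "\<lambda>z. real (table_of (\<lambda>i. lab (y i)) (\<lambda>j. blk k (real j / real n)) {1..n} \<sigma> z) / real n"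
  have rl: "lab y \<in> range lab" for y by simp
  have 1: "\<bar>(\<Sum>i=1..n. w (\<sigma> i) / real n * g (y i)) - (\<Sum>z\<in>?Z. ?q z * ?v z)\<bar> \<le> d + B * c"
    by (rule weighted_sum_cells[where lab=lab and g=g and gh=h, OF n w \<sigma> k lab(1) rl h wT])
  have 2: "\<bar>(\<integral>y. g y \<partial>mixture \<gamma> \<pi>) - (\<Sum>z\<in>?Z. ?p z * ?v z)\<bar> \<le> d + B * e"
    by (rule integral_mixture_cells[where lab=lab and g=g and gh=h, OF \<mu> lab(2,1) rl k \<pi> \<gamma> g h near])
  have "?q z * ?v z - ?p z * ?v z \<le> d1 * (M * B) \<and> ?p z * ?v z - ?q z * ?v z \<le> d1 * (M * B)" if z: "z \<in> ?Z" for z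
  proof -
    obtain y where "fst z = lab y" using z by auto
    then have "\<bar>?v z\<bar> \<le> M * B" unfolding abs_mult using T h(2)[of y] order_trans[OF T] by (intro mult_mono) auto
    with table[OF z] have "\<bar>?q z - ?p z\<bar> * \<bar>?v z\<bar> \<le> d1 * (M * B)" by (rule mult_mono) (use table[OF z] in auto)
    then show ?thesis unfolding abs_mult[symmetric] left_diff_distrib by linarith
  qed
  then have "\<bar>?q z * ?v z - ?p z * ?v z\<bar> \<le> d1 * (M * B)" if "z \<in> ?Z" for z using that by (simp only: abs_le_iff minus_diff_eq)
  then have "\<bar>(\<Sum>z\<in>?Z. ?q z * ?v z - ?p z * ?v z)\<bar> \<le> (\<Sum>z\<in>?Z. d1 * (M * B))"
    by (intro order_trans[OF sum_abs] sum_mono)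
  then have 3: "\<bar>(\<Sum>z\<in>?Z. ?q z * ?v z) - (\<Sum>z\<in>?Z. ?p z * ?v z)\<bar> \<le> real (card ?Z) * (M * B) * d1"
    by (simp only: sum_subtractf sum_constant mult_ac)
  have "B * (c + e) = B * c + B * e" by (rule distrib_left)
  then show ?thesis using 1 2 3 by linarith
qed

text \<open>Round the cell masses of \<pi> to a table with the margins that occur at stage
  \<open>n\<close>. All its permutations bring the weighted sums near the mixture, and their
  fraction is at least about \<open>exp (- n * h)\<close>, since discretising does not raise the
  entropy. The radius depends neither on \<open>n\<close> nor on the weights.\<close>

lemma matching_lower_bound:
  assumes \<gamma>: "\<gamma> \<in> M11_Rplus" and \<pi>: "\<pi> \<in> unit_couplings \<mu>" and H: "rel_entropy \<pi> (unit_prod \<mu>) \<le> ennreal h" "0 \<le> h"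
    and G: "finite G" "G \<subseteq> bounded_continuous" and \<epsilon>: "0 < \<epsilon>" and \<delta>: "0 < \<delta>"
  obtains r where "0 < (r::real)" "\<forall>\<^sub>F n in sequentially. \<forall>w\<in>weight_simplex n. cdf_dist \<gamma> (empirical Rplus n w) \<le> ennreal r \<longrightarrow>
    exp (- (real n * (h + \<delta>))) \<le> perm_fraction n (\<lambda>\<sigma>. \<forall>g\<in>G.
      \<bar>(\<Sum>i=1..n. (w \<circ> \<sigma>) i / real n * g (x n i)) - (\<integral>y. g y \<partial>mixture \<gamma> \<pi>)\<bar> < \<epsilon>)"
proof -
  obtain B where B: "1 \<le> B" "\<And>g y. g \<in> G \<Longrightarrow> \<bar>g y\<bar> \<le> B"
    using bounded_continuous_finite_bound[OF G] by blast
  define d where "d = min B (\<epsilon> / 8)"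
  have d: "0 < d" "d \<le> B" "d \<le> \<epsilon> / 8" using B(1) \<epsilon> by (auto simp: d_def)
  \<comment> \<open>With \<open>d \<le> \<epsilon> / 8\<close> and
    \<open>B * e = \<epsilon> / 24\<close> the final error consists of \<open>2 * d\<close>, of
    \<open>6 * (B * e)\<close> and of two terms of at most \<open>\<epsilon> / 8\<close>, in total
    at most \<open>3 * \<epsilon> / 4\<close>.\<close>
  define e where "e = \<epsilon> / (24 * B)"
  have e: "0 < e" "B * e = \<epsilon> / 24" using B(1) \<epsilon> by (auto simp: e_def)
  have Gb: "\<forall>g\<in>G. \<forall>y. \<bar>g y\<bar> \<le> B" using B(2) by blast
  obtain lab :: "'a \<Rightarrow> ('a \<Rightarrow> real) \<Rightarrow> int" and gh where lab: "finite (range lab)" "\<And>a. {y. lab y = a} \<in> sets borel"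
    and gh: "\<And>g y. g \<in> G \<Longrightarrow> \<bar>g y - gh g (lab y)\<bar> \<le> d" "\<And>g y. g \<in> G \<Longrightarrow> \<bar>gh g (lab y)\<bar> \<le> B + d"
    and freq: "\<And>a. (\<lambda>n. real (class_size (\<lambda>i. lab (x n i)) {1..n} a) / real n) \<longlonglongrightarrow> measure \<mu> {y. lab y = a}"
    using cell_labels[OF G Gb d(1)] by blast
  have rl: "lab y \<in> range lab" for y by simp
  obtain k M T where T: "1 \<le> k" "0 \<le> M" "mono T" "\<And>a. 0 \<le> T a" "\<And>a. T a \<le> M"
    "(\<integral>\<^sup>+u. ennreal \<bar>quantile \<gamma> u - T (blk k u)\<bar> \<partial>unit_interval) \<le> ennreal e"
    using step_approximation[OF \<gamma> e(1)] by blast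
  let ?A = "range lab"
  let ?Z = "?A \<times> {1..k}"
  let ?p = "\<lambda>z. measure \<pi> (pair_cell k lab z)"
  have te: "table_entropy ?A {1..k} ?p \<le> h"
    by (rule table_entropy_coupling_le[OF \<mu> lab(2,1) rl T(1) \<pi> H])
  have m1: "(\<Sum>b=1..k. ?p (a, b)) = measure \<mu> {y. lab y = a}" if "a \<in> ?A" for a
    by (rule coupling_table_margin1[OF \<mu> lab(2,1) rl T(1) \<pi> that])
  have m2: "(\<Sum>a\<in>?A. ?p (a, b)) = 1 / real k" if "b \<in> {1..k}" for b
    by (rule coupling_table_margin2[OF \<mu> lab(2,1) rl T(1) \<pi> that])
  have psum: "(\<Sum>z\<in>?Z. ?p z) = 1"
    by (rule sum_table[OF \<mu> lab(2,1) rl T(1) _ m1 m2]) auto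
  \<comment> \<open>Small enough for the rounded table to have entropy below
    \<open>h + \<delta> / 2\<close>; the other half of \<delta> absorbs the Stirling error.\<close>
  obtain d0 where d0: "0 < d0" "\<And>q. (\<And>z. 0 \<le> q z) \<Longrightarrow> (\<And>z. z \<in> ?Z \<Longrightarrow> \<bar>q z - ?p z\<bar> \<le> d0) \<Longrightarrow>
    table_entropy ?A {1..k} q < table_entropy ?A {1..k} ?p + \<delta> / 2"
  proof -
    have "0 < \<delta> / 2" using \<delta> by simp
    from table_entropy_near[OF this, of ?A "{1..k}" ?p] show thesis using that by blast
  qed
  have e8: "0 < \<epsilon> / 8" using \<epsilon> by simp
  obtain d1 where d1: "0 < d1" "d1 \<le> d0" "real (card ?Z) * (M * (B + d)) * d1 \<le> \<epsilon> / 8"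
    by (rule small_factor[OF d0(1) e8])
  let ?l = "\<lambda>n i. lab (x n i)" and ?b = "\<lambda>n j. blk k (real j / real n)"
  have lr: "?l n ` {1..n} \<subseteq> ?A" for n by auto
  have br: "?b n ` {1..n} \<subseteq> {1..k}" for n
  proof -
    have "?b n j \<in> {1..k}" if "j \<in> {1..n}" for j
      using that by (intro blk_range[OF T(1)]) (auto simp: divide_le_eq)
    then show ?thesis by blast
  qed
  have "\<forall>\<^sub>F n in sequentially. \<exists>N. (\<forall>a\<in>?A. (\<Sum>b=1..k. N (a, b)) = class_size (?l n) {1..n} a) \<and>
    (\<forall>b\<in>{1..k}. (\<Sum>a\<in>?A. N (a, b)) = class_size (?b n) {1..n} b) \<and> (\<forall>z\<in>?Z. \<bar>real (N z) / real n - ?p z\<bar> \<le> d1)"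
  proof (rule table_rounding)
    show "(\<Sum>a\<in>?A. class_size (?l n) {1..n} a) = n" for n using sum_class_size[OF _ lab(1) lr] by simp
    show "(\<Sum>b=1..k. class_size (?b n) {1..n} b) = n" for n using sum_class_size[OF _ _ br] by simp
    show "(\<lambda>n. real (class_size (?l n) {1..n} a) / real n) \<longlonglongrightarrow> (\<Sum>b=1..k. ?p (a, b))" if "a \<in> ?A" for a
      unfolding m1[OF that] by (rule freq)
    show "(\<lambda>n. real (class_size (?b n) {1..n} b) / real n) \<longlonglongrightarrow> (\<Sum>a\<in>?A. ?p (a, b))" if "b \<in> {1..k}" for b
      unfolding m2[OF that] by (rule block_frequency[OF T(1) that])
  qed (use psum d1 lab(1) in auto)
  moreover have "\<forall>\<^sub>F n in sequentially. 2 * B * M / real n < \<epsilon> / 8"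
    using \<epsilon> by (intro order_tendstoD(2)[OF lim_const_over_n]) auto
  moreover have "\<forall>\<^sub>F n in sequentially. real (card ?A + card {1..k} + card ?A * card {1..k} + 1) * log_error n / real n < \<delta> / 2"
    using \<delta> by (intro order_tendstoD(2)[OF log_error_lim]) auto
  moreover have "\<forall>\<^sub>F n in sequentially. n \<ge> (1::nat)" by (rule eventually_ge_at_top)
  ultimately have "\<forall>\<^sub>F n in sequentially. \<forall>w\<in>weight_simplex n. cdf_dist \<gamma> (empirical Rplus n w) \<le> ennreal e \<longrightarrow>
    exp (- (real n * (h + \<delta>))) \<le> perm_fraction n (\<lambda>\<sigma>. \<forall>g\<in>G.
      \<bar>(\<Sum>i=1..n. (w \<circ> \<sigma>) i / real n * g (x n i)) - (\<integral>y. g y \<partial>mixture \<gamma> \<pi>)\<bar> < \<epsilon>)"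
  proof eventually_elim
    case (elim n)
    have n: "1 \<le> n" and n0: "0 < real n" using elim(4) by auto
    obtain N where N: "\<And>a. a \<in> ?A \<Longrightarrow> (\<Sum>b=1..k. N (a, b)) = class_size (?l n) {1..n} a"
      "\<And>b. b \<in> {1..k} \<Longrightarrow> (\<Sum>a\<in>?A. N (a, b)) = class_size (?b n) {1..n} b"
      "\<And>z. z \<in> ?Z \<Longrightarrow> \<bar>real (N z) / real n - ?p z\<bar> \<le> d1" using elim(1) by blast
    have cn: "card {1..n} = n" by simp
    let ?TP = "table_permutations (?l n) (?b n) {1..n} ?Z N"
    note frac = table_permutations_fraction[OF finite_atLeastAtMost lab(1) finite_atLeastAtMost lr br cn n N(1,2)]
    have "table_entropy ?A {1..k} (\<lambda>z. real (N z) / real n) < table_entropy ?A {1..k} ?p + \<delta> / 2"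
      using N(3) d1(2) by (intro d0(2)) (auto intro: order_trans)
    then have teN: "table_entropy ?A {1..k} (\<lambda>z. real (N z) / real n) \<le> h + \<delta> / 2" using te by linarith
    have "- (real n * table_entropy ?A {1..k} (\<lambda>z. real (N z) / real n)) - real (card ?A + card {1..k} + card ?A * card {1..k} + 1) * log_error n
      \<le> ln (real (card ?TP) / fact n)"
      using abs_le_D2[OF frac(2)] by linarith
    moreover have "real n * table_entropy ?A {1..k} (\<lambda>z. real (N z) / real n) \<le> real n * (h + \<delta> / 2)"
      using teN n0 by (intro mult_left_mono) auto
    moreover have "real (card ?A + card {1..k} + card ?A * card {1..k} + 1) * log_error n \<le> real n * (\<delta> / 2)"
      using elim(3) n0 by (simp add: pos_divide_less_eq mult.commute)
    ultimately have "- (real n * (h + \<delta>)) \<le> ln (real (card ?TP) / fact n)" by (simp add: distrib_left)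
    then have "exp (- (real n * (h + \<delta>))) \<le> exp (ln (real (card ?TP) / fact n))" by simp
    also have "\<dots> = real (card ?TP) / fact n" using frac(1) by (intro exp_ln divide_pos_pos) auto
    finally have large: "exp (- (real n * (h + \<delta>))) \<le> real (card ?TP) / fact n" .
    show ?case
    proof (intro ballI impI)
      fix w assume w: "w \<in> weight_simplex n" and near: "cdf_dist \<gamma> (empirical Rplus n w) \<le> ennreal e"
      let ?P = "\<lambda>v. \<forall>g\<in>G. \<bar>(\<Sum>i=1..n. v i / real n * g (x n i)) - (\<integral>y. g y \<partial>mixture \<gamma> \<pi>)\<bar> < \<epsilon>"
      obtain \<tau> where \<tau>: "\<tau> permutes {1..n}" "mono_on {1..n} (w \<circ> \<tau>)" using sorting_permutation by blast
      have w': "w \<circ> \<tau> \<in> weight_simplex n" by (rule weight_simplex_permute[OF w \<tau>(1)])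
      have near': "cdf_dist \<gamma> (empirical Rplus n (w \<circ> \<tau>)) \<le> ennreal e"
        using near cdf_dist_empirical_permute[OF n w \<tau>(1)] by simp
      have wT: "(\<Sum>j=1..n. \<bar>(w \<circ> \<tau>) j - T (?b n j)\<bar>) / real n \<le> e + e + M / real n"
        using e(1) by (intro sorted_weights_step_approx[OF n w' \<tau>(2) \<gamma> near' _ T(1,3,4,5) _ T(6)]) auto
      have "?P (w \<circ> \<tau> \<circ> \<sigma>)" if \<sigma>: "\<sigma> \<in> ?TP" for \<sigma>
      proof
        fix g assume g: "g \<in> G"
        then have gc: "g \<in> bounded_continuous" using G(2) by blast
        have perm: "\<sigma> permutes {1..n}" and tab: "\<And>z. z \<in> ?Z \<Longrightarrow> table_of (?l n) (?b n) {1..n} \<sigma> z = N z"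
          using \<sigma> by (auto simp: table_permutations_def)
        have near: "\<bar>real (table_of (?l n) (?b n) {1..n} \<sigma> z) / real n - ?p z\<bar> \<le> d1" if "z \<in> ?Z" for z
          using N(3)[OF that] unfolding tab[OF that] .
        have "\<bar>(\<Sum>i=1..n. (w \<circ> \<tau>) (\<sigma> i) / real n * g (x n i)) - (\<integral>y. g y \<partial>mixture \<gamma> \<pi>)\<bar>
          \<le> 2 * d + (B + d) * (e + e + M / real n + e) + real (card ?Z) * (M * (B + d)) * d1"
          using e(1) by (intro matching_error[where g=g and h="gh g" and y="x n", OF lab T(1,4,5) \<gamma> \<pi> T(6) _ gc gh[OF g] n w' perm wT near]) auto
        also have "\<dots> \<le> 2 * d + 2 * B * (e + e + M / real n + e) + \<epsilon> / 8"
          using d d1(3) e(1) T(2) by (intro add_mono mult_right_mono) auto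
        also have "\<dots> = 2 * d + 6 * (B * e) + 2 * B * M / real n + \<epsilon> / 8" by (simp add: algebra_simps)
        also have "\<dots> < \<epsilon>" using d(3) elim(2) \<epsilon> unfolding e(2) by simp
        finally show "\<bar>(\<Sum>i=1..n. (w \<circ> \<tau> \<circ> \<sigma>) i / real n * g (x n i)) - (\<integral>y. g y \<partial>mixture \<gamma> \<pi>)\<bar> < \<epsilon>"
          by (simp only: comp_apply)
      qed
      then have "?TP \<subseteq> {\<sigma>. \<sigma> permutes {1..n} \<and> ?P (w \<circ> \<tau> \<circ> \<sigma>)}" by (auto simp: table_permutations_def)
      then have "real (card ?TP) / fact n \<le> perm_fraction n (\<lambda>\<sigma>. ?P (w \<circ> \<tau> \<circ> \<sigma>))"
        unfolding perm_fraction_def by (intro divide_right_mono of_nat_mono card_mono finite_permutes_Collect) auto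
      also have "\<dots> = perm_fraction n (\<lambda>\<sigma>. ?P (w \<circ> \<sigma>))" by (rule perm_fraction_permute[OF \<tau>(1)])
      finally show "exp (- (real n * (h + \<delta>))) \<le> perm_fraction n (\<lambda>\<sigma>. ?P (w \<circ> \<sigma>))" using large by linarith
    qed
  qed
  then show thesis using that[OF e(1)] by blast
qed

text \<open>A large fraction of matchings landing in \<open>C\<close> for infinitely many
  \<open>n\<close> would, by pigeonhole and compactness of tables, produce a coupling of entropy at
  most \<open>b\<close> and a point of \<open>C\<close> near its mixtures. In \<open>no\<close> the
  law \<gamma>' ranges over the ball after \<pi> is fixed, because \<gamma>' is chosen only later,
  as a nearly cheapest weight law of the ball.\<close>

lemma matching_upper_bound:
  assumes \<gamma>: "\<gamma> \<in> M11_Rplus" and G: "finite G" "G \<subseteq> bounded_continuous" and B: "0 < B" "\<And>g y. g \<in> G \<Longrightarrow> \<bar>g y\<bar> \<le> B"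
    and r: "0 < r" "4 * B * r < \<epsilon>"
    and no: "\<And>\<pi> \<nu>. \<pi> \<in> unit_couplings \<mu> \<Longrightarrow> rel_entropy \<pi> (unit_prod \<mu>) \<le> ennreal b \<Longrightarrow> \<nu> \<in> C \<Longrightarrow>
      (\<And>\<gamma>' g. \<gamma>' \<in> M11_Rplus \<Longrightarrow> cdf_dist \<gamma> \<gamma>' \<le> ennreal r \<Longrightarrow> g \<in> G \<Longrightarrow>
        \<bar>(\<integral>y. g y \<partial>\<nu>) - (\<integral>y. g y \<partial>mixture \<gamma>' \<pi>)\<bar> < \<epsilon>) \<Longrightarrow> False"
  shows "\<forall>\<^sub>F n in sequentially. \<forall>w\<in>weight_simplex n. cdf_dist \<gamma> (empirical Rplus n w) \<le> ennreal r \<longrightarrow>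
    perm_fraction n (\<lambda>\<sigma>. weighted_empirical borel n (w \<circ> \<sigma>) (x n) \<in> C) < exp (- (real n * b))"
proof (rule ccontr)
  assume not_ev: "\<not> ?thesis"
  \<comment> \<open>The part \<open>4 * B * r\<close> of \<epsilon> pays for two distances of at
    most \<open>r\<close>, from the sample to \<gamma> and from \<gamma> to \<gamma>', each
    multiplied by \<open>B + d \<le> 2 * B\<close>; the rest covers the discretisation.\<close>
  define \<eta> where "\<eta> = \<epsilon> - 4 * B * r"
  have \<eta>: "0 < \<eta>" using r by (simp add: \<eta>_def)
  define d where "d = min B (\<eta> / 8)"
  have d: "0 < d" "d \<le> B" "d \<le> \<eta> / 8" using B(1) \<eta> by (auto simp: d_def)
  define e where "e = \<eta> / (16 * B)"
  have e: "0 < e" "B * e = \<eta> / 16" using B(1) \<eta> by (auto simp: e_def)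
  have Gb: "\<forall>g\<in>G. \<forall>y. \<bar>g y\<bar> \<le> B" using B(2) by blast
  obtain lab :: "'a \<Rightarrow> ('a \<Rightarrow> real) \<Rightarrow> int" and gh where lab: "finite (range lab)" "\<And>a. {y. lab y = a} \<in> sets borel"
    and gh: "\<And>g y. g \<in> G \<Longrightarrow> \<bar>g y - gh g (lab y)\<bar> \<le> d" "\<And>g y. g \<in> G \<Longrightarrow> \<bar>gh g (lab y)\<bar> \<le> B + d"
    and freq: "\<And>a. (\<lambda>n. real (class_size (\<lambda>i. lab (x n i)) {1..n} a) / real n) \<longlonglongrightarrow> measure \<mu> {y. lab y = a}"
    using cell_labels[OF G Gb d(1)] by blast
  have rl: "lab y \<in> range lab" for y by simp
  obtain k M T where T: "1 \<le> k" "0 \<le> M" "mono T" "\<And>a. 0 \<le> T a" "\<And>a. T a \<le> M"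
    "(\<integral>\<^sup>+u. ennreal \<bar>quantile \<gamma> u - T (blk k u)\<bar> \<partial>unit_interval) \<le> ennreal e"
    using step_approximation[OF \<gamma> e(1)] by blast
  let ?A = "range lab"
  let ?Z = "?A \<times> {1..k}"
  have finZ: "finite ?Z" using lab(1) by simp
  let ?l = "\<lambda>n i. lab (x n i)" and ?b = "\<lambda>n j. blk k (real j / real n)"
  have lr: "?l n ` {1..n} \<subseteq> ?A" for n by auto
  have br: "?b n ` {1..n} \<subseteq> {1..k}" for n
  proof -
    have "?b n j \<in> {1..k}" if "j \<in> {1..n}" for j
      using that by (intro blk_range[OF T(1)]) (auto simp: divide_le_eq)
    then show ?thesis by blast
  qed
  let ?c = "real (card ?A + card {1..k} + 2 * card ?A * card {1..k} + 1)"
  let ?Q = "\<lambda>n w \<sigma>. w \<in> weight_simplex n \<and> mono_on {1..n} w \<and> cdf_dist \<gamma> (empirical Rplus n w) \<le> ennreal r \<and>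
    \<sigma> permutes {1..n} \<and> weighted_empirical borel n (w \<circ> \<sigma>) (x n) \<in> C \<and>
    table_entropy ?A {1..k} (\<lambda>z. real (table_of (?l n) (?b n) {1..n} \<sigma> z) / real n) \<le> b + ?c * log_error n / real n"
  define I where "I = {n. 1 \<le> n \<and> (\<exists>w \<sigma>. ?Q n w \<sigma>)}"
  \<comment> \<open>At each failing \<open>n\<close> the weights are sorted first; the pigeonhole
    lemma then supplies a permutation into \<open>C\<close> whose table has small entropy.\<close>
  have "infinite I"
    unfolding infinite_nat_iff_unbounded_le
  proof
    fix m
    obtain n where n: "max m 1 \<le> n" and "\<not> (\<forall>w\<in>weight_simplex n. cdf_dist \<gamma> (empirical Rplus n w) \<le> ennreal r \<longrightarrow>
      perm_fraction n (\<lambda>\<sigma>. weighted_empirical borel n (w \<circ> \<sigma>) (x n) \<in> C) < exp (- (real n * b)))"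
      using not_ev unfolding eventually_sequentially by blast
    then obtain w where w: "w \<in> weight_simplex n" "cdf_dist \<gamma> (empirical Rplus n w) \<le> ennreal r"
      "exp (- (real n * b)) \<le> perm_fraction n (\<lambda>\<sigma>. weighted_empirical borel n (w \<circ> \<sigma>) (x n) \<in> C)"
      by (auto simp: not_less)
    have n1: "1 \<le> n" using n by simp
    obtain \<tau> where \<tau>: "\<tau> permutes {1..n}" "mono_on {1..n} (w \<circ> \<tau>)" using sorting_permutation by blast
    have "exp (- (real n * b)) \<le> perm_fraction n (\<lambda>\<sigma>. weighted_empirical borel n (w \<circ> \<tau> \<circ> \<sigma>) (x n) \<in> C)"
      using w(3) perm_fraction_permute[OF \<tau>(1), of "\<lambda>v. weighted_empirical borel n v (x n) \<in> C" w] by simp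
    then obtain \<sigma> where "\<sigma> permutes {1..n}" "weighted_empirical borel n (w \<circ> \<tau> \<circ> \<sigma>) (x n) \<in> C"
      "table_entropy ?A {1..k} (\<lambda>z. real (table_of (?l n) (?b n) {1..n} \<sigma> z) / real n) \<le> b + ?c * log_error n / real n"
      by (rule table_with_large_class[OF n1 lab(1) finite_atLeastAtMost lr br])
    then have "?Q n (w \<circ> \<tau>) \<sigma>"
      using \<tau> weight_simplex_permute[OF w(1) \<tau>(1)] cdf_dist_empirical_permute[OF n1 w(1) \<tau>(1)] w(2) by simp
    then show "\<exists>n\<ge>m. n \<in> I" using n n1 unfolding I_def by auto
  qed
  then obtain ns :: "nat \<Rightarrow> nat" where ns: "strict_mono ns" "\<And>m. ns m \<in> I" using infinite_enumerate by blast
  then have "\<forall>m. \<exists>w \<sigma>. ?Q (ns m) w \<sigma>" by (auto simp: I_def)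
  then obtain w \<sigma> where Q: "\<And>m. ?Q (ns m) (w m) (\<sigma> m)" by metis
  have n1: "1 \<le> ns m" for m using ns(2)[of m] by (simp add: I_def)
  define p where "p m z = real (table_of (?l (ns m)) (?b (ns m)) {1..ns m} (\<sigma> m) z) / real (ns m)" for m z
  have p01: "0 \<le> p m z" "p m z \<le> 1" for m z
  proof -
    have "table_of (?l (ns m)) (?b (ns m)) {1..ns m} (\<sigma> m) z \<le> card {1..ns m}"
      unfolding table_of_def by (intro card_mono) auto
    then show "0 \<le> p m z" "p m z \<le> 1" using n1[of m] by (simp_all add: p_def divide_le_eq)
  qed
  then have "\<bar>p m z\<bar> \<le> 1" for m z by simp
  from finite_bounded_convergent_subseq[OF finZ, of p 1, OF this] obtain t q0 where t: "strict_mono (t :: nat \<Rightarrow> nat)"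
    "\<And>z. z \<in> ?Z \<Longrightarrow> (\<lambda>m. p (t m) z) \<longlonglongrightarrow> q0 z" by blast
  \<comment> \<open>Set to 0 outside the index set, since \<open>coupling_of_table\<close> wants a
    nonnegative function on the whole type.\<close>
  define q where "q z = (if z \<in> ?Z then q0 z else 0)" for z
  have q: "(\<lambda>m. p (t m) z) \<longlonglongrightarrow> q z" if "z \<in> ?Z" for z using t(2)[OF that] that by (simp add: q_def)
  have qnn: "0 \<le> q z" for z
  proof (cases "z \<in> ?Z")
    case True
    show ?thesis by (rule LIMSEQ_le_const[OF q[OF True]]) (use p01 in auto)
  qed (auto simp: q_def)
  define N where "N m = ns (t m)" for m
  have N: "strict_mono N" unfolding N_def using strict_mono_o[OF ns(1) t(1)] by (simp add: comp_def)
  have Nlim: "filterlim N at_top sequentially" by (rule filterlim_subseq[OF N])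
  have q1: "(\<Sum>b=1..k. q (a, b)) = measure \<mu> {y. lab y = a}" if a: "a \<in> ?A" for a
  proof (rule LIMSEQ_unique)
    have "(\<lambda>m. \<Sum>b=1..k. p (t m) (a, b)) \<longlonglongrightarrow> (\<Sum>b=1..k. q (a, b))" using a by (intro tendsto_sum q) auto
    moreover have "(\<Sum>b=1..k. p (t m) (a, b)) = real (class_size (?l (N m)) {1..N m} a) / real (N m)" for m
      using table_of_margins(1)[OF _ lab(1) _ lr br, of "N m" "\<sigma> (t m)" a] Q[of "t m"] a
      by (simp add: p_def N_def sum_divide_distrib[symmetric] flip: of_nat_sum)
    ultimately show "(\<lambda>m. real (class_size (?l (N m)) {1..N m} a) / real (N m)) \<longlonglongrightarrow> (\<Sum>b=1..k. q (a, b))" by simp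
    show "(\<lambda>m. real (class_size (?l (N m)) {1..N m} a) / real (N m)) \<longlonglongrightarrow> measure \<mu> {y. lab y = a}"
      using filterlim_compose[OF freq Nlim] by simp
  qed
  have q2: "(\<Sum>a\<in>?A. q (a, b)) = 1 / real k" if b: "b \<in> {1..k}" for b
  proof (rule LIMSEQ_unique)
    have "(\<lambda>m. \<Sum>a\<in>?A. p (t m) (a, b)) \<longlonglongrightarrow> (\<Sum>a\<in>?A. q (a, b))" using b by (intro tendsto_sum q) auto
    moreover have "(\<Sum>a\<in>?A. p (t m) (a, b)) = real (class_size (?b (N m)) {1..N m} b) / real (N m)" for m
      using table_of_margins(2)[OF _ lab(1) _ lr br, of "N m" "\<sigma> (t m)" b] Q[of "t m"] b
      by (simp add: p_def N_def sum_divide_distrib[symmetric] flip: of_nat_sum)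
    ultimately show "(\<lambda>m. real (class_size (?b (N m)) {1..N m} b) / real (N m)) \<longlonglongrightarrow> (\<Sum>a\<in>?A. q (a, b))" by simp
    show "(\<lambda>m. real (class_size (?b (N m)) {1..N m} b) / real (N m)) \<longlonglongrightarrow> 1 / real k"
      using filterlim_compose[OF block_frequency[OF T(1) b] Nlim] by simp
  qed
  have te: "table_entropy ?A {1..k} q \<le> b"
  proof (rule LIMSEQ_le)
    show "(\<lambda>m. table_entropy ?A {1..k} (p (t m))) \<longlonglongrightarrow> table_entropy ?A {1..k} q"
      using q p01 by (intro tendsto_table_entropy)
    have "(\<lambda>m. b + ?c * log_error (N m) / real (N m)) \<longlonglongrightarrow> b + 0"
      by (intro tendsto_add tendsto_const filterlim_compose[OF log_error_lim Nlim])
    then show "(\<lambda>m. b + ?c * log_error (N m) / real (N m)) \<longlonglongrightarrow> b" by simp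
    show "\<exists>n0. \<forall>m\<ge>n0. table_entropy ?A {1..k} (p (t m)) \<le> b + ?c * log_error (N m) / real (N m)"
    proof (intro exI allI impI)
      fix m :: nat
      have "p (t m) = (\<lambda>z. real (table_of (?l (N m)) (?b (N m)) {1..N m} (\<sigma> (t m)) z) / real (N m))"
        by (simp add: p_def N_def fun_eq_iff)
      then show "table_entropy ?A {1..k} (p (t m)) \<le> b + ?c * log_error (N m) / real (N m)"
        using Q[of "t m"] by (simp add: N_def)
    qed
  qed
  \<comment> \<open>Only the limit table has exactly the margins of a coupling; at finite
    \<open>n\<close> the margins are merely close.\<close>
  obtain \<pi> where \<pi>: "\<pi> \<in> unit_couplings \<mu>" "rel_entropy \<pi> (unit_prod \<mu>) = ennreal (table_entropy ?A {1..k} q)"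
    "\<And>z. z \<in> ?Z \<Longrightarrow> measure \<pi> (pair_cell k lab z) = q z"
    using coupling_of_table[OF \<mu> lab(2,1) rl T(1) qnn q1 q2] by blast
  have \<eta>8: "0 < \<eta> / 8" using \<eta> by simp
  obtain d1 where d1: "0 < d1" "real (card ?Z) * (M * (B + d)) * d1 \<le> \<eta> / 8"
    by (rule small_factor[OF zero_less_one \<eta>8])
  have "\<forall>\<^sub>F m in sequentially. \<forall>z\<in>?Z. \<bar>p (t m) z - q z\<bar> < d1"
    using tendstoD[OF q d1(1)] by (intro eventually_ball_finite[OF finZ] ballI) (simp add: dist_real_def)
  moreover have "\<forall>\<^sub>F m in sequentially. 2 * B * M / real (N m) < \<eta> / 8"
    using \<eta> by (intro order_tendstoD(2)[OF filterlim_compose[OF lim_const_over_n Nlim]]) auto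
  ultimately have "\<forall>\<^sub>F m in sequentially. (\<forall>z\<in>?Z. \<bar>p (t m) z - q z\<bar> < d1) \<and> 2 * B * M / real (N m) < \<eta> / 8"
    by (rule eventually_conj)
  then obtain m where m: "\<And>z. z \<in> ?Z \<Longrightarrow> \<bar>p (t m) z - q z\<bar> < d1" "2 * B * M / real (N m) < \<eta> / 8"
    by (auto simp: eventually_sequentially)
  define n where "n = N m"
  have mn: "2 * B * M / real n < \<eta> / 8" using m(2) by (simp only: n_def)
  define v where "v = w (t m)"
  define \<tau> where "\<tau> = \<sigma> (t m)"
  have Qm: "?Q n v \<tau>" using Q[of "t m"] by (simp add: n_def v_def \<tau>_def N_def)
  then have v: "v \<in> weight_simplex n" "mono_on {1..n} v" "cdf_dist \<gamma> (empirical Rplus n v) \<le> ennreal r"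
    and \<tau>: "\<tau> permutes {1..n}" and inC: "weighted_empirical borel n (v \<circ> \<tau>) (x n) \<in> C" by auto
  have nn1: "1 \<le> n" using n1 by (simp add: n_def N_def)
  have wT: "(\<Sum>j=1..n. \<bar>v j - T (?b n j)\<bar>) / real n \<le> r + e + M / real n"
    using e(1) r(1) by (intro sorted_weights_step_approx[OF nn1 v(1,2) \<gamma> v(3) _ T(1,3,4,5) _ T(6)]) auto
  show False
  proof (rule no[OF \<pi>(1) _ inC])
    show "rel_entropy \<pi> (unit_prod \<mu>) \<le> ennreal b" unfolding \<pi>(2) using te by (rule ennreal_leI)
    fix \<gamma>' g assume \<gamma>': "\<gamma>' \<in> M11_Rplus" "cdf_dist \<gamma> \<gamma>' \<le> ennreal r" and g: "g \<in> G"
    have vs: "v \<circ> \<tau> \<in> weight_simplex n" by (rule weight_simplex_permute[OF v(1) \<tau>])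
    have gc: "g \<in> bounded_continuous" using G(2) g by blast
    have int: "(\<integral>y. g y \<partial>weighted_empirical borel n (v \<circ> \<tau>) (x n)) = (\<Sum>i=1..n. v (\<tau> i) / real n * g (x n i))"
      using vs bounded_continuous_measurable[OF gc] by (subst integral_weighted_empirical) (auto simp: weight_simplex_def)
    \<comment> \<open>The step function \<open>T\<close> was chosen for \<gamma>; for \<gamma>' it
      is off by at most \<open>r\<close> more.\<close>
    have near: "(\<integral>\<^sup>+u. ennreal \<bar>quantile \<gamma>' u - T (blk k u)\<bar> \<partial>unit_interval) \<le> ennreal (r + e)"
    proof -
      have \<gamma>1: "\<gamma> \<in> M1 Rplus" "\<gamma>' \<in> M1 Rplus" using \<gamma> \<gamma>' by (auto intro: M11_Rplus_subset)
      note [measurable] = measurable_quantile_borel[OF \<gamma>1(1)] measurable_quantile_borel[OF \<gamma>1(2)] measurable_blk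
      have "(\<integral>\<^sup>+u. ennreal \<bar>quantile \<gamma>' u - T (blk k u)\<bar> \<partial>unit_interval)
        \<le> (\<integral>\<^sup>+u. ennreal \<bar>quantile \<gamma> u - quantile \<gamma>' u\<bar> + ennreal \<bar>quantile \<gamma> u - T (blk k u)\<bar> \<partial>unit_interval)"
        by (intro nn_integral_mono) (auto simp: ennreal_plus[symmetric] simp del: ennreal_plus intro!: ennreal_leI)
      also have "\<dots> = cdf_dist \<gamma> \<gamma>' + (\<integral>\<^sup>+u. ennreal \<bar>quantile \<gamma> u - T (blk k u)\<bar> \<partial>unit_interval)"
        by (simp add: nn_integral_add nn_integral_abs_diff_eq_cdf_dist[OF \<gamma>1])
      also have "\<dots> \<le> ennreal r + ennreal e" using \<gamma>'(2) T(6) by (rule add_mono)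
      also have "\<dots> = ennreal (r + e)" using r(1) e(1) by (simp flip: ennreal_plus)
      finally show ?thesis .
    qed
    have table: "\<bar>real (table_of (?l n) (?b n) {1..n} \<tau> z) / real n - measure \<pi> (pair_cell k lab z)\<bar> \<le> d1" if z: "z \<in> ?Z" for z
      using less_imp_le[OF m(1)[OF z]] unfolding \<pi>(3)[OF z] by (simp add: p_def n_def N_def \<tau>_def)
    have "\<bar>(\<Sum>i=1..n. v (\<tau> i) / real n * g (x n i)) - (\<integral>y. g y \<partial>mixture \<gamma>' \<pi>)\<bar>
      \<le> 2 * d + (B + d) * (r + e + M / real n + (r + e)) + real (card ?Z) * (M * (B + d)) * d1"
      using e(1) r(1) by (intro matching_error[where g=g and h="gh g" and y="x n", OF lab T(1,4,5) \<gamma>'(1) \<pi>(1) near _ gc gh[OF g] nn1 v(1) \<tau> wT table]) auto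
    also have "\<dots> \<le> 2 * d + 2 * B * (r + e + M / real n + (r + e)) + \<eta> / 8"
      using d d1(2) e(1) r(1) T(2) by (intro add_mono mult_right_mono) auto
    also have "\<dots> = 2 * d + 4 * (B * e) + 2 * B * M / real n + \<eta> / 8 + 4 * B * r" by (simp add: algebra_simps)
    also have "\<dots> < \<eta> + 4 * B * r" using d(3) mn \<eta> unfolding e(2) by simp
    also have "\<dots> = \<epsilon>" by (simp add: \<eta>_def)
    finally show "\<bar>(\<integral>y. g y \<partial>weighted_empirical borel n (v \<circ> \<tau>) (x n)) - (\<integral>y. g y \<partial>mixture \<gamma>' \<pi>)\<bar> < \<epsilon>"
      unfolding int .
  qed
qed

end

section \<open>Exchangeable weights\<close>

text \<open>Set to 0 outside \<open>{1..n}\<close>, so that the vector is a Borel map into sequences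
  and composition with a permutation of \<open>{1..n}\<close> keeps this form.\<close>

definition weight_vector :: "nat \<Rightarrow> (nat \<Rightarrow> 'w \<Rightarrow> real) \<Rightarrow> 'w \<Rightarrow> nat \<Rightarrow> real" where
  "weight_vector n W \<omega> = (\<lambda>i. if i \<in> {1..n} then W i \<omega> else 0)"

lemma weighted_empirical_cong:
  assumes "\<And>i. i \<in> {1..n} \<Longrightarrow> w i = w' i" "\<And>i. i \<in> {1..n} \<Longrightarrow> y i = y' i"
  shows "weighted_empirical E n w y = weighted_empirical E n w' y'"
  unfolding weighted_empirical_def
proof (rule distr_cong)
  show "point_measure {1..n} (\<lambda>i. ennreal (w i / real n)) = point_measure {1..n} (\<lambda>i. ennreal (w' i / real n))"
    unfolding point_measure_def using assms(1) by (intro density_cong) (auto simp: AE_count_space)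
qed (use assms(2) in \<open>auto simp: space_point_measure\<close>)

lemma empirical_weight_vector: "empirical E n (weight_vector n W \<omega>) = empirical E n (\<lambda>i. W i \<omega>)"
  unfolding empirical_def by (rule weighted_empirical_cong) (auto simp: weight_vector_def)

lemma weighted_empirical_weight_vector:
  "weighted_empirical E n (weight_vector n W \<omega>) y = weighted_empirical E n (\<lambda>i. W i \<omega>) y"
  by (rule weighted_empirical_cong) (auto simp: weight_vector_def)

lemma measurable_coordinate: "(\<lambda>w. w i) \<in> borel_measurable (borel :: (nat \<Rightarrow> real) measure)"
  by (intro borel_measurable_continuous_onI continuous_on_product_coordinates)

lemma weight_simplex_borel: "weight_simplex n \<in> sets borel"
proof -
  note [measurable] = measurable_coordinate
  have "weight_simplex n = (\<Inter>i\<in>{1..n}. {w \<in> space borel. 0 \<le> w i}) \<inter> {w \<in> space borel. (\<Sum>i=1..n. w i) = real n}"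
    by (auto simp: weight_simplex_def)
  also have "\<dots> \<in> sets borel" by (cases "n = 0") (auto intro!: sets.Int sets.finite_INT)
  finally show ?thesis .
qed

lemma weighted_empirical_vimage_borel:
  fixes x :: "nat \<Rightarrow> 'a::metric_space"
  assumes "1 \<le> n" "C \<in> sets (borel_of weak_topology)"
  shows "{w \<in> weight_simplex n. weighted_empirical borel n w x \<in> C} \<in> sets borel"
proof -
  have "(\<lambda>w. weighted_empirical borel n w x) -` C \<inter> space (restrict_space borel (weight_simplex n))
    \<in> sets (restrict_space borel (weight_simplex n))"
    by (rule measurable_sets[OF measurable_weighted_empirical[OF assms(1)] assms(2)])
  then have "(\<lambda>w. weighted_empirical borel n w x) -` C \<inter> weight_simplex n \<in> sets borel"
    by (subst (asm) sets_restrict_space_iff) (auto simp: weight_simplex_borel space_restrict_space)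
  moreover have "(\<lambda>w. weighted_empirical borel n w x) -` C \<inter> weight_simplex n
    = {w \<in> weight_simplex n. weighted_empirical borel n w x \<in> C}" by auto
  ultimately show ?thesis by simp
qed

lemma cdf_dist_empirical_vimage_borel:
  assumes \<gamma>: "\<gamma> \<in> M1 Rplus" and "1 \<le> n"
  shows "{w \<in> weight_simplex n. cdf_dist \<gamma> (empirical Rplus n w) < r} \<in> sets borel"
proof -
  \<comment> \<open>The distance as an integral over \<open>t\<close> with the weights as
    parameters, so that it is measurable as a parameter integral.\<close>
  define \<Psi> where "\<Psi> w = (\<integral>\<^sup>+t. ennreal \<bar>distribution_function \<gamma> t - (\<Sum>i=1..n. if w i \<le> t then 1 else 0) / real n\<bar> \<partial>lborel)"
    for w :: "nat \<Rightarrow> real"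
  note [measurable] = measurable_coordinate
  have [measurable]: "snd \<in> borel_measurable ((borel :: (nat \<Rightarrow> real) measure) \<Otimes>\<^sub>M lborel)"
    "(\<lambda>z. fst z i) \<in> borel_measurable ((borel :: (nat \<Rightarrow> real) measure) \<Otimes>\<^sub>M lborel)" for i
    using measurable_snd[of borel lborel] measurable_compose[OF measurable_fst measurable_coordinate] by simp_all
  note [measurable] = measurable_distribution_function[OF \<gamma>]
  have "\<Psi> \<in> borel_measurable borel"
    unfolding \<Psi>_def by measurable
  then have "{w \<in> space borel. \<Psi> w < r} \<in> sets borel" by measurable
  then have "weight_simplex n \<inter> {w. \<Psi> w < r} \<in> sets borel" using weight_simplex_borel by (intro sets.Int) auto
  moreover have "cdf_dist \<gamma> (empirical Rplus n w) = \<Psi> w" if w: "w \<in> weight_simplex n" for w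
  proof -
    have "distribution_function (empirical Rplus n w) t = (\<Sum>i=1..n. if w i \<le> t then 1 else 0) / real n" for t
      using w by (subst distribution_function_empirical[OF assms(2)]) (auto simp: weight_simplex_def sum.If_cases Int_def)
    then show ?thesis by (simp add: cdf_dist_def \<Psi>_def)
  qed
  then have "weight_simplex n \<inter> {w. \<Psi> w < r} = {w \<in> weight_simplex n. cdf_dist \<gamma> (empirical Rplus n w) < r}" by auto
  ultimately show ?thesis by simp
qed

context
  fixes \<Omega> :: "'w measure" and W :: "nat \<Rightarrow> 'w \<Rightarrow> real" and n :: nat
  assumes \<Omega>: "prob_space \<Omega>" and W: "\<And>i. i \<in> {1..n} \<Longrightarrow> W i \<in> \<Omega> \<rightarrow>\<^sub>M Rplus"
begin

lemma measurable_weight_vector: "weight_vector n W \<in> \<Omega> \<rightarrow>\<^sub>M borel"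
proof (rule measurable_coordinatewise_then_product)
  fix i
  have "W i \<in> borel_measurable \<Omega>" if "i \<in> {1..n}" using W[OF that] by (simp add: measurable_restrict_space2_iff)
  then show "(\<lambda>\<omega>. weight_vector n W \<omega> i) \<in> borel_measurable \<Omega>" unfolding weight_vector_def
    by (cases "i \<in> {1..n}") (simp_all only: if_True if_False measurable_const space_borel UNIV_I)
qed

text \<open>\<open>exchangeable\<close> speaks of laws on the finite product; extension by 0
  transports it to events of \<open>weight_vector\<close>.\<close>

lemma exchangeable_permute:
  assumes ex: "exchangeable \<Omega> n W" and \<sigma>: "\<sigma> permutes {1..n}" and D: "D \<in> sets borel"
  shows "{\<omega> \<in> space \<Omega>. weight_vector n W \<omega> \<circ> \<sigma> \<in> D} \<in> sets \<Omega>"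
    "measure \<Omega> {\<omega> \<in> space \<Omega>. weight_vector n W \<omega> \<circ> \<sigma> \<in> D} = measure \<Omega> {\<omega> \<in> space \<Omega>. weight_vector n W \<omega> \<in> D}"
proof -
  let ?\<Pi> = "\<Pi>\<^sub>M i\<in>{1..n}. Rplus"
  define \<phi> where "\<phi> f = (\<lambda>i. if i \<in> {1..n} then f i else 0)" for f :: "nat \<Rightarrow> real"
  have \<phi>: "\<phi> \<in> ?\<Pi> \<rightarrow>\<^sub>M borel"
  proof (rule measurable_coordinatewise_then_product)
    fix i
    have "(\<lambda>f. f i) \<in> borel_measurable ?\<Pi>" if "i \<in> {1..n}"
      using measurable_component_singleton[OF that, of "\<lambda>_. Rplus"] by (simp add: measurable_restrict_space2_iff)
    then show "(\<lambda>f. \<phi> f i) \<in> borel_measurable ?\<Pi>" unfolding \<phi>_def by (cases "i \<in> {1..n}") (simp_all only: if_True if_False measurable_const space_borel UNIV_I)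
  qed
  let ?f = "\<lambda>\<sigma> \<omega>. \<lambda>i\<in>{1..n}. W (\<sigma> i) \<omega>"
  have f: "?f \<sigma> \<in> \<Omega> \<rightarrow>\<^sub>M ?\<Pi>" if "\<sigma> permutes {1..n}" for \<sigma>
    using W permutes_in_image[OF that] by (intro measurable_restrict) auto
  have \<phi>f: "\<phi> (?f \<sigma> \<omega>) = weight_vector n W \<omega> \<circ> \<sigma>" if "\<sigma> permutes {1..n}" for \<sigma> \<omega>
    using permutes_in_image[OF that] by (auto simp: \<phi>_def weight_vector_def fun_eq_iff)
  have m: "\<phi> -` D \<inter> space ?\<Pi> \<in> sets ?\<Pi>" by (rule measurable_sets[OF \<phi> D])
  have eq: "?f \<sigma> -` (\<phi> -` D \<inter> space ?\<Pi>) \<inter> space \<Omega> = {\<omega> \<in> space \<Omega>. weight_vector n W \<omega> \<circ> \<sigma> \<in> D}"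
    if "\<sigma> permutes {1..n}" for \<sigma>
  proof -
    have "?f \<sigma> \<omega> \<in> space ?\<Pi>" if "\<omega> \<in> space \<Omega>" for \<omega> by (rule measurable_space[OF f that]) fact
    then show ?thesis using \<phi>f[OF that] by (auto simp del: restrict_apply)
  qed
  have law: "measure (distr \<Omega> ?\<Pi> (?f \<sigma>)) (\<phi> -` D \<inter> space ?\<Pi>) = measure \<Omega> {\<omega> \<in> space \<Omega>. weight_vector n W \<omega> \<circ> \<sigma> \<in> D}"
    if "\<sigma> permutes {1..n}" for \<sigma>
    unfolding measure_distr[OF f[OF that] m] eq[OF that] ..
  show "{\<omega> \<in> space \<Omega>. weight_vector n W \<omega> \<circ> \<sigma> \<in> D} \<in> sets \<Omega>"
    unfolding eq[OF \<sigma>, symmetric] by (rule measurable_sets[OF f[OF \<sigma>] m])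
  have "distr \<Omega> ?\<Pi> (?f \<sigma>) = distr \<Omega> ?\<Pi> (?f id)" using ex \<sigma> by (simp add: exchangeable_def)
  then show "measure \<Omega> {\<omega> \<in> space \<Omega>. weight_vector n W \<omega> \<circ> \<sigma> \<in> D} = measure \<Omega> {\<omega> \<in> space \<Omega>. weight_vector n W \<omega> \<in> D}"
    using law[OF \<sigma>] law[OF permutes_id] by simp
qed

text \<open>Exchangeability makes all \<open>n!\<close> permuted events equally likely, so their
  common probability is the expected fraction of permutations that lead into \<open>D\<close>. This
  is where the random matching comes from.\<close>

lemma exchangeable_perm_fraction:
  assumes ex: "exchangeable \<Omega> n W" and D: "D \<in> sets borel"
  shows "integrable \<Omega> (\<lambda>\<omega>. perm_fraction n (\<lambda>\<sigma>. weight_vector n W \<omega> \<circ> \<sigma> \<in> D))" (is ?int)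
    "measure \<Omega> {\<omega> \<in> space \<Omega>. weight_vector n W \<omega> \<in> D}
      = (\<integral>\<omega>. perm_fraction n (\<lambda>\<sigma>. weight_vector n W \<omega> \<circ> \<sigma> \<in> D) \<partial>\<Omega>)" (is ?eq)
proof -
  interpret prob_space \<Omega> by (rule \<Omega>)
  define S where "S = {\<sigma>. \<sigma> permutes {1..n}}"
  have S: "finite S" "card S = fact n" unfolding S_def by (simp_all add: finite_permutations card_permutations)
  define X where "X \<sigma> = {\<omega> \<in> space \<Omega>. weight_vector n W \<omega> \<circ> \<sigma> \<in> D}" for \<sigma>
  have X: "X \<sigma> \<in> events" "prob (X \<sigma>) = measure \<Omega> {\<omega> \<in> space \<Omega>. weight_vector n W \<omega> \<in> D}" if "\<sigma> \<in> S" for \<sigma>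
    using exchangeable_permute[OF ex _ D] that unfolding S_def X_def by auto
  have frac: "perm_fraction n (\<lambda>\<sigma>. weight_vector n W \<omega> \<circ> \<sigma> \<in> D) = (\<Sum>\<sigma>\<in>S. indicator (X \<sigma>) \<omega>) / fact n"
    if "\<omega> \<in> space \<Omega>" for \<omega>
  proof -
    have "(\<Sum>\<sigma>\<in>S. indicator (X \<sigma>) \<omega>) = (\<Sum>\<sigma>\<in>S. if weight_vector n W \<omega> \<circ> \<sigma> \<in> D then 1 else (0::real))"
      using that by (intro sum.cong) (auto simp: X_def indicator_def)
    also have "\<dots> = real (card {\<sigma>. \<sigma> permutes {1..n} \<and> weight_vector n W \<omega> \<circ> \<sigma> \<in> D})"
      using S(1) by (simp add: sum.If_cases S_def Int_def)
    finally show ?thesis by (simp add: perm_fraction_def)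
  qed
  have int: "integrable \<Omega> (indicator (X \<sigma>) :: _ \<Rightarrow> real)" if "\<sigma> \<in> S" for \<sigma> using X(1)[OF that] by (intro integrable_real_indicator) (auto simp: emeasure_eq_measure)
  have "integrable \<Omega> (\<lambda>\<omega>. (\<Sum>\<sigma>\<in>S. indicator (X \<sigma>) \<omega>) / fact n :: real)"
    by (intro integrable_divide Bochner_Integration.integrable_sum int)
  then show ?int by (subst Bochner_Integration.integrable_cong[OF refl frac])
  have "(\<integral>\<omega>. perm_fraction n (\<lambda>\<sigma>. weight_vector n W \<omega> \<circ> \<sigma> \<in> D) \<partial>\<Omega>) = (\<Sum>\<sigma>\<in>S. prob (X \<sigma>)) / fact n"
    using X(1) int by (simp add: Bochner_Integration.integral_cong[OF refl frac])
  also have "\<dots> = measure \<Omega> {\<omega> \<in> space \<Omega>. weight_vector n W \<omega> \<in> D}" using S(2) by (simp add: X(2))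
  finally show ?eq ..
qed

lemma perm_fraction_lower:
  assumes "exchangeable \<Omega> n W" "D \<in> sets borel" "E \<in> sets \<Omega>"
    and "\<And>\<omega>. \<omega> \<in> E \<Longrightarrow> c \<le> perm_fraction n (\<lambda>\<sigma>. weight_vector n W \<omega> \<circ> \<sigma> \<in> D)"
  shows "c * measure \<Omega> E \<le> measure \<Omega> {\<omega> \<in> space \<Omega>. weight_vector n W \<omega> \<in> D}"
proof -
  interpret prob_space \<Omega> by (rule \<Omega>)
  have "c * measure \<Omega> E = (\<integral>\<omega>. c * indicator E \<omega> \<partial>\<Omega>)" using assms(3) by simp
  also have "\<dots> \<le> (\<integral>\<omega>. perm_fraction n (\<lambda>\<sigma>. weight_vector n W \<omega> \<circ> \<sigma> \<in> D) \<partial>\<Omega>)"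
  proof (intro integral_mono exchangeable_perm_fraction(1)[OF assms(1,2)])
    show "c * indicator E \<omega> \<le> perm_fraction n (\<lambda>\<sigma>. weight_vector n W \<omega> \<circ> \<sigma> \<in> D)" for \<omega>
      using assms(4)[of \<omega>] by (cases "\<omega> \<in> E") (simp_all, simp add: perm_fraction_def)
  qed (use assms(3) in \<open>simp add: emeasure_eq_measure\<close>)
  finally show ?thesis by (simp add: exchangeable_perm_fraction(2)[OF assms(1,2)])
qed

text \<open>Off \<open>E\<close> no permutation leads into \<open>D\<close>, so the expected
  fraction is at most \<open>c\<close> times the probability of \<open>E\<close>.\<close>

lemma perm_fraction_upper:
  assumes "exchangeable \<Omega> n W" "D \<in> sets borel" "E \<in> sets \<Omega>"
    and "\<And>\<omega>. \<omega> \<in> E \<Longrightarrow> perm_fraction n (\<lambda>\<sigma>. weight_vector n W \<omega> \<circ> \<sigma> \<in> D) \<le> c"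
    and "\<And>\<omega> \<sigma>. \<omega> \<in> space \<Omega> \<Longrightarrow> \<sigma> permutes {1..n} \<Longrightarrow> weight_vector n W \<omega> \<circ> \<sigma> \<in> D \<Longrightarrow> \<omega> \<in> E"
  shows "measure \<Omega> {\<omega> \<in> space \<Omega>. weight_vector n W \<omega> \<in> D} \<le> c * measure \<Omega> E"
proof -
  interpret prob_space \<Omega> by (rule \<Omega>)
  have "(\<integral>\<omega>. perm_fraction n (\<lambda>\<sigma>. weight_vector n W \<omega> \<circ> \<sigma> \<in> D) \<partial>\<Omega>) \<le> (\<integral>\<omega>. c * indicator E \<omega> \<partial>\<Omega>)"
  proof (intro integral_mono exchangeable_perm_fraction(1)[OF assms(1,2)])
    fix \<omega> assume \<omega>: "\<omega> \<in> space \<Omega>"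
    show "perm_fraction n (\<lambda>\<sigma>. weight_vector n W \<omega> \<circ> \<sigma> \<in> D) \<le> c * indicator E \<omega>"
    proof (cases "\<omega> \<in> E")
      case False
      then have "{\<sigma>. \<sigma> permutes {1..n} \<and> weight_vector n W \<omega> \<circ> \<sigma> \<in> D} = {}" using assms(5)[OF \<omega>] by blast
      then have "perm_fraction n (\<lambda>\<sigma>. weight_vector n W \<omega> \<circ> \<sigma> \<in> D) = 0" by (simp only: perm_fraction_def) simp
      then show ?thesis using False by simp
    qed (simp add: assms(4))
  qed (use assms(3) in \<open>simp add: emeasure_eq_measure\<close>)
  then show ?thesis using assms(3) by (simp add: exchangeable_perm_fraction(2)[OF assms(1,2)])
qed

end

section \<open>The large deviation principle\<close>

lemma
  assumes "1 \<le> n" "0 \<le> p"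
  shows scaled_log_le_iff: "ereal (1 / real n) * ext_log p \<le> ereal t \<longleftrightarrow> p \<le> exp (real n * t)"
    and scaled_log_ge_iff: "ereal t \<le> ereal (1 / real n) * ext_log p \<longleftrightarrow> exp (real n * t) \<le> p"
proof -
  have n: "0 < real n" using assms by simp
  have "ln p / real n \<le> t \<longleftrightarrow> p \<le> exp (real n * t)" "t \<le> ln p / real n \<longleftrightarrow> exp (real n * t) \<le> p" if "0 < p"
    using that n ln_le_cancel_iff[of p "exp (real n * t)"]
    by (simp_all add: pos_divide_le_eq pos_le_divide_eq mult.commute ln_ge_iff)
  then show "ereal (1 / real n) * ext_log p \<le> ereal t \<longleftrightarrow> p \<le> exp (real n * t)"
    "ereal t \<le> ereal (1 / real n) * ext_log p \<longleftrightarrow> exp (real n * t) \<le> p"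
    using assms n by (cases "p = 0"; simp add: ext_log_def)+
qed

text \<open>A lower limit of at least \<open>- K\<close> amounts to an exponential lower bound at
  every real rate \<open>c\<close> above \<open>K\<close>; such a \<open>c\<close> is positive
  because \<open>K\<close> is nonnegative.\<close>

lemma liminf_scaled_log_iff:
  assumes p: "\<And>n. 0 \<le> p n"
  shows "- enn2ereal K \<le> liminf (\<lambda>n. ereal (1 / real n) * ext_log (p n)) \<longleftrightarrow>
    (\<forall>c>0. K < ennreal c \<longrightarrow> (\<forall>\<^sub>F n in sequentially. exp (- (real n * c)) \<le> p n))" (is "?l \<longleftrightarrow> ?r")
proof
  assume l: ?l
  show ?r
  proof (intro allI impI)
    fix c :: real assume c: "0 < c" "K < ennreal c"
    have "ereal (- c) < - enn2ereal K" using c by (simp add: ereal_less_uminus_reorder ennreal.rep_eq less_ennreal.rep_eq)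
    also note l
    finally have "\<forall>\<^sub>F n in sequentially. ereal (- c) < ereal (1 / real n) * ext_log (p n)" by (rule less_LiminfD)
    then show "\<forall>\<^sub>F n in sequentially. exp (- (real n * c)) \<le> p n"
      using eventually_ge_at_top[of 1]
    proof eventually_elim
      case (elim n)
      then show ?case using scaled_log_ge_iff[OF elim(2) p, of "- c" n] less_imp_le[OF elim(1)] by simp
    qed
  qed
next
  assume r: ?r
  show ?l
  proof (rule dense_le)
    fix y assume y: "y < - enn2ereal K"
    show "y \<le> liminf (\<lambda>n. ereal (1 / real n) * ext_log (p n))"
    proof (cases y)
      case (real t)
      have "enn2ereal K < ereal (- t)" using y real by (simp add: ereal_less_uminus_reorder)
      moreover have "0 < - t" using calculation enn2ereal_nonneg[of K] by (metis ereal_less(2) less_eq_ereal_def less_trans)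
      ultimately have "\<forall>\<^sub>F n in sequentially. exp (- (real n * - t)) \<le> p n"
        using r[rule_format, of "- t"] by (simp add: less_ennreal.rep_eq)
      then have "\<forall>\<^sub>F n in sequentially. y \<le> ereal (1 / real n) * ext_log (p n)"
        using eventually_ge_at_top[of 1]
      proof eventually_elim
        case (elim n)
        then show ?case using scaled_log_ge_iff[OF elim(2) p, of t n] real by simp
      qed
      then show ?thesis by (rule Liminf_bounded)
    qed (use y in auto)
  qed
qed

text \<open>Nonnegative rates \<open>c\<close> below \<open>K\<close> carry all the information: at
  a level \<open>t \<ge> 0\<close> the bound follows from \<open>p n \<le> 1\<close>.\<close>

lemma limsup_scaled_log_iff:
  assumes p: "\<And>n. 0 \<le> p n" "\<And>n. 1 \<le> n \<Longrightarrow> p n \<le> 1"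
  shows "limsup (\<lambda>n. ereal (1 / real n) * ext_log (p n)) \<le> - enn2ereal K \<longleftrightarrow>
    (\<forall>c\<ge>0. ennreal c < K \<longrightarrow> (\<forall>\<^sub>F n in sequentially. p n \<le> exp (- (real n * c))))" (is "?l \<longleftrightarrow> ?r")
proof
  assume l: ?l
  show ?r
  proof (intro allI impI)
    fix c :: real assume c: "0 \<le> c" "ennreal c < K"
    note l
    also have "- enn2ereal K < ereal (- c)" using c by (simp add: ereal_minus_less_minus less_ennreal.rep_eq flip: uminus_ereal.simps(1))
    finally have "\<forall>\<^sub>F n in sequentially. ereal (1 / real n) * ext_log (p n) < ereal (- c)" by (rule Limsup_lessD)
    then show "\<forall>\<^sub>F n in sequentially. p n \<le> exp (- (real n * c))"
      using eventually_ge_at_top[of 1]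
    proof eventually_elim
      case (elim n)
      then show ?case using scaled_log_le_iff[OF elim(2) p(1), of n "- c"] less_imp_le[OF elim(1)] by simp
    qed
  qed
next
  assume r: ?r
  show ?l
  proof (rule dense_ge)
    fix y assume y: "- enn2ereal K < y"
    show "limsup (\<lambda>n. ereal (1 / real n) * ext_log (p n)) \<le> y"
    proof (cases y)
      case (real t)
      have "\<forall>\<^sub>F n in sequentially. p n \<le> exp (real n * t)"
      proof (cases "0 \<le> t")
        case True
        have "p n \<le> exp (real n * t)" if "1 \<le> n" for n
        proof (rule order_trans[OF p(2)[OF that]])
          show "1 \<le> exp (real n * t)" using True by simp
        qed
        then show ?thesis unfolding eventually_sequentially by blast
      next
        case False
        have "ereal (- t) < enn2ereal K" using y real by (cases "enn2ereal K") auto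
        then have "\<forall>\<^sub>F n in sequentially. p n \<le> exp (- (real n * - t))"
          using r[rule_format, of "- t"] False by (simp add: less_ennreal.rep_eq)
        then show ?thesis by simp
      qed
      then have "\<forall>\<^sub>F n in sequentially. ereal (1 / real n) * ext_log (p n) \<le> y"
        using eventually_ge_at_top[of 1]
      proof eventually_elim
        case (elim n)
        then show ?case using scaled_log_le_iff[OF elim(2) p(1), of n t] real by simp
      qed
      then show ?thesis by (rule Limsup_bounded)
    qed (use y in auto)
  qed
qed

lemma sets_borel_of: "sets (borel_of T) = sigma_sets (topspace T) {U. openin T U}"
  and space_borel_of: "space (borel_of T) = topspace T"
  using openin_subset[of T] by (auto simp: borel_of_def intro!: sets_measure_of space_measure_of)

lemma borel_of_openin: "openin T U \<Longrightarrow> U \<in> sets (borel_of T)"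
  by (simp add: sets_borel_of sigma_sets.Basic)

text \<open>Trades logarithms and limits for eventual exponential bounds. Over the interior the
  infimum dissolves into single points, while over the closure it stays, as the threshold for
  \<open>c\<close>.\<close>

lemma LDP_iff:
  "LDP T P I \<longleftrightarrow> (\<forall>n\<ge>1. P n \<in> M1 (borel_of T)) \<and> lower_semicontinuous_on T I \<and>
    (\<forall>A\<in>sets (borel_of T).
      (\<forall>y\<in>T interior_of A. \<forall>c>0. I y < ennreal c \<longrightarrow> (\<forall>\<^sub>F n in sequentially. exp (- (real n * c)) \<le> measure (P n) A)) \<and>
      (\<forall>c\<ge>0. ennreal c < (INF y\<in>T closure_of A. I y) \<longrightarrow> (\<forall>\<^sub>F n in sequentially. measure (P n) A \<le> exp (- (real n * c)))))"
proof -
  have "measure (P n) A \<le> 1" if "\<forall>n\<ge>1. P n \<in> M1 (borel_of T)" "1 \<le> n" for n A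
    using that by (simp add: space_prob_algebra prob_space.prob_le_1)
  then have up: "limsup (\<lambda>n. ereal (1 / real n) * ext_log (measure (P n) A)) \<le> - enn2ereal K \<longleftrightarrow>
    (\<forall>c\<ge>0. ennreal c < K \<longrightarrow> (\<forall>\<^sub>F n in sequentially. measure (P n) A \<le> exp (- (real n * c))))"
    if "\<forall>n\<ge>1. P n \<in> M1 (borel_of T)" for A K
    using that by (intro limsup_scaled_log_iff) auto
  have lo: "- enn2ereal (INF y\<in>B. I y) \<le> liminf (\<lambda>n. ereal (1 / real n) * ext_log (measure (P n) A)) \<longleftrightarrow>
    (\<forall>y\<in>B. \<forall>c>0. I y < ennreal c \<longrightarrow> (\<forall>\<^sub>F n in sequentially. exp (- (real n * c)) \<le> measure (P n) A))" for A B
    unfolding liminf_scaled_log_iff[of "\<lambda>n. measure (P n) A", OF measure_nonneg] INF_less_iff by blast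
  show ?thesis
    unfolding LDP_def by (intro conj_cong refl ball_cong lo up)
qed

lemma limitin_weak_topology_empirical:
  fixes f :: "'a::topological_space \<Rightarrow> real"
  assumes lim: "limitin weak_topology (\<lambda>n. empirical borel n (x n)) \<mu> sequentially" and f: "f \<in> bounded_continuous"
  shows "(\<lambda>n. (\<Sum>i=1..n. f (x n i)) / real n) \<longlonglongrightarrow> (\<integral>y. f y \<partial>\<mu>)"
proof (rule tendstoI)
  fix e :: real assume e: "0 < e"
  let ?U = "{\<nu> \<in> M1 borel. \<forall>g\<in>{f}. \<bar>(\<integral>y. g y \<partial>\<nu>) - (\<integral>y. g y \<partial>\<mu>)\<bar> < e}"
  have "openin weak_topology ?U" using f by (intro openin_weak_topology_basic) auto
  moreover have "\<mu> \<in> ?U" using limitin_topspace[OF lim] e by (simp add: topspace_weak_topology)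
  ultimately have "\<forall>\<^sub>F n in sequentially. empirical borel n (x n) \<in> ?U" using lim unfolding limitin_def by blast
  then show "\<forall>\<^sub>F n in sequentially. dist ((\<Sum>i=1..n. f (x n i)) / real n) (\<integral>y. f y \<partial>\<mu>) < e"
  proof eventually_elim
    case (elim n)
    have "(\<integral>y. f y \<partial>empirical borel n (x n)) = (\<Sum>i=1..n. 1 / real n * f (x n i))"
      unfolding empirical_def using f by (intro integral_weighted_empirical) (auto simp: bounded_continuous_measurable)
    also have "\<dots> = (\<Sum>i=1..n. f (x n i)) / real n" by (simp add: sum_divide_distrib)
    finally show ?case using elim by (simp add: dist_real_def)
  qed
qed

text \<open>A Lebesgue number argument: cover \<open>S\<close> by finitely many neighbourhoods of
  half the admissible size, so that closeness to any point of \<open>S\<close> implies closeness to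
  a centre. It yields one finite set of test functions for a whole sublevel set of the rate.\<close>

lemma weak_topology_uniform_nhd:
  assumes comp: "compactin weak_topology S" and U: "openin weak_topology U" "S \<subseteq> U"
  obtains G e where "finite G" "G \<subseteq> bounded_continuous" "(e::real) > 0"
    "\<And>\<nu> \<nu>'. \<nu> \<in> S \<Longrightarrow> \<nu>' \<in> M1 borel \<Longrightarrow> (\<And>g. g \<in> G \<Longrightarrow> \<bar>(\<integral>x. g x \<partial>\<nu>') - (\<integral>x. g x \<partial>\<nu>)\<bar> < e) \<Longrightarrow> \<nu>' \<in> U"
proof -
  have "\<exists>G e. finite G \<and> G \<subseteq> bounded_continuous \<and> (e::real) > 0 \<and>
    (\<forall>\<nu>'\<in>M1 borel. (\<forall>g\<in>G. \<bar>(\<integral>x. g x \<partial>\<nu>') - (\<integral>x. g x \<partial>\<nu>)\<bar> < e) \<longrightarrow> \<nu>' \<in> U)" if \<nu>: "\<nu> \<in> S" for \<nu>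
  proof -
    have "\<nu> \<in> U" using \<nu> U(2) by blast
    from openin_weak_topology_nhd[OF U(1) this] show ?thesis by metis
  qed
  then obtain G e where Ge: "\<And>\<nu>. \<nu> \<in> S \<Longrightarrow> finite (G \<nu>)" "\<And>\<nu>. \<nu> \<in> S \<Longrightarrow> G \<nu> \<subseteq> bounded_continuous" "\<And>\<nu>. \<nu> \<in> S \<Longrightarrow> (e \<nu> :: real) > 0"
    "\<And>\<nu> \<nu>'. \<nu> \<in> S \<Longrightarrow> \<nu>' \<in> M1 borel \<Longrightarrow> (\<And>g. g \<in> G \<nu> \<Longrightarrow> \<bar>(\<integral>x. g x \<partial>\<nu>') - (\<integral>x. g x \<partial>\<nu>)\<bar> < e \<nu>) \<Longrightarrow> \<nu>' \<in> U"
    by metis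
  let ?O = "\<lambda>\<nu>. {\<nu>' \<in> M1 borel. \<forall>g\<in>G \<nu>. \<bar>(\<integral>x. g x \<partial>\<nu>') - (\<integral>x. g x \<partial>\<nu>)\<bar> < e \<nu> / 2}"
  have S: "S \<subseteq> M1 borel" using compactin_subset_topspace[OF comp] by (simp add: topspace_weak_topology)
  have "\<exists>\<F>. finite \<F> \<and> \<F> \<subseteq> ?O ` S \<and> S \<subseteq> \<Union>\<F>"
  proof (rule compactinD[OF comp])
    show "openin weak_topology V" if V: "V \<in> ?O ` S" for V
    proof -
      obtain \<nu> where \<nu>: "\<nu> \<in> S" "V = ?O \<nu>" using V by blast
      show ?thesis unfolding \<nu>(2) by (rule openin_weak_topology_basic[OF Ge(1,2)[OF \<nu>(1)]])
    qed
    have "\<nu> \<in> ?O \<nu>" if "\<nu> \<in> S" for \<nu> using that S Ge(3)[OF that] by auto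
    then show "S \<subseteq> \<Union>(?O ` S)" by blast
  qed
  then obtain \<F> where \<F>: "finite \<F>" "\<F> \<subseteq> ?O ` S" "S \<subseteq> \<Union>\<F>" by (elim exE conjE)
  from finite_subset_image[OF \<F>(1,2)] obtain F where F: "F \<subseteq> S" "finite F" and "\<F> = ?O ` F" by (elim exE conjE)
  with \<F>(3) have cover: "S \<subseteq> \<Union>(?O ` F)" by (simp only:)
  show thesis
  proof (rule that)
    show "finite (\<Union>\<nu>\<in>F. G \<nu>)" "(\<Union>\<nu>\<in>F. G \<nu>) \<subseteq> bounded_continuous" using F Ge(1,2) by blast+
    show "0 < Min (insert 1 ((\<lambda>\<nu>. e \<nu> / 2) ` F))" using F Ge(3) by (subst Min_gr_iff) auto
    fix \<nu> \<nu>' assume \<nu>: "\<nu> \<in> S" and \<nu>': "\<nu>' \<in> M1 borel"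
      and close: "\<And>g. g \<in> (\<Union>\<nu>\<in>F. G \<nu>) \<Longrightarrow> \<bar>(\<integral>x. g x \<partial>\<nu>') - (\<integral>x. g x \<partial>\<nu>)\<bar> < Min (insert 1 ((\<lambda>\<nu>. e \<nu> / 2) ` F))"
    obtain \<nu>0 where \<nu>0: "\<nu>0 \<in> F" "\<nu> \<in> ?O \<nu>0" using \<nu> cover by blast
    show "\<nu>' \<in> U"
    proof (rule Ge(4)[OF _ \<nu>'])
      show "\<nu>0 \<in> S" using \<nu>0(1) F(1) by blast
      fix g assume g: "g \<in> G \<nu>0"
      have "Min (insert 1 ((\<lambda>\<nu>. e \<nu> / 2) ` F)) \<le> e \<nu>0 / 2" using F(2) \<nu>0(1) by (intro Min_le) auto
      then have "\<bar>(\<integral>x. g x \<partial>\<nu>') - (\<integral>x. g x \<partial>\<nu>)\<bar> < e \<nu>0 / 2" using close[of g] g \<nu>0(1) by force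
      moreover have "\<bar>(\<integral>x. g x \<partial>\<nu>) - (\<integral>x. g x \<partial>\<nu>0)\<bar> < e \<nu>0 / 2" using \<nu>0(2) g by blast
      ultimately show "\<bar>(\<integral>x. g x \<partial>\<nu>') - (\<integral>x. g x \<partial>\<nu>0)\<bar> < e \<nu>0" by linarith
    qed
  qed
qed

section \<open>Lower and upper bound for the weighted empirical measures\<close>

context
  fixes x :: "nat \<Rightarrow> nat \<Rightarrow> 'a::polish_space"
    and \<mu> :: "'a measure" and \<Omega> :: "'w measure" and W :: "nat \<Rightarrow> nat \<Rightarrow> 'w \<Rightarrow> real" and I :: "real measure \<Rightarrow> ennreal"
  assumes \<mu>: "\<mu> \<in> M1 borel"
    and lim: "limitin weak_topology (\<lambda>n. empirical borel n (x n)) \<mu> sequentially"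
    and \<Omega>: "prob_space \<Omega>"
    and W: "\<And>n i. n \<ge> 1 \<Longrightarrow> i \<in> {1..n} \<Longrightarrow> W n i \<in> \<Omega> \<rightarrow>\<^sub>M Rplus"
    and sum_W: "\<And>n \<omega>. n \<ge> 1 \<Longrightarrow> \<omega> \<in> space \<Omega> \<Longrightarrow> (\<Sum>i=1..n. W n i \<omega>) = real n"
    and ex: "\<And>n. n \<ge> 1 \<Longrightarrow> exchangeable \<Omega> n (W n)"
    and LDP_W: "LDP_rv \<Omega> wasserstein_topology (\<lambda>n \<omega>. empirical Rplus n (\<lambda>i. W n i \<omega>)) I"
    and good_I: "good wasserstein_topology I"
begin

interpretation prob_space \<Omega> by (rule \<Omega>)

private abbreviation (input) V where "V n \<equiv> weight_vector n (W n)"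
private abbreviation (input) X where "X n \<omega> \<equiv> empirical Rplus n (\<lambda>i. W n i \<omega>)"
private abbreviation (input) L where "L n \<omega> \<equiv> weighted_empirical borel n (\<lambda>i. W n i \<omega>) (x n)"

lemma weight_vector_in_simplex: "V n \<omega> \<in> weight_simplex n" if "1 \<le> n" "\<omega> \<in> space \<Omega>"
  using sum_W[OF that] measurable_space[OF W[OF that(1)] that(2)]
  by (auto simp: weight_simplex_def weight_vector_def space_restrict_space)

lemma measurable_weighted_empirical_rv: "L n \<in> \<Omega> \<rightarrow>\<^sub>M borel_of weak_topology" if n: "1 \<le> n"
proof -
  have "V n \<in> \<Omega> \<rightarrow>\<^sub>M restrict_space borel (weight_simplex n)"
    using measurable_weight_vector[OF \<Omega> W[OF n]] weight_vector_in_simplex[OF n] by (intro measurable_restrict_space2) auto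
  from measurable_compose[OF this measurable_weighted_empirical[OF n]]
  show ?thesis by (simp only: weighted_empirical_weight_vector)
qed

lemma empirical_weights_in_M11: "X n \<omega> \<in> M11_Rplus" if "1 \<le> n" "\<omega> \<in> space \<Omega>"
  using empirical_in_M11[OF that(1) weight_vector_in_simplex[OF that]] by (simp only: empirical_weight_vector)

lemma empirical_weights_event: "{\<omega> \<in> space \<Omega>. X n \<omega> \<in> B} \<in> events" if "1 \<le> n" "B \<in> sets (borel_of wasserstein_topology)"
proof -
  have "X n -` B \<inter> space \<Omega> \<in> events" using LDP_W that by (intro measurable_sets[where A="borel_of wasserstein_topology"]) (simp_all add: LDP_rv_def)
  moreover have "X n -` B \<inter> space \<Omega> = {\<omega> \<in> space \<Omega>. X n \<omega> \<in> B}" by auto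
  ultimately show ?thesis by simp
qed

lemma prob_empirical_weights: "measure (distr \<Omega> (borel_of wasserstein_topology) (X n)) B = prob {\<omega> \<in> space \<Omega>. X n \<omega> \<in> B}"
  if "1 \<le> n" "B \<in> sets (borel_of wasserstein_topology)"
  using LDP_W that by (subst measure_distr) (auto simp: LDP_rv_def vimage_def Int_def conj_commute)

lemma prob_weighted_empirical: "measure (distr \<Omega> (borel_of weak_topology) (L n)) A = prob {\<omega> \<in> space \<Omega>. L n \<omega> \<in> A}"
  if "1 \<le> n" "A \<in> sets (borel_of weak_topology)"
  using measurable_weighted_empirical_rv that by (subst measure_distr) (auto simp: vimage_def Int_def conj_commute)

lemma empirical_weights_lower_bound:
  assumes "openin wasserstein_topology U" "\<gamma> \<in> U" "I \<gamma> < ennreal c" "0 < c"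
  shows "\<forall>\<^sub>F n in sequentially. exp (- (real n * c)) \<le> prob {\<omega> \<in> space \<Omega>. X n \<omega> \<in> U}"
proof -
  have U: "U \<in> sets (borel_of wasserstein_topology)" by (rule borel_of_openin[OF assms(1)])
  have "\<forall>\<^sub>F n in sequentially. exp (- (real n * c)) \<le> measure (distr \<Omega> (borel_of wasserstein_topology) (X n)) U"
    using LDP_W U assms interior_of_openin[OF assms(1)] unfolding LDP_rv_def LDP_iff by simp
  then show ?thesis using eventually_ge_at_top[of 1]
    by eventually_elim (use prob_empirical_weights[OF _ U] in simp)
qed

lemma empirical_weights_upper_bound:
  assumes U: "U \<in> sets (borel_of wasserstein_topology)" and C: "closedin wasserstein_topology C" "U \<subseteq> C"
    and c: "0 \<le> c" "ennreal c < (INF \<gamma>\<in>C. I \<gamma>)"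
  shows "\<forall>\<^sub>F n in sequentially. prob {\<omega> \<in> space \<Omega>. X n \<omega> \<in> U} \<le> exp (- (real n * c))"
proof -
  have "(INF \<gamma>\<in>C. I \<gamma>) \<le> (INF \<gamma>\<in>wasserstein_topology closure_of U. I \<gamma>)"
    by (intro INF_superset_mono closure_of_minimal[OF C(2,1)] order_refl)
  with c(2) have "ennreal c < (INF \<gamma>\<in>wasserstein_topology closure_of U. I \<gamma>)" by (rule less_le_trans)
  then have "\<forall>\<^sub>F n in sequentially. measure (distr \<Omega> (borel_of wasserstein_topology) (X n)) U \<le> exp (- (real n * c))"
    using LDP_W U c(1) unfolding LDP_rv_def LDP_iff by simp
  then show ?thesis using eventually_ge_at_top[of 1]
    by eventually_elim (use prob_empirical_weights[OF _ U] in simp)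
qed

text \<open>Take \<gamma> and \<pi> of total cost below \<open>c\<close>. The weights fall near
  \<gamma> with probability at least about \<open>exp (- n * i)\<close>, where \<open>i\<close> is
  the cost of \<gamma>, and on this event the fraction of matchings near the mixture is at least
  about \<open>exp (- n * h)\<close>; exchangeability multiplies the two.\<close>

lemma weighted_empirical_lower_bound:
  assumes A: "A \<in> sets (borel_of weak_topology)" and \<nu>: "\<nu> \<in> weak_topology interior_of A"
    and c: "K_rate I \<mu> \<nu> < ennreal c"
  shows "\<forall>\<^sub>F n in sequentially. exp (- (real n * c)) \<le> prob {\<omega> \<in> space \<Omega>. L n \<omega> \<in> A}"
proof -
  obtain \<gamma> \<pi> where \<gamma>: "\<gamma> \<in> M11_Rplus" and \<pi>: "\<pi> \<in> unit_couplings \<mu>" and \<nu>_eq: "mixture \<gamma> \<pi> = \<nu>"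
    and less: "rel_entropy \<pi> (unit_prod \<mu>) + I \<gamma> < ennreal c"
    using c unfolding K_rate_less_iff[OF \<mu>] by blast
  obtain h where h: "rel_entropy \<pi> (unit_prod \<mu>) = ennreal h" "0 \<le> h"
    using less by (cases "rel_entropy \<pi> (unit_prod \<mu>)") auto
  obtain i where i: "I \<gamma> = ennreal i" "0 \<le> i" using less by (cases "I \<gamma>") auto
  \<comment> \<open>The slack between the total cost and \<open>c\<close> is split evenly between
    the weights and the matching.\<close>
  define \<delta> where "\<delta> = (c - h - i) / 2"
  have "h + i < c" using less h i by (simp flip: ennreal_plus add: ennreal_less_iff)
  then have \<delta>: "0 < \<delta>" "h + \<delta> + (i + \<delta>) = c" by (simp_all add: \<delta>_def field_simps)
  obtain G e where G: "finite G" "G \<subseteq> bounded_continuous" and e: "(e::real) > 0"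
    and nhd: "\<And>\<nu>'. \<nu>' \<in> M1 borel \<Longrightarrow> (\<And>g. g \<in> G \<Longrightarrow> \<bar>(\<integral>x. g x \<partial>\<nu>') - (\<integral>x. g x \<partial>\<nu>)\<bar> < e) \<Longrightarrow> \<nu>' \<in> weak_topology interior_of A"
    using openin_weak_topology_nhd[OF openin_interior_of \<nu>] by blast
  obtain r where r: "0 < (r::real)" and perm: "\<forall>\<^sub>F n in sequentially. \<forall>w\<in>weight_simplex n.
      cdf_dist \<gamma> (empirical Rplus n w) \<le> ennreal r \<longrightarrow> exp (- (real n * (h + \<delta>))) \<le> perm_fraction n (\<lambda>\<sigma>. \<forall>g\<in>G.
      \<bar>(\<Sum>i=1..n. (w \<circ> \<sigma>) i / real n * g (x n i)) - (\<integral>y. g y \<partial>mixture \<gamma> \<pi>)\<bar> < e)"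
    using matching_lower_bound[OF \<mu> limitin_weak_topology_empirical[OF lim] \<gamma> \<pi> eq_refl[OF h(1)] h(2) G e \<delta>(1)] by blast
  let ?U = "{\<gamma>' \<in> M11_Rplus. cdf_dist \<gamma> \<gamma>' < ennreal r}"
  have U: "openin wasserstein_topology ?U" by (rule openin_cdf_dist_ball[OF \<gamma>])
  have "\<forall>\<^sub>F n in sequentially. exp (- (real n * (i + \<delta>))) \<le> prob {\<omega> \<in> space \<Omega>. X n \<omega> \<in> ?U}"
    using \<gamma> r i \<delta>(1) by (intro empirical_weights_lower_bound[OF U]) (auto simp: cdf_dist_self ennreal_less_iff)
  with perm show ?thesis using eventually_ge_at_top[of 1]
  proof eventually_elim
    case (elim n)
    \<comment> \<open>Only vectors in the simplex are considered, where the weighted empirical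
      measure depends measurably on the weights.\<close>
    let ?D = "{w \<in> weight_simplex n. weighted_empirical borel n w (x n) \<in> A}"
    have lower: "exp (- (real n * (h + \<delta>))) \<le> perm_fraction n (\<lambda>\<sigma>. V n \<omega> \<circ> \<sigma> \<in> ?D)"
      if \<omega>: "\<omega> \<in> {\<omega> \<in> space \<Omega>. X n \<omega> \<in> ?U}" for \<omega>
    proof -
      have w: "V n \<omega> \<in> weight_simplex n" using weight_vector_in_simplex[OF elim(3)] \<omega> by simp
      have "cdf_dist \<gamma> (empirical Rplus n (V n \<omega>)) \<le> ennreal r" using \<omega> by (simp add: empirical_weight_vector less_imp_le)
      then have "exp (- (real n * (h + \<delta>))) \<le> perm_fraction n (\<lambda>\<sigma>. \<forall>g\<in>G.
        \<bar>(\<Sum>i=1..n. (V n \<omega> \<circ> \<sigma>) i / real n * g (x n i)) - (\<integral>y. g y \<partial>\<nu>)\<bar> < e)" using elim(1) w \<nu>_eq by simp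
      also have "\<dots> \<le> perm_fraction n (\<lambda>\<sigma>. V n \<omega> \<circ> \<sigma> \<in> ?D)"
        unfolding perm_fraction_def
      proof (intro divide_right_mono of_nat_mono card_mono finite_permutes_Collect subsetI)
        fix \<sigma> assume "\<sigma> \<in> {\<sigma>. \<sigma> permutes {1..n} \<and> (\<forall>g\<in>G.
          \<bar>(\<Sum>i=1..n. (V n \<omega> \<circ> \<sigma>) i / real n * g (x n i)) - (\<integral>y. g y \<partial>\<nu>)\<bar> < e)}"
        then have \<sigma>: "\<sigma> permutes {1..n}" and close: "\<And>g. g \<in> G \<Longrightarrow>
          \<bar>(\<Sum>i=1..n. (V n \<omega> \<circ> \<sigma>) i / real n * g (x n i)) - (\<integral>y. g y \<partial>\<nu>)\<bar> < e" by blast+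
        have ws: "V n \<omega> \<circ> \<sigma> \<in> weight_simplex n" by (rule weight_simplex_permute[OF w \<sigma>])
        have "weighted_empirical borel n (V n \<omega> \<circ> \<sigma>) (x n) \<in> weak_topology interior_of A"
        proof (rule nhd[OF weighted_empirical_in_M1[OF elim(3) ws]])
          fix g assume g: "g \<in> G"
          have "(\<integral>y. g y \<partial>weighted_empirical borel n (V n \<omega> \<circ> \<sigma>) (x n)) = (\<Sum>i=1..n. (V n \<omega> \<circ> \<sigma>) i / real n * g (x n i))"
          proof (rule integral_weighted_empirical)
            show "g \<in> borel_measurable borel" using g G(2) by (intro bounded_continuous_measurable) blast
          qed (use ws in \<open>simp_all add: weight_simplex_def\<close>)
          then show "\<bar>(\<integral>y. g y \<partial>weighted_empirical borel n (V n \<omega> \<circ> \<sigma>) (x n)) - (\<integral>y. g y \<partial>\<nu>)\<bar> < e"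
            using close[OF g] by (simp only:)
        qed
        then have "weighted_empirical borel n (V n \<omega> \<circ> \<sigma>) (x n) \<in> A" by (rule subsetD[OF interior_of_subset])
        with \<sigma> ws show "\<sigma> \<in> {\<sigma>. \<sigma> permutes {1..n} \<and> V n \<omega> \<circ> \<sigma> \<in> ?D}" by simp
      qed simp
      finally show ?thesis .
    qed
    have "exp (- (real n * c)) = exp (- (real n * (h + \<delta>))) * exp (- (real n * (i + \<delta>)))"
      unfolding exp_add[symmetric] \<delta>(2)[symmetric] by (simp add: algebra_simps)
    also have "\<dots> \<le> exp (- (real n * (h + \<delta>))) * prob {\<omega> \<in> space \<Omega>. X n \<omega> \<in> ?U}"
      using elim(2) by (intro mult_left_mono) auto
    also have "\<dots> \<le> prob {\<omega> \<in> space \<Omega>. V n \<omega> \<in> ?D}"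
      by (rule perm_fraction_lower[OF \<Omega> W[OF elim(3)] ex[OF elim(3)] weighted_empirical_vimage_borel[OF elim(3) A]
        empirical_weights_event[OF elim(3) borel_of_openin[OF U]] lower])
    also have "{\<omega> \<in> space \<Omega>. V n \<omega> \<in> ?D} = {\<omega> \<in> space \<Omega>. L n \<omega> \<in> A}"
      using weight_vector_in_simplex[OF elim(3)] by (auto simp: weighted_empirical_weight_vector)
    finally show ?case .
  qed
qed

text \<open>A finite cover by balls reduces the claim to weight laws near one \<gamma>. There the
  weights account for the cheapest cost \<open>i\<close> in the ball and the matching for the rest:
  a coupling of entropy at most \<open>a + \<delta> - i\<close> would put a mixture of cost at most
  \<open>b\<close> next to a point of \<open>A\<close>, against the choice of \<epsilon>.\<close>

lemma weighted_empirical_upper_bound: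
  assumes A: "A \<in> sets (borel_of weak_topology)" and a: "0 \<le> a" "ennreal a < (INF \<nu>\<in>weak_topology closure_of A. K_rate I \<mu> \<nu>)"
  shows "\<forall>\<^sub>F n in sequentially. prob {\<omega> \<in> space \<Omega>. L n \<omega> \<in> A} \<le> exp (- (real n * a))"
proof -
  have A_sub: "A \<subseteq> M1 borel" using sets.sets_into_space[OF A] by (simp add: space_borel_of topspace_weak_topology)
  \<comment> \<open>A rate strictly between \<open>a\<close> and the infimum leaves room for the
    approximations; its sublevel set is compact and misses the closure of \<open>A\<close>.\<close>
  obtain b0 where b0: "ennreal a < b0" "b0 < (INF \<nu>\<in>weak_topology closure_of A. K_rate I \<mu> \<nu>)" using dense[OF a(2)] by blast
  then obtain b where b: "b0 = ennreal b" "0 \<le> b" by (cases b0) auto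
  define \<delta> where "\<delta> = (b - a) / 2"
  have \<delta>: "0 < \<delta>" "a + 2 * \<delta> = b" using b0(1) a(1) b by (auto simp: \<delta>_def ennreal_less_iff field_simps)
  let ?\<K> = "{\<nu> \<in> topspace weak_topology. K_rate I \<mu> \<nu> \<le> ennreal b}"
  let ?U = "topspace weak_topology - weak_topology closure_of A"
  have "compactin weak_topology ?\<K>" using good_K_rate[OF \<mu> good_I] by (simp add: good_def)
  moreover have "openin weak_topology ?U" by (intro openin_diff openin_topspace closedin_closure_of)
  moreover have "?\<K> \<subseteq> ?U"
  proof
    fix \<nu> assume \<nu>: "\<nu> \<in> ?\<K>"
    have "\<nu> \<notin> weak_topology closure_of A"
    proof
      assume "\<nu> \<in> weak_topology closure_of A"
      then have "(INF \<nu>\<in>weak_topology closure_of A. K_rate I \<mu> \<nu>) \<le> K_rate I \<mu> \<nu>" by (rule INF_lower)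
      also have "\<dots> \<le> b0" using \<nu> b by simp
      finally show False using b0(2) by simp
    qed
    then show "\<nu> \<in> ?U" using \<nu> by blast
  qed
  ultimately obtain G \<epsilon> where G: "finite G" "G \<subseteq> bounded_continuous" and \<epsilon>: "(\<epsilon>::real) > 0"
    and sep: "\<And>\<nu> \<nu>'. \<nu> \<in> ?\<K> \<Longrightarrow> \<nu>' \<in> M1 borel \<Longrightarrow> (\<And>g. g \<in> G \<Longrightarrow> \<bar>(\<integral>x. g x \<partial>\<nu>') - (\<integral>x. g x \<partial>\<nu>)\<bar> < \<epsilon>) \<Longrightarrow> \<nu>' \<in> ?U"
    by (rule weak_topology_uniform_nhd) blast
  obtain B where B: "1 \<le> B" "\<And>g y. g \<in> G \<Longrightarrow> \<bar>g y\<bar> \<le> B"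
    using bounded_continuous_finite_bound[OF G] by blast
  have B0: "0 < B" using B(1) by simp
  define r where "r = \<epsilon> / (8 * B)"
  have r: "0 < r" "4 * B * r < \<epsilon>" using B0 \<epsilon> by (simp_all add: r_def)
  let ?O = "\<lambda>\<gamma>. {\<gamma>' \<in> M11_Rplus. cdf_dist \<gamma> \<gamma>' < ennreal r}"
  let ?C = "\<lambda>\<gamma>. {\<gamma>' \<in> M11_Rplus. cdf_dist \<gamma> \<gamma>' \<le> ennreal r}"
  \<comment> \<open>The level \<open>a + 1\<close> exceeds the target rate, so weight laws outside
    the cover of this sublevel set are rare enough.\<close>
  let ?S = "{\<gamma> \<in> topspace wasserstein_topology. I \<gamma> \<le> ennreal (a + 1)}"
  have comp: "compactin wasserstein_topology ?S" using good_I by (simp add: good_def)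
  have "\<exists>\<F>. finite \<F> \<and> \<F> \<subseteq> ?O ` ?S \<and> ?S \<subseteq> \<Union>\<F>"
  proof (rule compactinD[OF comp])
    show "openin wasserstein_topology U" if U: "U \<in> ?O ` ?S" for U
    proof -
      obtain \<gamma> where \<gamma>: "\<gamma> \<in> M11_Rplus" "U = ?O \<gamma>" using U by (auto simp: topspace_wasserstein_topology)
      show ?thesis unfolding \<gamma>(2) by (rule openin_cdf_dist_ball[OF \<gamma>(1)])
    qed
    have "\<gamma> \<in> ?O \<gamma>" if "\<gamma> \<in> ?S" for \<gamma> using that r by (simp add: cdf_dist_self topspace_wasserstein_topology)
    then show "?S \<subseteq> \<Union>(?O ` ?S)" by blast
  qed
  then obtain \<F> where \<F>: "finite \<F>" "\<F> \<subseteq> ?O ` ?S" "?S \<subseteq> \<Union>\<F>" by (elim exE conjE)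
  from finite_subset_image[OF \<F>(1,2)] obtain \<Gamma> where \<Gamma>: "\<Gamma> \<subseteq> ?S" "finite \<Gamma>" and "\<F> = ?O ` \<Gamma>" by (elim exE conjE)
  with \<F>(3) have cover: "?S \<subseteq> (\<Union>\<gamma>\<in>\<Gamma>. ?O \<gamma>)" by (simp only:)
  have \<Gamma>_M11: "\<gamma> \<in> M11_Rplus" if "\<gamma> \<in> \<Gamma>" for \<gamma> using that \<Gamma>(1) by (auto simp: topspace_wasserstein_topology)
  \<comment> \<open>\<open>\<eta> < 1\<close> serves the complement of the cover,
    \<open>\<eta> \<le> \<delta> / 2\<close> the balls, and \<open>0 < \<eta>\<close> absorbs the
    number of balls at the end.\<close>
  define \<eta> where "\<eta> = min (\<delta> / 2) (1 / 2)"
  have \<eta>: "0 < \<eta>" "\<eta> \<le> \<delta> / 2" "\<eta> < 1" using \<delta>(1) by (auto simp: \<eta>_def)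

  let ?R = "topspace wasserstein_topology - (\<Union>\<gamma>\<in>\<Gamma>. ?O \<gamma>)"
  have "openin wasserstein_topology (\<Union>\<gamma>\<in>\<Gamma>. ?O \<gamma>)" using openin_cdf_dist_ball[OF \<Gamma>_M11] by blast
  then have R: "closedin wasserstein_topology ?R" "?R \<in> sets (borel_of wasserstein_topology)"
    using borel_of_openin[of wasserstein_topology] sets.compl_sets[of _ "borel_of wasserstein_topology"]
    by (auto simp: space_borel_of)
  have rest: "\<forall>\<^sub>F n in sequentially. prob {\<omega> \<in> space \<Omega>. X n \<omega> \<in> ?R} \<le> exp (- (real n * (a + \<eta>)))"
  proof (rule empirical_weights_upper_bound[OF R(2,1) order_refl])
    have "ennreal (a + \<eta>) < ennreal (a + 1)" using \<eta> a(1) by (simp add: ennreal_less_iff)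
    also have "\<dots> \<le> (INF \<gamma>\<in>?R. I \<gamma>)"
    proof (rule INF_greatest)
      fix \<gamma> assume "\<gamma> \<in> ?R"
      then have "\<not> I \<gamma> \<le> ennreal (a + 1)" using cover by blast
      then show "ennreal (a + 1) \<le> I \<gamma>" by simp
    qed
    finally show "ennreal (a + \<eta>) < (INF \<gamma>\<in>?R. I \<gamma>)" .
  qed (use a \<eta> in simp)

  have ball: "\<forall>\<^sub>F n in sequentially. prob {\<omega> \<in> space \<Omega>. X n \<omega> \<in> ?O \<gamma> \<and> L n \<omega> \<in> A} \<le> exp (- (real n * (a + \<eta>)))"
    if "\<gamma> \<in> \<Gamma>" for \<gamma>
  proof -
    have \<gamma>: "\<gamma> \<in> M11_Rplus" by (rule \<Gamma>_M11) fact
    have O: "?O \<gamma> \<in> sets (borel_of wasserstein_topology)" by (rule borel_of_openin[OF openin_cdf_dist_ball[OF \<gamma>]])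
    have OC: "?O \<gamma> \<subseteq> ?C \<gamma>" by (auto intro: less_imp_le)
    note up = empirical_weights_upper_bound[OF O closedin_cdf_dist_cball[OF \<gamma>] OC]
    \<comment> \<open>If the closed ball is more expensive than \<open>a + \<eta>\<close>, the
      weights alone suffice; otherwise its infimum \<open>i\<close> is at most
      \<open>a + \<eta>\<close>, so that the matching rate \<open>a + \<delta> - i\<close> is
      nonnegative.\<close>
    show ?thesis
    proof (cases "ennreal (a + \<eta>) < (INF \<gamma>\<in>?C \<gamma>. I \<gamma>)")
      case True
      have "\<forall>\<^sub>F n in sequentially. prob {\<omega> \<in> space \<Omega>. X n \<omega> \<in> ?O \<gamma>} \<le> exp (- (real n * (a + \<eta>)))"
        using a(1) \<eta>(1) True by (intro up) auto
      then show ?thesis using eventually_ge_at_top[of 1]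
      proof eventually_elim
        case (elim n)
        have "prob {\<omega> \<in> space \<Omega>. X n \<omega> \<in> ?O \<gamma> \<and> L n \<omega> \<in> A} \<le> prob {\<omega> \<in> space \<Omega>. X n \<omega> \<in> ?O \<gamma>}"
          by (intro finite_measure_mono empirical_weights_event[OF elim(2) O]) blast
        then show ?case using elim(1) by (rule order_trans)
      qed
    next
      case False
      then have le: "(INF \<gamma>\<in>?C \<gamma>. I \<gamma>) \<le> ennreal (a + \<eta>)" by (simp only: not_less)
      then obtain i where i: "(INF \<gamma>\<in>?C \<gamma>. I \<gamma>) = ennreal i" "0 \<le> i"
        by (cases "INF \<gamma>\<in>?C \<gamma>. I \<gamma>") (auto simp: top_unique)
      have i_le: "i \<le> a + \<eta>" using le a(1) \<eta>(1) unfolding i(1) by (simp add: ennreal_le_iff del: ennreal_plus)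
      have b1: "0 \<le> a + \<delta> - i" using i_le \<eta>(2) \<delta>(1) by linarith
      have "\<forall>\<^sub>F n in sequentially. \<forall>w\<in>weight_simplex n. cdf_dist \<gamma> (empirical Rplus n w) \<le> ennreal r \<longrightarrow>
        perm_fraction n (\<lambda>\<sigma>. weighted_empirical borel n (w \<circ> \<sigma>) (x n) \<in> A) < exp (- (real n * (a + \<delta> - i)))"
      proof (rule matching_upper_bound[where x=x and \<epsilon>=\<epsilon>, OF \<mu> _ \<gamma> G B0 _ r])
        show "(\<lambda>n. (\<Sum>i=1..n. f (x n i)) / real n) \<longlonglongrightarrow> (\<integral>y. f y \<partial>\<mu>)" if "f \<in> bounded_continuous" for f
          by (rule limitin_weak_topology_empirical[OF lim that])
        show "\<bar>g y\<bar> \<le> B" if "g \<in> G" for g y by (rule B(2)[OF that])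
      next
        fix \<pi> \<nu>
        assume \<pi>: "\<pi> \<in> unit_couplings \<mu>" and H: "rel_entropy \<pi> (unit_prod \<mu>) \<le> ennreal (a + \<delta> - i)" and \<nu>: "\<nu> \<in> A"
          and close: "\<And>\<gamma>' g. \<gamma>' \<in> M11_Rplus \<Longrightarrow> cdf_dist \<gamma> \<gamma>' \<le> ennreal r \<Longrightarrow> g \<in> G \<Longrightarrow>
            \<bar>(\<integral>y. g y \<partial>\<nu>) - (\<integral>y. g y \<partial>mixture \<gamma>' \<pi>)\<bar> < \<epsilon>"
        \<comment> \<open>A law \<gamma>' that attains the infimum over the closed ball up to
          \<delta>; with the entropy bound the total cost is at most
          \<open>a + 2 * \<delta> = b\<close>.\<close>
        have "(INF \<gamma>\<in>?C \<gamma>. I \<gamma>) < ennreal (i + \<delta>)" unfolding i(1) using i(2) \<delta>(1) by (simp add: ennreal_less_iff)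
        then obtain \<gamma>' where \<gamma>': "\<gamma>' \<in> M11_Rplus" "cdf_dist \<gamma> \<gamma>' \<le> ennreal r" and I_less: "I \<gamma>' < ennreal (i + \<delta>)"
          unfolding INF_less_iff by blast
        have "K_rate I \<mu> (mixture \<gamma>' \<pi>) \<le> rel_entropy \<pi> (unit_prod \<mu>) + I \<gamma>'"
          by (rule K_rate_mixture_le[OF \<mu> \<gamma>'(1) \<pi>])
        also have "\<dots> \<le> ennreal (a + \<delta> - i) + ennreal (i + \<delta>)" using H I_less by (intro add_mono less_imp_le[of "I \<gamma>'"])
        also have "\<dots> = ennreal b" using b1 i(2) \<delta> by (simp flip: ennreal_plus)
        finally have "mixture \<gamma>' \<pi> \<in> ?\<K>" using mixture_in_M1[OF \<mu> \<pi> \<gamma>'(1)] by (simp add: topspace_weak_topology)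
        then have "\<nu> \<in> ?U"
        proof (rule sep)
          show "\<nu> \<in> M1 borel" using \<nu> A_sub by blast
          show "\<bar>(\<integral>y. g y \<partial>\<nu>) - (\<integral>y. g y \<partial>mixture \<gamma>' \<pi>)\<bar> < \<epsilon>" if "g \<in> G" for g
            by (rule close[OF \<gamma>' that])
        qed
        then show False using \<nu> closure_of_subset[of A weak_topology] A_sub by (auto simp: topspace_weak_topology)
      qed
      \<comment> \<open>The rate \<open>i - \<delta> / 2\<close> stays strictly below the infimum,
        as the upper bound for the weights demands; if it is negative, the right-hand side is at
        least 1. Added to the matching rate it gives \<open>a + \<delta> / 2\<close>.\<close>
      moreover have "\<forall>\<^sub>F n in sequentially. prob {\<omega> \<in> space \<Omega>. X n \<omega> \<in> ?O \<gamma>} \<le> exp (- (real n * (i - \<delta> / 2)))"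
      proof (cases "0 \<le> i - \<delta> / 2")
        case True
        then show ?thesis using i \<delta>(1) by (intro up) (auto simp: ennreal_less_iff)
      next
        case False
        have "prob {\<omega> \<in> space \<Omega>. X n \<omega> \<in> ?O \<gamma>} \<le> exp (- (real n * (i - \<delta> / 2)))" for n
        proof (rule order_trans[OF prob_le_1])
          show "1 \<le> exp (- (real n * (i - \<delta> / 2)))" using False by (simp add: mult_nonneg_nonpos)
        qed
        then show ?thesis by (rule always_eventually[OF allI])
      qed
      ultimately show ?thesis using eventually_ge_at_top[of 1]
      proof eventually_elim
        case (elim n)
        \<comment> \<open>The ball is part of \<open>?D\<close>, so that a permuted vector in
          \<open>?D\<close> puts the original one into \<open>?E\<close>: the distance to \<gamma>
          is invariant under permutations.\<close>
        let ?D = "{w \<in> weight_simplex n. cdf_dist \<gamma> (empirical Rplus n w) < ennreal r}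
          \<inter> {w \<in> weight_simplex n. weighted_empirical borel n w (x n) \<in> A}"
        let ?E = "{\<omega> \<in> space \<Omega>. X n \<omega> \<in> ?O \<gamma>}"
        have D: "?D \<in> sets borel"
          using elim(3) A M11_Rplus_subset[OF \<gamma>] by (intro sets.Int weighted_empirical_vimage_borel cdf_dist_empirical_vimage_borel)
        have "{\<omega> \<in> space \<Omega>. X n \<omega> \<in> ?O \<gamma> \<and> L n \<omega> \<in> A} = {\<omega> \<in> space \<Omega>. V n \<omega> \<in> ?D}"
          using weight_vector_in_simplex[OF elim(3)] empirical_weights_in_M11[OF elim(3)] by (auto simp: weighted_empirical_weight_vector empirical_weight_vector)
        also have "prob \<dots> \<le> exp (- (real n * (a + \<delta> - i))) * prob ?E"
        proof (rule perm_fraction_upper[OF \<Omega> W[OF elim(3)] ex[OF elim(3)] D empirical_weights_event[OF elim(3) O]])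
          fix \<omega> assume \<omega>: "\<omega> \<in> ?E"
          have w: "V n \<omega> \<in> weight_simplex n" using weight_vector_in_simplex[OF elim(3)] \<omega> by simp
          have "cdf_dist \<gamma> (empirical Rplus n (V n \<omega>)) \<le> ennreal r"
            using \<omega> by (simp add: empirical_weight_vector less_imp_le)
          then have "perm_fraction n (\<lambda>\<sigma>. weighted_empirical borel n (V n \<omega> \<circ> \<sigma>) (x n) \<in> A) < exp (- (real n * (a + \<delta> - i)))"
            using elim(1) w by blast
          moreover have "perm_fraction n (\<lambda>\<sigma>. V n \<omega> \<circ> \<sigma> \<in> ?D) \<le> perm_fraction n (\<lambda>\<sigma>. weighted_empirical borel n (V n \<omega> \<circ> \<sigma>) (x n) \<in> A)"
            unfolding perm_fraction_def
            by (intro divide_right_mono of_nat_mono card_mono finite_permutes_Collect) auto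
          ultimately show "perm_fraction n (\<lambda>\<sigma>. V n \<omega> \<circ> \<sigma> \<in> ?D) \<le> exp (- (real n * (a + \<delta> - i)))" by linarith
        next
          fix \<omega> \<sigma> assume \<omega>: "\<omega> \<in> space \<Omega>" and \<sigma>: "\<sigma> permutes {1..n}" and "V n \<omega> \<circ> \<sigma> \<in> ?D"
          then have "cdf_dist \<gamma> (empirical Rplus n (V n \<omega> \<circ> \<sigma>)) < ennreal r" by blast
          then show "\<omega> \<in> ?E" using empirical_weights_in_M11[OF elim(3) \<omega>] \<omega>
            unfolding cdf_dist_empirical_permute[OF elim(3) weight_vector_in_simplex[OF elim(3) \<omega>] \<sigma>] empirical_weight_vector by blast
        qed
        also have "\<dots> \<le> exp (- (real n * (a + \<delta> - i))) * exp (- (real n * (i - \<delta> / 2)))"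
          using elim(2) by (intro mult_left_mono) auto
        also have "\<dots> = exp (- (real n * (a + \<delta> / 2)))"
          unfolding exp_add[symmetric] by (simp add: algebra_simps)
        also have "\<dots> \<le> exp (- (real n * (a + \<eta>)))" using \<eta>(2) by (simp add: mult_left_mono)
        finally show ?case .
      qed
    qed
  qed

  have "\<forall>\<^sub>F n in sequentially. \<forall>\<gamma>\<in>\<Gamma>. prob {\<omega> \<in> space \<Omega>. X n \<omega> \<in> ?O \<gamma> \<and> L n \<omega> \<in> A} \<le> exp (- (real n * (a + \<eta>)))"
    by (intro eventually_ball_finite \<Gamma>(2) ballI ball)
  \<comment> \<open>From here on \<open>card \<Gamma> + 1\<close>, the number of pieces, is at most
    \<open>exp (n * \<eta>)\<close>.\<close>
  moreover have "\<forall>\<^sub>F n in sequentially. ln (real (card \<Gamma>) + 1) / \<eta> \<le> real n"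
    using filterlim_real_sequentially by (simp add: filterlim_at_top)
  ultimately show ?thesis using rest eventually_ge_at_top[of 1]
  proof eventually_elim
    case (elim n)
    let ?E = "\<lambda>\<gamma>. {\<omega> \<in> space \<Omega>. X n \<omega> \<in> ?O \<gamma> \<and> L n \<omega> \<in> A}"
    have L_ev: "{\<omega> \<in> space \<Omega>. L n \<omega> \<in> A} \<in> events"
      using measurable_sets[OF measurable_weighted_empirical_rv[OF elim(4)] A] by (simp add: vimage_def Int_def conj_commute)
    have E: "?E \<gamma> \<in> events" if "\<gamma> \<in> \<Gamma>" for \<gamma>
      using sets.Int[OF empirical_weights_event[OF elim(4) borel_of_openin[OF openin_cdf_dist_ball[OF \<Gamma>_M11[OF that]]]] L_ev]
      by (simp add: Int_def conj_ac cong: conj_cong)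
    have UE: "(\<Union>\<gamma>\<in>\<Gamma>. ?E \<gamma>) \<in> events" using E \<Gamma>(2) by blast
    have "{\<omega> \<in> space \<Omega>. L n \<omega> \<in> A} \<subseteq> {\<omega> \<in> space \<Omega>. X n \<omega> \<in> ?R} \<union> (\<Union>\<gamma>\<in>\<Gamma>. ?E \<gamma>)"
      using empirical_weights_in_M11[OF elim(4)] unfolding topspace_wasserstein_topology by blast
    then have "prob {\<omega> \<in> space \<Omega>. L n \<omega> \<in> A} \<le> prob ({\<omega> \<in> space \<Omega>. X n \<omega> \<in> ?R} \<union> (\<Union>\<gamma>\<in>\<Gamma>. ?E \<gamma>))"
      by (intro finite_measure_mono sets.Un empirical_weights_event[OF elim(4) R(2)] UE)
    also have "\<dots> \<le> prob {\<omega> \<in> space \<Omega>. X n \<omega> \<in> ?R} + prob (\<Union>\<gamma>\<in>\<Gamma>. ?E \<gamma>)"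
      by (intro measure_Un_le empirical_weights_event[OF elim(4) R(2)] UE)
    also have "prob (\<Union>\<gamma>\<in>\<Gamma>. ?E \<gamma>) \<le> (\<Sum>\<gamma>\<in>\<Gamma>. prob (?E \<gamma>))"
      using E \<Gamma>(2) by (intro finite_measure_subadditive_finite) auto
    also have "\<dots> \<le> (\<Sum>\<gamma>\<in>\<Gamma>. exp (- (real n * (a + \<eta>))))" using elim(1) by (intro sum_mono) blast
    also note elim(3)
    finally have "prob {\<omega> \<in> space \<Omega>. L n \<omega> \<in> A} \<le> (real (card \<Gamma>) + 1) * exp (- (real n * (a + \<eta>)))"
      by (simp add: distrib_right)
    also have "\<dots> = exp (ln (real (card \<Gamma>) + 1)) * exp (- (real n * (a + \<eta>)))" by (subst exp_ln) auto
    also have "\<dots> \<le> exp (- (real n * a))"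
      using elim(2) \<eta>(1) unfolding exp_add[symmetric] by (simp add: pos_divide_le_eq algebra_simps)
    finally show ?case .
  qed
qed

end

theorem corollary1p1:
  fixes x :: "nat \<Rightarrow> nat \<Rightarrow> 'a::polish_space"
    and \<mu> :: "'a measure"
    and \<Omega> :: "'w measure"
    and W :: "nat \<Rightarrow> nat \<Rightarrow> 'w \<Rightarrow> real"
    and I\<^sub>W :: "real measure \<Rightarrow> ennreal"
  assumes "\<mu> \<in> M1 borel"
    and "limitin weak_topology (\<lambda>n. empirical borel n (x n)) \<mu> sequentially"
    and "prob_space \<Omega>"
    and "\<And>n i. n \<ge> 1 \<Longrightarrow> i \<in> {1..n} \<Longrightarrow> W n i \<in> \<Omega> \<rightarrow>\<^sub>M Rplus"
    and "\<And>n \<omega>. n \<ge> 1 \<Longrightarrow> \<omega> \<in> space \<Omega> \<Longrightarrow> (\<Sum>i=1..n. W n i \<omega>) = real n"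
    and "\<And>n. n \<ge> 1 \<Longrightarrow> exchangeable \<Omega> n (W n)"
    and "LDP_rv \<Omega> wasserstein_topology (\<lambda>n \<omega>. empirical Rplus n (\<lambda>i. W n i \<omega>)) I\<^sub>W"
    and "good wasserstein_topology I\<^sub>W"
  shows "LDP_rv \<Omega> weak_topology
           (\<lambda>n \<omega>. weighted_empirical borel n (\<lambda>i. W n i \<omega>) (x n)) (K_rate I\<^sub>W \<mu>)
       \<and> good weak_topology (K_rate I\<^sub>W \<mu>)
       \<and> (\<forall>\<nu>\<in>M1 borel. K_rate I\<^sub>W \<mu> \<nu> = K_rate_kernel I\<^sub>W \<mu> \<nu>)"
proof (intro conjI ballI)
  let ?L = "\<lambda>n \<omega>. weighted_empirical borel n (\<lambda>i. W n i \<omega>) (x n)"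
  let ?P = "\<lambda>n. distr \<Omega> (borel_of weak_topology) (?L n)"
  have L: "?L n \<in> \<Omega> \<rightarrow>\<^sub>M borel_of weak_topology" if "1 \<le> n" for n
    by (rule measurable_weighted_empirical_rv[OF assms that])
  have P: "measure (?P n) A = measure \<Omega> {\<omega> \<in> space \<Omega>. ?L n \<omega> \<in> A}" if "1 \<le> n" "A \<in> sets (borel_of weak_topology)" for n A
    by (rule prob_weighted_empirical[OF assms that])
  have "LDP weak_topology ?P (K_rate I\<^sub>W \<mu>)"
    unfolding LDP_iff
  proof (intro conjI allI ballI impI)
    show "?P n \<in> M1 (borel_of weak_topology)" if "1 \<le> n" for n
      using prob_space.prob_space_distr[OF assms(3) L[OF that]] by (simp add: space_prob_algebra)
    show "lower_semicontinuous_on weak_topology (K_rate I\<^sub>W \<mu>)"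
      by (rule lower_semicontinuous_K_rate[OF assms(1,8)])
    fix A assume A: "A \<in> sets (borel_of (weak_topology :: 'a measure topology))"
    show "\<forall>\<^sub>F n in sequentially. exp (- (real n * c)) \<le> measure (?P n) A"
      if "\<nu> \<in> weak_topology interior_of A" "K_rate I\<^sub>W \<mu> \<nu> < ennreal c" for \<nu> c
    proof -
      have "\<forall>\<^sub>F n in sequentially. exp (- (real n * c)) \<le> measure \<Omega> {\<omega> \<in> space \<Omega>. ?L n \<omega> \<in> A}"
        by (rule weighted_empirical_lower_bound[OF assms A that])
      then show ?thesis using eventually_ge_at_top[of 1] by eventually_elim (simp only: P[OF _ A])
    qed
    show "\<forall>\<^sub>F n in sequentially. measure (?P n) A \<le> exp (- (real n * c))"
      if "0 \<le> c" "ennreal c < (INF \<nu>\<in>weak_topology closure_of A. K_rate I\<^sub>W \<mu> \<nu>)" for c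
    proof -
      have "\<forall>\<^sub>F n in sequentially. measure \<Omega> {\<omega> \<in> space \<Omega>. ?L n \<omega> \<in> A} \<le> exp (- (real n * c))"
        by (rule weighted_empirical_upper_bound[OF assms A that])
      then show ?thesis using eventually_ge_at_top[of 1] by eventually_elim (simp only: P[OF _ A])
    qed
  qed
  with L show "LDP_rv \<Omega> weak_topology ?L (K_rate I\<^sub>W \<mu>)" unfolding LDP_rv_def by blast
  show "good weak_topology (K_rate I\<^sub>W \<mu>)" by (rule good_K_rate[OF assms(1,8)])
  show "K_rate I\<^sub>W \<mu> \<nu> = K_rate_kernel I\<^sub>W \<mu> \<nu>" for \<nu> by (rule K_rate_eq_kernel[OF assms(1)])
qed

end
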